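(* Let $(\bar u,\bar y)$ be a feasible trajectory for $(P)$ for which assumptions (A0)–(A4) hold. Suppose that for any $(v,z_0)\in C_2$ there exists $\lambda\in\Lambda$ such that $\mathcal J[\lambda]$ is a Legendre form and $$\mathcal J[\lambda](v,z_0)>0\quad\text{if }(v,z_0)\ne0.$$ Then $(\bar u,\bar y)$ is a local solution of $(P)$ satisfying the following quadratic growth condition: there exist $\beta>0$ and $\alpha>0$ such that $$J(u,y_0)\ge J(\bar u,\bar y_0)+\tfrac12\beta\big(\|u-\bar u\|_2+|y_0-\bar y_0|\big)^2$$ for any trajectory $(u,y)$ feasible for $(P)$ and such that $\|u-\bar u\|_\infty+|y_0-\bar y_0|\le\alpha$.
   Context: **Problem.** Let $T>0$, $\mathcal U:=L^\infty([0,T];\mathbb R^m)$, $\mathcal Y:=W^{1,\infty}([0,T];\mathbb R^n)$. The functions $\ell:\mathbb R^m\times\mathbb R^n\to\mathbb R$, $\phi:\mathbb R^n\times\mathbb R^n\to\mathbb R$, $f:\mathbb R\times\mathbb R\times\mathbb R^m\times\mathbb R^n\to\mathbb R^n$, $g=(g_1,\dots,g_r):\mathbb R^n\to\mathbb R^r$, $\Phi^E:\mathbb R^n\times\mathbb R^n\to\mathbb R^{s_E}$, $\Phi^I:\mathbb R^n\times\mathbb R^n\to\mathbb R^{s_I}$ are given. (A0): all of them are $C^\infty$ and $f$ is Lipschitz. $D_\tau f$ is the derivative of $f$ in its first variable. Put $\Phi:=(\Phi^E,\Phi^I)$, $d:=s_E+s_I$, $K:=\{0\}_{\mathbb R^{s_E}}\times(\mathbb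 R_-)^{s_I}$; a star as in $\mathbb R^{n*}$ denotes row vectors. $(P)$: minimize $\int_0^T\ell(u_t,y_t)\,dt+\phi(y_0,y_T)$ over $(u,y)\in\mathcal U\times\mathcal Y$ subject to the state equation $y_t=y_0+\int_0^tf(t,s,u_s,y_s)\,ds$, $t\in[0,T]$, and to $g(y_t)\le0$ for all $t\in[0,T]$, $\Phi(y_0,y_T)\in K$. A trajectory is a pair satisfying the state equation; it is feasible if it satisfies all constraints. Local solutions are with respect to the norm of $\mathcal U\times\mathcal Y$. For $(u,y_0)\in\mathcal U\times\mathbb R^n$ the state equation has a unique solution $y[u,y_0]\in\mathcal Y$, and $J(u,y_0):=\int_0^T\ell(u_t,y[u,y_0]_t)\,dt+\phi(y_0,y[u,y_0]_T)$. **Linearization.** For $s\in[1,\infty]$ let $\mathcal V_s:=L^s([0,T];\mathbb R^m)$, $\mathcal Z_s:=W^{1,s}([0,T];\mathbb R^n)$. Given a trajectory $(u,y)$ and $(v,z_0)\in\mathcal V_s\times\mathbb R^n$, $z[v,z_0]\in\mathcal Z_s$ is the unique solution of $z_t=z_0+\int_0^tD_{(u,y)}f(t,s,u_s,y_s)(v_s,z_s)\,ds$. **Multipliers.** $\mathcal M$ is the space of finite $\mathbb R^{r*}$-valued Radon measures on $[0,T]$. $\mathcal P:=BV([0,T];\mathbb R^{n*})$ is the space of $h\in L^1(I;\mathbb R^{n*})$ ($I\supset[0,T]$ an open interval) whose distributional derivative $dh$ is a finite measure supported in $[0,T]$; $h_{0_-}$, $h_{T_+}$ are the constant values of $h$ to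 the left of $0$ and right of $T$. Let $H[p](t,u,y):=\ell(u,y)+p_tf(t,t,u,y)+\int_t^Tp_sD_\tau f(s,t,u,y)\,ds$ and $\Phi[\Psi](y_1,y_2):=\phi(y_1,y_2)+\Psi\Phi(y_1,y_2)$. A Lagrange multiplier associated with $(\bar u,\bar y)$ is $(d\eta,\Psi,p)\in\mathcal M\times\mathbb R^{d*}\times\mathcal P$ such that: $-dp_t=D_yH[p](t,\bar u_t,\bar y_t)\,dt+d\eta_t\,g'(\bar y_t)$ and $(-p_{0_-},p_{T_+})=D\Phi[\Psi](\bar y_0,\bar y_T)$; $d\eta\ge0$, $g(\bar y)\le0$, $\int_{[0,T]}d\eta_t\,g(\bar y_t)=0$; $\Psi\in N_K(\Phi(\bar y_0,\bar y_T))$ (normal cone); $D_uH[p](t,\bar u_t,\bar y_t)=0$ for a.a. $t\in[0,T]$. $\Lambda$ is the set of these multipliers, assumed nonempty (so that $C_2$ below is defined). **Order of constraints.** $\mathcal S$ is the ring of functions $h(t,\tilde u,\tilde y,u,y)=\sum_\alpha a_\alpha(t,\tilde u,\tilde y)\prod_\beta\int_0^tb_{\alpha,\beta}(t,s,u_s,y_s)\,ds$ of $(t,\tilde u,\tilde y,u,y)\in\mathbb R\times\mathbb R^m\times\mathbb R^n\times\mathcal U\times\mathcal Y$, with $a_\alpha,b_{\alpha,\beta}$ real $C^\infty$ functions, finite sums and products (empty product $=1$). $D^{(1)}:\mathcal S\to\mathcal S$ is the derivation (additive and satisfying the Leibniz rule) with: for $h=a(t,\tilde u,\tilde y)$, $D^{(1)}h=D_ta(t,\tilde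 u,\tilde y)+D_{\tilde y}a(t,\tilde u,\tilde y)\big(f(t,t,\tilde u,\tilde y)+\int_0^tD_\tau f(t,s,u_s,y_s)\,ds\big)$; for $h=\int_0^tb(t,s,u_s,y_s)\,ds$, $D^{(1)}h=b(t,t,\tilde u,\tilde y)+\int_0^tD_\tau b(t,s,u_s,y_s)\,ds$. Put $g_i^{(0)}:=g_i(\tilde y)$, $g_i^{(j+1)}:=D^{(1)}g_i^{(j)}$. The order of $g_i$ is the greatest positive integer $q_i$ with $D_{\tilde u}g_i^{(j)}\equiv0$ for $j=0,\dots,q_i-1$. The constraints are numbered so that $g_i$ is of order $1$ for $i\le r_1$ and not of order $1$ (i.e. $D_{\tilde u}g_i^{(1)}\equiv0$) for $r_1<i\le r$. **Structure of the feasible trajectory $(\bar u,\bar y)$.** An arc is a maximal interval, relatively open in $[0,T]$, on which the set of active running constraints $\{i:g_i(\bar y_t)=0\}$ is constant; a time in no arc is a junction time. An arc is a boundary arc for $g_i$ if $g_i$ is active on it, otherwise an interior arc for $g_i$. If $(\tau_1,\tau_2)$ is an interior arc for $g_i$, $\tau_2$ is an entry point if $g_i(\bar y_{\tau_2})=0$, and $\tau_1$ an exit point if $g_i(\bar y_{\tau_1})=0$. A touch point for $g_i$ is a time that is both an entry and an exit point; it is reducible if the weak derivative $\frac{d^2}{dt^2}g_i(\bar y_t)$ is a function near $\tau$, continuous at $\tau$, with negative value at $\tau$. For $i\le r_1$, $\mathcal I_i:=\{t:g_i(\bar y_t)=0\}$; for $i>r_1$, $\mathcal T_i$ is the set of touch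 points for $g_i$ and $\mathcal I_i:=\{t:g_i(\bar y_t)=0\}\setminus\mathcal T_i$. For $\delta\ge0$, $\mathcal I_i^\delta:=\{t\in[0,T]:\mathrm{dist}(t,\mathcal I_i)\le\delta\}$ and $I_t^\delta:=\{i:t\in\mathcal I_i^\delta\}$. **Assumptions.** (A1) There are finitely many junction times, and for $i>r_1$ all touch points for $g_i$ are reducible. (A2) Each $g_i$ has finite order $q_i$. (A3) There exist $\varepsilon_0,\gamma>0$ such that for all $t\in[0,T]$, $|M_t^T\xi|\ge\gamma|\xi|$ for all $\xi\in\mathbb R^{|I_t^{\varepsilon_0}|}$, where $M_t$ is the matrix with rows $D_{\tilde u}g_i^{(q_i)}(t,\bar u_t,\bar y_t,\bar u,\bar y)$, $i\in I_t^{\varepsilon_0}$. (A4) $g(\bar y_0)<0$ and $T$ is not an entry point, i.e. there is $\tau<T$ such that the set of active constraints at time $t$ (those $i$ with $t\in\mathcal I_i$) is constant for $t\in(\tau,T]$. **Critical cone** (linearization at $(\bar u,\bar y)$). Write $[\eta_{i,\tau}]:=d\eta_i(\{\tau\})$. Given any $(d\bar\eta,\bar\Psi,\bar p)\in\Lambda$ (the definition does not depend on the choice), $C_2$ is the set of $(v,z_0)\in\mathcal V_2\times\mathbb R^n$ such that, with $z=z[v,z_0]$: $g_i'(\bar y)z\le0$ on $\mathcal I_i$ and $g_i'(\bar y)z=0$ on $\mathrm{supp}(d\bar\eta_i)\cap\mathcal I_i$, $i=1,\dots,r$; $g_i'(\bar y_\tau)z_\tau\le0$ and $[\bar\eta_{i,\tau}]g_i'(\bar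 y_\tau)z_\tau=0$ for $\tau\in\mathcal T_i$, $r_1<i\le r$; $D\Phi(\bar y_0,\bar y_T)(z_0,z_T)\in T_K(\Phi(\bar y_0,\bar y_T))$ (tangent cone) and $\bar\Psi D\Phi(\bar y_0,\bar y_T)(z_0,z_T)=0$. **Hessian of the Lagrangian.** For $\lambda=(d\eta,\Psi,p)\in\Lambda$, $(v,z_0)\in\mathcal V_2\times\mathbb R^n$, $z=z[v,z_0]$, $$\mathcal J[\lambda](v,z_0):=\int_0^TD^2_{(u,y)^2}H[p](t,\bar u_t,\bar y_t)(v_t,z_t)^2dt+D^2\Phi[\Psi](\bar y_0,\bar y_T)(z_0,z_T)^2+\int_{[0,T]}d\eta_t\,g''(\bar y_t)(z_t)^2-\sum_{r_1<i\le r}\ \sum_{\tau\in\mathcal T_i}[\eta_{i,\tau}]\frac{\big(\frac{d}{dt}(g_i'(\bar y_t)z_t)|_{t=\tau}\big)^2}{\frac{d^2}{dt^2}g_i(\bar y_t)|_{t=\tau}}.$$ **Legendre form.** A quadratic form $Q$ on a Hilbert space $X$ (here $\mathcal V_2\times\mathbb R^n$) is a Legendre form if it is weakly lower semi-continuous and if $x^k\rightharpoonup x$ weakly and $Q(x^k)\to Q(x)$ imply $x^k\to x$ strongly. *)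

theory Defs
  imports "HOL-Probability.Essential_Supremum"
begin

section \<open>Differential calculus\<close>

primrec Ck :: "nat \<Rightarrow> ('a::euclidean_space \<Rightarrow> 'b::real_normed_vector) \<Rightarrow> bool" where
  "Ck 0 F \<longleftrightarrow> continuous_on UNIV F"
| "Ck (Suc k) F \<longleftrightarrow>
     (\<forall>x. F differentiable (at x)) \<and> (\<forall>v. Ck k (\<lambda>x. frechet_derivative F (at x) v))"

definition smooth :: "('a::euclidean_space \<Rightarrow> 'b::real_normed_vector) \<Rightarrow> bool" where
  "smooth F \<longleftrightarrow> (\<forall>k. Ck k F)"

text \<open>Row vectors are identified with elements of \<open>real ^ 'k\<close>; a row vector acts on a column
  vector by the inner product.\<close>

definition grad :: "((real ^ 'k) \<Rightarrow> real) \<Rightarrow> (real ^ 'k) \<Rightarrow> (real ^ 'k)" where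
  "grad F x = (\<chi> j. frechet_derivative F (at x) (axis j 1))"

definition D2 :: "('a::euclidean_space \<Rightarrow> real) \<Rightarrow> 'a \<Rightarrow> 'a \<Rightarrow> 'a \<Rightarrow> real" where
  "D2 F x h k = frechet_derivative (\<lambda>x'. frechet_derivative F (at x') h) (at x) k"

text \<open>Partial derivative in the first (real) argument.\<close>

definition Dtau :: "(real \<times> 'a \<Rightarrow> 'b::real_normed_vector) \<Rightarrow> real \<times> 'a \<Rightarrow> 'b" where
  "Dtau F = (\<lambda>(\<tau>, x). vector_derivative (\<lambda>\<sigma>. F (\<sigma>, x)) (at \<tau>))"

text \<open>Smooth functions with compact support in the open interval from \<open>a\<close> to \<open>b\<close>.\<close>

definition test_functions :: "real \<Rightarrow> real \<Rightarrow> (real \<Rightarrow> real) set" where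
  "test_functions a b =
     {\<theta>. smooth \<theta> \<and> (\<exists>c d. a < c \<and> d < b \<and> (\<forall>t. t \<notin> {c..d} \<longrightarrow> \<theta> t = 0))}"

section \<open>Function spaces\<close>

text \<open>Elements of Lebesgue spaces over the interval are represented by functions on the real line;
  only their values on \<open>{0..T}\<close>, up to null sets, matter. Elements of \<open>W\<^sup>1\<^sup>,\<^sup>s\<close> are represented by
  their absolutely continuous version on \<open>{0..T}\<close>, whose pointwise values are used.\<close>

definition Linf_norm :: "real \<Rightarrow> (real \<Rightarrow> 'a::euclidean_space) \<Rightarrow> real" where
  "Linf_norm T u = real_of_ereal (esssup (lebesgue_on {0..T}) (\<lambda>t. ereal (norm (u t))))"

definition Linf :: "real \<Rightarrow> (real \<Rightarrow> 'a::euclidean_space) set" where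
  "Linf T = {u. u \<in> borel_measurable (lebesgue_on {0..T}) \<and>
                esssup (lebesgue_on {0..T}) (\<lambda>t. ereal (norm (u t))) < \<infinity>}"

definition L2 :: "real \<Rightarrow> (real \<Rightarrow> 'a::euclidean_space) set" where
  "L2 T = {v. v \<in> borel_measurable (lebesgue_on {0..T}) \<and>
              integrable (lebesgue_on {0..T}) (\<lambda>t. (norm (v t))\<^sup>2)}"

definition L2_norm :: "real \<Rightarrow> (real \<Rightarrow> 'a::euclidean_space) \<Rightarrow> real" where
  "L2_norm T v = sqrt (LINT t|lebesgue_on {0..T}. (norm (v t))\<^sup>2)"

definition has_weak_deriv ::
  "real \<Rightarrow> (real \<Rightarrow> 'a::euclidean_space) \<Rightarrow> (real \<Rightarrow> 'a) \<Rightarrow> bool" where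
  "has_weak_deriv T y w \<longleftrightarrow>
     integrable (lebesgue_on {0..T}) w \<and>
     (\<forall>t\<in>{0..T}. y t = y 0 + (LINT s|lebesgue_on {0..t}. w s))"

definition W1inf :: "real \<Rightarrow> (real \<Rightarrow> 'a::euclidean_space) set" where
  "W1inf T = {y. \<exists>w\<in>Linf T. has_weak_deriv T y w}"

definition W12 :: "real \<Rightarrow> (real \<Rightarrow> 'a::euclidean_space) set" where
  "W12 T = {y. \<exists>w\<in>L2 T. has_weak_deriv T y w}"

text \<open>The weak derivative is unique up to a null set, so the choice does not affect the norm.\<close>

definition W1inf_norm :: "real \<Rightarrow> (real \<Rightarrow> 'a::euclidean_space) \<Rightarrow> real" where
  "W1inf_norm T y = Linf_norm T y + Linf_norm T (SOME w. has_weak_deriv T y w)"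

section \<open>The optimal control problem\<close>

text \<open>The vector valued data \<open>g\<close>, \<open>\<Phi>\<^sup>E\<close>, \<open>\<Phi>\<^sup>I\<close> are given by their components, which are indexed
  from \<open>0\<close>, so that \<open>ncon\<close>, \<open>nE\<close>, \<open>nI\<close> are arbitrary natural numbers. The running constraints
  of order one are those with index below \<open>nord1\<close>.\<close>

record ('m::finite, 'n::finite) ocp =
  horizon :: real
  ell :: "(real ^ 'm) \<times> (real ^ 'n) \<Rightarrow> real"
  phi :: "(real ^ 'n) \<times> (real ^ 'n) \<Rightarrow> real"
  dyn :: "real \<times> real \<times> (real ^ 'm) \<times> (real ^ 'n) \<Rightarrow> (real ^ 'n)"
  ncon :: nat
  nord1 :: nat
  con :: "nat \<Rightarrow> (real ^ 'n) \<Rightarrow> real"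
  nE :: nat
  PhiE :: "nat \<Rightarrow> (real ^ 'n) \<times> (real ^ 'n) \<Rightarrow> real"
  nI :: nat
  PhiI :: "nat \<Rightarrow> (real ^ 'n) \<times> (real ^ 'n) \<Rightarrow> real"

definition A0 :: "('m::finite, 'n::finite) ocp \<Rightarrow> bool" where
  "A0 P \<longleftrightarrow> smooth (ell P) \<and> smooth (phi P) \<and> smooth (dyn P) \<and>
     (\<forall>i<ncon P. smooth (con P i)) \<and> (\<forall>i<nE P. smooth (PhiE P i)) \<and>
     (\<forall>i<nI P. smooth (PhiI P i)) \<and> (\<exists>L. L-lipschitz_on UNIV (dyn P))"

text \<open>\<open>\<real>\<^sup>d\<close> is represented by the sequences that vanish from index \<open>d\<close> on.\<close>

definition Rd :: "nat \<Rightarrow> (nat \<Rightarrow> real) set" where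
  "Rd d = {x. \<forall>i\<ge>d. x i = 0}"

definition dimPhi :: "('m::finite, 'n::finite) ocp \<Rightarrow> nat" where
  "dimPhi P = nE P + nI P"

definition Phi :: "('m::finite, 'n::finite) ocp \<Rightarrow> (real ^ 'n) \<times> (real ^ 'n) \<Rightarrow> nat \<Rightarrow> real" where
  "Phi P x i = (if i < nE P then PhiE P i x else if i < dimPhi P then PhiI P (i - nE P) x else 0)"

definition coneK :: "('m::finite, 'n::finite) ocp \<Rightarrow> (nat \<Rightarrow> real) set" where
  "coneK P = {x \<in> Rd (dimPhi P). (\<forall>i<nE P. x i = 0) \<and> (\<forall>i\<in>{nE P..<dimPhi P}. x i \<le> 0)}"

definition normal_cone :: "nat \<Rightarrow> (nat \<Rightarrow> real) set \<Rightarrow> (nat \<Rightarrow> real) \<Rightarrow> (nat \<Rightarrow> real) set" where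
  "normal_cone d K x = {\<psi> \<in> Rd d. x \<in> K \<and> (\<forall>y\<in>K. (\<Sum>i<d. \<psi> i * (y i - x i)) \<le> 0)}"

definition tangent_cone :: "nat \<Rightarrow> (nat \<Rightarrow> real) set \<Rightarrow> (nat \<Rightarrow> real) \<Rightarrow> (nat \<Rightarrow> real) set" where
  "tangent_cone d K x = {h \<in> Rd d. \<exists>\<sigma> hs. (\<forall>k. \<sigma> k > 0) \<and> \<sigma> \<longlonglongrightarrow> 0 \<and>
      (\<forall>i<d. (\<lambda>k. hs k i) \<longlonglongrightarrow> h i) \<and> (\<forall>k::nat. (\<lambda>i. x i + \<sigma> k * hs k i) \<in> K)}"

definition trajectory ::
  "('m::finite, 'n::finite) ocp \<Rightarrow> (real \<Rightarrow> (real ^ 'm)) \<Rightarrow> (real \<Rightarrow> (real ^ 'n)) \<Rightarrow> bool" where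
  "trajectory P u y \<longleftrightarrow> u \<in> Linf (horizon P) \<and> y \<in> W1inf (horizon P) \<and>
     (\<forall>t\<in>{0..horizon P}. y t = y 0 + (LINT s|lebesgue_on {0..t}. dyn P (t, s, u s, y s)))"

definition feasible ::
  "('m::finite, 'n::finite) ocp \<Rightarrow> (real \<Rightarrow> (real ^ 'm)) \<Rightarrow> (real \<Rightarrow> (real ^ 'n)) \<Rightarrow> bool" where
  "feasible P u y \<longleftrightarrow> trajectory P u y \<and>
     (\<forall>t\<in>{0..horizon P}. \<forall>i<ncon P. con P i (y t) \<le> 0) \<and>
     Phi P (y 0, y (horizon P)) \<in> coneK P"

definition cost ::
  "('m::finite, 'n::finite) ocp \<Rightarrow> (real \<Rightarrow> (real ^ 'm)) \<Rightarrow> (real \<Rightarrow> (real ^ 'n)) \<Rightarrow> real" where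
  "cost P u y = (LINT t|lebesgue_on {0..horizon P}. ell P (u t, y t)) + phi P (y 0, y (horizon P))"

definition local_solution ::
  "('m::finite, 'n::finite) ocp \<Rightarrow> (real \<Rightarrow> (real ^ 'm)) \<Rightarrow> (real \<Rightarrow> (real ^ 'n)) \<Rightarrow> bool" where
  "local_solution P ubar ybar \<longleftrightarrow> feasible P ubar ybar \<and>
     (\<exists>\<epsilon>>0. \<forall>u y. feasible P u y \<and>
        Linf_norm (horizon P) (\<lambda>t. u t - ubar t) + W1inf_norm (horizon P) (\<lambda>t. y t - ybar t) \<le> \<epsilon>
        \<longrightarrow> cost P ubar ybar \<le> cost P u y)"

text \<open>For a given control and initial state, the state is uniquely determined on \<open>{0..T}\<close>, hence the
  choice below is immaterial there. The same applies to the linearized state.\<close>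

definition state ::
  "('m::finite, 'n::finite) ocp \<Rightarrow> (real \<Rightarrow> (real ^ 'm)) \<Rightarrow> (real ^ 'n) \<Rightarrow> real \<Rightarrow> (real ^ 'n)" where
  "state P u y0 = (SOME y. y \<in> W1inf (horizon P) \<and>
     (\<forall>t\<in>{0..horizon P}. y t = y0 + (LINT s|lebesgue_on {0..t}. dyn P (t, s, u s, y s))))"

definition Jcost ::
  "('m::finite, 'n::finite) ocp \<Rightarrow> (real \<Rightarrow> (real ^ 'm)) \<Rightarrow> (real ^ 'n) \<Rightarrow> real" where
  "Jcost P u y0 =
     (LINT t|lebesgue_on {0..horizon P}. ell P (u t, state P u y0 t))
       + phi P (y0, state P u y0 (horizon P))"

definition lin_state ::
  "('m::finite, 'n::finite) ocp \<Rightarrow> (real \<Rightarrow> (real ^ 'm)) \<Rightarrow> (real \<Rightarrow> (real ^ 'n)) \<Rightarrow>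
     (real \<Rightarrow> (real ^ 'm)) \<Rightarrow> (real ^ 'n) \<Rightarrow> real \<Rightarrow> (real ^ 'n)" where
  "lin_state P u y v z0 = (SOME z. z \<in> W12 (horizon P) \<and>
     (\<forall>t\<in>{0..horizon P}. z t = z0 +
        (LINT s|lebesgue_on {0..t}.
           frechet_derivative (\<lambda>x. dyn P (t, s, x)) (at (u s, y s)) (v s, z s))))"

section \<open>Order of the running constraints\<close>

text \<open>Functions of \<open>(t, \<tilde>u, \<tilde>y, u, y)\<close>. They are considered on the set where \<open>t \<in> {0..T}\<close>, so that
  integrals over \<open>{0..t}\<close> make sense, and \<open>u\<close>, \<open>y\<close> belong to the control and state spaces.\<close>

type_synonym ('m, 'n) sfun =
  "real \<Rightarrow> (real ^ 'm) \<Rightarrow> (real ^ 'n) \<Rightarrow> (real \<Rightarrow> (real ^ 'm)) \<Rightarrow> (real \<Rightarrow> (real ^ 'n)) \<Rightarrow> real"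

definition sfun_dom ::
  "('m::finite, 'n::finite) ocp \<Rightarrow> real \<Rightarrow> (real \<Rightarrow> (real ^ 'm)) \<Rightarrow> (real \<Rightarrow> (real ^ 'n)) \<Rightarrow> bool" where
  "sfun_dom P t u y \<longleftrightarrow> t \<in> {0..horizon P} \<and> u \<in> Linf (horizon P) \<and> y \<in> W1inf (horizon P)"

definition sfun_eq ::
  "('m::finite, 'n::finite) ocp \<Rightarrow> ('m, 'n) sfun \<Rightarrow> ('m, 'n) sfun \<Rightarrow> bool" where
  "sfun_eq P h k \<longleftrightarrow> (\<forall>t w x u y. sfun_dom P t u y \<longrightarrow> h t w x u y = k t w x u y)"

text \<open>The graph of the derivation \<open>D\<^sup>(\<^sup>1\<^sup>)\<close>, whose domain is the ring \<open>\<S>\<close> generated by the functions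
  \<open>a(t, \<tilde>u, \<tilde>y)\<close> and the integrals of \<open>b(t, s, u\<^sub>s, y\<^sub>s)\<close> over \<open>{0..t}\<close>. The rule \<open>cong\<close> says
  that functions which agree on the set above are identified.\<close>

inductive S_deriv ::
  "('m::finite, 'n::finite) ocp \<Rightarrow> ('m, 'n) sfun \<Rightarrow> ('m, 'n) sfun \<Rightarrow> bool" for P where
  point: "smooth a \<Longrightarrow>
    S_deriv P (\<lambda>t w x u y. a (t, w, x))
      (\<lambda>t w x u y. Dtau a (t, w, x) +
         frechet_derivative (\<lambda>\<xi>. a (t, w, \<xi>)) (at x)
           (dyn P (t, t, w, x) + (LINT s|lebesgue_on {0..t}. Dtau (dyn P) (t, s, u s, y s))))"
| integral: "smooth b \<Longrightarrow>
    S_deriv P (\<lambda>t w x u y. LINT s|lebesgue_on {0..t}. b (t, s, u s, y s))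
      (\<lambda>t w x u y. b (t, t, w, x) + (LINT s|lebesgue_on {0..t}. Dtau b (t, s, u s, y s)))"
| add: "S_deriv P h h' \<Longrightarrow> S_deriv P k k' \<Longrightarrow>
    S_deriv P (\<lambda>t w x u y. h t w x u y + k t w x u y)
      (\<lambda>t w x u y. h' t w x u y + k' t w x u y)"
| mult: "S_deriv P h h' \<Longrightarrow> S_deriv P k k' \<Longrightarrow>
    S_deriv P (\<lambda>t w x u y. h t w x u y * k t w x u y)
      (\<lambda>t w x u y. h' t w x u y * k t w x u y + h t w x u y * k' t w x u y)"
| cong: "S_deriv P h h' \<Longrightarrow> sfun_eq P h k \<Longrightarrow> sfun_eq P h' k' \<Longrightarrow> S_deriv P k k'"

text \<open>The relation is single valued up to \<open>sfun_eq\<close>: its value at \<open>h\<close> is the right derivative at time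
  \<open>t < T\<close> of \<open>h\<close> along continuations of \<open>(u, y)\<close> beyond \<open>t\<close> by \<open>(\<tilde>u, \<tilde>y)\<close>, and it is continuous in \<open>t\<close>.\<close>

definition D1 :: "('m::finite, 'n::finite) ocp \<Rightarrow> ('m, 'n) sfun \<Rightarrow> ('m, 'n) sfun" where
  "D1 P h = (SOME h'. S_deriv P h h')"

definition gder :: "('m::finite, 'n::finite) ocp \<Rightarrow> nat \<Rightarrow> nat \<Rightarrow> ('m, 'n) sfun" where
  "gder P i j = (D1 P ^^ j) (\<lambda>t w x u y. con P i x)"

definition Du_vanishes :: "('m::finite, 'n::finite) ocp \<Rightarrow> ('m, 'n) sfun \<Rightarrow> bool" where
  "Du_vanishes P h \<longleftrightarrow>
     (\<forall>t w x u y. sfun_dom P t u y \<longrightarrow> grad (\<lambda>\<omega>. h t \<omega> x u y) w = 0)"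

definition has_order :: "('m::finite, 'n::finite) ocp \<Rightarrow> nat \<Rightarrow> nat \<Rightarrow> bool" where
  "has_order P i q \<longleftrightarrow> q > 0 \<and> (\<forall>j<q. Du_vanishes P (gder P i j)) \<and>
     (\<forall>q'>0. (\<forall>j<q'. Du_vanishes P (gder P i j)) \<longrightarrow> q' \<le> q)"

definition ord_con :: "('m::finite, 'n::finite) ocp \<Rightarrow> nat \<Rightarrow> nat" where
  "ord_con P i = (THE q. has_order P i q)"

definition numbered_by_order :: "('m::finite, 'n::finite) ocp \<Rightarrow> bool" where
  "numbered_by_order P \<longleftrightarrow> nord1 P \<le> ncon P \<and> (\<forall>i<nord1 P. has_order P i 1) \<and>
     (\<forall>i\<in>{nord1 P..<ncon P}. \<not> has_order P i 1)"

section \<open>Structure of the trajectory\<close>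

definition active :: "('m::finite, 'n::finite) ocp \<Rightarrow> (real \<Rightarrow> (real ^ 'n)) \<Rightarrow> real \<Rightarrow> nat set" where
  "active P y t = {i. i < ncon P \<and> con P i (y t) = 0}"

definition const_active ::
  "('m::finite, 'n::finite) ocp \<Rightarrow> (real \<Rightarrow> (real ^ 'n)) \<Rightarrow> real set \<Rightarrow> bool" where
  "const_active P y A \<longleftrightarrow> A \<noteq> {} \<and> is_interval A \<and> openin (top_of_set {0..horizon P}) A \<and>
     (\<forall>s\<in>A. \<forall>t\<in>A. active P y s = active P y t)"

definition arc ::
  "('m::finite, 'n::finite) ocp \<Rightarrow> (real \<Rightarrow> (real ^ 'n)) \<Rightarrow> real set \<Rightarrow> bool" where
  "arc P y A \<longleftrightarrow> const_active P y A \<and> (\<forall>B. const_active P y B \<and> A \<subseteq> B \<longrightarrow> A = B)"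

definition junction_times ::
  "('m::finite, 'n::finite) ocp \<Rightarrow> (real \<Rightarrow> (real ^ 'n)) \<Rightarrow> real set" where
  "junction_times P y = {t\<in>{0..horizon P}. \<not> (\<exists>A. arc P y A \<and> t \<in> A)}"

definition interior_arc ::
  "('m::finite, 'n::finite) ocp \<Rightarrow> (real \<Rightarrow> (real ^ 'n)) \<Rightarrow> nat \<Rightarrow> real set \<Rightarrow> bool" where
  "interior_arc P y i A \<longleftrightarrow> arc P y A \<and> (\<forall>t\<in>A. i \<notin> active P y t)"

definition entry_point ::
  "('m::finite, 'n::finite) ocp \<Rightarrow> (real \<Rightarrow> (real ^ 'n)) \<Rightarrow> nat \<Rightarrow> real \<Rightarrow> bool" where
  "entry_point P y i \<tau> \<longleftrightarrow> (\<exists>A. interior_arc P y i A \<and> \<tau> = Sup A \<and> con P i (y \<tau>) = 0)"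

definition exit_point ::
  "('m::finite, 'n::finite) ocp \<Rightarrow> (real \<Rightarrow> (real ^ 'n)) \<Rightarrow> nat \<Rightarrow> real \<Rightarrow> bool" where
  "exit_point P y i \<tau> \<longleftrightarrow> (\<exists>A. interior_arc P y i A \<and> \<tau> = Inf A \<and> con P i (y \<tau>) = 0)"

definition touch_points ::
  "('m::finite, 'n::finite) ocp \<Rightarrow> (real \<Rightarrow> (real ^ 'n)) \<Rightarrow> nat \<Rightarrow> real set" where
  "touch_points P y i = {\<tau>. entry_point P y i \<tau> \<and> exit_point P y i \<tau>}"

text \<open>Near \<open>\<tau>\<close> (and inside \<open>{0..T}\<close>), the second distributional derivative of \<open>h\<close> is an integrable
  function which is continuous at \<open>\<tau>\<close>, with value \<open>c\<close> there. There is at most one such \<open>c\<close>.\<close>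

definition has_weak_deriv2_at :: "real \<Rightarrow> (real \<Rightarrow> real) \<Rightarrow> real \<Rightarrow> real \<Rightarrow> bool" where
  "has_weak_deriv2_at T h \<tau> c \<longleftrightarrow>
     (\<exists>a b w. 0 \<le> a \<and> a < \<tau> \<and> \<tau> < b \<and> b \<le> T \<and> integrable (lebesgue_on {a<..<b}) w \<and>
        (\<forall>\<theta>\<in>test_functions a b.
           (LINT t|lebesgue_on {a<..<b}. deriv (deriv \<theta>) t * h t) =
           (LINT t|lebesgue_on {a<..<b}. \<theta> t * w t)) \<and>
        isCont w \<tau> \<and> w \<tau> = c)"

definition weak_deriv2_at :: "real \<Rightarrow> (real \<Rightarrow> real) \<Rightarrow> real \<Rightarrow> real" where
  "weak_deriv2_at T h \<tau> = (THE c. has_weak_deriv2_at T h \<tau> c)"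

definition reducible_touch_point ::
  "('m::finite, 'n::finite) ocp \<Rightarrow> (real \<Rightarrow> (real ^ 'n)) \<Rightarrow> nat \<Rightarrow> real \<Rightarrow> bool" where
  "reducible_touch_point P y i \<tau> \<longleftrightarrow>
     \<tau> \<in> touch_points P y i \<and>
     (\<exists>c<0. has_weak_deriv2_at (horizon P) (\<lambda>t. con P i (y t)) \<tau> c)"

definition Icon ::
  "('m::finite, 'n::finite) ocp \<Rightarrow> (real \<Rightarrow> (real ^ 'n)) \<Rightarrow> nat \<Rightarrow> real set" where
  "Icon P y i = {t\<in>{0..horizon P}. con P i (y t) = 0} -
     (if i < nord1 P then {} else touch_points P y i)"

text \<open>The distance to the empty set is infinite, whereas \<open>infdist\<close> is \<open>0\<close> in that case.\<close>

definition Icon_delta ::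
  "('m::finite, 'n::finite) ocp \<Rightarrow> (real \<Rightarrow> (real ^ 'n)) \<Rightarrow> real \<Rightarrow> nat \<Rightarrow> real set" where
  "Icon_delta P y \<delta> i = {t\<in>{0..horizon P}. Icon P y i \<noteq> {} \<and> infdist t (Icon P y i) \<le> \<delta>}"

definition I_at ::
  "('m::finite, 'n::finite) ocp \<Rightarrow> (real \<Rightarrow> (real ^ 'n)) \<Rightarrow> real \<Rightarrow> real \<Rightarrow> nat set" where
  "I_at P y \<delta> t = {i. i < ncon P \<and> t \<in> Icon_delta P y \<delta> i}"

definition A1 :: "('m::finite, 'n::finite) ocp \<Rightarrow> (real \<Rightarrow> (real ^ 'n)) \<Rightarrow> bool" where
  "A1 P y \<longleftrightarrow> finite (junction_times P y) \<and>
     (\<forall>i\<in>{nord1 P..<ncon P}. \<forall>\<tau>\<in>touch_points P y i. reducible_touch_point P y i \<tau>)"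

definition A2 :: "('m::finite, 'n::finite) ocp \<Rightarrow> bool" where
  "A2 P \<longleftrightarrow> (\<forall>i<ncon P. \<exists>q. has_order P i q)"

definition A3 ::
  "('m::finite, 'n::finite) ocp \<Rightarrow> (real \<Rightarrow> (real ^ 'm)) \<Rightarrow> (real \<Rightarrow> (real ^ 'n)) \<Rightarrow> bool" where
  "A3 P u y \<longleftrightarrow> (\<exists>\<epsilon>0>0. \<exists>\<gamma>>0. \<forall>t\<in>{0..horizon P}. \<forall>\<xi>.
     norm (\<Sum>i\<in>I_at P y \<epsilon>0 t. \<xi> i *\<^sub>R grad (\<lambda>\<omega>. gder P i (ord_con P i) t \<omega> (y t) u y) (u t))
       \<ge> \<gamma> * L2_set \<xi> (I_at P y \<epsilon>0 t))"

definition A4 :: "('m::finite, 'n::finite) ocp \<Rightarrow> (real \<Rightarrow> (real ^ 'n)) \<Rightarrow> bool" where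
  "A4 P y \<longleftrightarrow> (\<forall>i<ncon P. con P i (y 0) < 0) \<and>
     (\<exists>\<tau>. 0 \<le> \<tau> \<and> \<tau> < horizon P \<and>
        (\<forall>s\<in>{\<tau><..horizon P}. \<forall>t\<in>{\<tau><..horizon P}.
           {i. i < ncon P \<and> s \<in> Icon P y i} = {i. i < ncon P \<and> t \<in> Icon P y i}))"

section \<open>Lagrange multipliers\<close>

definition ham ::
  "('m::finite, 'n::finite) ocp \<Rightarrow> (real \<Rightarrow> (real ^ 'n)) \<Rightarrow> real \<Rightarrow> (real ^ 'm) \<times> (real ^ 'n) \<Rightarrow> real" where
  "ham P p t x = ell P x + p t \<bullet> dyn P (t, t, x) +
     (LINT s|lebesgue_on {t..horizon P}. p s \<bullet> Dtau (dyn P) (s, t, x))"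

definition endpoint_lagrangian ::
  "('m::finite, 'n::finite) ocp \<Rightarrow> (nat \<Rightarrow> real) \<Rightarrow> (real ^ 'n) \<times> (real ^ 'n) \<Rightarrow> real" where
  "endpoint_lagrangian P \<Psi> x = phi P x + (\<Sum>i<dimPhi P. \<Psi> i * Phi P x i)"

definition finite_measure_on :: "real \<Rightarrow> real measure \<Rightarrow> bool" where
  "finite_measure_on T \<mu> \<longleftrightarrow> finite_measure \<mu> \<and> sets \<mu> = sets (restrict_space borel {0..T})"

definition supp :: "real measure \<Rightarrow> real set" where
  "supp \<mu> = {t\<in>space \<mu>. \<forall>U. open U \<and> t \<in> U \<longrightarrow> emeasure \<mu> (U \<inter> space \<mu>) > 0}"

text \<open>Functions of bounded variation live on the open interval from \<open>-1\<close> to \<open>T + 1\<close>. The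
  derivative is given by its action on test functions. A finite vector valued measure is written as
  an integrable density with respect to a finite positive measure (for instance its total
  variation).\<close>

definition has_distr_deriv ::
  "real \<Rightarrow> (real \<Rightarrow> (real ^ 'n)) \<Rightarrow> ((real \<Rightarrow> real) \<Rightarrow> (real ^ 'n)) \<Rightarrow> bool" where
  "has_distr_deriv T p D \<longleftrightarrow>
     (\<forall>\<theta>\<in>test_functions (-1) (T + 1).
        D \<theta> = - (LINT t|lebesgue_on {-1<..<T + 1}. deriv \<theta> t *\<^sub>R p t))"

definition BV :: "real \<Rightarrow> (real \<Rightarrow> (real ^ 'n)) set" where
  "BV T = {p. integrable (lebesgue_on {-1<..<T + 1}) p \<and>
     (\<exists>\<mu> w. finite_measure_on T \<mu> \<and> integrable \<mu> w \<and>
        has_distr_deriv T p (\<lambda>\<theta>. LINT t|\<mu>. \<theta> t *\<^sub>R w t))}"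

definition left_val :: "(real \<Rightarrow> (real ^ 'n)) \<Rightarrow> (real ^ 'n)" where
  "left_val p = (THE c. AE t in lebesgue_on {-1<..<0}. p t = c)"

definition right_val :: "real \<Rightarrow> (real \<Rightarrow> (real ^ 'n)) \<Rightarrow> (real ^ 'n)" where
  "right_val T p = (THE c. AE t in lebesgue_on {T<..<T + 1}. p t = c)"

type_synonym 'n multiplier = "(nat \<Rightarrow> real measure) \<times> (nat \<Rightarrow> real) \<times> (real \<Rightarrow> (real ^ 'n))"

text \<open>The components of \<open>d\<eta>\<close> are required to be nonnegative, hence they are measures in the
  sense of the library; the sign condition on \<open>d\<eta>\<close> is thus part of \<open>finite_measure_on\<close>.\<close>

definition multipliers ::
  "('m::finite, 'n::finite) ocp \<Rightarrow> (real \<Rightarrow> (real ^ 'm)) \<Rightarrow> (real \<Rightarrow> (real ^ 'n)) \<Rightarrow> 'n multiplier set"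
  where
  "multipliers P u y = {(\<eta>, \<Psi>, p).
     (\<forall>i<ncon P. finite_measure_on (horizon P) (\<eta> i)) \<and>
     \<Psi> \<in> Rd (dimPhi P) \<and>
     p \<in> BV (horizon P) \<and>
     has_distr_deriv (horizon P) p
       (\<lambda>\<theta>. - ((LINT t|lebesgue_on {0..horizon P}. \<theta> t *\<^sub>R grad (\<lambda>x. ham P p t (u t, x)) (y t)) +
               (\<Sum>i<ncon P. LINT t|\<eta> i. \<theta> t *\<^sub>R grad (con P i) (y t)))) \<and>
     (\<forall>a b. frechet_derivative (endpoint_lagrangian P \<Psi>) (at (y 0, y (horizon P))) (a, b) =
              - left_val p \<bullet> a + right_val (horizon P) p \<bullet> b) \<and>
     (\<forall>t\<in>{0..horizon P}. \<forall>i<ncon P. con P i (y t) \<le> 0) \<and>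
     (\<Sum>i<ncon P. LINT t|\<eta> i. con P i (y t)) = 0 \<and>
     \<Psi> \<in> normal_cone (dimPhi P) (coneK P) (Phi P (y 0, y (horizon P))) \<and>
     (AE t in lebesgue_on {0..horizon P}. grad (\<lambda>\<omega>. ham P p t (\<omega>, y t)) (u t) = 0)}"

section \<open>Second order objects\<close>

definition dcon ::
  "('m::finite, 'n::finite) ocp \<Rightarrow> (real \<Rightarrow> (real ^ 'n)) \<Rightarrow> (real \<Rightarrow> (real ^ 'n)) \<Rightarrow> nat \<Rightarrow> real \<Rightarrow> real"
  where
  "dcon P y z i t = frechet_derivative (con P i) (at (y t)) (z t)"

definition dPhi ::
  "('m::finite, 'n::finite) ocp \<Rightarrow> (real ^ 'n) \<times> (real ^ 'n) \<Rightarrow> (real ^ 'n) \<times> (real ^ 'n) \<Rightarrow> nat \<Rightarrow> real" where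
  "dPhi P x h i = frechet_derivative (\<lambda>x. Phi P x i) (at x) h"

fun critical_cone ::
  "('m::finite, 'n::finite) ocp \<Rightarrow> (real \<Rightarrow> (real ^ 'm)) \<Rightarrow> (real \<Rightarrow> (real ^ 'n)) \<Rightarrow> 'n multiplier \<Rightarrow>
     ((real \<Rightarrow> (real ^ 'm)) \<times> (real ^ 'n)) set" where
  "critical_cone P u y (\<eta>, \<Psi>, p) = {(v, z0). v \<in> L2 (horizon P) \<and>
     (let T = horizon P; z = lin_state P u y v z0 in
       (\<forall>i<ncon P. (\<forall>t\<in>Icon P y i. dcon P y z i t \<le> 0) \<and>
                    (\<forall>t\<in>supp (\<eta> i) \<inter> Icon P y i. dcon P y z i t = 0)) \<and>
       (\<forall>i\<in>{nord1 P..<ncon P}. \<forall>\<tau>\<in>touch_points P y i.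
          dcon P y z i \<tau> \<le> 0 \<and> measure (\<eta> i) {\<tau>} * dcon P y z i \<tau> = 0) \<and>
       dPhi P (y 0, y T) (z0, z T) \<in> tangent_cone (dimPhi P) (coneK P) (Phi P (y 0, y T)) \<and>
       (\<Sum>i<dimPhi P. \<Psi> i * dPhi P (y 0, y T) (z0, z T) i) = 0)}"

fun hessian ::
  "('m::finite, 'n::finite) ocp \<Rightarrow> (real \<Rightarrow> (real ^ 'm)) \<Rightarrow> (real \<Rightarrow> (real ^ 'n)) \<Rightarrow> 'n multiplier \<Rightarrow>
     (real \<Rightarrow> (real ^ 'm)) \<times> (real ^ 'n) \<Rightarrow> real" where
  "hessian P u y (\<eta>, \<Psi>, p) (v, z0) =
     (let T = horizon P; z = lin_state P u y v z0 in
       (LINT t|lebesgue_on {0..T}. D2 (ham P p t) (u t, y t) (v t, z t) (v t, z t)) +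
       D2 (endpoint_lagrangian P \<Psi>) (y 0, y T) (z0, z T) (z0, z T) +
       (\<Sum>i<ncon P. LINT t|\<eta> i. D2 (con P i) (y t) (z t) (z t)) -
       (\<Sum>i\<in>{nord1 P..<ncon P}. \<Sum>\<tau>\<in>touch_points P y i.
          measure (\<eta> i) {\<tau>} * ((deriv (dcon P y z i) \<tau>)\<^sup>2 /
            weak_deriv2_at T (\<lambda>t. con P i (y t)) \<tau>)))"

section \<open>Legendre forms on the Hilbert space of pairs \<open>(v, z\<^sub>0)\<close>\<close>

type_synonym ('m, 'n) dir = "(real \<Rightarrow> (real ^ 'm)) \<times> (real ^ 'n)"

definition X2 :: "real \<Rightarrow> ('m::finite, 'n::finite) dir set" where
  "X2 T = {(v, z0). v \<in> L2 T}"

fun X2_inner :: "real \<Rightarrow> ('m::finite, 'n::finite) dir \<Rightarrow> ('m, 'n) dir \<Rightarrow> real" where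
  "X2_inner T (v, z) (w, \<zeta>) = (LINT t|lebesgue_on {0..T}. v t \<bullet> w t) + z \<bullet> \<zeta>"

fun X2_dist :: "real \<Rightarrow> ('m::finite, 'n::finite) dir \<Rightarrow> ('m, 'n) dir \<Rightarrow> real" where
  "X2_dist T (v, z) (w, \<zeta>) =
     sqrt (X2_inner T (\<lambda>t. v t - w t, z - \<zeta>) (\<lambda>t. v t - w t, z - \<zeta>))"

fun X2_is_zero :: "real \<Rightarrow> ('m::finite, 'n::finite) dir \<Rightarrow> bool" where
  "X2_is_zero T (v, z0) \<longleftrightarrow> (AE t in lebesgue_on {0..T}. v t = 0) \<and> z0 = 0"

definition X2_weakly_converges ::
  "real \<Rightarrow> (nat \<Rightarrow> ('m::finite, 'n::finite) dir) \<Rightarrow> ('m, 'n) dir \<Rightarrow> bool" where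
  "X2_weakly_converges T xs x \<longleftrightarrow>
     (\<forall>h\<in>X2 T. (\<lambda>k. X2_inner T (xs k) h) \<longlonglongrightarrow> X2_inner T x h)"

definition legendre_form :: "real \<Rightarrow> (('m::finite, 'n::finite) dir \<Rightarrow> real) \<Rightarrow> bool" where
  "legendre_form T Q \<longleftrightarrow>
     (\<forall>xs x. (\<forall>k. xs k \<in> X2 T) \<and> x \<in> X2 T \<and> X2_weakly_converges T xs x \<longrightarrow>
        ereal (Q x) \<le> liminf (\<lambda>k. ereal (Q (xs k))) \<and>
        ((\<lambda>k. Q (xs k)) \<longlonglongrightarrow> Q x \<longrightarrow> (\<lambda>k. X2_dist T (xs k) x) \<longlonglongrightarrow> 0))"

end

theory Submission
  imports Defs "HOL-Library.Diagonal_Subsequence" "HOL-Computational_Algebra.Polynomial"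
begin

text \<open>Suppose that the growth condition fails along feasible trajectories \<open>(u\<^sub>k, y\<^sub>k)\<close>, let
  \<open>\<epsilon>\<^sub>k\<close> be the \<open>L\<^sup>2 \<times> \<real>\<^sup>n\<close> distance to the reference and \<open>v\<^sub>k = (u\<^sub>k - u) / \<epsilon>\<^sub>k\<close>. A subsequence of
  \<open>v\<^sub>k\<close> converges weakly, and since an integral equation regularizes, the quotients \<open>(y\<^sub>k - y) / \<epsilon>\<^sub>k\<close>
  converge pointwise to the linearized state of the weak limit. Integrating the adjoint equation by
  parts turns the increment of the Lagrangian into the second order Taylor remainders of the
  Hamiltonian, of the endpoint Lagrangian and of the running constraints, exactly. Divided by
  \<open>\<epsilon>\<^sub>k\<close>, this identity shows that the weak limit is critical; divided by \<open>\<epsilon>\<^sub>k\<^sup>2\<close>, it shows that the upper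
  limit of the Hessian along \<open>v\<^sub>k\<close> is nonpositive. Here the curvature term at a reducible touch
  point \<open>\<tau>\<close> comes from evaluating the constraint along \<open>y\<^sub>k\<close> at a time shifted by a multiple of \<open>\<epsilon>\<^sub>k\<close>,
  where it is nonpositive as well. A Legendre form that is positive on nonzero critical directions then
  forces strong convergence of the normalized directions to zero, which is absurd. Constraints of
  higher order enter only through the fact that \<open>g'(y) f(t, t, u, y)\<close> does not depend on \<open>u\<close>.\<close>

text \<open>Growth is measured in L2 but closeness of the control is uniform, and this two-norm
  setting controls the Taylor remainders: divided by \<open>\<epsilon>\<^sub>k\<^sup>2\<close>, a
  cubic remainder is essentially the uniform norm of \<open>\<epsilon>\<^sub>k v\<^sub>k\<close>
  times \<open>|v\<^sub>k|\<^sup>2\<close>, so its integral tends to zero although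
  \<open>v\<^sub>k\<close> is bounded only in L2. The obstacle is that the Hessian is not weakly
  continuous, so no limit of it along \<open>v\<^sub>k\<close> is computed. An upper bound meets the
  two halves of the Legendre property: lower semicontinuity forces the weak limit to be zero, and
  convergence of the values to zero then makes the convergence strong. The multiplier may depend on
  the direction. The weak limit is therefore found before a multiplier is selected, and the
  estimates along the sequence are proved for every multiplier. The shift at a touch point maximizes
  \<open>\<zeta> s + c s\<^sup>2 / 2\<close>, where \<open>c < 0\<close> is the second derivative of
  the constraint and \<open>\<zeta>\<close> the time derivative of its linearization. The maximum
  \<open>- \<zeta>\<^sup>2 / (2 c)\<close> is half of the curvature term per unit mass.\<close>

abbreviation leb :: "real \<Rightarrow> real measure" where "leb t \<equiv> lebesgue_on {0..t}"

abbreviation cont :: "real \<Rightarrow> (real \<Rightarrow> 'b::topological_space) \<Rightarrow> bool" where "cont t \<equiv> continuous_on {0..t}"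

notation (input) scaleR (infixr "*R" 75)

abbreviation (input) seq_limit (infix "~~>" 60) where "X ~~> l \<equiv> X \<longlonglongrightarrow> l"

lemmas b_integrable_add = Bochner_Integration.integrable_add
lemmas b_integrable_bound = Bochner_Integration.integrable_bound
lemmas b_integrable_cong = Bochner_Integration.integrable_cong
lemmas b_integrable_diff = Bochner_Integration.integrable_diff
lemmas b_integrable_norm = Bochner_Integration.integrable_norm
lemmas b_integrable_sum = Bochner_Integration.integrable_sum
lemmas b_integral_add = Bochner_Integration.integral_add
lemmas b_integral_cong = Bochner_Integration.integral_cong
lemmas b_integral_diff = Bochner_Integration.integral_diff
lemmas b_integral_norm_bound_integral = Bochner_Integration.integral_norm_bound_integral

section \<open>Calculus of smooth functions\<close>

abbreviation fd :: "('a::real_normed_vector => 'b::real_normed_vector) => 'a => 'a => 'b" where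
 "fd F x \<equiv> frechet_derivative F (at x)"

lemma fdI: "(F has_derivative F') (at x) ==> fd F x = F'"
 by (metis frechet_derivative_at)

lemma Ck_continuous: "Ck k F ==> continuous_on UNIV F"
 by (cases k) (auto simp: continuous_on_eq_continuous_at differentiable_imp_continuous_within)

lemma Ck_Suc_D: "Ck (Suc k) F ==> Ck k F"
proof (induction k arbitrary: F)
 case 0
 then show ?case using Ck_continuous[OF 0] by simp
next
 case (Suc k)
 have "F differentiable (at x)" for x using Suc.prems by simp
 moreover have "Ck k (%x. fd F x v)" for v
 proof -
  have "Ck (Suc k) (%x. fd F x v)" using Suc.prems Ck.simps(2)[of "Suc k" F] by blast
  then show ?thesis by (rule Suc.IH)
 qed
 ultimately show ?case by simp
qed

lemma Ck_SucI:
 assumes "!!x. (F has_derivative F' x) (at x)" "!!v. Ck k (%x. F' x v)"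
 shows "Ck (Suc k) F"
proof -
 have "fd F x = F' x" for x by (rule fdI[OF assms(1)])
 then show ?thesis using assms by (auto simp: differentiable_def)
qed

lemma Ck_Suc_has_derivative: "Ck (Suc k) F ==> (F has_derivative fd F x) (at x)"
 by (simp add: frechet_derivative_works)

lemma Ck_const: "Ck k (%x. c)"
proof (induction k arbitrary: c)
 case (Suc k)
 show ?case by (rule Ck_SucI[where F'="%_ _. 0"]) (auto intro: Suc)
qed simp

lemma Ck_bounded_linear:
 assumes "bounded_linear L" shows "Ck k L"
proof (cases k)
 case 0 then show ?thesis using assms by (simp add: linear_continuous_on)
next
 case (Suc j)
 show ?thesis unfolding Suc
  by (rule Ck_SucI[where F'="%_. L"]) (auto intro: Ck_const bounded_linear_imp_has_derivative assms)
qed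

lemma has_derivative_affine: "bounded_linear L ==> ((%x. a + L x) has_derivative L) (at x)"
 by (auto intro!: derivative_eq_intros bounded_linear_imp_has_derivative)

text \<open>Affine substitution, linear images, sums and bilinear products are the closure rules for
  smoothness; the derived kernels below are arranged to be combinations of this kind of the data and
  their derivatives.\<close>

lemma Ck_compose_affine:
 assumes "bounded_linear L" shows "Ck k F ==> Ck k (%x. F (a + L x))"
proof (induction k arbitrary: F)
 case 0
 have "continuous_on UNIV (%x. a + L x)"
  by (intro continuous_intros linear_continuous_on assms)
 then show ?case using 0 continuous_on_compose2[of UNIV F UNIV "%x. a + L x"] by simp
next
 case (Suc k)
 have "((%x. F (a + L x)) has_derivative (%v. fd F (a + L x) (L v))) (at x)" for x
  by (rule has_derivative_compose[OF has_derivative_affine[OF assms] Ck_Suc_has_derivative[OF Suc.prems]])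
 then show ?case
  using Suc by (intro Ck_SucI[where F'="%x v. fd F (a + L x) (L v)"]) auto
qed

lemma Ck_linear_compose:
 fixes F :: "'a::euclidean_space => 'b::real_normed_vector"
 assumes L: "bounded_linear L" shows "Ck k F ==> Ck k (%x. L (F x))"
proof (induction k arbitrary: F)
 case 0
 then show ?case by (simp add: bounded_linear.continuous_on[OF L])
next
 case (Suc k)
 have "((%x. L (F x)) has_derivative (%v. L (fd F x v))) (at x)" for x
  by (rule bounded_linear.has_derivative[OF L Ck_Suc_has_derivative[OF Suc.prems]])
 then show ?case
  using Suc by (intro Ck_SucI[where F'="%x v. L (fd F x v)"]) auto
qed

lemma Ck_add: "Ck k F ==> Ck k G ==> Ck k (%x. F x + G x)"
proof (induction k arbitrary: F G)
 case (Suc k)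
 show ?case
  by (rule Ck_SucI[where F'="%x v. fd F x v + fd G x v"])
   (use Suc in \<open>auto intro!: has_derivative_add Ck_Suc_has_derivative\<close>)
qed (auto intro: continuous_intros)

lemma Ck_sum: "(!!i. i : I ==> Ck k (F i)) ==> Ck k (%x. \<Sum>i\<in>I. F i x)"
 by (induction I rule: infinite_finite_induct) (auto intro: Ck_const Ck_add)

lemma Ck_bilinear:
 fixes F :: "'a::euclidean_space => 'b::real_normed_vector" and G :: "'a => 'c::real_normed_vector"
 assumes "bounded_bilinear pr"
 shows "Ck k F ==> Ck k G ==> Ck k (%x. pr (F x) (G x))"
proof (induction k arbitrary: F G)
 case 0
 then show ?case by (auto intro: bounded_bilinear.continuous_on[OF assms])
next
 case (Suc k)
 have "Ck k F" "Ck k G" using Suc.prems by (auto intro: Ck_Suc_D simp del: Ck.simps)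
 then show ?case
  by (intro Ck_SucI[where F'="%x v. pr (F x) (fd G x v) + pr (fd F x v) (G x)"] Ck_add Suc.IH
    bounded_bilinear.FDERIV[OF assms] Ck_Suc_has_derivative[of k] Suc.prems)
   (use Suc.prems in auto)
qed

lemma smooth_const: "smooth (%x. c)" by (simp add: smooth_def Ck_const)
lemma smooth_add: "smooth F ==> smooth G ==> smooth (%x. F x + G x)"
 by (simp add: smooth_def Ck_add)
lemma smooth_sum: "(!!i. i : I ==> smooth (F i)) ==> smooth (%x. \<Sum>i\<in>I. F i x)"
 by (simp add: smooth_def Ck_sum)
lemma smooth_linear: "bounded_linear L ==> smooth L" by (simp add: smooth_def Ck_bounded_linear)
lemma smooth_compose_affine: "bounded_linear L ==> smooth F ==> smooth (%x. F (a + L x))"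
 by (simp add: smooth_def Ck_compose_affine)
lemma smooth_compose_linear: "bounded_linear L ==> smooth F ==> smooth (%x. F (L x))"
 using smooth_compose_affine[of L F 0] by simp
lemma smooth_linear_compose: "bounded_linear L ==> smooth F ==> smooth (%x. L (F x))"
 by (simp add: smooth_def Ck_linear_compose)
lemma smooth_bilinear:
 fixes F :: "'a::euclidean_space => 'b::real_normed_vector" and G :: "'a => 'c::real_normed_vector"
 shows "bounded_bilinear pr ==> smooth F ==> smooth G ==> smooth (%x. pr (F x) (G x))"
 by (simp add: smooth_def Ck_bilinear)
lemmas smooth_mult = smooth_bilinear[OF bounded_bilinear_mult]
lemmas smooth_scaleR = smooth_bilinear[OF bounded_bilinear_scaleR]
lemmas smooth_inner = smooth_bilinear[OF bounded_bilinear_inner]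

lemma smooth_has_derivative: "smooth F ==> (F has_derivative fd F x) (at x)"
 unfolding smooth_def using Ck_Suc_has_derivative[of 0] by blast

lemma smooth_fd: "smooth F ==> smooth (%x. fd F x v)"
 unfolding smooth_def using Ck.simps(2) by blast

lemma smooth_continuous: "smooth F ==> continuous_on S F"
 unfolding smooth_def using Ck_continuous continuous_on_subset by blast

lemma linear_fd: "smooth F ==> linear (fd F x)"
 by (rule has_derivative_linear[OF smooth_has_derivative])

lemma bounded_linear_fd: "smooth F ==> bounded_linear (fd F x)"
 by (rule has_derivative_bounded_linear[OF smooth_has_derivative])

lemma linear_basis_expansion:
 fixes L :: "'a::euclidean_space => 'b::real_normed_vector"
 assumes "linear L" shows "L h = (\<Sum>b\<in>Basis. (h \<bullet> b) *R L b)"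
proof -
 have "L h = L (\<Sum>b\<in>Basis. (h \<bullet> b) *R b)" by (simp add: euclidean_representation)
 then show ?thesis by (simp add: linear_sum[OF assms] linear_scale[OF assms])
qed

lemmas fd_basis = linear_basis_expansion[OF linear_fd]

text \<open>Linearity in the direction allows an expansion over \<open>Basis\<close>, which
  separates the two variables into products of a coordinate of \<open>h\<close> and a smooth
  function of \<open>x\<close>.\<close>

lemma smooth_fd_pair:
 assumes "smooth F" shows "smooth (%(x, h). fd F x h)"
proof -
 have "smooth (%q. \<Sum>b\<in>Basis. (snd q \<bullet> b) *R fd F (fst q) b)"
  by (rule smooth_sum, rule smooth_scaleR)
   (rule smooth_inner[OF smooth_linear[OF bounded_linear_snd] smooth_const],
    rule smooth_compose_linear[OF bounded_linear_fst smooth_fd[OF assms]])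
 then show ?thesis unfolding case_prod_beta fd_basis[OF assms, of "fst _" "snd _"] .
qed

lemma fd_compose_affine:
 assumes "bounded_linear L" "smooth F"
 shows "fd (%x. F (a + L x)) x h = fd F (a + L x) (L h)"
proof -
 have "((%x. F (a + L x)) has_derivative (%v. fd F (a + L x) (L v))) (at x)"
  by (rule has_derivative_compose[OF has_derivative_affine[OF assms(1)] smooth_has_derivative[OF assms(2)]])
 then show ?thesis by (simp add: fdI)
qed

lemma smooth_bounded_on_ball:
 fixes F :: "'a::euclidean_space => 'b::real_normed_vector"
 assumes "smooth F" obtains C where "C >= 0" "!!x. norm x <= R ==> norm (F x) <= C"
proof -
 have "bounded (F ` cball 0 R)"
  by (intro compact_imp_bounded compact_continuous_image smooth_continuous assms compact_cball)
 then obtain C where "\<forall>y\<in>F ` cball 0 R. norm y <= C" unfolding bounded_iff by blast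
 then have "!!x. norm x <= R ==> norm (F x) <= C" by simp
 then show thesis by (intro that[of "max C 0"]) (auto simp: le_max_iff_disj)
qed

lemma fd_bound:
 fixes F :: "'a::euclidean_space => 'b::real_normed_vector"
 assumes "smooth F" obtains C where "C >= 0" "!!x h. norm x <= R ==> norm (fd F x h) <= C * norm h"
proof -
 have "ALL b. EX C. C >= 0 & (ALL x. norm x <= R --> norm (fd F x b) <= C)"
  using smooth_bounded_on_ball[OF smooth_fd[OF assms]] by metis
 then obtain C where C: "!!b. C b >= 0" "!!b x. norm x <= R ==> norm (fd F x b) <= C b" by metis
 show thesis
 proof (rule that[of "sum C Basis"])
  show "sum C Basis >= 0" using C by (simp add: sum_nonneg)
  fix x h :: 'a assume x: "norm x <= R"
  have "norm (fd F x h) <= (\<Sum>b\<in>Basis. norm ((h \<bullet> b) *R fd F x b))"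
   unfolding fd_basis[OF assms, of x h] by (rule norm_sum)
  also have "... <= (\<Sum>b\<in>Basis. norm h * C b)"
  proof (rule sum_mono)
   fix b :: 'a assume "b : Basis"
   then show "norm ((h \<bullet> b) *R fd F x b) <= norm h * (C b)"
    unfolding norm_scaleR by (intro mult_mono[OF _ C(2)[OF x]]) (auto simp: Basis_le_norm)
  qed
  finally show "norm (fd F x h) <= sum C Basis * norm h" by (simp add: sum_distrib_left mult.commute)
 qed
qed

text \<open>A mean value inequality instead of a mean value point, because the values are vectors.
  The Taylor bounds apply it to the remainder along the segment from \<open>x\<close> to
  \<open>x + h\<close>.\<close>

lemma segment_bound:
 fixes \<psi> :: "real => 'b::real_normed_vector"
 assumes "!!\<theta>. \<theta> : {0..1} ==> (\<psi> has_vector_derivative \<psi>' \<theta>) (at \<theta>)"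
  "!!\<theta>. \<theta> : {0..1} ==> norm (\<psi>' \<theta>) <= B"
 shows "norm (\<psi> 1 - \<psi> 0) <= B"
proof -
 have "norm (\<psi> 1 - \<psi> 0) <= B * norm (1 - 0 :: real)"
 proof (rule differentiable_bound[where S="{0..1}" and f'="%\<theta> x. x *R \<psi>' \<theta>"])
  fix \<theta> :: real assume \<theta>: "\<theta> : {0..1}"
  show "(\<psi> has_derivative (%x. x *R \<psi>' \<theta>)) (at \<theta> within {0..1})"
   using assms(1)[OF \<theta>] by (auto simp: has_vector_derivative_def intro: has_derivative_at_withinI)
  show "onorm (%x. x *R \<psi>' \<theta>) <= B"
   using mult_left_mono[OF assms(2)[OF \<theta>]] by (intro onorm_le) (simp add: mult.commute[of B])
 qed auto
 then show ?thesis by simp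
qed

lemma smooth_line_derivative:
 assumes "smooth F"
 shows "((%\<theta>. F (x + \<theta> *R h)) has_vector_derivative fd F (x + \<theta> *R h) h) (at \<theta>)"
proof -
 have "((%\<theta>. F (x + \<theta> *R h)) has_derivative (%v. fd F (x + \<theta> *R h) (v *R h))) (at \<theta>)"
  by (rule has_derivative_compose[OF has_derivative_affine[OF bounded_linear_scaleR_left] smooth_has_derivative[OF assms]])
 then show ?thesis by (simp add: has_vector_derivative_def linear_scale[OF linear_fd[OF assms]])
qed

lemma norm_segment_le:
 fixes x h :: "'a::real_normed_vector"
 assumes "norm x <= R" "norm (x + h) <= R" "\<theta> : {0..1}"
 shows "norm (x + \<theta> *R h) <= R"
proof -
 have "x + \<theta> *R h = (1 - \<theta>) *R x + \<theta> *R (x + h)" by (simp add: algebra_simps)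
 also have "norm ... <= (1 - \<theta>) * norm x + \<theta> * norm (x + h)"
  using assms(3) by (intro order.trans[OF norm_triangle_ineq]) auto
 also have "... <= (1 - \<theta>) * R + \<theta> * R"
  using assms by (intro add_mono mult_left_mono) auto
 finally show ?thesis by (simp add: algebra_simps)
qed

lemma smooth_lipschitz:
 fixes F :: "'a::euclidean_space => 'b::real_normed_vector"
 assumes "smooth F"
 obtains C where "C >= 0" "!!x h. norm x <= R ==> norm (x + h) <= R ==> norm (F (x + h) - F x) <= C * norm h"
proof -
 obtain C where C: "C >= 0" "!!x h. norm x <= R ==> norm (fd F x h) <= C * norm h"
  using fd_bound[OF assms] by metis
 show thesis
 proof (rule that[OF C(1)])
  fix x h :: 'a assume x: "norm x <= R" "norm (x + h) <= R"
  show "norm (F (x + h) - F x) <= C * norm h"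
   using segment_bound[OF smooth_line_derivative[OF assms], of x h "C * norm h"]
    C(2) norm_segment_le[OF x] by simp
 qed
qed

lemma fd_lipschitz:
 fixes F :: "'a::euclidean_space => 'b::real_normed_vector"
 assumes "smooth F"
 obtains C where "C >= 0" "!!x h k. norm x <= R ==> norm (x + h) <= R ==>
  norm (fd F (x + h) k - fd F x k) <= C * norm h * norm k"
proof -
 have "ALL b. EX C. C >= 0 & (ALL x h. norm x <= R --> norm (x + h) <= R --> norm (fd F (x + h) b - fd F x b) <= C * norm h)"
  using smooth_lipschitz[OF smooth_fd[OF assms]] by metis
 then obtain C where C: "!!b. C b >= 0" 
  "!!b x h. norm x <= R ==> norm (x + h) <= R ==> norm (fd F (x + h) b - fd F x b) <= C b * norm h" by metis
 show thesis
 proof (rule that[of "sum C Basis"])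
  show "sum C Basis >= 0" using C by (simp add: sum_nonneg)
  fix x h k :: 'a assume x: "norm x <= R" "norm (x + h) <= R"
  have eq: "fd F (x + h) k - fd F x k = (\<Sum>b\<in>Basis. (k \<bullet> b) *R (fd F (x + h) b - fd F x b))"
   by (simp only: fd_basis[OF assms, of _ k] sum_subtractf[symmetric] scaleR_diff_right)
  have "norm (fd F (x + h) k - fd F x k) <= (\<Sum>b\<in>Basis. norm ((k \<bullet> b) *R (fd F (x + h) b - fd F x b)))"
   unfolding eq by (rule norm_sum)
  also have "... <= (\<Sum>b\<in>Basis. norm k * (C b * norm h))"
  proof (rule sum_mono)
   fix b :: 'a assume "b : Basis"
   then show "norm ((k \<bullet> b) *R (fd F (x + h) b - fd F x b)) <= norm k * (C b * norm h)"
    unfolding norm_scaleR by (intro mult_mono[OF _ C(2)[OF x]]) (auto simp: Basis_le_norm)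
  qed
  finally show "norm (fd F (x + h) k - fd F x k) <= sum C Basis * norm h * norm k"
   by (simp add: sum_distrib_left sum_distrib_right mult_ac)
 qed
qed

lemma taylor1:
 fixes F :: "'a::euclidean_space => 'b::real_normed_vector"
 assumes "smooth F"
 obtains C where "C >= 0" "!!x h. norm x <= R ==> norm (x + h) <= R ==>
  norm (F (x + h) - F x - fd F x h) <= C * (norm h)\<^sup>2"
proof -
 obtain C where C: "C >= 0" "!!x h k. norm x <= R ==> norm (x + h) <= R ==>
  norm (fd F (x + h) k - fd F x k) <= C * norm h * norm k"
  using fd_lipschitz[OF assms] by metis
 show thesis
 proof (rule that[OF C(1)])
  fix x h :: 'a assume x: "norm x <= R" "norm (x + h) <= R"
  have "norm ((F (x + 1 *R h) - 1 *R fd F x h) - (F (x + 0 *R h) - 0 *R fd F x h)) <= C * (norm h)\<^sup>2"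
  proof (rule segment_bound)
   fix \<theta> :: real assume \<theta>: "\<theta> : {0..1}"
   show "((%\<theta>. F (x + \<theta> *R h) - \<theta> *R fd F x h) has_vector_derivative
    fd F (x + \<theta> *R h) h - fd F x h) (at \<theta>)"
    by (intro has_vector_derivative_diff smooth_line_derivative[OF assms])
    (auto simp: has_vector_derivative_def intro!: derivative_eq_intros)
   have "norm (fd F (x + \<theta> *R h) h - fd F x h) <= C * norm (\<theta> *R h) * norm h"
    by (rule C(2)[OF x(1) norm_segment_le[OF x \<theta>]])
   also have "... <= C * norm h * norm h"
    using \<theta> C(1) by (intro mult_right_mono mult_left_mono) (auto simp: mult_left_le_one_le)
   finally show "norm (fd F (x + \<theta> *R h) h - fd F x h) <= C * (norm h)\<^sup>2"
    by (simp add: power2_eq_square mult_ac)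
  qed
  then show "norm (F (x + h) - F x - fd F x h) <= C * (norm h)\<^sup>2" by (simp add: algebra_simps)
 qed
qed

text \<open>Vector valued counterpart of \<open>D2\<close>, for the second derivatives of the
  dynamics that enter those of the Hamiltonian. The first direction belongs to the inner
  derivative.\<close>

definition D2v :: "('a::euclidean_space => 'b::real_normed_vector) => 'a => 'a => 'a => 'b" where
 "D2v F x h k = fd (%x'. fd F x' h) x k"

lemma D2_eq_D2v: "D2 F = D2v F" by (simp add: D2_def D2v_def fun_eq_iff)

lemma D2v_basis:
 assumes "smooth F" shows "D2v F x h k = (\<Sum>b\<in>Basis. (h \<bullet> b) *R D2v F x b k)"
proof -
 have "((%x'. \<Sum>b\<in>Basis. (h \<bullet> b) *R fd F x' b) has_derivative (%k. \<Sum>b\<in>Basis. (h \<bullet> b) *R D2v F x b k)) (at x)"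
  unfolding D2v_def by (intro derivative_intros smooth_has_derivative smooth_fd assms)
 moreover have "(%x'. fd F x' h) = (%x'. \<Sum>b\<in>Basis. (h \<bullet> b) *R fd F x' b)"
  by (rule ext, rule fd_basis[OF assms])
 ultimately show ?thesis by (simp add: D2v_def[of F x h k] fdI)
qed

lemma D2v_linear1: "smooth F ==> linear (%h. D2v F x h k)"
 by (subst D2v_basis, assumption)
  (auto intro!: linearI simp: inner_add_left scaleR_add_left sum.distrib scaleR_sum_right)

lemma D2v_linear2: "smooth F ==> linear (D2v F x h)"
 unfolding D2v_def by (rule linear_fd[OF smooth_fd])

lemma smooth_D2v_pair:
 assumes "smooth F" shows "smooth (%(x, h, k). D2v F x h k)"
proof -
 have "smooth (%q. \<Sum>b\<in>Basis. (fst (snd q) \<bullet> b) *R (%(x, k). fd (%x'. fd F x' b) x k) (fst q, snd (snd q)))"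
  by (rule smooth_sum, rule smooth_scaleR)
   (rule smooth_inner[OF smooth_linear smooth_const], intro bounded_linear_intros,
    rule smooth_compose_linear[OF _ smooth_fd_pair[OF smooth_fd[OF assms]]], intro bounded_linear_intros)
 then show ?thesis
  unfolding case_prod_beta D2v_basis[OF assms, of "fst _" "fst (snd _)"] by (simp add: D2v_def)
qed

lemma D2v_bound:
 fixes F :: "'a::euclidean_space => 'b::real_normed_vector"
 assumes "smooth F" obtains C where "C >= 0"
  "!!x h k. norm x <= R ==> norm (D2v F x h k) <= C * norm h * norm k"
proof -
 have "ALL b. EX C. C >= 0 & (ALL x k. norm x <= R --> norm (D2v F x b k) <= C * norm k)"
  unfolding D2v_def using fd_bound[OF smooth_fd[OF assms]] by metis
 then obtain C where C: "!!b. C b >= 0" "!!b x k. norm x <= R ==> norm (D2v F x b k) <= C b * norm k" by metis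
 show thesis
 proof (rule that[of "sum C Basis"])
  show "sum C Basis >= 0" using C by (simp add: sum_nonneg)
  fix x h k :: 'a assume x: "norm x <= R"
  have "norm (D2v F x h k) <= (\<Sum>b\<in>Basis. norm ((h \<bullet> b) *R D2v F x b k))"
   unfolding D2v_basis[OF assms, of x h k] by (rule norm_sum)
  also have "... <= (\<Sum>b\<in>Basis. norm h * (C b * norm k))"
  proof (rule sum_mono)
   fix b :: 'a assume "b : Basis"
   then show "norm ((h \<bullet> b) *R D2v F x b k) <= norm h * (C b * norm k)"
    unfolding norm_scaleR by (intro mult_mono[OF _ C(2)[OF x]]) (auto simp: Basis_le_norm)
  qed
  finally show "norm (D2v F x h k) <= sum C Basis * norm h * norm k"
   by (simp add: sum_distrib_left sum_distrib_right mult_ac)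
 qed
qed

text \<open>The quadratic term may be evaluated at a perturbation \<open>k\<close> of the increment \<open>h\<close>.\<close>

lemma taylor1_fd:
 fixes F :: "'a::euclidean_space => 'b::real_normed_vector"
 assumes "smooth F"
 obtains C where "C >= 0" "!!x h k. norm x <= R ==> norm (x + h) <= R ==>
  norm (fd F (x + h) k - fd F x k - D2v F x k h) <= C * (norm h)\<^sup>2 * norm k"
proof -
 have "ALL b. EX C. C >= 0 & (ALL x h. norm x <= R --> norm (x + h) <= R -->
   norm (fd F (x + h) b - fd F x b - D2v F x b h) <= C * (norm h)\<^sup>2)"
  unfolding D2v_def using taylor1[OF smooth_fd[OF assms]] by metis
 then obtain C where C: "!!b. C b >= 0" 
  "!!b x h. norm x <= R ==> norm (x + h) <= R ==>
   norm (fd F (x + h) b - fd F x b - D2v F x b h) <= C b * (norm h)\<^sup>2" by metis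
 show thesis
 proof (rule that[of "sum C Basis"])
  show "sum C Basis >= 0" using C by (simp add: sum_nonneg)
  fix x h k :: 'a assume x: "norm x <= R" "norm (x + h) <= R"
  have eq: "fd F (x + h) k - fd F x k - D2v F x k h =
    (\<Sum>b\<in>Basis. (k \<bullet> b) *R (fd F (x + h) b - fd F x b - D2v F x b h))"
   by (simp only: fd_basis[OF assms, of _ k] D2v_basis[OF assms, of _ k] sum_subtractf[symmetric] scaleR_diff_right)
  have "norm (fd F (x + h) k - fd F x k - D2v F x k h) <= (\<Sum>b\<in>Basis. norm ((k \<bullet> b) *R (fd F (x + h) b - fd F x b - D2v F x b h)))"
   unfolding eq by (rule norm_sum)
  also have "... <= (\<Sum>b\<in>Basis. norm k * (C b * (norm h)\<^sup>2))"
  proof (rule sum_mono)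
   fix b :: 'a assume "b : Basis"
   then show "norm ((k \<bullet> b) *R (fd F (x + h) b - fd F x b - D2v F x b h)) <= norm k * (C b * (norm h)\<^sup>2)"
    unfolding norm_scaleR by (intro mult_mono[OF _ C(2)[OF x]]) (auto simp: Basis_le_norm)
  qed
  finally show "norm (fd F (x + h) k - fd F x k - D2v F x k h) <= sum C Basis * (norm h)\<^sup>2 * norm k"
   by (simp add: sum_distrib_left sum_distrib_right mult_ac)
 qed
qed

text \<open>Once the quadratic polynomial in \<open>\<theta>\<close> is subtracted from
  \<open>F (x + \<theta> h)\<close>, the derivative in \<open>\<theta>\<close> is the first order
  remainder of \<open>fd F\<close> in direction \<open>h\<close>, which \<open>taylor1_fd\<close>
  bounds by a multiple of the cube of \<open>norm h\<close>.\<close>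

lemma taylor2:
 fixes F :: "'a::euclidean_space => 'b::real_normed_vector"
 assumes "smooth F"
 obtains C where "C >= 0" "!!x h. norm x <= R ==> norm (x + h) <= R ==>
  norm (F (x + h) - F x - fd F x h - (1/2) *R D2v F x h h) <= C * norm h ^ 3"
proof -
 obtain C where C: "C >= 0" "!!x h k. norm x <= R ==> norm (x + h) <= R ==>
  norm (fd F (x + h) k - fd F x k - D2v F x k h) <= C * (norm h)\<^sup>2 * norm k"
  using taylor1_fd[OF assms] by metis
 show thesis
 proof (rule that[OF C(1)])
  fix x h :: 'a assume x: "norm x <= R" "norm (x + h) <= R"
  have "norm ((F (x + 1 *R h) - 1 *R fd F x h - (1\<^sup>2/2) *R D2v F x h h)
    - (F (x + 0 *R h) - 0 *R fd F x h - (0\<^sup>2/2) *R D2v F x h h)) <= C * norm h ^ 3"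
  proof (rule segment_bound)
   fix \<theta> :: real assume \<theta>: "\<theta> : {0..1}"
   have 1: "((%\<theta>. (\<theta>\<^sup>2/2) *R D2v F x h h) has_vector_derivative \<theta> *R D2v F x h h) (at \<theta>)"
    by (auto simp: has_vector_derivative_def intro!: derivative_eq_intros)
   have 2: "((%\<theta>. \<theta> *R fd F x h) has_vector_derivative fd F x h) (at \<theta>)"
    by (auto simp: has_vector_derivative_def intro!: derivative_eq_intros)
   show "((%\<theta>. F (x + \<theta> *R h) - \<theta> *R fd F x h - (\<theta>\<^sup>2/2) *R D2v F x h h) has_vector_derivative
    fd F (x + \<theta> *R h) h - fd F x h - \<theta> *R D2v F x h h) (at \<theta>)"
    by (intro has_vector_derivative_diff smooth_line_derivative[OF assms] 1 2)
   have "norm (fd F (x + \<theta> *R h) h - fd F x h - D2v F x h (\<theta> *R h)) <= C * (norm (\<theta> *R h))\<^sup>2 * norm h"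
    by (rule C(2)[OF x(1) norm_segment_le[OF x \<theta>]])
   also have "... <= C * (norm h)\<^sup>2 * norm h"
    using \<theta> C(1) by (intro mult_right_mono mult_left_mono power_mono) (auto simp: mult_left_le_one_le)
   finally show "norm (fd F (x + \<theta> *R h) h - fd F x h - \<theta> *R D2v F x h h) <= C * norm h ^ 3"
    by (simp add: power2_eq_square power3_eq_cube mult_ac linear_scale[OF D2v_linear2[OF assms]])
  qed
  then show "norm (F (x + h) - F x - fd F x h - (1/2) *R D2v F x h h) <= C * norm h ^ 3"
   by (simp add: algebra_simps)
 qed
qed

section \<open>Weak compactness in L2\<close>

text \<open>Functions are not identified modulo null sets, so \<open>ip\<close> below is only a
  semidefinite inner product; equality of weak limits is always expressed by testing.\<close>

definition sqint :: "'x measure => ('x => 'b::euclidean_space) => bool" where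
 "sqint M f \<longleftrightarrow> f : borel_measurable M & integrable M (%x. (norm (f x))\<^sup>2)"

definition ip :: "'x measure => ('x => 'b::euclidean_space) => ('x => 'b) => real" where
 "ip M f g = (LINT x|M. f x \<bullet> g x)"

lemma sqint_ip_integrable:
 assumes "sqint M f" "sqint M g" shows "integrable M (%x. f x \<bullet> g x)"
proof (rule b_integrable_bound)
 show "integrable M (%x. (norm (f x))\<^sup>2 + (norm (g x))\<^sup>2)" using assms by (simp add: sqint_def)
 show "(%x. f x \<bullet> g x) : borel_measurable M" using assms by (auto simp: sqint_def)
 have "\<bar>f x \<bullet> g x\<bar> <= (norm (f x))\<^sup>2 + (norm (g x))\<^sup>2" for x
  using Cauchy_Schwarz_ineq2[of "f x" "g x"] sum_squares_bound[of "norm (f x)" "norm (g x)"]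
   mult_nonneg_nonneg[OF norm_ge_zero[of "f x"] norm_ge_zero[of "g x"]] by linarith
 then show "AE x in M. norm (f x \<bullet> g x) <= norm ((norm (f x))\<^sup>2 + (norm (g x))\<^sup>2)" by simp
qed

lemma sqint_scale: "sqint M f ==> sqint M (%x. c *R f x)"
 by (auto simp: sqint_def power_mult_distrib)

lemma sqint_add:
 assumes "sqint M f" "sqint M g" shows "sqint M (%x. f x + g x)"
proof -
 have "integrable M (%x. (norm (f x))\<^sup>2 + 2 * (f x \<bullet> g x) + (norm (g x))\<^sup>2)"
  using assms sqint_ip_integrable[OF assms] by (simp add: sqint_def)
 then show ?thesis using assms by (auto simp: sqint_def dot_norm[symmetric] power2_norm_eq_inner
   inner_add_left inner_add_right inner_commute algebra_simps)
qed

lemma sqint_diff: "sqint M f ==> sqint M g ==> sqint M (%x. f x - g x)"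
 using sqint_add[of M f "%x. (-1) *R g x"] sqint_scale[of M g "-1"] by simp

lemma ip_add: "sqint M f ==> sqint M g ==> sqint M h ==> ip M (%x. f x + g x) h = ip M f h + ip M g h"
 by (simp add: ip_def inner_add_left sqint_ip_integrable)

lemma ip_diff: "sqint M f ==> sqint M g ==> sqint M h ==> ip M (%x. f x - g x) h = ip M f h - ip M g h"
 by (simp add: ip_def inner_diff_left sqint_ip_integrable)

lemma ip_scale: "ip M (%x. c *R f x) h = c * ip M f h"
 by (simp add: ip_def)

lemma ip_commute: "ip M f g = ip M g f" by (simp add: ip_def inner_commute)

lemma ip_nonneg: "ip M f f >= 0" by (simp add: ip_def)

lemma ip_self: "ip M f f = (LINT x|M. (norm (f x))\<^sup>2)" by (simp add: ip_def power2_norm_eq_inner)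

lemma ip_Cauchy_Schwarz:
 assumes "sqint M f" "sqint M g" shows "(ip M f g)\<^sup>2 <= ip M f f * ip M g g"
proof -
 have quad: "0 <= ip M f f - 2 * t * ip M f g + t\<^sup>2 * ip M g g" for t
 proof -
  have "0 <= ip M (%x. f x - t *R g x) (%x. f x - t *R g x)" by (rule ip_nonneg)
  also have "... = ip M f (%x. f x - t *R g x) - t * ip M g (%x. f x - t *R g x)"
   using assms by (simp add: ip_diff ip_scale sqint_diff sqint_scale)
  also have "... = ip M f f - 2 * t * ip M f g + t\<^sup>2 * ip M g g"
   using assms by (simp add: ip_commute[of _ _ "%x. f x - t *R g x"] ip_diff ip_scale sqint_scale
    ip_commute[of _ g f] power2_eq_square algebra_simps)
  finally show ?thesis .
 qed
 show ?thesis
 proof (cases "ip M g g = 0")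
  case True
  have "ip M f g = 0"
  proof (rule ccontr)
   assume n: "ip M f g ~= 0"
   \<comment> \<open>At this parameter the affine function \<open>ip M f f - 2 t ip M f g\<close>
     has the value \<open>-1\<close>.\<close>
   show False using quad[of "(ip M f f + 1) / (2 * ip M f g)"] True n by simp
  qed
  then show ?thesis using True by simp
 next
  case False
  then have p: "ip M g g > 0" using ip_nonneg[of M g] by simp
  have "0 <= ip M f f - (ip M f g)\<^sup>2 / ip M g g"
   using quad[of "ip M f g / ip M g g"] p by (simp add: power2_eq_square field_simps)
  then show ?thesis using p by (simp add: field_simps)
 qed
qed

lemma ip_Cauchy_Schwarz_abs:
 assumes "sqint M f" "sqint M g" shows "\<bar>ip M f g\<bar> <= sqrt (ip M f f) * sqrt (ip M g g)"
 using real_sqrt_le_mono[OF ip_Cauchy_Schwarz[OF assms]] by (simp add: real_sqrt_mult)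

lemma ip_zero_AE:
 assumes "sqint M f" "ip M f f = 0" shows "AE x in M. f x = 0"
proof -
 have "AE x in M. (norm (f x))\<^sup>2 = 0"
  using assms integral_nonneg_eq_0_iff_AE[of M "%x. (norm (f x))\<^sup>2"] by (simp add: ip_self sqint_def)
 then show ?thesis by simp
qed

text \<open>Along a subsequence with squared increments below \<open>(1/8)^k\<close>, the sum of
  \<open>2^k |\<Delta> k|\<^sup>2\<close> has a finite integral, hence is finite almost everywhere.
  As \<open>|\<Delta> k| \<le> 2^k |\<Delta> k|\<^sup>2 + 2^(-k)\<close>, the increments are then
  absolutely summable, which gives a pointwise limit.\<close>

lemma L2_complete:
 fixes w :: "nat => 'x => 'b::euclidean_space"
 assumes sq: "!!n. sqint M (w n)"
  and Cauchy: "!!e. e > 0 ==> EX N. \<forall>m\<ge>N. \<forall>n\<ge>N. ip M (%x. w m x - w n x) (%x. w m x - w n x) < e"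
 obtains v where "sqint M v" "(%n. ip M (%x. w n x - v x) (%x. w n x - v x)) ~~> 0"
proof -
 have meas [measurable]: "w n : borel_measurable M" for n using sq by (simp add: sqint_def)
 have "EX N. \<forall>m\<ge>N. \<forall>n\<ge>N. ip M (%x. w m x - w n x) (%x. w m x - w n x) < (1/8)^k" for k :: nat
  by (rule Cauchy) simp
 then obtain N where N: "!!k m n. m >= N k ==> n >= N k ==>
   ip M (%x. w m x - w n x) (%x. w m x - w n x) < (1/8)^k" by metis
 \<comment> \<open>The partial sums make \<open>s\<close> increasing and keep \<open>s k\<close>
   above both \<open>k\<close> and \<open>N k\<close>.\<close>
 define s where "s k = k + (\<Sum>j\<le>k. N j)" for k
 have s_N: "s k >= N k" for k
  by (metis s_def atMost_iff finite_atMost le_add2 le_trans member_le_sum order_refl zero_le)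
 have s_mono: "s k <= s (Suc k)" for k by (simp add: s_def)
 define \<Delta> where "\<Delta> k x = w (s (Suc k)) x - w (s k) x" for k x
 have [measurable]: "\<Delta> k : borel_measurable M" for k unfolding \<Delta>_def by measurable
 have sq\<Delta>: "sqint M (\<Delta> k)" for k unfolding \<Delta>_def by (intro sqint_diff sq)
 have ip\<Delta>: "ip M (\<Delta> k) (\<Delta> k) < (1/8)^k" for k
  unfolding \<Delta>_def by (intro N s_N order.trans[OF s_N s_mono])
 have sqn: "(\<integral>\<^sup>+x. ennreal ((norm (f x))\<^sup>2) \<partial>M) = ennreal (ip M f f)" if "sqint M f" for f :: "'x => 'b"
  using that by (simp add: nn_integral_eq_integral sqint_def ip_self)
 have "(\<integral>\<^sup>+x. (\<Sum>k. ennreal (2^k * (norm (\<Delta> k x))\<^sup>2)) \<partial>M) = (\<Sum>k. \<integral>\<^sup>+x. ennreal (2^k * (norm (\<Delta> k x))\<^sup>2) \<partial>M)"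
  by (rule nn_integral_suminf) measurable
 also have "... <= (\<Sum>k. ennreal ((1/4)^k))"
 proof (intro suminf_le summableI)
  fix k
  have "(\<integral>\<^sup>+x. ennreal (2^k * (norm (\<Delta> k x))\<^sup>2) \<partial>M) = ennreal (2^k) * (\<integral>\<^sup>+x. ennreal ((norm (\<Delta> k x))\<^sup>2) \<partial>M)"
   by (subst nn_integral_cmult[symmetric]) (auto simp: ennreal_mult)
  also have "... = ennreal (2^k * ip M (\<Delta> k) (\<Delta> k))"
   by (simp add: sqn[OF sq\<Delta>] ennreal_mult ip_nonneg)
  also have "... <= ennreal (2^k * (1/8)^k)"
   using ip\<Delta>[of k] by (intro ennreal_leI mult_left_mono) auto
  also have "(2::real)^k * (1/8)^k = (1/4)^k" by (simp add: power_mult_distrib[symmetric])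
  finally show "(\<integral>\<^sup>+x. ennreal (2^k * (norm (\<Delta> k x))\<^sup>2) \<partial>M) <= ennreal ((1/4)^k)" .
 qed
 also have "... < \<infinity>" by (subst suminf_ennreal2) (auto intro: summable_geometric)
 finally have "AE x in M. (\<Sum>k. ennreal (2^k * (norm (\<Delta> k x))\<^sup>2)) ~= \<infinity>"
  by (intro nn_integral_noteq_infinite) auto
 then have conv: "AE x in M. convergent (%k. w (s k) x)"
 proof eventually_elim
  case (elim x)
  then have 1: "summable (%k. 2^k * (norm (\<Delta> k x))\<^sup>2)" by (intro summable_suminf_not_top) auto
  have 2: "summable (%k. (2^k * (norm (\<Delta> k x))\<^sup>2 + (1/2)^k))"
   by (intro summable_add 1 summable_geometric) auto
  have "norm (\<Delta> k x) <= 2^k * (norm (\<Delta> k x))\<^sup>2 + (1/2)^k" for k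
  proof -
   define a :: real where "a = 2^k"
   have a: "a > 0" "(1/2)^k = 1 / a" by (auto simp: a_def power_one_over)
   have "norm (\<Delta> k x) * a <= (norm (\<Delta> k x) * a)\<^sup>2 + 1"
    using sum_squares_bound[of "norm (\<Delta> k x) * a" 1] a(1)
    by (smt (verit, best) mult.right_neutral mult_nonneg_nonneg norm_ge_zero one_power2)
   then show ?thesis unfolding a_def[symmetric] a(2) using a(1) by (simp add: field_simps power2_eq_square)
  qed
  then have "summable (%k. norm (\<Delta> k x))"
   using summable_comparison_test[OF _ 2, of "%k. norm (\<Delta> k x)"] by auto
  then have "summable (%k. \<Delta> k x)" by (rule summable_norm_cancel)
  then have "convergent (%n. \<Sum>k<n. \<Delta> k x)" by (simp add: summable_iff_convergent)
  moreover have "(\<Sum>k<n. \<Delta> k x) = w (s n) x - w (s 0) x" for n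
   unfolding \<Delta>_def by (rule sum_lessThan_telescope)
  ultimately have "convergent (%n. w (s n) x - w (s 0) x)" by simp
  from convergent_add[OF this convergent_const[of "w (s 0) x"]]
  have "convergent (%n. (w (s n) x - w (s 0) x) + w (s 0) x)" .
  then show ?case by simp
 qed
 define v where "v x = lim (%k. w (s k) x)" for x
 have [measurable]: "v : borel_measurable M" unfolding v_def by measurable
 have vlim: "AE x in M. (%k. w (s k) x) ~~> v x"
  using conv unfolding v_def by eventually_elim (simp add: convergent_LIMSEQ_iff)
 \<comment> \<open>Fatou's lemma along the subsequence turns the Cauchy estimate for the full
   sequence into an estimate of the distance to \<open>v\<close>.\<close>
 have bnd: "\<exists>n0. \<forall>n\<ge>n0. (\<integral>\<^sup>+x. ennreal ((norm (w n x - v x))\<^sup>2) \<partial>M) <= ennreal e" if e: "e > 0" for e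
 proof -
  obtain n0 where n0: "!!m n. m >= n0 ==> n >= n0 ==> ip M (%x. w m x - w n x) (%x. w m x - w n x) < e"
   using Cauchy[OF e] by blast
  have "(\<integral>\<^sup>+x. ennreal ((norm (w n x - v x))\<^sup>2) \<partial>M) <= ennreal e" if n: "n >= n0" for n
  proof -
   have "(\<integral>\<^sup>+x. ennreal ((norm (w n x - v x))\<^sup>2) \<partial>M)
    = (\<integral>\<^sup>+x. liminf (%k. ennreal ((norm (w n x - w (s k) x))\<^sup>2)) \<partial>M)"
   proof (rule nn_integral_cong_AE, use vlim in eventually_elim)
    case (elim x)
    have "(%k. ennreal ((norm (w n x - w (s k) x))\<^sup>2)) ~~> ennreal ((norm (w n x - v x))\<^sup>2)"
    by (intro tendsto_intros tendsto_ennrealI elim)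
    then show ?case using lim_imp_Liminf[OF sequentially_bot] by metis
   qed
   also have "... <= liminf (%k. \<integral>\<^sup>+x. ennreal ((norm (w n x - w (s k) x))\<^sup>2) \<partial>M)"
    by (rule nn_integral_liminf) measurable
   also have "... <= ennreal e"
   proof (rule Liminf_le)
    have "\<forall>\<^sub>F k in sequentially. k >= n0" by (rule eventually_ge_at_top)
    then show "\<forall>\<^sub>F k in sequentially. (\<integral>\<^sup>+x. ennreal ((norm (w n x - w (s k) x))\<^sup>2) \<partial>M) <= ennreal e"
    proof eventually_elim
    case (elim k)
    have "s k >= n0" using elim by (simp add: s_def)
    then show ?case using n0[OF n, of "s k"] by (simp add: sqn sqint_diff sq ennreal_leI)
    qed
   qed simp
   finally show ?thesis .
  qed
  then show ?thesis by blast
 qed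
 obtain n1 where "(\<integral>\<^sup>+x. ennreal ((norm (w n1 x - v x))\<^sup>2) \<partial>M) <= ennreal 1" using bnd[of 1] by auto
 then have "sqint M (%x. w n1 x - v x)"
  by (auto simp: sqint_def integrable_iff_bounded intro: order.strict_trans1)
 from sqint_diff[OF sq[of n1] this] have sqv: "sqint M v" by simp
 have "(%n. ip M (%x. w n x - v x) (%x. w n x - v x)) ~~> 0"
 proof (rule LIMSEQ_I)
  fix e :: real assume e: "e > 0"
  obtain n0 where "!!n. n >= n0 ==> (\<integral>\<^sup>+x. ennreal ((norm (w n x - v x))\<^sup>2) \<partial>M) <= ennreal (e/2)"
   using bnd[of "e/2"] e by auto
  then have "!!n. n >= n0 ==> ip M (%x. w n x - v x) (%x. w n x - v x) <= e/2"
   using e by (simp add: sqn sqint_diff sq sqv)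
  then show "EX no. \<forall>n\<ge>no. norm (ip M (%x. w n x - v x) (%x. w n x - v x) - 0) < e"
   using e ip_nonneg by (smt (verit) field_sum_of_halves real_norm_def)
 qed
 with sqv that show thesis by blast
qed

text \<open>Dyadic convex combinations of the tail from index \<open>n\<close> on. Closure under
  midpoints is exactly what the parallelogram identity asks for in the minimization below.\<close>

inductive_set midpoints :: "(nat => 'x => 'b::real_vector) => nat => ('x => 'b) set" for v n where
 base: "k >= n ==> v k : midpoints v n"
| mid: "f : midpoints v n ==> g : midpoints v n ==> (%x. (1/2) *R (f x + g x)) : midpoints v n"

lemma midpoints_antimono: "f : midpoints v m ==> n <= m ==> f : midpoints v n"
 by (induction rule: midpoints.induct) (auto intro: midpoints.intros)

lemma midpoints_sqint: "f : midpoints v n ==> (!!k. sqint M (v k)) ==> sqint M f"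
 by (induction rule: midpoints.induct) (auto intro: sqint_add sqint_scale)

lemma midpoints_ip:
 assumes "f : midpoints v n" "!!k. sqint M (v k)" "sqint M h" "!!k. k >= n ==> \<bar>ip M (v k) h - l\<bar> <= e"
 shows "\<bar>ip M f h - l\<bar> <= e"
 using assms(1)
proof (induction rule: midpoints.induct)
 case (mid f g)
 have "ip M (%x. (1/2) *R (f x + g x)) h = (1/2) * (ip M f h + ip M g h)"
  using mid(1,2) assms(2,3) by (simp only: ip_scale ip_add midpoints_sqint)
 then show ?case using mid(3,4) by (simp add: abs_le_iff field_simps)
qed (use assms(4) in auto)

lemma parallelogram:
 fixes a b :: "'b::real_inner"
 shows "(norm (a - b))\<^sup>2 = 2 * (norm a)\<^sup>2 + 2 * (norm b)\<^sup>2 - 4 * (norm ((1/2) *R (a + b)))\<^sup>2"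
 by (simp add: power2_norm_eq_inner inner_add_left inner_add_right inner_diff_left inner_diff_right
   inner_commute algebra_simps power_mult_distrib)

text \<open>Almost minimal elements of the midpoint hulls of the tails form a Cauchy sequence.\<close>

lemma weak_cluster_vector:
 fixes v :: "nat => 'x => 'b::euclidean_space"
 assumes sq: "!!k. sqint M (v k)" and bd: "!!k. ip M (v k) (v k) <= B"
 obtains w where "sqint M w"
  "!!h l. sqint M h ==> (%k. ip M (v k) h) ~~> l ==> ip M w h = l"
proof -
 define a where "a n = Inf ((%f. ip M f f) ` midpoints v n)" for n
 have ne: "midpoints v n ~= {}" for n using base[of n n v] by blast
 have bb: "bdd_below ((%f. ip M f f) ` midpoints v n)" for n
  by (rule bdd_belowI[of _ 0]) (auto simp: ip_nonneg)
 have a_le: "a n <= ip M f f" if "f : midpoints v n" for n f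
  unfolding a_def using that by (intro cInf_lower bb) auto
 have a_mono: "a n <= a m" if "n <= m" for n m
  unfolding a_def using that ne bb by (intro cInf_superset_mono) (auto intro: midpoints_antimono)
 have a_B: "a n <= B" for n using a_le[OF base[of n n v]] bd[of n] by simp
 have "bdd_above (range a)" by (rule bdd_aboveI[of _ B]) (use a_B in auto)
 then have "convergent a"
  using LIMSEQ_incseq_SUP[of a] a_mono by (auto simp: incseq_def convergent_def)
 then obtain A where A: "a ~~> A" by (auto simp: convergent_def)
 have "\<exists>f\<in>midpoints v n. ip M f f < a n + 1 / real (Suc n)" for n
  using cInf_lessD[of "(%f. ip M f f) ` midpoints v n" "a n + 1 / real (Suc n)"] ne[of n]
  unfolding a_def by auto
 then obtain w where w: "!!n. w n : midpoints v n" "!!n. ip M (w n) (w n) < a n + 1 / real (Suc n)" by metis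
 have sqw: "sqint M (w n)" for n using midpoints_sqint[OF w(1) sq] .
 \<comment> \<open>The midpoint of two almost minimal elements lies in the hull of the tail from
   \<open>N\<close>, so its squared norm is at least \<open>a N\<close>; the parallelogram identity
   then bounds the distance by the gap between \<open>a N\<close> and the limit
   \<open>A\<close>.\<close>
 have est: "ip M (%x. w m x - w n x) (%x. w m x - w n x) <= 4 * (A - a N) + 4 / real (Suc N)"
  if "m >= N" "n >= N" for m n N
 proof -
  let ?h = "%x. (1/2) *R (w m x + w n x)"
  have hm: "?h : midpoints v N" using that by (intro mid) (auto intro: midpoints_antimono w)
  have sqh: "sqint M ?h" using midpoints_sqint[OF hm sq] .
  have "ip M (%x. w m x - w n x) (%x. w m x - w n x) =
    2 * ip M (w m) (w m) + 2 * ip M (w n) (w n) - 4 * ip M ?h ?h"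
   unfolding ip_self parallelogram using sqw[of m] sqw[of n] sqh
   by (simp add: sqint_def del: norm_scaleR)
  also have "... <= 2 * (a m + 1 / real (Suc m)) + 2 * (a n + 1 / real (Suc n)) - 4 * a N"
   by (intro diff_mono add_mono mult_left_mono less_imp_le[OF w(2)] a_le[OF hm]) auto
  also have "... <= 2 * (A + 1 / real (Suc N)) + 2 * (A + 1 / real (Suc N)) - 4 * a N"
  proof -
   have "a m <= A" for m using a_mono by (intro LIMSEQ_le_const[OF A]) auto
   moreover have "1 / real (Suc m) <= 1 / real (Suc N)" "1 / real (Suc n) <= 1 / real (Suc N)"
    using that by (auto simp: field_simps)
   ultimately show ?thesis by (smt (verit))
  qed
  finally show ?thesis by simp
 qed
 have lim0: "(%N. 4 * (A - a N) + 4 / real (Suc N)) ~~> 4 * (A - A) + 4 * 0"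
  unfolding divide_inverse by (intro tendsto_intros A LIMSEQ_inverse_real_of_nat)
 have "EX N. \<forall>m\<ge>N. \<forall>n\<ge>N. ip M (%x. w m x - w n x) (%x. w m x - w n x) < e" if "e > 0" for e
 proof -
  have "\<forall>\<^sub>F N in sequentially. 4 * (A - a N) + 4 / real (Suc N) < e"
   using order_tendstoD(2)[OF lim0] that by simp
  then obtain N where "4 * (A - a N) + 4 / real (Suc N) < e" by (auto simp: eventually_sequentially)
  then show ?thesis using est[of N] by (intro exI[of _ N]) (auto intro: order.strict_trans1)
 qed
 from L2_complete[OF sqw this] obtain u where u: "sqint M u"
  "(%n. ip M (%x. w n x - u x) (%x. w n x - u x)) ~~> 0" by blast
 show thesis
 proof (rule that[OF u(1)])
  fix h l assume h: "sqint M h" and l: "(%k. ip M (v k) h) ~~> l"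
  \<comment> \<open>Testing against \<open>h\<close> is affine, so an element of the hull of a late
    tail is tested as closely to \<open>l\<close> as the members of the tail.\<close>
  have "(%n. ip M (w n) h) ~~> l"
  proof (rule LIMSEQ_I)
   fix e :: real assume e: "e > 0"
   obtain n0 where n0: "!!k. k >= n0 ==> norm (ip M (v k) h - l) < e/2" using LIMSEQ_D[OF l, of "e/2"] e by auto
   have le: "\<bar>ip M (w n) h - l\<bar> <= e/2" if "n >= n0" for n
    by (rule midpoints_ip[OF w(1) sq h]) (use n0 that in \<open>force intro: less_imp_le\<close>)
   then show "EX no. \<forall>n\<ge>no. norm (ip M (w n) h - l) < e"
   proof (intro exI[of _ n0] allI impI)
    fix n assume "n0 <= n"
    from le[OF this] show "norm (ip M (w n) h - l) < e" using e by simp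
   qed
  qed
  moreover have "(%n. ip M (w n) h) ~~> ip M u h"
  proof (rule LIM_zero_cancel, rule tendsto_rabs_zero_cancel, rule tendsto_sandwich)
   show "\<forall>\<^sub>F n in sequentially. 0 <= \<bar>ip M (w n) h - ip M u h\<bar>" by simp
   show "\<forall>\<^sub>F n in sequentially. \<bar>ip M (w n) h - ip M u h\<bar> \<le>
    sqrt (ip M (%x. w n x - u x) (%x. w n x - u x)) * sqrt (ip M h h)"
    using ip_Cauchy_Schwarz_abs[OF sqint_diff[OF sqw u(1)] h] by (simp add: ip_diff sqw u h)
   show "(%n. sqrt (ip M (%x. w n x - u x) (%x. w n x - u x)) * sqrt (ip M h h)) ~~> 0"
    using tendsto_mult_right[OF tendsto_real_sqrt[OF u(2)], of "sqrt (ip M h h)"] by simp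
  qed simp
  ultimately show "ip M u h = l" using LIMSEQ_unique by blast
 qed
qed

lemma ip_bounded:
 assumes "!!k. sqint M (v k)" "!!k. ip M (v k) (v k) <= B" "sqint M h"
 shows "\<bar>ip M (v k) h\<bar> <= sqrt B * sqrt (ip M h h)"
 by (rule order.trans[OF ip_Cauchy_Schwarz_abs[OF assms(1,3)]])
  (intro mult_right_mono, use assms in \<open>auto simp: ip_nonneg\<close>)

lemma bounded_real_subseq:
 fixes X :: "nat => real"
 assumes "!!k. \<bar>X k\<bar> <= B" obtains r l where "strict_mono (r :: nat => nat)" "(X \<circ> r) ~~> l"
proof -
 have "seq_compact {-B..B}" using compact_Icc compact_imp_seq_compact by blast
 then show thesis using assms that unfolding seq_compact_def by (metis abs_le_iff atLeastAtMost_iff minus_le_iff)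
qed

text \<open>The diagonal subsequence is tested only against the members of the sequence itself, in
  place of a dense set. If testing against some \<open>h\<close> failed, a further subsequence would
  have a cluster vector \<open>w'\<close> that has the same products as \<open>w\<close> with all
  \<open>v n\<close>. Then \<open>w' - w\<close> is orthogonal to every \<open>v n\<close>, hence to
  \<open>w\<close> and \<open>w'\<close>, which are limits of such vectors in the tested sense,
  hence to itself.\<close>

theorem weak_compactness:
 fixes v :: "nat => 'x => 'b::euclidean_space"
 assumes sq: "!!k. sqint M (v k)" and bd: "!!k. ip M (v k) (v k) <= B"
 obtains r w where "strict_mono (r :: nat => nat)" "sqint M w"
  "!!h. sqint M h ==> (%k. ip M (v (r k)) h) ~~> ip M w h"
proof -
 interpret subseqs "%n s. convergent (%k. ip M (v (s k)) (v n))"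
 proof
  fix n and s :: "nat => nat" assume "strict_mono s"
  obtain r l where "strict_mono (r :: nat => nat)" "((%k. ip M (v (s k)) (v n)) \<circ> r) ~~> l"
   using bounded_real_subseq[of "%k. ip M (v (s k)) (v n)"] ip_bounded[OF sq bd sq] by metis
  then show "EX r'. strict_mono r' & convergent (%k. ip M (v ((s \<circ> r') k)) (v n))"
   by (auto simp: convergent_def o_def)
 qed
 define r where "r = diagseq"
 have r: "strict_mono r" unfolding r_def by (rule subseq_diagseq)
 have conv: "convergent (%k. ip M (v (r k)) (v n))" for n
 proof -
  have "convergent (%k. ip M (v ((diagseq \<circ> (+) (Suc n)) k)) (v n))"
   by (rule diagseq_holds) (auto intro: convergent_subseq_convergent[unfolded o_def])
  then show ?thesis
   using convergent_ignore_initial_segment[of "%k. ip M (v (r k)) (v n)" "Suc n"]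
   by (simp add: r_def add.commute o_def)
 qed
 obtain w where w: "sqint M w"
  "!!h l. sqint M h ==> (%k. ip M (v (r k)) h) ~~> l ==> ip M w h = l"
  using weak_cluster_vector[of M "%k. v (r k)" B, OF sq bd] by blast
 have wv: "(%k. ip M (v (r k)) (v n)) ~~> ip M w (v n)" for n
  using conv[of n] w(2)[OF sq] unfolding convergent_def by metis
 show thesis
 proof (rule that[OF r w(1)])
  fix h :: "'x => 'b" assume h: "sqint M h"
  show "(%k. ip M (v (r k)) h) ~~> ip M w h"
  proof (rule ccontr)
   assume "~ ?thesis"
   then obtain e where e: "e > 0" "!!n0. \<exists>n\<ge>n0. norm (ip M (v (r n)) h - ip M w h) >= e"
    unfolding LIMSEQ_iff by (meson not_less)
   then have "infinite {n. norm (ip M (v (r n)) h - ip M w h) >= e}"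
    by (auto simp: infinite_nat_iff_unbounded_le)
   then obtain r1 where r1: "strict_mono (r1 :: nat => nat)"
    "!!n. norm (ip M (v (r (r1 n))) h - ip M w h) >= e"
    using infinite_enumerate by (metis (mono_tags, lifting) mem_Collect_eq)
   obtain r2 l where r2: "strict_mono (r2 :: nat => nat)" "((%k. ip M (v (r (r1 k))) h) \<circ> r2) ~~> l"
    using bounded_real_subseq[of "%k. ip M (v (r (r1 k))) h"] ip_bounded[OF sq bd h] by metis
   define q where "q = r1 \<circ> r2"
   have q: "strict_mono q" unfolding q_def by (rule strict_mono_o[OF r1(1) r2(1)])
   obtain w' where w': "sqint M w'"
    "!!h l. sqint M h ==> (%k. ip M (v (r (q k))) h) ~~> l ==> ip M w' h = l"
    using weak_cluster_vector[of M "%k. v (r (q k))" B, OF sq bd] by blast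
   have l: "ip M w' h = l" using r2(2) by (intro w'(2) h) (simp add: q_def o_def)
   have same: "ip M w' (v n) = ip M w (v n)" for n
    using LIMSEQ_subseq_LIMSEQ[OF wv q] by (intro w'(2) sq) (simp add: o_def)
   let ?d = "%x. w' x - w x"
   have d: "sqint M ?d" by (intro sqint_diff w w')
   have z: "ip M (v n) ?d = 0" for n
    using same[of n] by (simp add: ip_commute[of _ "v n"] ip_diff w w' sq)
   have "ip M w ?d = 0" by (rule w(2)[OF d]) (simp add: z)
   moreover have "ip M w' ?d = 0" by (rule w'(2)[OF d]) (simp add: z)
   ultimately have dd: "ip M ?d ?d = 0" by (simp add: ip_diff w w' d)
   have "(ip M ?d h)\<^sup>2 <= 0" using ip_Cauchy_Schwarz[OF d h] dd by simp
   then have "ip M w' h = ip M w h" by (simp add: ip_diff w w' h)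
   moreover have "norm (l - ip M w h) >= e"
    by (rule LIMSEQ_le_const[OF tendsto_norm[OF tendsto_diff[OF r2(2) tendsto_const]]]) (use r1 in auto)
   ultimately show False using l e(1) by simp
  qed
 qed
qed

section \<open>Integrals over subintervals and Volterra equations\<close>

lemma AE_neq_lebesgue_on: "AE s in leb T. s ~= (t::real)"
proof -
 have "AE s in lebesgue. s ~= t" by (rule AE_completion[OF AE_lborel_singleton])
 then show ?thesis by (subst AE_restrict_space_iff) auto
qed

lemma finite_measure_Icc: "finite_measure (leb T)"
 by (rule finite_measure_lebesgue_on) simp

lemma sigma_finite_Icc: "sigma_finite_measure (leb T)"
 by (rule finite_measure.axioms(1)[OF finite_measure_Icc])

lemma integrable_const_Icc: "integrable (leb T) (%_. c :: 'b::euclidean_space)"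
 by (rule finite_measure.integrable_const[OF finite_measure_Icc])

text \<open>Moves a variable domain of integration into an indicator, so that dominated convergence
  and Fubini can be used on one fixed measure space.\<close>

lemma LINT_sub:
 fixes F :: "real => 'b::euclidean_space"
 assumes "t <= T"
 shows "(LINT s|leb t. F s) = (LINT s|leb T. indicat_real {0..t} s *R F s)"
proof -
 have "(LINT s|leb t. F s) = (LINT s|lebesgue. indicat_real {0..t} s *R F s)"
  by (rule integral_restrict_space) simp
 also have "... = (LINT s|lebesgue. indicat_real {0..T} s *R (indicat_real {0..t} s *R F s))"
  using assms by (intro b_integral_cong) (auto simp: indicator_def)
 also have "... = (LINT s|leb T. indicat_real {0..t} s *R F s)"
  by (rule integral_restrict_space[symmetric]) simp
 finally show ?thesis .
qed

lemma LINT_super: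
 fixes F :: "real => 'b::euclidean_space"
 assumes "0 <= t"
 shows "(LINT s|lebesgue_on {t..T}. F s) = (LINT s|leb T. indicat_real {t..T} s *R F s)"
proof -
 have "(LINT s|lebesgue_on {t..T}. F s) = (LINT s|lebesgue. indicat_real {t..T} s *R F s)"
  by (rule integral_restrict_space) simp
 also have "... = (LINT s|lebesgue. indicat_real {0..T} s *R (indicat_real {t..T} s *R F s))"
  using assms by (intro b_integral_cong) (auto simp: indicator_def)
 also have "... = (LINT s|leb T. indicat_real {t..T} s *R F s)"
  by (rule integral_restrict_space[symmetric]) simp
 finally show ?thesis .
qed

lemma measurable_id_Icc [measurable]: "(%x. x) : borel_measurable (lebesgue_on {a..b::real})"
 using id_borel_measurable_lebesgue_on[of "{a..b}"] by (simp add: id_def)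

lemma indicator_measurable_Icc [measurable]: "A : sets borel ==> indicat_real A : borel_measurable (lebesgue_on {a..b})"
 by (intro measurable_restrict_space1 borel_measurable_indicator) simp

lemma integrable_indicator_mult:
 fixes F :: "'a => 'b::euclidean_space"
 assumes "integrable M F" "indicat_real A : borel_measurable M"
 shows "integrable M (%s. indicat_real A s *R F s)"
 by (rule b_integrable_bound[OF assms(1)
    borel_measurable_scaleR[OF assms(2) borel_measurable_integrable[OF assms(1)]]])
  (auto simp: indicator_def)

lemma integrable_sub:
 fixes F :: "real => 'b::euclidean_space"
 assumes "integrable (leb T) F" "t <= T"
 shows "integrable (leb t) F"
proof -
 have "integrable (leb T) (%s. indicat_real {0..t} s *R F s)"
  by (rule integrable_indicator_mult[OF assms(1)]) simp
 then have "integrable lebesgue (%s. indicat_real {0..T} s *R (indicat_real {0..t} s *R F s))"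
  by (subst (asm) integrable_restrict_space) auto
 also have "(%s. indicat_real {0..T} s *R (indicat_real {0..t} s *R F s)) = (%s. indicat_real {0..t} s *R F s)"
  using assms(2) by (auto simp: indicator_def)
 finally show ?thesis by (subst integrable_restrict_space) auto
qed

lemma AE_sub: "AE s in leb T. P s ==> t <= T ==> AE s in leb t. P s"
 by (subst (asm) AE_restrict_space_iff, simp, subst AE_restrict_space_iff, simp)
  (auto elim!: eventually_mono)

lemma measurable_sub: "F : borel_measurable (leb T) ==> t <= T ==> F : borel_measurable (leb t)"
 by (rule measurable_restrict_mono) auto

lemma LINT_increment:
 fixes F :: "real => 'b::euclidean_space"
 assumes "integrable (leb T) F" "0 <= a" "a <= b" "b <= T"
 shows "(LINT s|leb b. F s) - (LINT s|leb a. F s) =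
  (LINT s|leb T. indicat_real {a<..b} s *R F s)"
proof -
 have "(LINT s|leb b. F s) - (LINT s|leb a. F s) =
   (LINT s|leb T. indicat_real {0..b} s *R F s - indicat_real {0..a} s *R F s)"
  using assms by (subst (1 2) LINT_sub[of _ T])
   (auto intro!: b_integral_diff[symmetric] integrable_indicator_mult)
 also have "... = (LINT s|leb T. indicat_real {a<..b} s *R F s)"
  using assms by (intro b_integral_cong) (auto simp: indicator_def)
 finally show ?thesis .
qed

lemma continuous_measurable_Icc:
 fixes F :: "real => 'b::euclidean_space"
 assumes "cont T F" shows "F : borel_measurable (leb T)"
 by (rule continuous_imp_measurable_on_sets_lebesgue[OF assms]) simp

lemma continuous_compose_measurable:
 fixes k :: "'y::euclidean_space => 'b::euclidean_space"
 assumes "continuous_on UNIV k" "Y : borel_measurable M"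
 shows "(%s. k (Y s)) : borel_measurable M"
 using measurable_comp[OF assms(2) borel_measurable_continuous_onI[OF assms(1)]] by (simp add: o_def)

text \<open>The indicators of the moving intervals converge at every \<open>s\<close> except
  possibly the limit time, which is a null set; the rest is dominated convergence.\<close>

lemma volterra_tendsto:
 fixes K :: "nat => real => 'b::euclidean_space"
 assumes meas: "!!k. K k : borel_measurable (leb T)" "Kl : borel_measurable (leb T)"
  and \<beta>: "integrable (leb T) \<beta>"
  and bound: "!!k. AE s in leb T. norm (K k s) <= \<beta> s"
  and lim: "AE s in leb T. (%k. K k s) ~~> Kl s"
  and t: "!!k. t k : {0..T}" "tx : {0..T}" "t ~~> tx"
 shows "(%k. LINT s|lebesgue_on {0..t k}. K k s) ~~> (LINT s|leb tx. Kl s)"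
proof -
 have "(%k. LINT s|leb T. indicat_real {0..t k} s *R K k s)
   ~~> (LINT s|leb T. indicat_real {0..tx} s *R Kl s)"
 proof (rule integral_dominated_convergence[OF _ _ \<beta>])
  show "AE s in leb T. (%k. indicat_real {0..t k} s *R K k s) ~~> indicat_real {0..tx} s *R Kl s"
   using lim AE_neq_lebesgue_on[where T=T and t=tx]
  proof eventually_elim
   case (elim s)
   have "\<forall>\<^sub>F k in sequentially. indicat_real {0..t k} s = indicat_real {0..tx} s"
   proof (cases "s < tx")
    case True
    then have "\<forall>\<^sub>F k in sequentially. s < t k" by (rule order_tendstoD(1)[OF t(3)])
    then show ?thesis by eventually_elim (use True in \<open>auto simp: indicator_def\<close>)
   next
    case False
    then have "\<forall>\<^sub>F k in sequentially. t k < s" using elim(2) by (intro order_tendstoD(2)[OF t(3)]) auto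
    then show ?thesis by eventually_elim (use False elim(2) in \<open>auto simp: indicator_def\<close>)
   qed
   then have "(%k. indicat_real {0..t k} s) ~~> indicat_real {0..tx} s" by (rule tendsto_eventually)
   then show ?case using elim(1) by (rule tendsto_scaleR)
  qed
  show "AE s in leb T. norm (indicat_real {0..t k} s *R K k s) <= \<beta> s" for k
   using bound[of k] by eventually_elim (auto simp: indicator_def intro: order.trans[OF norm_ge_zero])
 qed (intro borel_measurable_scaleR meas indicator_measurable_Icc; simp)+
 moreover have "(LINT s|lebesgue_on {0..t k}. K k s) = (LINT s|leb T. indicat_real {0..t k} s *R K k s)" for k
  using t(1)[of k] by (intro LINT_sub) auto
 moreover have "(LINT s|leb tx. Kl s) = (LINT s|leb T. indicat_real {0..tx} s *R Kl s)"
  using t(2) by (intro LINT_sub) auto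
 ultimately show ?thesis by simp
qed

lemma volterra_continuous:
 fixes K :: "real => real => 'b::euclidean_space"
 assumes "!!t. t : {0..T} ==> K t : borel_measurable (leb T)"
  and "integrable (leb T) \<beta>"
  and "!!t. t : {0..T} ==> AE s in leb T. norm (K t s) <= \<beta> s"
  and c: "AE s in leb T. cont T (%t. K t s)"
 shows "cont T (%t. LINT s|leb t. K t s)"
 unfolding continuous_on_sequentially
proof (safe, unfold o_def)
 fix t :: "nat => real" and tx assume t: "tx : {0..T}" "ALL n. t n : {0..T}" "t ~~> tx"
 show "(%n. LINT s|lebesgue_on {0..t n}. K (t n) s) ~~> (LINT s|leb tx. K tx s)"
 proof (rule volterra_tendsto[where T=T and \<beta>=\<beta>])
  show "AE s in leb T. (%n. K (t n) s) ~~> K tx s"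
   using c by eventually_elim (use t in \<open>auto simp: continuous_on_sequentially o_def\<close>)
 qed (use t assms in auto)
qed

lemma indefinite_integral_continuous:
 fixes F :: "real => 'b::euclidean_space"
 assumes "integrable (leb T) F"
 shows "cont T (%t. LINT s|leb t. F s)"
 by (rule volterra_continuous[where \<beta>="%s. norm (F s)"]) (use assms in auto)

section \<open>Gronwall's inequality, uniqueness and existence for Volterra equations\<close>

text \<open>With the weight \<open>exp (- 2 C s)\<close> the integral operator has norm at most one
  half, so evaluating the hypothesis at a maximum point of the weighted function already gives the
  bound, without iteration. This is the origin of both factors 2 in the conclusion.\<close>

lemma gronwall:
 fixes \<phi> :: "real => real"
 assumes cont: "cont T \<phi>" and a: "a >= 0" and C: "C > 0"
  and le: "!!t. t : {0..T} ==> \<phi> t <= a + C * (LINT s|leb t. \<phi> s)"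
  and t: "t : {0..T}"
 shows "\<phi> t <= 2 * a * exp (2 * C * T)"
proof -
 define f where "f s = exp (- (2 * C * s)) * \<phi> s" for s
 have cf: "cont T f" unfolding f_def by (intro continuous_intros cont)
 obtain m where m: "m : {0..T}" "!!s. s : {0..T} ==> f s <= f m"
  using continuous_attains_sup[OF compact_Icc _ cf] t by fastforce
 have \<phi>_le: "\<phi> s <= f m * exp (2 * C * s)" if "s : {0..T}" for s
  using m(2)[OF that] by (simp add: f_def exp_minus field_simps)
 have ce: "cont m (%s. f m * exp (2 * C * s))" by (intro continuous_intros)
 have "(LINT s|leb m. \<phi> s) <= (LINT s|leb m. f m * exp (2 * C * s))"
 proof (rule integral_mono)
  show "integrable (leb m) \<phi>"
   using m(1) by (intro continuous_imp_integrable_real continuous_on_subset[OF cont]) auto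
  show "integrable (leb m) (%s. f m * exp (2 * C * s))"
   by (intro continuous_imp_integrable_real ce)
 qed (use m(1) in \<open>auto intro!: \<phi>_le\<close>)
 also have "... = integral {0..m} (%s. f m * exp (2 * C * s))"
  by (intro lebesgue_integral_eq_integral continuous_imp_integrable_real ce) auto
 also have "... = f m * exp (2 * C * m) / (2 * C) - f m * exp (2 * C * 0) / (2 * C)"
  using m(1) C by (intro integral_unique fundamental_theorem_of_calculus)
   (auto intro!: derivative_eq_intros simp: has_real_derivative_iff_has_vector_derivative[symmetric])
 finally have 1: "C * (LINT s|leb m. \<phi> s) <= (f m * exp (2 * C * m) - f m) / 2"
  using C by (simp add: field_simps)
 have "f m <= exp (- (2 * C * m)) * (a + (f m * exp (2 * C * m) - f m) / 2)"
 proof -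
  have "\<phi> m <= a + (f m * exp (2 * C * m) - f m) / 2"
   by (rule order.trans[OF le[OF m(1)] add_left_mono[OF 1]])
  then show ?thesis by (subst f_def[of m], rule mult_left_mono) simp
 qed
 also have "... = exp (- (2 * C * m)) * a + f m / 2 - exp (- (2 * C * m)) * f m / 2"
  by (simp add: field_simps exp_minus)
 finally have 2: "f m * (1 + exp (- (2 * C * m))) <= 2 * (exp (- (2 * C * m)) * a)" by (simp add: field_simps)
 have e1: "exp (- (2 * C * m)) <= 1" using C m(1) by simp
 have "f m <= 2 * a"
 proof (cases "f m <= 0")
  case False
  then have "f m <= f m * (1 + exp (- (2 * C * m)))" by (simp add: field_simps)
  also have "... <= 2 * (exp (- (2 * C * m)) * a)" by (rule 2)
  also have "... <= 2 * (1 * a)" by (intro mult_left_mono mult_right_mono e1 a) auto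
  finally show ?thesis by simp
 qed (use a in simp)
 then have "f m * exp (2 * C * t) <= 2 * a * exp (2 * C * T)"
  using t C a by (intro mult_mono) (auto simp: mult_left_mono)
 then show ?thesis using \<phi>_le[OF t] by simp
qed

lemma volterra_unique:
 fixes Kf :: "real => real => 'b::euclidean_space => 'b"
 assumes lip: "!!t. t : {0..T} ==> AE s in leb T. ALL z z'. norm (Kf t s z - Kf t s z') <= C * norm (z - z')"
  and c: "cont T z" "cont T z'"
  and int: "!!t. t : {0..T} ==> integrable (leb t) (%s. Kf t s (z s))"
   "!!t. t : {0..T} ==> integrable (leb t) (%s. Kf t s (z' s))"
  and eq: "!!t. t : {0..T} ==> z t = z0 + (LINT s|leb t. Kf t s (z s))"
   "!!t. t : {0..T} ==> z' t = z0 + (LINT s|leb t. Kf t s (z' s))"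
  and t: "t : {0..T}"
 shows "z t = z' t"
proof -
 \<comment> \<open>Gronwall's inequality asks for a strictly positive constant.\<close>
 let ?C = "max C 1"
 have "norm (z t - z' t) <= 2 * 0 * exp (2 * ?C * T)"
 proof (rule gronwall[of T "%t. norm (z t - z' t)" 0 ?C])
  show cn: "cont T (%t. norm (z t - z' t))" by (intro continuous_intros c)
  fix t assume t: "t : {0..T}"
  have cn': "integrable (leb t) (%s. norm (z s - z' s))"
   using t by (intro continuous_imp_integrable_real continuous_on_subset[OF cn]) auto
  have "norm (z t - z' t) = norm (LINT s|leb t. Kf t s (z s) - Kf t s (z' s))"
   using int t by (simp add: eq(1)[OF t] eq(2)[OF t])
  also have "... <= (LINT s|leb t. norm (Kf t s (z s) - Kf t s (z' s)))"
   by (rule integral_norm_bound)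
  also have "... <= (LINT s|leb t. ?C * norm (z s - z' s))"
  proof (rule integral_mono_AE)
   show "AE s in leb t. norm (Kf t s (z s) - Kf t s (z' s)) <= ?C * norm (z s - z' s)"
    using AE_sub[OF lip[OF t], of t] t
    by (auto elim!: eventually_mono intro: order.trans[OF _ mult_right_mono[of C ?C]])
  qed (use int t cn' in auto)
  finally show "norm (z t - z' t) <= 0 + ?C * (LINT s|leb t. norm (z s - z' s))" by simp
 qed (use t in auto)
 then show ?thesis by simp
qed

text \<open>Existence follows from Banach's theorem for a weighted supremum norm.\<close>

lemma volterra_exists:
 fixes Kf :: "real => real => 'b::euclidean_space => 'b"
 assumes T: "T >= 0"
  and cont: "!!z. cont T z ==> cont T (%t. LINT s|leb t. Kf t s (z s))"
  and int: "!!z t. cont T z ==> t : {0..T} ==> integrable (leb t) (%s. Kf t s (z s))"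
  and lip: "!!t. t : {0..T} ==> AE s in leb T. ALL z z'. norm (Kf t s z - Kf t s z') <= C * norm (z - z')"
 obtains z where "cont T z"
  "!!t. t : {0..T} ==> z t = z0 + (LINT s|leb t. Kf t s (z s))"
proof -
 \<comment> \<open>The exponent is at least twice the Lipschitz constant, and the integral of
   \<open>exp (w s)\<close> up to \<open>t\<close> is below \<open>exp (w t) / w\<close>; this
   yields the contraction factor one half.\<close>
 define w where "w = 2 * max C 1"
 have w: "w > 0" "C <= w / 2" by (auto simp: w_def)
 \<comment> \<open>Bounded continuous functions are available as a complete space on the whole line;
   clamping the time extends functions from \<open>{0..T}\<close> to it.\<close>
 define c where "c t = max 0 (min T t)" for t
 have c: "c t : {0..T}" "t : {0..T} ==> c t = t" for t using T by (auto simp: c_def)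
 have cc: "continuous_on UNIV c" unfolding c_def by (intro continuous_intros)
 \<comment> \<open>The unknown is \<open>\<zeta> s = exp (- w s) z s\<close>, so that the plain
   supremum norm of \<open>\<zeta>\<close> is the weighted norm of \<open>z\<close>.\<close>
 define I where "I \<zeta> t = exp (- w * t) *R (z0 + (LINT s|leb t. Kf t s (exp (w * s) *R \<zeta> s)))"
  for \<zeta> :: "real => 'b" and t
 define G where "G \<zeta> = Bcontfun (%t. I (apply_bcontfun \<zeta>) (c t))" for \<zeta> :: "real \<Rightarrow>\<^sub>C 'b"
 have cz: "cont T (%s. exp (w * s) *R apply_bcontfun \<zeta> s)" for \<zeta> :: "real \<Rightarrow>\<^sub>C 'b"
  by (intro continuous_intros continuous_on_apply_bcontfun)
 have cI: "cont T (I (apply_bcontfun \<zeta>))" for \<zeta>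
  unfolding I_def by (intro continuous_intros cont cz)
 have Gt: "apply_bcontfun (G \<zeta>) t = I (apply_bcontfun \<zeta>) (c t)" for \<zeta> t
 proof -
  have "bounded (I (apply_bcontfun \<zeta>) ` {0..T})"
   by (intro compact_imp_bounded compact_continuous_image cI compact_Icc)
  then obtain B where "\<forall>y\<in>I (apply_bcontfun \<zeta>) ` {0..T}. norm y <= B" unfolding bounded_iff by blast
  then have "(%t. I (apply_bcontfun \<zeta>) (c t)) : bcontfun"
   by (intro bcontfun_normI[where b=B] continuous_on_compose2[OF cI cc]) (use c in auto)
  then show ?thesis unfolding G_def by (simp add: Bcontfun_inverse)
 qed
 have "\<exists>!\<zeta>. G \<zeta> = \<zeta>"
 proof (rule banach_fix_type[where c="1/2"])
  show "\<forall>\<zeta> \<zeta>'. dist (G \<zeta>) (G \<zeta>') <= 1/2 * dist \<zeta> \<zeta>'"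
  proof (intro allI dist_bound)
   fix \<zeta> \<zeta>' :: "real \<Rightarrow>\<^sub>C 'b" and t'
   define t where "t = c t'"
   have t: "t : {0..T}" unfolding t_def by (rule c)
   let ?z = "%s. exp (w * s) *R apply_bcontfun \<zeta> s" and ?z' = "%s. exp (w * s) *R apply_bcontfun \<zeta>' s"
   have i: "integrable (leb t) (%s. Kf t s (?z s))"
    "integrable (leb t) (%s. Kf t s (?z' s))" by (intro int cz t)+
   have ie: "integrable (leb t) (%s. w / 2 * exp (w * s) * dist \<zeta> \<zeta>')"
    by (intro continuous_imp_integrable_real continuous_intros)
   have "norm (LINT s|leb t. Kf t s (?z s) - Kf t s (?z' s))
    <= (LINT s|leb t. norm (Kf t s (?z s) - Kf t s (?z' s)))"
    by (rule integral_norm_bound)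
   also have "... <= (LINT s|leb t. w / 2 * exp (w * s) * dist \<zeta> \<zeta>')"
   proof (rule integral_mono_AE)
    have "AE s in leb t. ALL z z'. norm (Kf t s z - Kf t s z') <= C * norm (z - z')"
    by (rule AE_sub[OF lip[OF t]]) (use t in auto)
    then show "AE s in leb t. norm (Kf t s (?z s) - Kf t s (?z' s)) <= w / 2 * exp (w * s) * dist \<zeta> \<zeta>'"
    proof eventually_elim
    case (elim s)
    have "norm (Kf t s (?z s) - Kf t s (?z' s)) <= C * norm (?z s - ?z' s)" using elim by blast
    also have "... = C * (exp (w * s) * dist (apply_bcontfun \<zeta> s) (apply_bcontfun \<zeta>' s))"
    by (simp add: scaleR_diff_right[symmetric] dist_norm del: scaleR_diff_right)
    also have "... <= w / 2 * (exp (w * s) * dist \<zeta> \<zeta>')"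
    using w by (intro mult_mono dist_bounded) auto
    finally show ?case by (simp add: mult_ac)
    qed
   qed (use i ie in auto)
   also have "... = integral {0..t} (%s. w / 2 * exp (w * s) * dist \<zeta> \<zeta>')"
    by (intro lebesgue_integral_eq_integral ie) auto
   also have "... = exp (w * t) / 2 * dist \<zeta> \<zeta>' - exp (w * 0) / 2 * dist \<zeta> \<zeta>'"
    using t w by (intro integral_unique fundamental_theorem_of_calculus)
    (auto intro!: derivative_eq_intros simp: has_real_derivative_iff_has_vector_derivative[symmetric])
   also have "... <= exp (w * t) / 2 * dist \<zeta> \<zeta>'" by simp
   finally have b: "norm (LINT s|leb t. Kf t s (?z s) - Kf t s (?z' s)) <= exp (w * t) / 2 * dist \<zeta> \<zeta>'" .
   have eq: "dist (apply_bcontfun (G \<zeta>) t') (apply_bcontfun (G \<zeta>') t') =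
    exp (- w * t) * norm (LINT s|leb t. Kf t s (?z s) - Kf t s (?z' s))"
    unfolding Gt I_def t_def[symmetric] dist_norm 
    by (subst b_integral_diff[OF i]) (simp add: scaleR_diff_right[symmetric] del: scaleR_diff_right)
   show "dist (apply_bcontfun (G \<zeta>) t') (apply_bcontfun (G \<zeta>') t') <= 1/2 * dist \<zeta> \<zeta>'"
    unfolding eq using mult_left_mono[OF b, of "exp (- w * t)"]
    by (simp add: mult.assoc[symmetric] exp_add[symmetric])
  qed
 qed auto
 then obtain \<zeta> where \<zeta>: "G \<zeta> = \<zeta>" by blast
 define z where "z s = exp (w * s) *R apply_bcontfun \<zeta> s" for s
 show thesis
 proof (rule that)
  show "cont T z" unfolding z_def by (rule cz)
  fix t assume t: "t : {0..T}"
  have "apply_bcontfun \<zeta> t = I (apply_bcontfun \<zeta>) t" using Gt[of \<zeta> t] \<zeta> c(2)[OF t] by simp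
  then show "z t = z0 + (LINT s|leb t. Kf t s (z s))"
   unfolding z_def I_def by (simp add: exp_minus)
 qed
qed

section \<open>Kernels depending on two times\<close>

text \<open>A majorant of product form replaces integrability on the product space, since this is
  what the kernel estimates supply: a bound in \<open>s\<close> times an integrable function of
  \<open>r\<close>.\<close>

lemma fubini_swap:
 fixes F :: "'s => 'r => 'b::euclidean_space"
 assumes sf: "sigma_finite_measure \<nu>" "sigma_finite_measure \<mu>"
  and F: "case_prod F : borel_measurable (\<nu> \<Otimes>\<^sub>M \<mu>)"
  and \<beta>: "integrable \<nu> \<beta>" and \<gamma>: "integrable \<mu> \<gamma>"
  and bd: "AE s in \<nu>. AE r in \<mu>. norm (F s r) <= \<beta> s * \<gamma> r"
 shows "(LINT s|\<nu>. LINT r|\<mu>. F s r) = (LINT r|\<mu>. LINT s|\<nu>. F s r)"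
  "integrable \<nu> (%s. LINT r|\<mu>. F s r)" "integrable \<mu> (%r. LINT s|\<nu>. F s r)"
proof -
 interpret pair_sigma_finite \<nu> \<mu> using sf by (rule pair_sigma_finite.intro)
 have Fs: "F s : borel_measurable \<mu>" if "s : space \<nu>" for s
  using measurable_Pair2[OF F that] by simp
 have "AE s in \<nu>. integrable \<mu> (F s)"
  using bd AE_space
 proof eventually_elim
  case (elim s)
  show ?case
   by (rule b_integrable_bound[OF integrable_mult_right[OF \<gamma>, of "\<beta> s"] Fs[OF elim(2)]])
    (use elim(1) in \<open>auto elim!: eventually_mono\<close>)
 qed
 note int = this
 have "integrable (\<nu> \<Otimes>\<^sub>M \<mu>) (case_prod F)"
 proof (rule Fubini_integrable[OF F])
  show "AE s in \<nu>. integrable \<mu> (%r. case (s, r) of (x, xa) => F x xa)" using int by simp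
  show "integrable \<nu> (%s. LINT r|\<mu>. norm (case (s, r) of (x, xa) => F x xa))"
  proof (rule b_integrable_bound[OF integrable_mult_left[OF \<beta>, of "LINT r|\<mu>. \<gamma> r"]])
   show "(%s. LINT r|\<mu>. norm (case (s, r) of (x, xa) => F x xa)) : borel_measurable \<nu>"
    using F by (intro M2.borel_measurable_lebesgue_integral) (auto simp: case_prod_beta')
   show "AE s in \<nu>. norm (LINT r|\<mu>. norm (case (s, r) of (x, xa) => F x xa)) <= norm (\<beta> s * integral\<^sup>L \<mu> \<gamma>)"
    using bd int
   proof eventually_elim
    case (elim s)
    have "(LINT r|\<mu>. norm (F s r)) <= (LINT r|\<mu>. \<beta> s * \<gamma> r)"
    using elim \<gamma> by (intro integral_mono_AE) auto
    then show ?case by simp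
   qed
  qed
 qed
 from Fubini_integral[OF this] integrable_fst'[OF this] integrable_snd[OF this]
 show "(LINT s|\<nu>. LINT r|\<mu>. F s r) = (LINT r|\<mu>. LINT s|\<nu>. F s r)"
  "integrable \<nu> (%s. LINT r|\<mu>. F s r)" "integrable \<mu> (%r. LINT s|\<nu>. F s r)" by simp_all
qed

text \<open>One majorant \<open>\<beta>\<close> serves the kernel and its derivative in the first
  time, uniformly in that time. It is constant for kernels along bounded trajectories and a multiple
  of \<open>norm (H s)\<close> for the linearized ones.\<close>

definition kernel_bound :: "real => (real \<times> real \<times> 'y::euclidean_space => 'b::euclidean_space) => (real => 'y) => (real => real) => bool" where
 "kernel_bound T k Y \<beta> \<longleftrightarrow> smooth k & Y : borel_measurable (leb T) &
   integrable (leb T) \<beta> &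
   (AE s in leb T. \<forall>r\<in>{0..T}. norm (k (r, s, Y s)) <= \<beta> s & norm (Dtau k (r, s, Y s)) <= \<beta> s)"

lemma Dtau_eq_fd:
 fixes k :: "real \<times> 'x::euclidean_space => 'b::real_normed_vector"
 assumes "smooth k" shows "Dtau k = (%q. fd k q (1, 0))"
  and "((%\<sigma>. k (\<sigma>, x)) has_vector_derivative Dtau k (\<tau>, x)) (at \<tau>)"
proof -
 have d: "((%\<sigma>. k (\<sigma>, x)) has_vector_derivative fd k (\<tau>, x) (1, 0)) (at \<tau>)" for \<tau> x
  using smooth_line_derivative[OF assms, of "(0, x)" "(1, 0)" \<tau>] by simp
 show "Dtau k = (%q. fd k q (1, 0))"
  by (auto simp: Dtau_def fun_eq_iff vector_derivative_at[OF d])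
 then show "((%\<sigma>. k (\<sigma>, x)) has_vector_derivative Dtau k (\<tau>, x)) (at \<tau>)" using d by simp
qed

lemma smooth_Dtau: "smooth k ==> smooth (Dtau k)"
 for k :: "real \<times> 'x::euclidean_space => 'b::real_normed_vector"
 by (simp add: Dtau_eq_fd(1) smooth_fd)

lemma kernel_measurable:
 fixes k :: "real \<times> real \<times> 'y::euclidean_space => 'b::euclidean_space"
 assumes "smooth k" "Y : borel_measurable M" "(%s. s) : borel_measurable M"
 shows "(%s. k (r, s, Y s)) : borel_measurable M" "(%s. k (s, s, Y s)) : borel_measurable M"
 using assms by (intro continuous_compose_measurable[OF smooth_continuous[OF assms(1)]] borel_measurable_Pair; simp)+

lemma kernel_integrable:
 assumes "kernel_bound T k Y \<beta>" "r : {0..T}"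
 shows "integrable (leb T) (%s. k (r, s, Y s))"
  "integrable (leb T) (%s. Dtau k (r, s, Y s))"
  "integrable (leb T) (%s. k (s, s, Y s))"
proof -
 note kb = assms(1)[unfolded kernel_bound_def]
 from kb have \<beta>: "integrable (leb T) \<beta>"
  and ae: "AE s in leb T. \<forall>r\<in>{0..T}. norm (k (r, s, Y s)) <= \<beta> s & norm (Dtau k (r, s, Y s)) <= \<beta> s"
  by auto
 have ae2: "AE s in leb T. s : {0..T}" using AE_space[of "leb T"] by simp
 show "integrable (leb T) (%s. k (r, s, Y s))"
  by (rule b_integrable_bound[OF \<beta>])
   (use kb ae assms(2) in \<open>auto intro!: kernel_measurable elim!: eventually_mono intro: order.trans[OF _ abs_ge_self]\<close>)
 show "integrable (leb T) (%s. Dtau k (r, s, Y s))"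
  by (rule b_integrable_bound[OF \<beta>])
   (use kb ae assms(2) in \<open>auto intro!: kernel_measurable smooth_Dtau elim!: eventually_mono intro: order.trans[OF _ abs_ge_self]\<close>)
 have "AE s in leb T. norm (k (s, s, Y s)) <= norm (\<beta> s)"
  using ae ae2 by eventually_elim (auto intro: order.trans[OF _ abs_ge_self])
 then show "integrable (leb T) (%s. k (s, s, Y s))"
  by (intro b_integrable_bound[OF \<beta>] kernel_measurable) (use kb in auto)
qed

lemma kernel_integral_continuous:
 assumes "kernel_bound T k Y \<beta>"
 shows "cont T (%r. LINT s|leb r. k (r, s, Y s))"
  "cont T (%r. LINT s|leb r. Dtau k (r, s, Y s))"
proof -
 note kb = assms(1)[unfolded kernel_bound_def]
 have c: "continuous_on A (%r. F (r, s, Y s))" if "smooth F" for F :: "real \<times> real \<times> 'a => 'b" and s A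
  by (rule continuous_on_compose2[OF smooth_continuous[OF that, of UNIV]]) (auto intro!: continuous_intros)
 show "cont T (%r. LINT s|leb r. k (r, s, Y s))"
  by (rule volterra_continuous[where \<beta>=\<beta>])
   (use kb in \<open>auto intro!: c kernel_measurable elim!: eventually_mono\<close>)
 show "cont T (%r. LINT s|leb r. Dtau k (r, s, Y s))"
  by (rule volterra_continuous[where \<beta>=\<beta>])
   (use kb in \<open>auto intro!: c kernel_measurable smooth_Dtau elim!: eventually_mono\<close>)
qed

text \<open>The fundamental theorem of calculus in the first time for fixed \<open>s\<close>, then
  Fubini on the triangle \<open>s \<le> r \<le> t\<close>. A Volterra integral thus becomes an
  indefinite integral, whose integrand is the weak derivative of a state.\<close>

lemma volterra_weak_derivative:
 fixes k :: "real \<times> real \<times> 'y::euclidean_space => 'b::euclidean_space"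
 assumes kb: "kernel_bound T k Y \<beta>" and t: "t : {0..T}"
 shows "(LINT s|leb t. k (t, s, Y s)) =
  (LINT r|leb t. k (r, r, Y r) + (LINT s|leb r. Dtau k (r, s, Y s)))"
proof -
 let ?M = "leb T"
 note kb' = kb[unfolded kernel_bound_def]
 have sm: "smooth k" and Y [measurable]: "Y : borel_measurable ?M" and \<beta>: "integrable ?M \<beta>"
  and ae: "AE s in ?M. \<forall>r\<in>{0..T}. norm (k (r, s, Y s)) <= \<beta> s & norm (Dtau k (r, s, Y s)) <= \<beta> s"
  using kb' by auto
 define F where "F s r = indicat_real {(s, r). 0 <= s & s <= r & r <= t} (s, r) *R Dtau k (r, s, Y s)" for s r
 have ftc: "k (t, s, Y s) = k (s, s, Y s) + (LINT r|?M. F s r)" if s: "s : {0..t}" for s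
 proof -
  have c: "continuous_on {s..t} (%r. Dtau k (r, s, Y s))"
   by (rule continuous_on_compose2[OF smooth_continuous[OF smooth_Dtau[OF sm], of UNIV]])
    (auto intro!: continuous_intros)
  have i: "integrable (lebesgue_on {s..t}) (%r. Dtau k (r, s, Y s))" by (rule continuous_imp_integrable_real[OF c])
  have "(LINT r|?M. F s r) = (LINT r|lebesgue. indicat_real {0..T} r *R F s r)"
   by (rule integral_restrict_space) simp
  also have "... = (LINT r|lebesgue. indicat_real {s..t} r *R Dtau k (r, s, Y s))"
   using s t by (intro b_integral_cong) (auto simp: F_def indicator_def)
  also have "... = (LINT r|lebesgue_on {s..t}. Dtau k (r, s, Y s))"
   by (rule integral_restrict_space[symmetric]) simp
  also have "... = integral {s..t} (%r. Dtau k (r, s, Y s))"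
   by (rule lebesgue_integral_eq_integral[OF i]) simp
  also have "... = k (t, s, Y s) - k (s, s, Y s)"
   using s by (intro integral_unique fundamental_theorem_of_calculus)
    (auto intro!: has_vector_derivative_at_within Dtau_eq_fd(2) sm)
  finally show ?thesis by simp
 qed
 have Fmeas: "case_prod F : borel_measurable (?M \<Otimes>\<^sub>M ?M)"
 proof -
  have [measurable]: "fst : borel_measurable (?M \<Otimes>\<^sub>M ?M)" "snd : borel_measurable (?M \<Otimes>\<^sub>M ?M)"
   using measurable_comp[OF measurable_fst measurable_id_Icc] measurable_comp[OF measurable_snd measurable_id_Icc]
   by (simp_all add: o_def)
  have "(%q. indicat_real {(s, r). 0 <= s & s <= r & r <= t} (fst q, snd q) *R Dtau k (snd q, fst q, Y (fst q)))
    : borel_measurable (?M \<Otimes>\<^sub>M ?M)"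
  proof (rule borel_measurable_scaleR)
   show "(%q. indicat_real {(s, r). 0 <= s & s <= r & r <= t} (fst q, snd q)) : borel_measurable (?M \<Otimes>\<^sub>M ?M)"
    unfolding indicator_def by simp measurable
   show "(%q. Dtau k (snd q, fst q, Y (fst q))) : borel_measurable (?M \<Otimes>\<^sub>M ?M)"
    by (intro continuous_compose_measurable[OF smooth_continuous[OF smooth_Dtau[OF sm]]] borel_measurable_Pair) measurable
  qed
  moreover have "case_prod F = (%q. indicat_real {(s, r). 0 <= s & s <= r & r <= t} (fst q, snd q) *\<^sub>R
    Dtau k (snd q, fst q, Y (fst q)))"
   by (rule ext) (simp only: case_prod_beta F_def)
  ultimately show ?thesis by (simp only:)
 qed
 have bd: "AE s in ?M. AE r in ?M. norm (F s r) <= \<beta> s * 1"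
  using ae AE_space
 proof eventually_elim
  case (elim s)
  have "0 <= \<beta> s" using elim by (auto intro: order.trans[OF norm_ge_zero])
  then show ?case using elim by (intro AE_I2) (auto simp: F_def indicator_def)
 qed
 note fub = fubini_swap[OF sigma_finite_Icc sigma_finite_Icc Fmeas \<beta> integrable_const_Icc[of T 1] bd]
 have i1: "integrable ?M (%s. indicat_real {0..t} s *R k (s, s, Y s))"
  by (intro integrable_indicator_mult kernel_integrable(3)[OF kb t]) simp
 have F0: "(LINT r|?M. F s r) = indicat_real {0..t} s *R (LINT r|?M. F s r)" for s
 proof (cases "s : {0..t}")
  case False
  then have "F s = (%_. 0)" by (auto simp: F_def indicator_def)
  then show ?thesis by simp
 qed simp
 have inner: "(LINT s|?M. F s r) = indicat_real {0..t} r *R (LINT s|leb r. Dtau k (r, s, Y s))"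
  if "r : {0..T}" for r
 proof (cases "r : {0..t}")
  case True
  then show ?thesis using that by (subst LINT_sub[of r T])
    (auto intro!: b_integral_cong simp: F_def indicator_def)
 next
  case False
  then have "(%s. F s r) = (%_. 0)" by (auto simp: F_def indicator_def)
  then show ?thesis using False by simp
 qed
 have i2: "integrable ?M (%r. indicat_real {0..t} r *R (LINT s|leb r. Dtau k (r, s, Y s)))"
  using fub(3) by (rule b_integrable_cong[THEN iffD1, rotated -1]) (auto simp: inner)
 have "(LINT s|leb t. k (t, s, Y s)) = (LINT s|?M. indicat_real {0..t} s *R k (t, s, Y s))"
  using t by (intro LINT_sub) auto
 also have "... = (LINT s|?M. indicat_real {0..t} s *R k (s, s, Y s) + (LINT r|?M. F s r))"
  by (intro b_integral_cong refl, subst F0)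
   (auto simp: ftc indicator_def)
 also have "... = (LINT s|?M. indicat_real {0..t} s *R k (s, s, Y s)) + (LINT s|?M. LINT r|?M. F s r)"
  by (rule b_integral_add[OF i1 fub(2)])
 also have "(LINT s|?M. LINT r|?M. F s r) = (LINT r|?M. indicat_real {0..t} r *R (LINT s|leb r. Dtau k (r, s, Y s)))"
  unfolding fub(1) by (intro b_integral_cong refl inner) simp
 also have "(LINT s|?M. indicat_real {0..t} s *R k (s, s, Y s)) + ... =
   (LINT r|?M. indicat_real {0..t} r *R (k (r, r, Y r) + (LINT s|leb r. Dtau k (r, s, Y s))))"
  unfolding scaleR_add_right by (rule b_integral_add[OF i1 i2, symmetric])
 also have "... = (LINT r|leb t. k (r, r, Y r) + (LINT s|leb r. Dtau k (r, s, Y s)))"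
  using t by (intro LINT_sub[symmetric]) auto
 finally show ?thesis .
qed

section \<open>Test functions and the lemma of du Bois-Reymond\<close>

lemma Ck_real_derivative:
 fixes F :: "real => real"
 assumes "!!x. (F has_real_derivative G x) (at x)" "Ck k G" shows "Ck (Suc k) F"
 by (rule Ck_SucI[where F'="%x v. G x * v"])
  (use assms in \<open>auto simp: has_field_derivative_def intro!: Ck_bilinear[OF bounded_bilinear_mult] Ck_const\<close>)

lemma smooth_real_derivative:
 fixes F :: "real => real"
 assumes "!!x. (F has_real_derivative G x) (at x)" "smooth G" shows "smooth F"
 unfolding smooth_def using Ck_real_derivative[OF assms(1)] assms(2) Ck_Suc_D unfolding smooth_def by blast

text \<open>The function \<open>exp (- 1 / x)\<close> with a polynomial factor in
  \<open>1 / x\<close>; the factor is there to make the family closed under differentiation, so that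
  smoothness follows by induction over all polynomials at once.\<close>

definition flat :: "real poly => real => real" where
 "flat p x = (if x <= 0 then 0 else poly p (1 / x) * exp (- (1 / x)))"

lemma flat_tendsto_0: "(flat p \<longlongrightarrow> 0) (at 0)"
proof -
 have "((%y. \<Sum>i\<le>degree p. coeff p i * (y ^ i / exp y)) \<longlongrightarrow> (\<Sum>i\<le>degree p. coeff p i * 0)) at_top"
  by (intro tendsto_intros tendsto_power_div_exp_0)
 then have "((%y. poly p y * exp (- y)) \<longlongrightarrow> 0) at_top"
  by (simp add: poly_altdef sum_distrib_right exp_minus divide_inverse mult.assoc)
 from filterlim_compose[OF this filterlim_inverse_at_top_right]
 have "((%x. poly p (inverse x) * exp (- inverse x)) \<longlongrightarrow> 0) (at_right 0)" .
 then have "(flat p \<longlongrightarrow> 0) (at_right 0)"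
  by (rule Lim_transform_eventually)
   (auto simp: flat_def inverse_eq_divide eventually_at_right_less intro: eventually_mono[OF eventually_at_right_less[of 0]])
 moreover have "(flat p \<longlongrightarrow> 0) (at_left 0)"
  by (rule Lim_transform_eventually[OF tendsto_const])
   (auto simp: flat_def eventually_at_filter)
 ultimately show ?thesis by (simp add: filterlim_at_split)
qed

lemma flat_derivative:
 "(flat p has_real_derivative flat ([:0, 0, 1:] * (p - pderiv p)) x) (at x)"
proof -
 consider "x < 0" | "x > 0" | "x = 0" by linarith
 then show ?thesis
 proof cases
  case 1
  have "((%_. 0) has_real_derivative 0) (at x)" by simp
  then have "(flat p has_real_derivative 0) (at x)"
   by (rule has_field_derivative_transform_within_open[of _ _ _ "{..<0}"]) (use 1 in \<open>auto simp: flat_def\<close>)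
  then show ?thesis using 1 by (simp add: flat_def)
 next
  case 2
  have "((%x. poly p (1 / x) * exp (- (1 / x))) has_real_derivative
    (poly (pderiv p) (1 / x) * (- 1 / x\<^sup>2)) * exp (- (1 / x)) + (exp (- (1 / x)) * (1 / x\<^sup>2)) * poly p (1 / x)) (at x)"
   using 2 by (auto intro!: derivative_eq_intros poly_DERIV[THEN DERIV_chain2] simp: power2_eq_square field_simps)
  then have "(flat p has_real_derivative
    (poly (pderiv p) (1 / x) * (- 1 / x\<^sup>2)) * exp (- (1 / x)) + (exp (- (1 / x)) * (1 / x\<^sup>2)) * poly p (1 / x)) (at x)"
   by (rule has_field_derivative_transform_within_open[of _ _ _ "{0<..}"]) (use 2 in \<open>auto simp: flat_def\<close>)
  then show ?thesis using 2 by (simp add: flat_def algebra_simps power2_eq_square)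
 next
  case 3
  \<comment> \<open>At the origin the difference quotient of \<open>flat p\<close> is itself a
    member of the family, with the polynomial multiplied by its variable.\<close>
  have "(flat ([:0, 1:] * p) \<longlongrightarrow> 0) (at 0)" by (rule flat_tendsto_0)
  then have "((%y. (flat p y - flat p 0) / (y - 0)) \<longlongrightarrow> 0) (at 0)"
   by (rule Lim_transform_eventually) (auto simp: flat_def eventually_at_filter)
  then show ?thesis using 3 by (simp add: has_field_derivative_iff flat_def)
 qed
qed

lemma smooth_flat: "smooth (flat p)"
proof -
 have "Ck k (flat p)" for k
 proof (induction k arbitrary: p)
  case 0
  have "continuous_on UNIV (flat p)"
   by (auto simp only: continuous_on_eq_continuous_at open_UNIV intro!: DERIV_isCont[OF flat_derivative])
  then show ?case by simp
 next
  case (Suc k)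
  show ?case by (rule Ck_real_derivative[OF flat_derivative Suc])
 qed
 then show ?thesis by (simp add: smooth_def)
qed

lemma antiderivative_exists:
 fixes \<phi> :: "real => real"
 assumes "continuous_on UNIV \<phi>" obtains \<Phi> where "!!x. (\<Phi> has_real_derivative \<phi> x) (at x)"
 using einterval_antiderivative[of "-\<infinity>" "\<infinity>" \<phi>] assms
 by (auto simp: continuous_on_eq_continuous_at has_real_derivative_iff_has_vector_derivative)

text \<open>A normalized antiderivative of the bump
  \<open>exp (- 1 / x) exp (- 1 / (1 - x))\<close>, which lives on the unit interval.\<close>

lemma smooth_step_exists:
 obtains S :: "real => real" where "smooth S" "!!x. x <= 0 ==> S x = 0" "!!x. x >= 1 ==> S x = 1" "!!x. S x : {0..1::real}"
proof -
 define b where "b x = flat 1 x * flat 1 (1 + (- x))" for x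
 have smb: "smooth b" unfolding b_def
  by (rule smooth_mult[OF smooth_flat smooth_compose_affine[OF bounded_linear_minus[OF bounded_linear_ident] smooth_flat]])
 obtain B where B: "!!x. (B has_real_derivative b x) (at x)"
  using antiderivative_exists[OF smooth_continuous[OF smb]] by blast
 have bnn: "b x >= 0" and bpos: "0 < x ==> x < 1 ==> b x > 0" and b0: "x <= 0 \<or> x >= 1 ==> b x = 0" for x
  by (auto simp: b_def flat_def)
 have mono: "B x <= B y" if "x <= y" for x y
  by (rule DERIV_nonneg_imp_nondecreasing[OF that]) (use B bnn in blast)
 have cB: "continuous_on A B" for A
  by (rule DERIV_continuous_on[where D=b]) (use B in \<open>auto intro: has_field_derivative_at_within\<close>)
 have lt: "B 0 < B 1"
  by (rule DERIV_pos_imp_increasing_open[OF _ _ cB]) (use B bpos in auto)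
 have dB: "DERIV B x :> 0" if "x <= 0 \<or> x >= 1" for x using B[of x] b0[OF that] by simp
 have left: "B x = B 0" if "x <= 0" for x
  using DERIV_isconst_end[of x 0 B, OF _ cB] dB that by (cases "x = 0") auto
 have right: "B x = B 1" if "x >= 1" for x
  using DERIV_isconst_end[of 1 x B, OF _ cB] dB that by (cases "x = 1") auto
 define S where "S x = (B x - B 0) / (B 1 - B 0)" for x
 show thesis
 proof (rule that[of S])
  have "(S has_real_derivative (1 / (B 1 - B 0)) * b x) (at x)" for x
   unfolding S_def using lt by (auto intro!: derivative_eq_intros B)
  then show "smooth S" by (rule smooth_real_derivative) (rule smooth_mult[OF smooth_const smb])
  show "S x = 0" if "x <= 0" for x using left[OF that] by (simp add: S_def)
  show "S x = 1" if "x >= 1" for x using right[OF that] lt by (simp add: S_def)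
  show "S x : {0..1}" for x
  proof -
   have "B 0 <= B x" using mono[of 0 x] left[of x] by (cases "x >= 0") auto
   moreover have "B x <= B 1" using mono[of x 1] right[of x] by (cases "x <= 1") auto
   ultimately show ?thesis using lt by (auto simp: S_def divide_simps)
  qed
 qed
qed

lemma test_functionsI:
 "smooth \<theta> ==> a < c ==> d < b ==> (!!t. t \<notin> {c..d} ==> \<theta> t = 0) ==> \<theta> : test_functions a b"
 unfolding test_functions_def by blast

lemma smooth_indicator_approx:
 fixes a b s :: real
 assumes "a <= s" "s < b"
 obtains \<kappa> :: "nat => real => real" where "!!n. \<kappa> n : test_functions a b" "!!n x. \<kappa> n x : {0..1}"
  "!!x. (%n. \<kappa> n x) ~~> indicat_real {s<..<b} x"
proof -
 obtain S :: "real => real" where S: "smooth S" "!!x. x <= 0 ==> S x = 0" "!!x. x >= 1 ==> S x = 1" "!!x. S x : {0..1::real}"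
  using smooth_step_exists by blast
 \<comment> \<open>Each factor rises from 0 to 1 over a length \<open>1 / (n + 1)\<close>. The shift
   by 1 moves the beginning of the rise by the same length away from \<open>s\<close> and from
   \<open>b\<close>, so the support is compact in the open interval even when
   \<open>s = a\<close>.\<close>
 define \<kappa> where "\<kappa> n x = S ((- real (Suc n) * s - 1) + real (Suc n) * x) * S ((real (Suc n) * b - 1) + (- real (Suc n)) * x)" for n x
 have l: "bounded_linear (%x. c * x)" for c :: real by (rule bounded_linear_mult_right)
 have sm: "smooth (\<kappa> n)" for n unfolding \<kappa>_def
  by (intro smooth_mult smooth_compose_affine[OF l] S)
 have z: "\<kappa> n x = 0" if "x \<notin> {s + 1 / real (Suc n)..b - 1 / real (Suc n)}" for n x
 proof -
  have "x < s + 1 / real (Suc n) \<or> x > b - 1 / real (Suc n)" using that by auto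
  then have "- real (Suc n) * s - 1 + real (Suc n) * x <= 0 \<or> (real (Suc n) * b - 1) + (- real (Suc n)) * x <= 0"
   by (auto simp: field_simps)
  then show ?thesis using S(2) by (auto simp: \<kappa>_def)
 qed
 show thesis
 proof (rule that[of \<kappa>])
  show "\<kappa> n : test_functions a b" for n
   by (rule test_functionsI[OF sm _ _ z[of _ n]])
    (use assms(1) in \<open>auto intro!: add_le_less_mono[of a s 0, simplified]\<close>)
  show "\<kappa> n x : {0..1}" for n x
   using S(4) unfolding \<kappa>_def by (auto intro!: mult_nonneg_nonneg mult_le_one)
  show "(%n. \<kappa> n x) ~~> indicat_real {s<..<b} x" for x
  proof (cases "x : {s<..<b}")
   case True
   have e: "\<forall>\<^sub>F n in sequentially. c <= real (Suc n)" for c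
   proof (rule eventually_sequentiallyI[of "nat \<lceil>c\<rceil>"])
    fix n assume "nat \<lceil>c\<rceil> <= n"
    from of_nat_mono[OF this, where 'a=real] real_nat_ceiling_ge[of c] show "c <= real (Suc n)" by simp
   qed
   have "\<forall>\<^sub>F n in sequentially. \<kappa> n x = 1"
    using e[of "2 / (x - s)"] e[of "2 / (b - x)"]
   proof eventually_elim
    case (elim n)
    have "- real (Suc n) * s - 1 + real (Suc n) * x >= 1" "(real (Suc n) * b - 1) + (- real (Suc n)) * x >= 1"
    using elim True by (simp_all add: field_simps del: of_nat_Suc)
    then show ?case using S(3) by (simp add: \<kappa>_def del: of_nat_Suc)
   qed
   then show ?thesis using True by (simp add: tendsto_eventually)
  next
   case False
   have "\<kappa> n x = 0" for n
   proof (rule z)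
    define e where "e = 1 / real (Suc n)"
    have "0 < e" by (simp add: e_def)
    then show "x \<notin> {s + 1 / real (Suc n)..b - 1 / real (Suc n)}"
    unfolding e_def[symmetric] using False by auto
   qed
   then show ?thesis using False by simp
  qed
 qed
qed

text \<open>The positive and the negative part of \<open>G\<close>, taken as densities, give
  measures that are finite and equal on all half-lines \<open>{x<..}\<close>; such measures
  coincide, hence so do their densities almost everywhere.\<close>

lemma AE_zero_if_tail_integrals_zero:
 fixes G :: "real => real"
 assumes G: "integrable lborel G" and z: "!!x. (LINT t|lborel. indicat_real {x<..} t * G t) = 0"
 shows "AE t in lborel. G t = 0"
proof -
 have m: "indicat_real {x<..} : borel_measurable lborel" for x :: real by measurable
 define P where "P t = max (G t) 0" for t
 define N where "N t = max (- G t) 0" for t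
 have iP: "integrable lborel P" "integrable lborel N" unfolding P_def N_def using G by auto
 have em: "emeasure (density lborel (%t. ennreal (F t))) {x<..} = ennreal (LINT t|lborel. indicat_real {x<..} t * F t)"
  if "integrable lborel F" "!!t. F t >= 0" for F :: "real => real" and x
 proof -
  have i: "integrable lborel (%t. indicat_real {x<..} t * F t)"
   using integrable_indicator_mult[OF that(1) m] by simp
  have "emeasure (density lborel (%t. ennreal (F t))) {x<..} = (\<integral>\<^sup>+t. ennreal (F t) * indicator {x<..} t \<partial>lborel)"
   using that(1) by (intro emeasure_density) auto
  also have "... = (\<integral>\<^sup>+t. ennreal (indicat_real {x<..} t * F t) \<partial>lborel)"
   by (intro nn_integral_cong) (auto simp: indicator_def)
  also have "... = ennreal (LINT t|lborel. indicat_real {x<..} t * F t)"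
   by (intro nn_integral_eq_integral i) (auto simp: that)
  finally show ?thesis .
 qed
 have "density lborel (%t. ennreal (P t)) = density lborel (%t. ennreal (N t))"
 proof (rule measure_eqI_lessThan)
  fix x
  have i: "integrable lborel (%t. indicat_real {x<..} t * P t)" "integrable lborel (%t. indicat_real {x<..} t * N t)"
   using integrable_indicator_mult[OF iP(1) m] integrable_indicator_mult[OF iP(2) m] by auto
  have "(LINT t|lborel. indicat_real {x<..} t * P t) - (LINT t|lborel. indicat_real {x<..} t * N t)
    = (LINT t|lborel. indicat_real {x<..} t * G t)"
   by (subst b_integral_diff[OF i, symmetric])
    (auto intro!: b_integral_cong simp: P_def N_def max_def indicator_def)
  then show "emeasure (density lborel (%t. ennreal (P t))) {x<..} = emeasure (density lborel (%t. ennreal (N t))) {x<..}"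
   using z[of x] by (subst (1 2) em) (auto simp: iP P_def N_def)
  show "emeasure (density lborel (%t. ennreal (P t))) {x<..} < \<infinity>"
   by (subst em) (auto simp: iP P_def)
 qed auto
 then have "AE t in lborel. ennreal (P t) = ennreal (N t)"
  using iP by (intro sigma_finite_measure.density_unique[OF sigma_finite_lborel]) auto
 then show ?thesis by eventually_elim (auto simp: P_def N_def max_def split: if_splits)
qed

lemma integrable_test_mult:
 assumes "integrable M p" "!!t. \<bar>\<theta> t\<bar> <= B" "\<theta> : borel_measurable M"
 shows "integrable M (%t. \<theta> t * (p t :: real))"
proof (rule b_integrable_bound[OF integrable_mult_right[OF assms(1), of B]])
 show "AE t in M. norm (\<theta> t * p t) <= norm (B * p t)"
  using assms(2) by (auto simp: abs_mult intro!: mult_right_mono order.trans[OF assms(2) abs_ge_self])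
qed (use assms in auto)

lemma smooth_measurable_lebesgue:
 fixes \<theta> :: "real => real"
 assumes "smooth \<theta>" shows "\<theta> : borel_measurable (lebesgue_on A)"
 by (intro measurable_restrict_space1 measurable_completion)
  (simp add: borel_measurable_continuous_onI smooth_continuous[OF assms])

lemma integrable_Ioo_iff:
 fixes F :: "real => real"
 shows "integrable (lebesgue_on {a<..<b}) F \<longleftrightarrow> integrable lebesgue (%t. indicat_real {a<..<b} t * F t)"
 by (subst integrable_restrict_space) auto

lemma LINT_Ioo:
 fixes F :: "real => real"
 shows "(LINT t|lebesgue_on {a<..<b}. F t) = (LINT t|lebesgue. indicat_real {a<..<b} t * F t)"
 by (subst integral_restrict_space) auto

text \<open>Indicators of \<open>{s<..<b}\<close> are dominated limits of test functions, so the
  tail integrals of \<open>g\<close> vanish. The Borel version \<open>G'\<close> is introduced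
  because \<open>g\<close> is only Lebesgue measurable.\<close>

lemma AE_zero_if_test_integrals_zero:
 fixes g :: "real => real"
 assumes ab: "a < b" and g: "integrable (lebesgue_on {a<..<b}) g"
  and z: "!!\<kappa>. \<kappa> : test_functions a b ==> (LINT t|lebesgue_on {a<..<b}. \<kappa> t * g t) = 0"
 shows "AE t in lebesgue_on {a<..<b}. g t = 0"
proof -
 have tail: "(LINT t|lebesgue_on {a<..<b}. indicat_real {s<..<b} t * g t) = 0" if s: "a <= s" "s < b" for s
 proof -
  obtain \<kappa> :: "nat => real => real" where \<kappa>: "!!n. \<kappa> n : test_functions a b" "!!n x. \<kappa> n x : {0..1}"
   "!!x. (%n. \<kappa> n x) ~~> indicat_real {s<..<b} x"
   using smooth_indicator_approx[OF s] by blast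
  have "(%n. LINT t|lebesgue_on {a<..<b}. \<kappa> n t * g t) ~~> (LINT t|lebesgue_on {a<..<b}. indicat_real {s<..<b} t * g t)"
  proof (rule integral_dominated_convergence[where w="%t. norm (g t)"])
   show "(%t. \<kappa> n t * g t) : borel_measurable (lebesgue_on {a<..<b})" for n
    by (intro borel_measurable_times smooth_measurable_lebesgue borel_measurable_integrable[OF g])
    (use \<kappa>(1)[of n] in \<open>auto simp: test_functions_def\<close>)
   show "(%t. indicat_real {s<..<b} t * g t) : borel_measurable (lebesgue_on {a<..<b})"
    by (rule borel_measurable_times[OF measurable_restrict_space1[OF borel_measurable_indicator]
    borel_measurable_integrable[OF g]]) simp
   show "AE t in lebesgue_on {a<..<b}. (%n. \<kappa> n t * g t) ~~> indicat_real {s<..<b} t * g t"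
    by (intro AE_I2 tendsto_intros \<kappa>)
   show "AE t in lebesgue_on {a<..<b}. norm (\<kappa> n t * g t) <= norm (g t)" for n
    using \<kappa>(2)[of n] by (auto simp: abs_mult intro!: mult_left_le_one_le)
  qed (use g in auto)
  then show ?thesis using z[OF \<kappa>(1)] LIMSEQ_unique[OF tendsto_const, of 0] by fastforce
 qed
 define G where "G t = indicat_real {a<..<b} t * g t" for t
 have iG: "integrable lebesgue G" using g unfolding integrable_Ioo_iff G_def .
 then obtain G' where G': "G' : borel_measurable lborel" "AE t in lborel. G t = G' t"
  using completion_ex_borel_measurable_real[of G lborel] by (auto dest: borel_measurable_integrable)
 have aeG: "AE t in lebesgue. G t = G' t" by (rule AE_completion[OF G'(2)])
 have G'l: "G' : borel_measurable lebesgue" by (rule measurable_completion[OF G'(1)])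
 have "integrable lebesgue G'" using integrable_cong_AE[THEN iffD1, OF _ G'l aeG iG] iG by auto
 then have iG': "integrable lborel G'" using integrable_completion[OF G'(1)] by blast
 have "AE t in lborel. G' t = 0"
 proof (rule AE_zero_if_tail_integrals_zero[OF iG'])
  fix x
  have "(LINT t|lborel. indicat_real {x<..} t * G' t) = (LINT t|lebesgue. indicat_real {x<..} t * G' t)"
   using G'(1) by (intro integral_completion[symmetric] borel_measurable_times) auto
  also have "... = (LINT t|lebesgue. indicat_real {x<..} t * G t)"
  proof (rule integral_cong_AE)
   have m: "indicat_real {x<..} : borel_measurable lebesgue" by (rule measurable_completion) simp
   show "(%t. indicat_real {x<..} t * G' t) : borel_measurable lebesgue"
    by (rule borel_measurable_times[OF m G'l])
   show "(%t. indicat_real {x<..} t * G t) : borel_measurable lebesgue"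
    by (rule borel_measurable_times[OF m borel_measurable_integrable[OF iG]])
   show "AE t in lebesgue. indicat_real {x<..} t * G' t = indicat_real {x<..} t * G t"
    using aeG by eventually_elim simp
  qed
  also have "... = 0"
  proof (cases "x < b")
   case True
   have "(LINT t|lebesgue. indicat_real {x<..} t * G t) = (LINT t|lebesgue. indicat_real {a<..<b} t * (indicat_real {max a x<..<b} t * g t))"
    by (intro b_integral_cong) (auto simp: G_def indicator_def)
   also have "... = 0" using tail[of "max a x"] True ab unfolding LINT_Ioo by simp
   finally show ?thesis .
  next
   case False
   then have "(%t. indicat_real {x<..} t * G t) = (%t. 0)" by (auto simp: G_def indicator_def)
   then show ?thesis by simp
  qed
  finally show "(LINT t|lborel. indicat_real {x<..} t * G' t) = 0" .
 qed
 then have "AE t in lebesgue. G' t = 0" by (rule AE_completion)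
 then have "AE t in lebesgue. t : {a<..<b} --> g t = 0"
  using aeG by eventually_elim (auto simp: G_def)
 then show ?thesis by (subst AE_restrict_space_iff) auto
qed

text \<open>Vanishing mean is what brings the antiderivative back to zero to the right of the
  support.\<close>

lemma test_function_antiderivative:
 fixes \<kappa> :: "real => real"
 assumes \<kappa>: "\<kappa> : test_functions a b" and z: "(LINT t|lebesgue_on {a<..<b}. \<kappa> t) = 0"
 obtains \<theta> where "\<theta> : test_functions a b" "!!t. deriv \<theta> t = \<kappa> t"
proof -
 from \<kappa> obtain c d where sm: "smooth \<kappa>" and cd: "a < c" "d < b" "!!t. t \<notin> {c..d} ==> \<kappa> t = 0"
  by (auto simp: test_functions_def)
 obtain \<Phi> where \<Phi>: "!!x. (\<Phi> has_real_derivative \<kappa> x) (at x)"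
  using antiderivative_exists[OF smooth_continuous[OF sm]] by blast
 have c\<Phi>: "continuous_on A \<Phi>" for A
  by (rule DERIV_continuous_on[where D=\<kappa>]) (use \<Phi> in \<open>auto intro: has_field_derivative_at_within\<close>)
 have const: "\<Phi> x = \<Phi> y" if xy: "x < y" and k0: "!!t. x < t ==> t < y ==> \<kappa> t = 0" for x y
 proof -
  have "DERIV \<Phi> t :> 0" if "x < t" "t < y" for t using \<Phi>[of t] k0[OF that] by simp
  then show ?thesis using DERIV_isconst_end[OF xy c\<Phi>] by simp
 qed
 show thesis
 proof (cases "c <= d")
  case False
  then have "\<kappa> t = 0" for t using cd by auto
  then have "\<kappa> = (%_. 0)" by auto
  then show ?thesis using \<kappa> by (intro that[of "%_. 0"]) auto
 next
  case True
  have ic: "integrable (lebesgue_on {c..d}) \<kappa>" by (intro continuous_imp_integrable_real smooth_continuous sm)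
  have "0 = (LINT t|lebesgue. indicat_real {a<..<b} t * \<kappa> t)" using z by (simp add: LINT_Ioo)
  also have "... = (LINT t|lebesgue. indicat_real {c..d} t *R \<kappa> t)"
   using cd by (intro b_integral_cong) (auto simp: indicator_def)
  also have "... = (LINT t|lebesgue_on {c..d}. \<kappa> t)" by (rule integral_restrict_space[symmetric]) simp
  also have "... = integral {c..d} \<kappa>" by (rule lebesgue_integral_eq_integral[OF ic]) simp
  also have "... = \<Phi> d - \<Phi> c"
   using True \<Phi> by (intro integral_unique fundamental_theorem_of_calculus)
    (auto simp: has_real_derivative_iff_has_vector_derivative[symmetric] intro: has_field_derivative_at_within)
  finally have dc: "\<Phi> d = \<Phi> c" by simp
  have out: "\<Phi> t = \<Phi> c" if "t \<notin> {c..d}" for t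
   using that const[of t c] const[of d t] cd(3) dc by (cases "t < c") auto
  have der: "((%t. \<Phi> t - \<Phi> c) has_real_derivative \<kappa> t) (at t)" for t
   by (auto intro!: derivative_eq_intros \<Phi>)
  show ?thesis
  proof (rule that[of "%t. \<Phi> t - \<Phi> c"])
   show "(%t. \<Phi> t - \<Phi> c) : test_functions a b"
    unfolding test_functions_def using smooth_real_derivative[OF der sm] cd(1,2) out by auto
   show "deriv (%t. \<Phi> t - \<Phi> c) t = \<kappa> t" for t by (rule DERIV_imp_deriv[OF der])
  qed
 qed
qed

lemma test_function_diff:
 assumes "\<kappa> : test_functions a b" "\<psi> : test_functions a b"
 shows "(%t. \<kappa> t - k * \<psi> t) : test_functions a b"
proof -
 from assms obtain c d c' d' where "smooth \<kappa>" "a < c" "d < b" "!!t. t \<notin> {c..d} ==> \<kappa> t = 0"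
  "smooth \<psi>" "a < c'" "d' < b" "!!t. t \<notin> {c'..d'} ==> \<psi> t = 0"
  by (auto simp: test_functions_def)
 note h = this
 have "smooth (%t. \<kappa> t + (- k) * \<psi> t)" by (intro smooth_add smooth_mult smooth_const h)
 then have "smooth (%t. \<kappa> t - k * \<psi> t)" by simp
 then show ?thesis
 proof (rule test_functionsI[of _ _ "min c c'" "max d d'"])
  fix t assume "t \<notin> {min c c'..max d d'}"
  then have "t \<notin> {c..d}" "t \<notin> {c'..d'}" by auto
  then show "\<kappa> t - k * \<psi> t = 0" using h(4,8) by simp
 qed (use h in auto)
qed

lemma test_function_bounded:
 assumes "\<theta> : test_functions a b" obtains B where "!!t. \<bar>\<theta> t\<bar> <= B"
proof -
 from assms obtain c d where sm: "smooth \<theta>" and z: "!!t. t \<notin> {c..d} ==> \<theta> t = 0"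
  by (auto simp: test_functions_def)
 have "bounded (\<theta> ` {c..d})"
  by (intro compact_imp_bounded compact_continuous_image smooth_continuous sm compact_Icc)
 then obtain B where "\<forall>y\<in>\<theta> ` {c..d}. norm y <= B" unfolding bounded_iff by blast
 then have "!!t. t : {c..d} ==> \<bar>\<theta> t\<bar> <= B" by simp
 then have "\<bar>\<theta> t\<bar> <= max B 0" for t using z[of t] by (cases "t : {c..d}") (auto simp: le_max_iff_disj)
 then show thesis by (rule that)
qed

text \<open>Subtracting a multiple of a fixed test function \<open>\<psi>\<close> of nonzero mean
  turns any test function into a derivative of one. The constant is accordingly the
  \<open>\<psi>\<close>-weighted mean of \<open>p\<close>.\<close>

theorem du_bois_reymond:
 fixes p :: "real => real"
 assumes ab: "a < b" and p: "integrable (lebesgue_on {a<..<b}) p"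
  and z: "!!\<theta>. \<theta> : test_functions a b ==> (LINT t|lebesgue_on {a<..<b}. deriv \<theta> t * p t) = 0"
 obtains c where "AE t in lebesgue_on {a<..<b}. p t = c"
proof -
 let ?M = "lebesgue_on {a<..<b}"
 have fin: "finite_measure ?M" by (rule finite_measure_lebesgue_on) simp
 have i: "integrable ?M (%t. \<kappa> t * q t)" if \<kappa>: "\<kappa> : test_functions a b" and q: "integrable ?M q" for \<kappa> q
 proof -
  obtain B where "!!t. \<bar>\<kappa> t\<bar> <= B" using test_function_bounded[OF \<kappa>] by blast
  then show ?thesis using \<kappa> by (intro integrable_test_mult[OF q] smooth_measurable_lebesgue) (auto simp: test_functions_def)
 qed
 have i1: "integrable ?M \<kappa>" if "\<kappa> : test_functions a b" for \<kappa>
  using i[OF that, of "%_. 1"] finite_measure.integrable_const[OF fin] by auto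
 obtain \<kappa>0 :: "nat => real => real" where \<kappa>0: "!!n. \<kappa>0 n : test_functions a b" "!!n x. \<kappa>0 n x : {0..1}"
   "!!x. (%n. \<kappa>0 n x) ~~> indicat_real {a<..<b} x"
  using smooth_indicator_approx[of a a b] ab by blast
 have "EX n. (LINT t|?M. \<kappa>0 n t) ~= 0"
 proof (rule ccontr)
  assume no: "~ (EX n. (LINT t|?M. \<kappa>0 n t) ~= 0)"
  have "(%n. LINT t|?M. \<kappa>0 n t) ~~> (LINT t|?M. 1)"
  proof (rule integral_dominated_convergence[where w="%_. 1"])
   show "AE t in ?M. (%n. \<kappa>0 n t) ~~> 1"
    using \<kappa>0(3) by (intro AE_I2) (metis indicator_simps(1) space_lebesgue_on)
  qed (use \<kappa>0 i1 finite_measure.integrable_const[OF fin] in auto)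
  then have "(LINT t|?M. 1) = (0::real)" using no LIMSEQ_unique[OF tendsto_const] by fastforce
  moreover have "(LINT t|?M. 1) = b - a" using ab by (subst LINT_Ioo) simp
  ultimately show False using ab by simp
 qed
 then obtain n0 where n0: "(LINT t|?M. \<kappa>0 n0 t) ~= 0" by blast
 define \<psi> where "\<psi> = \<kappa>0 n0"
 have \<psi>: "\<psi> : test_functions a b" "(LINT t|?M. \<psi> t) ~= 0" using \<kappa>0 n0 by (auto simp: \<psi>_def)
 define c where "c = (LINT t|?M. \<psi> t * p t) / (LINT t|?M. \<psi> t)"
 have "AE t in ?M. p t - c = 0"
 proof (rule AE_zero_if_test_integrals_zero[OF ab])
  show "integrable ?M (%t. p t - c)"
   by (rule b_integrable_diff[OF p finite_measure.integrable_const[OF fin]])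
  fix \<kappa> assume \<kappa>: "\<kappa> : test_functions a b"
  define k where "k = (LINT t|?M. \<kappa> t) / (LINT t|?M. \<psi> t)"
  have "(LINT t|?M. \<kappa> t - k * \<psi> t) = 0"
   using i1[OF \<kappa>] i1[OF \<psi>(1)] \<psi>(2) by (simp add: k_def)
  then obtain \<theta> where \<theta>: "\<theta> : test_functions a b" "!!t. deriv \<theta> t = \<kappa> t - k * \<psi> t"
   using test_function_antiderivative[OF test_function_diff[OF \<kappa> \<psi>(1)]] by blast
  have "0 = (LINT t|?M. \<kappa> t * p t - k * (\<psi> t * p t))"
   using z[OF \<theta>(1)] by (simp add: \<theta>(2) algebra_simps)
  also have "... = (LINT t|?M. \<kappa> t * p t) - k * (LINT t|?M. \<psi> t * p t)"
   using i[OF \<kappa> p] i[OF \<psi>(1) p] by simp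
  finally have "(LINT t|?M. \<kappa> t * p t) = c * (LINT t|?M. \<kappa> t)" by (simp add: k_def c_def)
  moreover have "(LINT t|?M. \<kappa> t * (p t - c)) = (LINT t|?M. \<kappa> t * p t) - c * (LINT t|?M. \<kappa> t)"
   using i[OF \<kappa> p] i1[OF \<kappa>] by (simp add: right_diff_distrib mult.commute[of _ c])
  ultimately show "(LINT t|?M. \<kappa> t * (p t - c)) = 0" by simp
 qed
 then show thesis using that[of c] by auto
qed

section \<open>The adjoint state\<close>

lemma smooth_real_deriv:
 fixes \<theta> :: "real => real"
 assumes "smooth \<theta>"
 shows "(\<theta> has_real_derivative deriv \<theta> x) (at x)" "smooth (deriv \<theta>)"
proof -
 have d: "(\<theta> has_real_derivative fd \<theta> x 1) (at x)" for x
  using smooth_line_derivative[OF assms, of 0 1 x]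
  by (simp add: has_real_derivative_iff_has_vector_derivative)
 then have e: "deriv \<theta> = (%x. fd \<theta> x 1)" using DERIV_imp_deriv by blast
 show "(\<theta> has_real_derivative deriv \<theta> x) (at x)" using d by (simp add: e)
 show "smooth (deriv \<theta>)" unfolding e by (rule smooth_fd[OF assms])
qed

text \<open>The vector measure with density \<open>w\<close> with respect to \<open>\<nu>\<close>.
  It covers alike the absolutely continuous part of the adjoint equation (Lebesgue measure) and the
  parts carried by the components of the multiplier measure; \<open>cumulative\<close> is its
  distribution function.\<close>

locale time_measure =
 fixes \<nu> :: "real measure" and w :: "real => 'b::euclidean_space"
 assumes sf: "sigma_finite_measure \<nu>"
  and id: "(%s. s) : borel_measurable \<nu>" and w: "integrable \<nu> w"
begin

definition cumulative :: "real => 'b" where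
 "cumulative t = (LINT s|\<nu>. indicat_real {s..} t *R w s)"

lemma cumulative_bound: "norm (cumulative t) <= (LINT s|\<nu>. norm (w s))"
proof -
 have "norm (cumulative t) <= (LINT s|\<nu>. norm (indicat_real {s..} t *R w s))"
  unfolding cumulative_def by (rule integral_norm_bound)
 also have "... <= (LINT s|\<nu>. norm (w s))"
  by (rule integral_mono') (use w in \<open>auto simp: indicator_def\<close>)
 finally show ?thesis .
qed

lemma kernel_measurable_prod:
 assumes h: "h : borel_measurable \<mu>" and idm: "(%t. t) : borel_measurable \<mu>"
 shows "(%(s, t). indicat_real {s..} t *R (h t *R w s)) : borel_measurable (\<nu> \<Otimes>\<^sub>M \<mu>)"
proof -
 have [measurable]: "fst : borel_measurable (\<nu> \<Otimes>\<^sub>M \<mu>)" "snd : borel_measurable (\<nu> \<Otimes>\<^sub>M \<mu>)"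
  "(%q. h (snd q)) : borel_measurable (\<nu> \<Otimes>\<^sub>M \<mu>)" "(%q. w (fst q)) : borel_measurable (\<nu> \<Otimes>\<^sub>M \<mu>)"
  using measurable_comp[OF measurable_fst id] measurable_comp[OF measurable_snd idm]
   measurable_comp[OF measurable_snd h] measurable_comp[OF measurable_fst borel_measurable_integrable[OF w]]
  by (simp_all add: o_def)
 have "(%q. (if fst q <= snd q then 1 else 0) *R (h (snd q) *R w (fst q))) : borel_measurable (\<nu> \<Otimes>\<^sub>M \<mu>)"
  by measurable
 moreover have "(%(s, t). indicat_real {s..} t *R (h t *R w s)) =
   (%q. (if fst q <= snd q then 1 else 0) *R (h (snd q) *R w (fst q)))"
  by (rule ext) (simp add: indicator_def split: prod.split)
 ultimately show ?thesis by (simp only:)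
qed

lemma cumulative_swap:
 assumes \<mu>: "sigma_finite_measure \<mu>" "(%t. t) : borel_measurable \<mu>"
  and h: "integrable \<mu> (h :: real => real)"
 shows "(LINT t|\<mu>. h t *R cumulative t) = (LINT s|\<nu>. (LINT t|\<mu>. indicat_real {s..} t * h t) *R w s)"
  "integrable \<mu> (%t. h t *R cumulative t)"
proof -
 have nw: "integrable \<nu> (%s. norm (w s))" and nh: "integrable \<mu> (%t. norm (h t))" using w h by auto
 have bd: "AE s in \<nu>. AE t in \<mu>. norm (indicat_real {s..} t *R (h t *R w s)) <= norm (w s) * norm (h t)"
  by (auto simp: indicator_def)
 note fs = fubini_swap[OF sf \<mu>(1) kernel_measurable_prod[OF borel_measurable_integrable[OF h] \<mu>(2)] nw nh bd]
 have 1: "(LINT s|\<nu>. indicat_real {s..} t *R (h t *R w s)) = h t *R cumulative t" for t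
  unfolding cumulative_def by (subst integral_scaleR_right[symmetric]) (simp add: mult.commute)
 have 2: "(LINT t|\<mu>. indicat_real {s..} t *R (h t *R w s)) = (LINT t|\<mu>. indicat_real {s..} t * h t) *R w s" for s
 proof -
  have "integrable \<mu> (%t. indicat_real {s..} t * h t)"
  proof (rule integrable_indicator_mult[OF h, simplified])
   have "{s..} : sets borel" by simp
   from measurable_comp[OF \<mu>(2) borel_measurable_indicator[OF this]]
   show "indicat_real {s..} : borel_measurable \<mu>" by (simp add: o_def)
  qed
  then show ?thesis by (subst integral_scaleR_left[symmetric]) auto
 qed
 show "(LINT t|\<mu>. h t *R cumulative t) = (LINT s|\<nu>. (LINT t|\<mu>. indicat_real {s..} t * h t) *R w s)"
  using fs(1) unfolding 1 2 by simp
 show "integrable \<mu> (%t. h t *R cumulative t)" using fs(3) unfolding 1 .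
qed

lemma measurable_id_Ioo: "(%t. t) : borel_measurable (lebesgue_on {a<..<b::real})"
 using id_borel_measurable_lebesgue_on[of "{a<..<b}"] by (simp add: id_def)

lemma finite_measure_Ioo: "finite_measure (lebesgue_on {a<..<b::real})"
 by (rule finite_measure_lebesgue_on) simp

lemma integrable_cumulative: "integrable (lebesgue_on {lo<..<hi}) cumulative"
proof -
 have one: "integrable (lebesgue_on {lo<..<hi}) (%_. 1 :: real)"
  by (rule finite_measure.integrable_const[OF finite_measure_Ioo])
 show ?thesis
  using cumulative_swap(2)[OF finite_measure.axioms(1)[OF finite_measure_Ioo] measurable_id_Ioo one] by simp
qed

text \<open>This makes \<open>cumulative\<close> a primitive of the measure in the sense of
  distributions: by Fubini, the integral of \<open>deriv \<theta>\<close> from \<open>s\<close> to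
  the right end is \<open>- \<theta> s\<close>, since \<open>\<theta>\<close> vanishes
  there.\<close>

lemma cumulative_distr:
 assumes "\<theta> : test_functions lo hi" and space: "space \<nu> <= {lo<..<hi}"
 shows "(LINT s|\<nu>. \<theta> s *R w s) = - (LINT t|lebesgue_on {lo<..<hi}. deriv \<theta> t *R cumulative t)"
  "integrable (lebesgue_on {lo<..<hi}) (%t. deriv \<theta> t *R cumulative t)"
proof -
 from assms obtain c d where sm: "smooth \<theta>" and cd: "d < hi" "!!t. t \<notin> {c..d} ==> \<theta> t = 0"
  by (auto simp: test_functions_def)
 have id: "integrable (lebesgue_on {lo<..<hi}) (deriv \<theta>)"
 proof -
  have "integrable (lebesgue_on {lo..hi}) (deriv \<theta>)"
   by (intro continuous_imp_integrable_real smooth_continuous smooth_real_deriv sm)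
  then have "integrable lebesgue (%t. indicat_real {lo..hi} t * deriv \<theta> t)"
   by (subst (asm) integrable_restrict_space) auto
  from integrable_indicator_mult[OF this, of "{lo<..<hi}"]
  have "integrable lebesgue (%t. indicat_real {lo<..<hi} t * (indicat_real {lo..hi} t * deriv \<theta> t))"
   by (simp add: borel_measurable_indicator)
  also have "(%t. indicat_real {lo<..<hi} t * (indicat_real {lo..hi} t * deriv \<theta> t)) =
    (%t. indicat_real {lo<..<hi} t * deriv \<theta> t)" by (auto simp: indicator_def)
  finally show ?thesis by (simp add: integrable_Ioo_iff)
 qed
 note sw = cumulative_swap[OF finite_measure.axioms(1)[OF finite_measure_Ioo] measurable_id_Ioo id]
 have *: "(LINT t|lebesgue_on {lo<..<hi}. indicat_real {s..} t * deriv \<theta> t) = - \<theta> s" if "s : {lo<..<hi}" for s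
 proof -
  have i: "integrable (lebesgue_on {s..hi}) (deriv \<theta>)"
   by (intro continuous_imp_integrable_real smooth_continuous smooth_real_deriv sm)
  have ne: "AE t in lebesgue. t ~= hi" by (rule AE_completion[OF AE_lborel_singleton])
  have m: "deriv \<theta> : borel_measurable lebesgue"
   using smooth_measurable_lebesgue[OF smooth_real_deriv(2)[OF sm], of UNIV] by (simp add: lebesgue_on_UNIV_eq)
  have mi: "A : sets borel ==> indicat_real A : borel_measurable lebesgue" for A
   by (rule measurable_completion) simp
  have "(LINT t|lebesgue_on {lo<..<hi}. indicat_real {s..} t * deriv \<theta> t) =
    (LINT t|lebesgue. indicat_real {lo<..<hi} t * (indicat_real {s..} t * deriv \<theta> t))" by (rule LINT_Ioo)
  also have "... = (LINT t|lebesgue. indicat_real {s..hi} t *R deriv \<theta> t)"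
  proof (rule integral_cong_AE)
   show "AE t in lebesgue. indicat_real {lo<..<hi} t * (indicat_real {s..} t * deriv \<theta> t) = indicat_real {s..hi} t *R deriv \<theta> t"
    using ne by eventually_elim (use that in \<open>auto simp: indicator_def\<close>)
  qed (auto intro!: borel_measurable_times borel_measurable_scaleR mi m)
  also have "... = (LINT t|lebesgue_on {s..hi}. deriv \<theta> t)"
   by (rule integral_restrict_space[symmetric]) simp
  also have "... = integral {s..hi} (deriv \<theta>)" by (rule lebesgue_integral_eq_integral[OF i]) simp
  also have "... = \<theta> hi - \<theta> s"
   using that by (intro integral_unique fundamental_theorem_of_calculus)
    (auto simp: has_real_derivative_iff_has_vector_derivative[symmetric]
    intro: has_field_derivative_at_within smooth_real_deriv sm)
  also have "\<theta> hi = 0" using cd by auto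
  finally show ?thesis by simp
 qed
 have "(LINT s|\<nu>. (LINT t|lebesgue_on {lo<..<hi}. indicat_real {s..} t * deriv \<theta> t) *R w s) = (LINT s|\<nu>. - (\<theta> s *R w s))"
  by (rule b_integral_cong) (use * space in auto)
 then show "(LINT s|\<nu>. \<theta> s *R w s) = - (LINT t|lebesgue_on {lo<..<hi}. deriv \<theta> t *R cumulative t)"
  using sw(1) by simp
 show "integrable (lebesgue_on {lo<..<hi}) (%t. deriv \<theta> t *R cumulative t)" by (rule sw(2))
qed

end

locale time_measure_Icc = time_measure +
 fixes T :: real
 assumes T: "T > 0" and space: "space \<nu> = {0..T}"
begin

lemma cumulative_before: "t < 0 ==> cumulative t = 0"
 unfolding cumulative_def by (subst b_integral_cong[of \<nu> \<nu> _ "%_. 0"]) (auto simp: space)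

lemma cumulative_after: "t >= T ==> cumulative t = integral\<^sup>L \<nu> w"
 unfolding cumulative_def by (rule b_integral_cong) (auto simp: space)

text \<open>Fubini on the region \<open>s \<le> t\<close>, where the inner integral of
  \<open>om\<close> is \<open>\<delta> T - \<delta> s\<close>. Atoms of \<open>\<nu>\<close> cause
  no ambiguity: \<open>\<delta>\<close> is evaluated pointwise, and a single time is a Lebesgue null
  set.\<close>

lemma cumulative_by_parts:
 assumes om: "integrable (leb T) om"
  and \<delta>: "!!t. t : {0..T} ==> \<delta> t = \<delta> 0 + (LINT s|leb t. om s)"
 shows "(LINT t|leb T. cumulative t \<bullet> om t) = integral\<^sup>L \<nu> w \<bullet> \<delta> T - (LINT s|\<nu>. w s \<bullet> \<delta> s)"
  "integrable (leb T) (%t. cumulative t \<bullet> om t)" "integrable \<nu> (%s. w s \<bullet> \<delta> s)"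
proof -
 let ?M = "leb T"
 define F where "F s t = indicat_real {s..} t *R (w s \<bullet> om t)" for s t
 have nw: "integrable \<nu> (%s. norm (w s))" and no: "integrable ?M (%t. norm (om t))" using w om by auto
 have bd: "AE s in \<nu>. AE t in ?M. norm (F s t) <= norm (w s) * norm (om t)"
  by (auto simp: indicator_def F_def intro: order.trans[OF Cauchy_Schwarz_ineq2])
 have Fm: "case_prod F : borel_measurable (\<nu> \<Otimes>\<^sub>M ?M)"
 proof -
  have [measurable]: "fst : borel_measurable (\<nu> \<Otimes>\<^sub>M ?M)" "snd : borel_measurable (\<nu> \<Otimes>\<^sub>M ?M)"
   "(%q. om (snd q)) : borel_measurable (\<nu> \<Otimes>\<^sub>M ?M)" "(%q. w (fst q)) : borel_measurable (\<nu> \<Otimes>\<^sub>M ?M)"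
   using measurable_comp[OF measurable_fst id] measurable_comp[OF measurable_snd measurable_id_Icc]
    measurable_comp[OF measurable_snd borel_measurable_integrable[OF om]] measurable_comp[OF measurable_fst borel_measurable_integrable[OF w]]
   by (simp_all add: o_def)
  have "(%q. (if fst q <= snd q then 1 else 0) *R (w (fst q) \<bullet> om (snd q))) : borel_measurable (\<nu> \<Otimes>\<^sub>M ?M)"
   by measurable
  moreover have "case_prod F = (%q. (if fst q <= snd q then 1 else 0) *R (w (fst q) \<bullet> om (snd q)))"
   by (rule ext) (simp add: F_def indicator_def split: prod.split)
  ultimately show ?thesis by (simp only:)
 qed
 note fs = fubini_swap[OF sf sigma_finite_Icc Fm nw no bd]
 have Fs: "(LINT t|?M. F s t) = w s \<bullet> \<delta> T - w s \<bullet> \<delta> s" if s: "s : {0..T}" for s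
 proof -
  have i: "integrable ?M (%t. indicat_real {s..} t *R om t)"
   by (rule integrable_indicator_mult[OF om]) simp
  have "(LINT t|?M. F s t) = w s \<bullet> (LINT t|?M. indicat_real {s..} t *R om t)"
   unfolding F_def by (subst integral_inner_right[symmetric]) (use i in auto)
  also have "(LINT t|?M. indicat_real {s..} t *R om t) = (LINT t|?M. indicat_real {s<..T} t *R om t)"
  proof (rule integral_cong_AE)
   show "AE t in ?M. indicat_real {s..} t *R om t = indicat_real {s<..T} t *R om t"
    using AE_neq_lebesgue_on[where T=T and t=s] AE_space by eventually_elim (auto simp: indicator_def)
   show "(%t. indicat_real {s<..T} t *R om t) : borel_measurable ?M"
    by (rule borel_measurable_integrable[OF integrable_indicator_mult[OF om]]) simp
  qed (use i in auto)
  also have "... = (LINT t|leb T. om t) - (LINT t|leb s. om t)"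
   using s by (intro LINT_increment[symmetric] om) auto
  also have "... = \<delta> T - \<delta> s" using \<delta>[OF s] \<delta>[of T] T by simp
  finally show ?thesis by (simp add: inner_diff_right)
 qed
 have Ft: "(LINT s|\<nu>. F s t) = cumulative t \<bullet> om t" for t
 proof -
  have i: "integrable \<nu> (%s. indicat_real {s..} t *R w s)"
  proof (rule b_integrable_bound[OF w])
   have "indicat_real {..t} : borel_measurable \<nu>"
    using measurable_comp[OF id, of "indicat_real {..t}" borel] by (simp add: o_def)
   then have "(%s. indicat_real {..t} s *R w s) : borel_measurable \<nu>"
    by (rule borel_measurable_scaleR[OF _ borel_measurable_integrable[OF w]])
   moreover have "(%s. indicat_real {..t} s *R w s) = (%s. indicat_real {s..} t *R w s)" by (auto simp: indicator_def)
   ultimately show "(%s. indicat_real {s..} t *R w s) : borel_measurable \<nu>" by simp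
  qed (auto simp: indicator_def)
  show ?thesis unfolding cumulative_def F_def
   by (subst integral_inner_left[symmetric]) (use i in auto)
 qed
 show "integrable ?M (%t. cumulative t \<bullet> om t)" using fs(3) unfolding Ft .
 have i3: "integrable \<nu> (%s. w s \<bullet> \<delta> T - w s \<bullet> \<delta> s)"
  using fs(2) by (rule b_integrable_cong[THEN iffD1, rotated -1]) (auto simp: Fs space)
 have i4: "integrable \<nu> (%s. w s \<bullet> \<delta> T)" using w by simp
 from b_integrable_diff[OF i4 i3] show i5: "integrable \<nu> (%s. w s \<bullet> \<delta> s)" by simp
 have "(LINT t|?M. cumulative t \<bullet> om t) = (LINT s|\<nu>. LINT t|?M. F s t)" using fs(1) unfolding Ft by simp
 also have "... = (LINT s|\<nu>. w s \<bullet> \<delta> T - w s \<bullet> \<delta> s)"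
  by (rule b_integral_cong) (auto simp: Fs space)
 also have "... = integral\<^sup>L \<nu> w \<bullet> \<delta> T - (LINT s|\<nu>. w s \<bullet> \<delta> s)"
  using i4 i5 w by simp
 finally show "(LINT t|?M. cumulative t \<bullet> om t) = integral\<^sup>L \<nu> w \<bullet> \<delta> T - (LINT s|\<nu>. w s \<bullet> \<delta> s)" .
qed

end

lemma AE_const_Ioo:
 assumes "a < (b::real)" "AE t in lebesgue_on {a<..<b}. P" shows P
proof (rule ccontr)
 assume "~ P"
 then have "AE t in lebesgue_on {a<..<b}. False" using assms(2) by simp
 then have "emeasure (lebesgue_on {a<..<b}) (space (lebesgue_on {a<..<b})) = 0"
  unfolding ae_filter_eq_bot_iff[symmetric] by (simp add: eventually_False)
 then show False using assms(1) by (simp add: emeasure_restrict_space)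
qed

lemma AE_Ioo_subset:
 "AE t in lebesgue_on {a<..<b::real}. P t ==> a <= c ==> d <= b ==> AE t in lebesgue_on {c<..<d}. P t"
 by (subst (asm) AE_restrict_space_iff, simp, subst AE_restrict_space_iff, simp)
  (auto elim!: eventually_mono)

text \<open>The adjoint equation is given only in the sense of distributions. Adding the
  distribution functions of all parts of its right-hand side to \<open>p\<close> leaves a function
  with zero distributional derivative, hence a constant. So \<open>p\<close> equals a constant minus
  a bounded function almost everywhere; its outer values are that constant and the constant minus
  the total mass \<open>e\<close>, and integration by parts reduces to the distribution
  functions.\<close>

theorem adjoint_by_parts:
 fixes p q :: "real => real ^ 'n" and \<gamma> :: "nat => real => real ^ 'n"
 assumes T: "T > 0" and p: "integrable (lebesgue_on {-1<..<T + 1}) p"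
  and q: "integrable (leb T) q"
  and \<eta>: "!!i. i < N ==> finite_measure_on T (\<eta> i)"
  and \<gamma>: "!!i. i < N ==> integrable (\<eta> i) (\<gamma> i)"
  and dp: "has_distr_deriv T p (%\<theta>. - ((LINT t|leb T. \<theta> t *R q t) + (\<Sum>i<N. LINT t|\<eta> i. \<theta> t *R \<gamma> i t)))"
 shows "EX B. AE t in leb T. norm (p t) <= B"
  "p : borel_measurable (leb T)"
  "!!\<delta> om. integrable (leb T) om ==>
   (!!t. t : {0..T} ==> \<delta> t = \<delta> 0 + (LINT s|leb t. om s)) ==>
   (LINT t|leb T. p t \<bullet> om t) = right_val T p \<bullet> \<delta> T - left_val p \<bullet> \<delta> 0 +
    (LINT t|leb T. q t \<bullet> \<delta> t) + (\<Sum>i<N. LINT t|\<eta> i. \<gamma> i t \<bullet> \<delta> t)"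
proof -
 let ?M = "leb T" and ?I = "lebesgue_on {-1<..<T + 1}"
 interpret Q: time_measure_Icc ?M q T
  by unfold_locales (use T q sigma_finite_Icc in \<open>auto simp: sigma_finite_measure_def\<close>)
 have tmi: "time_measure_Icc (\<eta> i) (\<gamma> i) T" if "i < N" for i
 proof
  from \<eta>[OF that] have f: "finite_measure (\<eta> i)" and s: "sets (\<eta> i) = sets (restrict_space borel {0..T})"
   by (auto simp: finite_measure_on_def)
  from sets_eq_imp_space_eq[OF s] show sp: "space (\<eta> i) = {0..T}" by (simp add: space_restrict_space)
  show "EX A. countable A & A <= sets (\<eta> i) & \<Union> A = space (\<eta> i) & (\<forall>a\<in>A. emeasure (\<eta> i) a ~= \<infinity>)"
   using finite_measure.axioms(1)[OF f] by (simp add: sigma_finite_measure_def)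
  show "(%s. s) : borel_measurable (\<eta> i)"
   by (subst measurable_cong_sets[OF s refl]) (rule measurable_restrict_space1, simp)
 qed (use T \<gamma>[OF that] in auto)
 note tm = time_measure_Icc.axioms(1)[OF tmi]
 define m where "m i = time_measure.cumulative (\<eta> i) (\<gamma> i)" for i
 define mm where "mm t = Q.cumulative t + (\<Sum>i<N. m i t)" for t
 have m_int: "integrable ?I (m i)" if "i < N" for i
  unfolding m_def by (rule time_measure.integrable_cumulative[OF tm[OF that]])
 have mm_int: "integrable ?I mm" unfolding mm_def
  by (intro b_integrable_add b_integrable_sum Q.integrable_cumulative m_int) simp
 have zero: "(LINT t|?I. deriv \<theta> t *R (p t + mm t)) = 0" and ip: "integrable ?I (%t. deriv \<theta> t *R (p t + mm t))"
  if \<theta>: "\<theta> : test_functions (-1) (T + 1)" for \<theta>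
 proof -
  have sm: "smooth (deriv \<theta>)" using \<theta> by (auto simp: test_functions_def intro: smooth_real_deriv)
  have "bounded (deriv \<theta> ` {-1..T+1})"
   by (intro compact_imp_bounded compact_continuous_image smooth_continuous sm compact_Icc)
  then obtain B where "\<forall>y\<in>deriv \<theta> ` {-1..T+1}. norm y <= B" unfolding bounded_iff by blast
  then have B: "!!t. t : {-1..T+1} ==> \<bar>deriv \<theta> t\<bar> <= B" by simp
  have bi: "integrable ?I (%t. deriv \<theta> t *R f t)" if f: "integrable ?I f" for f :: "real => real ^ 'n"
  proof (rule b_integrable_bound[OF integrable_scaleR_right[of B, OF f]])
   show "(%t. deriv \<theta> t *R f t) : borel_measurable ?I"
    by (intro borel_measurable_scaleR smooth_measurable_lebesgue sm borel_measurable_integrable f)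
   show "AE t in ?I. norm (deriv \<theta> t *R f t) <= norm (B *R f t)"
    using B by (intro AE_I2) (auto intro!: mult_right_mono order.trans[OF B abs_ge_self])
  qed
  have spQ: "space ?M <= {-1<..<T + 1}" by auto
  have s: "(\<Sum>i<N. LINT t|\<eta> i. \<theta> t *R \<gamma> i t) = (\<Sum>i<N. - (LINT t|?I. deriv \<theta> t *R m i t))"
   unfolding m_def by (intro sum.cong refl time_measure.cumulative_distr(1)[OF tm \<theta>])
    (auto simp: time_measure_Icc.space[OF tmi])
  have "(LINT t|?I. deriv \<theta> t *R p t) = (LINT t|?M. \<theta> t *R q t) + (\<Sum>i<N. LINT t|\<eta> i. \<theta> t *R \<gamma> i t)"
   using dp \<theta> unfolding has_distr_deriv_def by (simp only: neg_equal_iff_equal)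
  also have "... = - ((LINT t|?I. deriv \<theta> t *R Q.cumulative t) + (\<Sum>i<N. LINT t|?I. deriv \<theta> t *R m i t))"
   unfolding Q.cumulative_distr(1)[OF \<theta> spQ] s by (simp add: sum_negf)
  also have "... = - (LINT t|?I. deriv \<theta> t *R mm t)"
   unfolding mm_def scaleR_add_right scaleR_sum_right
   using bi[OF Q.integrable_cumulative] bi[OF m_int]
   by (subst b_integral_add) (auto intro!: b_integrable_sum)
  finally show "(LINT t|?I. deriv \<theta> t *R (p t + mm t)) = 0"
   unfolding scaleR_add_right using bi[OF p] bi[OF mm_int] by simp
  show "integrable ?I (%t. deriv \<theta> t *R (p t + mm t))"
   using p mm_int by (intro bi) auto
 qed
 have "EX c. AE t in ?I. (p t + mm t) \<bullet> b = c" for b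
 proof -
  have "(LINT t|?I. deriv \<theta> t * ((p t + mm t) \<bullet> b)) = 0" if \<theta>: "\<theta> : test_functions (-1) (T + 1)" for \<theta>
  proof -
   have "(LINT t|?I. deriv \<theta> t * ((p t + mm t) \<bullet> b)) = (LINT t|?I. deriv \<theta> t *R (p t + mm t)) \<bullet> b"
    by (subst integral_inner_left[symmetric]) (use ip[OF \<theta>] in auto)
   then show ?thesis using zero[OF \<theta>] by simp
  qed
  moreover have "integrable ?I (%t. (p t + mm t) \<bullet> b)" using p mm_int by simp
  moreover have "-1 < T + 1" using T by simp
  ultimately show ?thesis using du_bois_reymond[of "-1" "T + 1" "%t. (p t + mm t) \<bullet> b"] by blast
 qed
 then obtain cb where cb: "!!b. AE t in ?I. (p t + mm t) \<bullet> b = cb b" by metis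
 define c where "c = (\<Sum>b\<in>Basis. cb b *R b)"
 have "AE t in ?I. \<forall>b\<in>Basis. (p t + mm t) \<bullet> b = cb b" using cb by (intro AE_finite_allI) auto
 then have rep: "AE t in ?I. p t = c - mm t"
 proof eventually_elim
  case (elim t)
  have "p t + mm t = c" unfolding c_def using elim
   by (subst euclidean_representation[symmetric, of "p t + mm t"]) simp
  then show ?case by (simp add: algebra_simps)
 qed
 have mm0: "mm t = 0" if "t < 0" for t
  using that Q.cumulative_before time_measure_Icc.cumulative_before[OF tmi] by (simp add: mm_def m_def)
 define e where "e = integral\<^sup>L ?M q + (\<Sum>i<N. integral\<^sup>L (\<eta> i) (\<gamma> i))"
 have mmT: "mm t = e" if "t >= T" for t
  using that Q.cumulative_after time_measure_Icc.cumulative_after[OF tmi] by (simp add: mm_def m_def e_def)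
 have lv: "left_val p = c" unfolding left_val_def
 proof (rule the_equality)
  have "AE t in lebesgue_on {-1<..<0}. t < (0::real)" using AE_space[of "lebesgue_on {-1<..<0::real}"] by simp
  with AE_Ioo_subset[OF rep, of "-1" 0] show *: "AE t in lebesgue_on {-1<..<0}. p t = c"
   using T by (auto simp: mm0 elim: eventually_elim2)
  fix c' assume "AE t in lebesgue_on {-1<..<0}. p t = c'"
  with * have "AE t in lebesgue_on {-1<..<0::real}. c' = c" by eventually_elim simp
  then show "c' = c" by (rule AE_const_Ioo[rotated]) simp
 qed
 have rv: "right_val T p = c - e" unfolding right_val_def
 proof (rule the_equality)
  have "AE t in lebesgue_on {T<..<T + 1}. T < t" using AE_space[of "lebesgue_on {T<..<T + 1}"] by simp
  with AE_Ioo_subset[OF rep, of T "T + 1"] show *: "AE t in lebesgue_on {T<..<T + 1}. p t = c - e"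
   using T by (auto simp: mmT elim: eventually_elim2)
  fix c' assume "AE t in lebesgue_on {T<..<T + 1}. p t = c'"
  with * have "AE t in lebesgue_on {T<..<T + 1}. c' = c - e" by eventually_elim simp
  then show "c' = c - e" by (rule AE_const_Ioo[rotated]) simp
 qed
 have repM: "AE t in ?M. p t = c - mm t"
  using rep T by (subst (asm) AE_restrict_space_iff, simp, subst AE_restrict_space_iff, simp)
   (auto elim!: eventually_mono)
 have "norm (c - mm t) <= norm c + ((LINT s|?M. norm (q s)) + (\<Sum>i<N. LINT s|\<eta> i. norm (\<gamma> i s)))" for t
 proof -
  have "norm (m i t) <= (LINT s|\<eta> i. norm (\<gamma> i s))" if "i < N" for i
   unfolding m_def by (rule time_measure.cumulative_bound[OF tm[OF that]])
  then have "norm (\<Sum>i<N. m i t) <= (\<Sum>i<N. LINT s|\<eta> i. norm (\<gamma> i s))" by (intro sum_norm_le) simp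
  then have "norm (mm t) <= (LINT s|?M. norm (q s)) + (\<Sum>i<N. LINT s|\<eta> i. norm (\<gamma> i s))"
   unfolding mm_def using Q.cumulative_bound[of t] by (intro order.trans[OF norm_triangle_ineq] add_mono)
  then show ?thesis by (intro order.trans[OF norm_triangle_ineq4] add_left_mono)
 qed
 note bnd = this
 show "EX B. AE t in ?M. norm (p t) <= B"
 proof (rule exI)
  show "AE t in ?M. norm (p t) <= norm c + ((LINT s|?M. norm (q s)) + (\<Sum>i<N. LINT s|\<eta> i. norm (\<gamma> i s)))"
   using repM by eventually_elim (simp only: bnd)
 qed
 show pm: "p : borel_measurable ?M"
  by (rule measurable_restrict_mono[OF borel_measurable_integrable[OF p]]) (use T in auto)
 have mmM: "mm : borel_measurable ?M"
  by (rule measurable_restrict_mono[OF borel_measurable_integrable[OF mm_int]]) (use T in auto)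
 fix \<delta> om :: "real => real ^ 'n" assume om: "integrable ?M om"
  and \<delta>: "!!t. t : {0..T} ==> \<delta> t = \<delta> 0 + (LINT s|leb t. om s)"
 note bq = Q.cumulative_by_parts[OF om \<delta>] and bm = time_measure_Icc.cumulative_by_parts[OF tmi om \<delta>, folded m_def]
 have "(LINT t|?M. p t \<bullet> om t) = (LINT t|?M. c \<bullet> om t - (Q.cumulative t \<bullet> om t + (\<Sum>i<N. m i t \<bullet> om t)))"
 proof (rule integral_cong_AE)
  show "AE t in ?M. p t \<bullet> om t = c \<bullet> om t - (Q.cumulative t \<bullet> om t + (\<Sum>i<N. m i t \<bullet> om t))"
   using repM by eventually_elim (simp add: mm_def inner_diff_left inner_add_left inner_sum_left)
  show "(%t. c \<bullet> om t - (Q.cumulative t \<bullet> om t + (\<Sum>i<N. m i t \<bullet> om t))) : borel_measurable ?M"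
   using om bq(2) bm(2) by (intro borel_measurable_integrable b_integrable_diff
    b_integrable_add b_integrable_sum) auto
  show "(%t. p t \<bullet> om t) : borel_measurable ?M" using pm om by (intro borel_measurable_inner) auto
 qed
 also have "... = c \<bullet> (\<delta> T - \<delta> 0) - ((LINT t|?M. Q.cumulative t \<bullet> om t) + (\<Sum>i<N. LINT t|?M. m i t \<bullet> om t))"
  using om bq(2) bm(2) \<delta>[of T] T
  by (subst b_integral_diff; (subst b_integral_add)?;
    (intro b_integrable_add b_integrable_sum)?) auto
 finally have main: "(LINT t|?M. p t \<bullet> om t) = c \<bullet> (\<delta> T - \<delta> 0) -
   ((LINT t|?M. Q.cumulative t \<bullet> om t) + (\<Sum>i<N. LINT t|?M. m i t \<bullet> om t))" .
 have sums: "(\<Sum>i<N. LINT t|?M. m i t \<bullet> om t) = (\<Sum>i<N. integral\<^sup>L (\<eta> i) (\<gamma> i) \<bullet> \<delta> T - (LINT t|\<eta> i. \<gamma> i t \<bullet> \<delta> t))"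
  by (intro sum.cong refl bm(1)) auto
 show "(LINT t|?M. p t \<bullet> om t) = right_val T p \<bullet> \<delta> T - left_val p \<bullet> \<delta> 0 +
    (LINT t|?M. q t \<bullet> \<delta> t) + (\<Sum>i<N. LINT t|\<eta> i. \<gamma> i t \<bullet> \<delta> t)"
  using bq(1) unfolding main sums
  unfolding lv rv e_def
  by (simp add: inner_diff_left inner_diff_right inner_add_left inner_sum_left sum_subtractf algebra_simps)
qed

section \<open>Kernels along bounded trajectories\<close>

text \<open>Both orders of differentiation differ from one and the same second difference, taken
  with steps \<open>s h\<close> and \<open>s k\<close>, by a multiple of \<open>s^3\<close>. After
  division by \<open>s\<^sup>2\<close> the difference of the two is bounded by a multiple of
  \<open>s\<close>.\<close>

lemma D2v_symmetric:
 fixes F :: "'a::euclidean_space => 'b::real_normed_vector"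
 assumes "smooth F" shows "D2v F x h k = D2v F x k h"
proof -
 obtain R where R: "norm x + norm h + norm k <= R" by blast
 obtain C where C: "C >= 0" "!!e v. norm (x + e) <= R ==> norm (fd F (x + e) v - fd F x v - D2v F x v e) <= C * (norm e)\<^sup>2 * norm v"
  using taylor1_fd[OF assms, of R] R by (metis add_increasing2 norm_ge_zero add.assoc add_nonneg_nonneg order_trans le_add_same_cancel1)
 define N where "N = norm h + norm k"
 have est: "norm (F (x + s *R k + s *R h) - F (x + s *R h) - F (x + s *R k) + F x - s\<^sup>2 *R D2v F x h k) <= (2 * C * N ^ 3) * s ^ 3"
  if s: "0 < s" "s <= 1" and hk: "norm h + norm k = N" "norm x + N <= R" for s :: real and h k :: 'a
 proof -
  let ?\<psi> = "%\<theta>. F ((x + s *R k) + \<theta> *R (s *R h)) - F (x + \<theta> *R (s *R h)) - \<theta> *R (s\<^sup>2 *R D2v F x h k)"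
  let ?\<psi>' = "%\<theta>. fd F ((x + s *R k) + \<theta> *R (s *R h)) (s *R h) - fd F (x + \<theta> *R (s *R h)) (s *R h) - s\<^sup>2 *R D2v F x h k"
  have "norm (?\<psi> 1 - ?\<psi> 0) <= (2 * C * N ^ 3) * s ^ 3"
  proof (rule segment_bound)
   fix \<theta> :: real assume \<theta>: "\<theta> : {0..1}"
   show "(?\<psi> has_vector_derivative ?\<psi>' \<theta>) (at \<theta>)"
    by (intro has_vector_derivative_diff smooth_line_derivative[OF assms])
    (auto simp: has_vector_derivative_def intro!: derivative_eq_intros)
   have N0: "N >= 0" using hk(1) by (metis add_nonneg_nonneg norm_ge_zero)
   let ?e1 = "s *R k + \<theta> *R (s *R h)" and ?e2 = "\<theta> *R (s *R h)"
   have th: "norm ?e2 <= s * norm h" using \<theta> s by (simp add: mult_left_le_one_le)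
   have e2: "norm ?e2 <= s * N" using th s(1) hk(1) by (smt (verit) mult_left_mono norm_ge_zero)
   have e1: "norm ?e1 <= s * N" using th s(1) hk(1) norm_triangle_ineq[of "s *R k" ?e2]
    by (simp add: distrib_left[symmetric] flip: hk(1)) (smt (verit) distrib_left)
   have sN: "s * N <= N" using s N0 by (simp add: mult_left_le_one_le)
   have x1: "norm (x + ?e1) <= R" using norm_triangle_ineq[of x ?e1] e1 sN hk(2) by linarith
   have x2: "norm (x + ?e2) <= R" using norm_triangle_ineq[of x ?e2] e2 sN hk(2) by linarith
   have Cb: "C * (norm e)\<^sup>2 * norm (s *R h) <= C * N ^ 3 * s ^ 3" if "norm e <= s * N" for e :: 'a
   proof -
    have "norm (s *R h) <= s * N" using s(1) hk(1) by (auto simp: mult_left_mono)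
    then have "(norm e)\<^sup>2 * norm (s *R h) <= (s * N)\<^sup>2 * (s * N)"
    using that s N0 by (intro mult_mono power_mono) auto
    from mult_left_mono[OF this C(1)] show ?thesis by (simp add: power2_eq_square power3_eq_cube mult_ac)
   qed
   have lin: "D2v F x (s *R h) ?e1 - D2v F x (s *R h) ?e2 = s\<^sup>2 *R D2v F x h k"
    by (simp only: linear_add[OF D2v_linear2[OF assms]] linear_scale[OF D2v_linear2[OF assms]]
    linear_scale[OF D2v_linear1[OF assms]]) (simp add: power2_eq_square)
   have "?\<psi>' \<theta> = (fd F (x + ?e1) (s *R h) - fd F x (s *R h) - D2v F x (s *R h) ?e1)
    - (fd F (x + ?e2) (s *R h) - fd F x (s *R h) - D2v F x (s *R h) ?e2)"
    unfolding lin[symmetric] by (simp add: algebra_simps)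
   then have "norm (?\<psi>' \<theta>) <= norm (fd F (x + ?e1) (s *R h) - fd F x (s *R h) - D2v F x (s *R h) ?e1)
    + norm (fd F (x + ?e2) (s *R h) - fd F x (s *R h) - D2v F x (s *R h) ?e2)"
    by (simp only: norm_triangle_ineq4)
   also have "... <= C * N ^ 3 * s ^ 3 + C * N ^ 3 * s ^ 3"
    by (intro add_mono order.trans[OF C(2) Cb] x1 x2 e1 e2)
   finally show "norm (?\<psi>' \<theta>) <= (2 * C * N ^ 3) * s ^ 3" by (simp add: algebra_simps)
  qed
  then show ?thesis by (simp add: algebra_simps)
 qed
 have "norm (D2v F x h k - D2v F x k h) <= (4 * C * N ^ 3) * s" if s: "0 < s" "s <= 1" for s
 proof -
  let ?G = "F (x + s *R k + s *R h) - F (x + s *R h) - F (x + s *R k) + F x"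
  have hk: "norm h + norm k = N" "norm k + norm h = N" "norm x + N <= R" using R by (simp_all add: N_def)
  have c: "x + s *R h + s *R k = x + s *R k + s *R h" by (simp add: add_ac)
  have eqG: "F (x + s *R h + s *R k) - F (x + s *R k) - F (x + s *R h) + F x = ?G"
   by (subst c) simp
  have "s\<^sup>2 *R (D2v F x h k - D2v F x k h) = (?G - s\<^sup>2 *R D2v F x k h) - (?G - s\<^sup>2 *R D2v F x h k)"
   by (simp add: algebra_simps)
  then have "norm (s\<^sup>2 *R (D2v F x h k - D2v F x k h)) <= norm (?G - s\<^sup>2 *R D2v F x k h) + norm (?G - s\<^sup>2 *R D2v F x h k)"
   by (simp only: norm_triangle_ineq4)
  also have "... <= (2 * C * N ^ 3) * s ^ 3 + (2 * C * N ^ 3) * s ^ 3"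
   by (intro add_mono est[OF s hk(2,3), unfolded eqG] est[OF s hk(1,3)])
  also have "... = s\<^sup>2 * ((4 * C * N ^ 3) * s)" by (simp add: power2_eq_square power3_eq_cube)
  finally have "s\<^sup>2 * norm (D2v F x h k - D2v F x k h) <= s\<^sup>2 * ((4 * C * N ^ 3) * s)"
   unfolding norm_scaleR abs_power2 .
  then show ?thesis using s by simp
 qed
 then have "\<forall>\<^sub>F s in at_right 0. norm (D2v F x h k - D2v F x k h) <= (4 * C * N ^ 3) * s"
  by (auto simp: eventually_at_right_field intro!: exI[of _ 1])
 moreover have "((%s. (4 * C * N ^ 3) * s) \<longlongrightarrow> (4 * C * N ^ 3) * 0) (at_right 0)"
  by (intro tendsto_intros)
 ultimately have "norm (D2v F x h k - D2v F x k h) <= 0"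
  using tendsto_lowerbound[of _ _ "at_right (0::real)"] by fastforce
 then show ?thesis by simp
qed

lemma fd_partial:
 assumes "smooth k"
 shows "fd (%x. k (t, s, x)) x h = fd k (t, s, x) (0, 0, h)"
 using fd_compose_affine[of "%x. (0, 0, x)" k "(t, s, 0)" x h] assms
 by (simp add: bounded_linear_Pair bounded_linear_zero bounded_linear_ident)

lemma smooth_partial: "smooth k ==> smooth (%x. k (t, s, x))"
 using smooth_compose_affine[of "%x. (0, 0, x)" k "(t, s, 0)"]
 by (simp add: bounded_linear_Pair bounded_linear_zero bounded_linear_ident)

text \<open>The derivative of a kernel in the pair of control and state, with the direction as an
  additional argument. The linearized equation is then again of kernel form, and the results on
  kernels apply to it.\<close>

definition lin_kernel :: "(real \<times> real \<times> 'x::euclidean_space => 'b::real_normed_vector) => real \<times> real \<times> 'x \<times> 'x => 'b" where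
 "lin_kernel k = (%(t, s, x, h). fd k (t, s, x) (0, 0, h))"

lemma smooth_lin_kernel: "smooth k ==> smooth (lin_kernel k)"
 using smooth_compose_linear[OF _ smooth_fd_pair, of "%(t, s, x, h). ((t, s, x), (0, 0, h))" k]
 unfolding lin_kernel_def case_prod_beta
 by (simp add: bounded_linear_intros bounded_linear_Pair bounded_linear_zero
   bounded_linear_compose[OF bounded_linear_fst] bounded_linear_compose[OF bounded_linear_snd] bounded_linear_fst bounded_linear_snd)

text \<open>Differentiation in time and in the state commute by symmetry of the second derivative,
  so the memory of the linearized equation is the linearization of the memory.\<close>

lemma Dtau_lin_kernel:
 fixes k :: "real \<times> real \<times> 'x::euclidean_space => 'b::real_normed_vector"
 assumes "smooth k" shows "Dtau (lin_kernel k) (t, s, x, h) = lin_kernel (Dtau k) (t, s, x, h)"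
proof -
 have "((%\<sigma>. lin_kernel k (\<sigma>, s, x, h)) has_vector_derivative D2v k (t, s, x) (0, 0, h) (1, 0, 0)) (at t)"
  using smooth_line_derivative[OF smooth_fd[OF assms, of "(0, 0, h)"], of "(0, s, x)" "(1, 0, 0)" t]
  by (simp add: lin_kernel_def D2v_def)
 then have "Dtau (lin_kernel k) (t, s, x, h) = D2v k (t, s, x) (0, 0, h) (1, 0, 0)"
  unfolding Dtau_def by (simp add: vector_derivative_at)
 also have "... = D2v k (t, s, x) (1, 0, 0) (0, 0, h)" by (rule D2v_symmetric[OF assms])
 also have "... = lin_kernel (Dtau k) (t, s, x, h)"
  by (simp add: lin_kernel_def D2v_def Dtau_eq_fd(1)[OF assms] zero_prod_def)
 finally show ?thesis .
qed

lemma norm_triple_le: "norm (t, s, x) <= \<bar>t\<bar> + \<bar>s\<bar> + norm x"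
 for t s :: real
 using norm_Pair_le[of t "(s, x)"] norm_Pair_le[of s x] by simp

lemma AE_time_bound:
 assumes "AE s in leb T. norm (X s) <= R"
 shows "AE s in leb T. \<forall>r\<in>{0..T::real}. norm (r, s, X s) <= 2 * T + R"
 using assms AE_space
proof eventually_elim
 case (elim s)
 show ?case
 proof
  fix r assume "r : {0..T}"
  then show "norm (r, s, X s) <= 2 * T + R" using elim norm_triple_le[of r s "X s"] by auto
 qed
qed

lemma kernel_bound_bounded:
 fixes k :: "real \<times> real \<times> 'x::euclidean_space => 'b::euclidean_space"
 assumes "smooth k" "X : borel_measurable (leb T)" "AE s in leb T. norm (X s) <= R"
 obtains C where "C >= 0" "kernel_bound T k X (%_. C)"
proof -
 obtain C1 where C1: "C1 >= 0" "!!q. norm q <= 2 * T + R ==> norm (k q) <= C1" using smooth_bounded_on_ball[OF assms(1)] by metis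
 obtain C2 where C2: "C2 >= 0" "!!q. norm q <= 2 * T + R ==> norm (Dtau k q) <= C2" using smooth_bounded_on_ball[OF smooth_Dtau[OF assms(1)]] by metis
 show thesis
 proof (rule that[of "max C1 C2"])
  show "kernel_bound T k X (%_. max C1 C2)"
   unfolding kernel_bound_def using AE_time_bound[OF assms(3)] assms(1,2)
   by (auto simp: integrable_const_Icc elim!: eventually_mono intro: max.coboundedI1[OF C1(2)] max.coboundedI2[OF C2(2)])
 qed (use C1 in auto)
qed

lemma lin_kernel_bound:
 fixes k :: "real \<times> real \<times> 'x::euclidean_space => 'b::euclidean_space"
 assumes "smooth k" obtains C where "C >= 0"
  "!!t s x h. norm (t, s, x) <= R ==> norm (lin_kernel k (t, s, x, h)) <= C * norm h"
proof -
 obtain C where C: "C >= 0" "!!q h. norm q <= R ==> norm (fd k q h) <= C * norm h" using fd_bound[OF assms] by metis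
 show thesis
 proof (rule that[OF C(1)])
  fix t s :: real and x h :: 'x assume "norm (t, s, x) <= R"
  then show "norm (lin_kernel k (t, s, x, h)) <= C * norm h"
   using C(2)[of "(t, s, x)" "(0, 0, h)"] by (simp add: lin_kernel_def norm_Pair)
 qed
qed

lemma kernel_bound_linear:
 fixes k :: "real \<times> real \<times> 'x::euclidean_space => 'b::euclidean_space"
 assumes k: "smooth k" and X: "X : borel_measurable (leb T)" "AE s in leb T. norm (X s) <= R"
  and H: "integrable (leb T) H"
 obtains C where "C >= 0" "kernel_bound T (lin_kernel k) (%s. (X s, H s)) (%s. C * norm (H s))"
proof -
 obtain C1 where C1: "C1 >= 0" "!!t s x h. norm (t, s, x) <= 2 * T + R ==> norm (lin_kernel k (t, s, x, h)) <= C1 * norm h"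
  using lin_kernel_bound[OF k, of "2 * T + R"] by metis
 obtain C2 where C2: "C2 >= 0" "!!t s x h. norm (t, s, x) <= 2 * T + R ==> norm (lin_kernel (Dtau k) (t, s, x, h)) <= C2 * norm h"
  using lin_kernel_bound[OF smooth_Dtau[OF k], of "2 * T + R"] by metis
 show thesis
 proof (rule that[of "max C1 C2"])
  have "AE s in leb T. \<forall>r\<in>{0..T}. norm (lin_kernel k (r, s, X s, H s)) <= max C1 C2 * norm (H s) &
    norm (Dtau (lin_kernel k) (r, s, X s, H s)) <= max C1 C2 * norm (H s)"
   using AE_time_bound[OF X(2)]
  proof eventually_elim
   case (elim s)
   show ?case
    using elim unfolding Dtau_lin_kernel[OF k]
    by (auto intro!: order.trans[OF C1(2)] order.trans[OF C2(2)] mult_right_mono)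
  qed
  then show "kernel_bound T (lin_kernel k) (%s. (X s, H s)) (%s. max C1 C2 * norm (H s))"
   unfolding kernel_bound_def using H X by (auto intro!: smooth_lin_kernel[OF k] borel_measurable_Pair)
 qed (use C1 in auto)
qed

section \<open>Derivatives of functions of a state\<close>

lemma has_real_derivative_LINT:
 assumes "cont T \<alpha>" "t : {0..T}"
 shows "((%x. LINT s|leb x. \<alpha> s) has_real_derivative \<alpha> t) (at t within {0..T})"
proof -
 have "((%x. integral {0..x} \<alpha>) has_real_derivative \<alpha> t) (at t within {0..T})"
  by (rule integral_has_real_derivative[OF assms])
 moreover have "integral {0..x} \<alpha> = (LINT s|leb x. \<alpha> s)" if "x : {0..T}" for x
  by (intro lebesgue_integral_eq_integral[symmetric] continuous_imp_integrable_real continuous_on_subset[OF assms(1)])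
   (use that in auto)
 ultimately show ?thesis
  using has_field_derivative_transform_within[of "%x. integral {0..x} \<alpha>" "\<alpha> t" t "{0..T}" 1] assms(2) by auto
qed

lemma sqint_integrable:
 assumes "finite_measure M" "sqint M f" shows "integrable M f"
proof (rule b_integrable_bound)
 show "integrable M (%x. (norm (f x))\<^sup>2 + 1)"
  using assms finite_measure.integrable_const[OF assms(1), of "1::real"] by (auto simp: sqint_def)
 have "norm (f x) <= (norm (f x))\<^sup>2 + 1" for x
 proof -
  have "2 * norm (f x) <= (norm (f x))\<^sup>2 + 1" using sum_squares_bound[of "norm (f x)" 1] by simp
  then show ?thesis using norm_ge_zero[of "f x"] by linarith
 qed
 then show "AE x in M. norm (f x) <= norm ((norm (f x))\<^sup>2 + 1)" by simp
qed (use assms in \<open>auto simp: sqint_def\<close>)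

lemma integrable_Icc_sub_Cauchy_Schwarz:
 fixes w :: "real => 'b::euclidean_space"
 assumes w: "sqint (leb T) w" and ab: "0 <= a" "a <= b" "b <= T"
 shows "(LINT s|leb T. indicat_real {a<..b} s * norm (w s))\<^sup>2 \<le>
  (b - a) * (LINT s|leb T. indicat_real {a<..b} s * (norm (w s))\<^sup>2)"
proof -
 let ?M = "leb T"
 let ?f = "%s. indicat_real {a<..b} s" and ?g = "%s. indicat_real {a<..b} s * norm (w s)"
 have sq: "(?f s)\<^sup>2 = ?f s" "(?g s)\<^sup>2 = ?f s * (norm (w s))\<^sup>2" "?f s * ?g s = ?g s" for s by (auto simp: indicator_def)
 have i1: "integrable ?M ?f" using integrable_indicator_mult[OF integrable_const_Icc[of T "1::real"], of "{a<..b}"] by (simp add: indicator_measurable_Icc)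
 have i2: "integrable ?M (%s. ?f s * (norm (w s))\<^sup>2)"
  using integrable_indicator_mult[of ?M "%s. (norm (w s))\<^sup>2" "{a<..b}"] w by (simp add: indicator_measurable_Icc sqint_def)
 have sqf: "sqint ?M ?f" unfolding sqint_def using i1 by (simp add: indicator_measurable_Icc sq)
 have wm: "w : borel_measurable ?M" using w by (simp add: sqint_def)
 have sqg: "sqint ?M ?g" unfolding sqint_def
  using i2 wm by (simp add: sq abs_mult indicator_measurable_Icc borel_measurable_times power_mult_distrib)
 have "(LINT s|?M. ?f s) = b - a"
 proof -
  have "(LINT s|?M. ?f s) = (LINT s|lebesgue. indicat_real {0..T} s *R ?f s)" by (rule integral_restrict_space) simp
  also have "... = (LINT s|lebesgue. indicat_real {a<..b} s)"
   using ab by (intro b_integral_cong) (auto simp: indicator_def)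
  also have "... = b - a" using ab by simp
  finally show ?thesis .
 qed
 then show ?thesis using ip_Cauchy_Schwarz[OF sqf sqg] by (simp add: ip_def sq mult.assoc[symmetric] flip: power2_eq_square)
qed

text \<open>Chain rule for \<open>G \<circ> X\<close> at every time, although the state \<open>X\<close> is only differentiable almost
  everywhere: the derivative of \<open>G \<circ> X\<close> has a continuous representative.\<close>

lemma composite_derivative:
 fixes X w :: "real => 'b::euclidean_space" and G :: "'b => real"
 assumes w: "sqint (leb T) w"
  and X: "!!t. t : {0..T} ==> X t = X 0 + (LINT s|leb t. w s)"
  and G: "smooth G" and \<alpha>: "cont T \<alpha>"
  and ae: "AE s in leb T. fd G (X s) (w s) = \<alpha> s"
  and t: "t : {0..T}"
 shows "((%t. G (X t)) has_real_derivative \<alpha> t) (at t within {0..T})"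
proof -
 let ?M = "leb T"
 have iw: "integrable ?M w" by (rule sqint_integrable[OF finite_measure_Icc w])
 have i2: "integrable ?M (%s. (norm (w s))\<^sup>2)" using w by (simp add: sqint_def)
 define L where "L a b = (LINT s|?M. indicat_real {a<..b} s * norm (w s))" for a b
 define Q where "Q t = (LINT s|leb t. (norm (w s))\<^sup>2)" for t
 have cQ: "cont T Q" unfolding Q_def by (rule indefinite_integral_continuous[OF i2])
 have L2: "(L a b)\<^sup>2 <= (b - a) * (Q b - Q a)" if "0 <= a" "a <= b" "b <= T" for a b
  using integrable_Icc_sub_Cauchy_Schwarz[OF w that] LINT_increment[OF i2 that] by (simp add: L_def Q_def)
 have L0: "L a b >= 0" for a b unfolding L_def by (rule Bochner_Integration.integral_nonneg) auto
 have iL: "integrable ?M (%s. indicat_real {a<..b} s * norm (w s))" for a b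
  using integrable_indicator_mult[of ?M "%s. norm (w s)" "{a<..b}"] iw by (simp add: indicator_measurable_Icc)
 have Xinc: "X b - X a = (LINT s|?M. indicat_real {a<..b} s *R w s)" if "0 <= a" "a <= b" "b <= T" for a b
  using LINT_increment[OF iw that] X[of a] X[of b] that by simp
 have XL: "norm (X b - X a) <= L c d" if "0 <= a" "a <= b" "b <= T" "c <= a" "b <= d" for a b c d
 proof -
  have "norm (X b - X a) <= (LINT s|?M. norm (indicat_real {a<..b} s *R w s))"
   unfolding Xinc[OF that(1-3)] by (rule integral_norm_bound)
  also have "... <= L c d" unfolding L_def
   by (rule integral_mono') (use iL that in \<open>auto simp: indicator_def\<close>)
  finally show ?thesis .
 qed
 have cX: "cont T X"
 proof -
  have "cont T (%t. X 0 + (LINT s|leb t. w s))"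
   by (intro continuous_intros indefinite_integral_continuous iw)
  then show ?thesis by (subst continuous_on_cong[OF refl X])
 qed
 then have "bounded (X ` {0..T})" by (intro compact_imp_bounded compact_continuous_image compact_Icc)
 then obtain R where "\<forall>y\<in>X ` {0..T}. norm y <= R" unfolding bounded_iff by blast
 then have R: "!!t. t : {0..T} ==> norm (X t) <= R" by simp
 obtain C1 where C1: "C1 >= 0" "!!x h. norm x <= R ==> norm (x + h) <= R ==> norm (G (x + h) - G x - fd G x h) <= C1 * (norm h)\<^sup>2"
  using taylor1[OF G] by metis
 obtain C2 where C2: "C2 >= 0" "!!x h k. norm x <= R ==> norm (x + h) <= R ==> norm (fd G (x + h) k - fd G x k) <= C2 * norm h * norm k"
  using fd_lipschitz[OF G] by metis
 define A where "A t = (LINT s|leb t. \<alpha> s)" for t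
 have i\<alpha>: "integrable ?M \<alpha>" by (rule continuous_imp_integrable_real[OF \<alpha>])
 \<comment> \<open>On a short interval \<open>G\<close> is linearized at an end point
   \<open>c\<close>. The Taylor error and the variation of the derivative are both of order
   \<open>(L a b)\<^sup>2\<close>, and Cauchy-Schwarz gives a factor \<open>b - a\<close> times an
   increment of the continuous function \<open>Q\<close>; divided by \<open>b - a\<close> this still
   tends to zero.\<close>
 have key: "\<bar>(G (X b) - G (X a)) - (A b - A a)\<bar> <= (C1 + C2) * ((b - a) * (Q b - Q a))"
  if ab: "0 <= a" "a <= b" "b <= T" and c: "c = a \<or> c = b" for a b c
 proof -
  have blb: "bounded_linear (fd G (X c))" by (rule bounded_linear_fd[OF G])
  have 1: "\<bar>(G (X b) - G (X a)) - fd G (X c) (X b - X a)\<bar> <= C1 * (L a b)\<^sup>2"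
  proof -
   have "\<bar>(G (X b) - G (X a)) - fd G (X c) (X b - X a)\<bar> <= C1 * (norm (X b - X a))\<^sup>2"
    using c
   proof
    assume "c = a" then show ?thesis using C1(2)[of "X a" "X b - X a"] R ab by simp
   next
    assume "c = b"
    then show ?thesis using C1(2)[of "X b" "X a - X b"] R ab
    linear_neg[OF linear_fd[OF G], of "X b" "X b - X a"] by (simp add: norm_minus_commute abs_le_iff)
   qed
   also have "... <= C1 * (L a b)\<^sup>2" using XL[OF ab, of a b] C1(1) by (intro mult_left_mono power_mono) auto
   finally show ?thesis .
  qed
  have ii: "integrable ?M (%s. indicat_real {a<..b} s *R w s)" by (rule integrable_indicator_mult[OF iw]) simp
  have ii2: "integrable ?M (%s. indicat_real {a<..b} s *R \<alpha> s)" by (rule integrable_indicator_mult[OF i\<alpha>]) simp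
  have "fd G (X c) (X b - X a) - (A b - A a) =
    (LINT s|?M. fd G (X c) (indicat_real {a<..b} s *R w s)) - (LINT s|?M. indicat_real {a<..b} s *R \<alpha> s)"
   unfolding Xinc[OF ab] A_def LINT_increment[OF i\<alpha> ab] integral_bounded_linear[OF blb ii] ..
  also have "... = (LINT s|?M. fd G (X c) (indicat_real {a<..b} s *R w s) - indicat_real {a<..b} s *R \<alpha> s)"
   by (intro b_integral_diff[symmetric] ii2 integrable_bounded_linear[OF blb ii])
  finally have "\<bar>fd G (X c) (X b - X a) - (A b - A a)\<bar> \<le>
    (LINT s|?M. norm (fd G (X c) (indicat_real {a<..b} s *R w s) - indicat_real {a<..b} s *R \<alpha> s))"
   by (simp only: real_norm_def[symmetric] integral_norm_bound)
  also have "... <= (LINT s|?M. C2 * L a b * (indicat_real {a<..b} s * norm (w s)))"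
  proof (rule integral_mono_AE)
   show "AE s in ?M. norm (fd G (X c) (indicat_real {a<..b} s *R w s) - indicat_real {a<..b} s *R \<alpha> s)
    <= C2 * L a b * (indicat_real {a<..b} s * norm (w s))"
    using ae AE_space
   proof eventually_elim
    case (elim s)
    show ?case
    proof (cases "s : {a<..b}")
    case True
    have "norm (X c - X s) <= L a b"
    using c XL[of a s a b] XL[of s b a b] True ab by (auto simp: norm_minus_commute)
    moreover have "norm (fd G (X c) (w s) - fd G (X s) (w s)) <= C2 * norm (X c - X s) * norm (w s)"
    using C2(2)[of "X s" "X c - X s" "w s"] R[of s] R[of c] True ab c by auto
    ultimately have "norm (fd G (X c) (w s) - fd G (X s) (w s)) <= C2 * L a b * norm (w s)"
    using C2(1) by (smt (verit) mult_left_mono mult_right_mono norm_ge_zero)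
    then show ?thesis using True elim by simp
    qed (simp add: linear_0[OF linear_fd[OF G]])
   qed
   show "integrable ?M (%s. C2 * L a b * (indicat_real {a<..b} s * norm (w s)))" using iL by simp
  qed (intro b_integrable_norm b_integrable_diff ii2 integrable_bounded_linear[OF blb ii])
  also have "... = C2 * (L a b)\<^sup>2" by (simp add: L_def power2_eq_square)
  finally have 2: "\<bar>fd G (X c) (X b - X a) - (A b - A a)\<bar> <= C2 * (L a b)\<^sup>2" .
  have "\<bar>(G (X b) - G (X a)) - (A b - A a)\<bar> <= (C1 + C2) * (L a b)\<^sup>2"
   using 1 2 by (simp add: distrib_right)
  also have "... <= (C1 + C2) * ((b - a) * (Q b - Q a))" using L2[OF ab] C1(1) C2(1) by (intro mult_left_mono) auto
  finally show ?thesis .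
 qed
 have "((%x. G (X x) - A x) has_real_derivative 0) (at t within {0..T})"
  unfolding has_field_derivative_iff
 proof (rule tendsto_rabs_zero_cancel, rule tendsto_sandwich)
  show "\<forall>\<^sub>F y in at t within {0..T}. 0 <= \<bar>(G (X y) - A y - (G (X t) - A t)) / (y - t)\<bar>" by simp
  show "\<forall>\<^sub>F y in at t within {0..T}. \<bar>(G (X y) - A y - (G (X t) - A t)) / (y - t)\<bar> <= (C1 + C2) * \<bar>Q y - Q t\<bar>"
   unfolding eventually_at_filter
  proof (intro always_eventually allI impI)
   fix y assume y: "y ~= t" "y : {0..T}"
   have "\<bar>G (X y) - A y - (G (X t) - A t)\<bar> <= (C1 + C2) * \<bar>Q y - Q t\<bar> * \<bar>y - t\<bar>"
   proof (cases "t < y")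
    case True
    have "(C1 + C2) * ((y - t) * (Q y - Q t)) <= (C1 + C2) * (\<bar>y - t\<bar> * \<bar>Q y - Q t\<bar>)"
    using True C1(1) C2(1) by (intro mult_left_mono) auto
    then show ?thesis using key[of t y t] True t y by (simp add: algebra_simps)
   next
    case False
    have "(t - y) * (Q t - Q y) <= \<bar>y - t\<bar> * \<bar>Q y - Q t\<bar>"
    using abs_ge_self[of "(t - y) * (Q t - Q y)"] by (simp only: abs_mult abs_minus_commute)
    then have "(C1 + C2) * ((t - y) * (Q t - Q y)) <= (C1 + C2) * (\<bar>y - t\<bar> * \<bar>Q y - Q t\<bar>)"
    using C1(1) C2(1) by (intro mult_left_mono) auto
    then show ?thesis using key[of y t t] False t y by (simp add: algebra_simps abs_minus_commute)
   qed
   then show "\<bar>(G (X y) - A y - (G (X t) - A t)) / (y - t)\<bar> <= (C1 + C2) * \<bar>Q y - Q t\<bar>"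
    using y(1) by (simp add: abs_divide pos_divide_le_eq)
  qed
  have "(Q \<longlongrightarrow> Q t) (at t within {0..T})" using cQ t by (simp add: continuous_on_def)
  then have "((%y. (C1 + C2) * \<bar>Q y - Q t\<bar>) \<longlongrightarrow> (C1 + C2) * \<bar>Q t - Q t\<bar>) (at t within {0..T})" by (intro tendsto_intros)
  then show "((%y. (C1 + C2) * \<bar>Q y - Q t\<bar>) \<longlongrightarrow> 0) (at t within {0..T})" by simp
 qed simp
 from DERIV_add[OF this has_real_derivative_LINT[OF \<alpha> t, folded A_def]] show ?thesis by simp
qed

lemma indicator_measurable_lebesgue: "A : sets borel ==> indicat_real A : borel_measurable lebesgue"
 by (rule measurable_completion) simp

lemma LINT_Ioo_compact_support:
 fixes h :: "real => real"
 assumes "a < c" "d < b" "!!t. t \<notin> {c..d} ==> h t = 0" "continuous_on {c..d} h"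
 shows "integrable (lebesgue_on {a<..<b}) h" "(LINT t|lebesgue_on {a<..<b}. h t) = integral {c..d} h"
proof -
 have i: "integrable (lebesgue_on {c..d}) h" by (rule continuous_imp_integrable_real[OF assms(4)])
 have e: "(%t. indicat_real {a<..<b} t * h t) = (%t. indicat_real {c..d} t *R h t)"
  using assms(1-3) by (fastforce simp: indicator_def)
 have "integrable lebesgue (%t. indicat_real {c..d} t *R h t)" using i by (subst (asm) integrable_restrict_space) auto
 then show "integrable (lebesgue_on {a<..<b}) h" unfolding integrable_Ioo_iff e .
 have "(LINT t|lebesgue_on {a<..<b}. h t) = (LINT t|lebesgue_on {c..d}. h t)"
  unfolding LINT_Ioo e by (rule integral_restrict_space[symmetric]) simp
 then show "(LINT t|lebesgue_on {a<..<b}. h t) = integral {c..d} h"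
  using lebesgue_integral_eq_integral[OF i] by simp
qed

text \<open>Integrating by parts once, \<open>\<alpha>\<close> and the distribution function of
  \<open>w\<close> have the same integral against every \<open>deriv \<theta>\<close>, so they
  differ by a constant almost everywhere, and everywhere by continuity. Continuity of
  \<open>w\<close> at \<open>\<tau>\<close> then makes the primitive differentiable there.\<close>

lemma weak_deriv2_imp_derivative:
 fixes G \<alpha> :: "real => real"
 assumes G: "!!t. t : {0..T} ==> (G has_real_derivative \<alpha> t) (at t within {0..T})"
  and \<alpha>: "cont T \<alpha>" and wd: "has_weak_deriv2_at T G \<tau> c"
 shows "(\<alpha> has_real_derivative c) (at \<tau>)"
proof -
 from wd obtain a b w where ab: "0 <= a" "a < \<tau>" "\<tau> < b" "b <= T" and iw: "integrable (lebesgue_on {a<..<b}) w"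
  and th: "!!\<theta>. \<theta> : test_functions a b ==> (LINT t|lebesgue_on {a<..<b}. deriv (deriv \<theta>) t * G t) = (LINT t|lebesgue_on {a<..<b}. \<theta> t * w t)"
  and cw: "isCont w \<tau>" "w \<tau> = c"
  unfolding has_weak_deriv2_at_def by blast
 let ?I = "lebesgue_on {a<..<b}"
 have Gd: "(G has_real_derivative \<alpha> t) (at t)" if "t : {a<..<b}" for t
  using G[of t] at_within_Icc_at[of 0 t T] that ab by auto
 have cG: "cont T G" using G by (rule DERIV_continuous_on)
 interpret W: time_measure ?I w
  by unfold_locales (use iw finite_measure.axioms(1)[OF finite_measure_lebesgue_on[of "{a<..<b}"]] id_borel_measurable_lebesgue_on[of "{a<..<b}"] in \<open>auto simp: sigma_finite_measure_def id_def\<close>)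
 define w' where "w' t = indicat_real {a<..<b} t * w t" for t
 have w'i: "integrable lebesgue w'" using iw by (simp add: integrable_Ioo_iff w'_def[abs_def])
 have w'on: "w' integrable_on {a..b}"
  using integrable_on_lebesgue[OF w'i] by (rule integrable_on_subinterval[of _ UNIV]) auto
 have Weq: "W.cumulative t = integral {a..t} w'" if "t : {a<..<b}" for t
 proof -
  have il: "integrable (lebesgue_on {a..t}) w'"
   using integrable_indicator_mult[OF w'i indicator_measurable_lebesgue[of "{a..t}"]] by (subst integrable_restrict_space) auto
  have "W.cumulative t = (LINT s|lebesgue. indicat_real {a<..<b} s * (indicat_real {s..} t * w s))"
   unfolding W.cumulative_def by (simp add: LINT_Ioo)
  also have "... = (LINT s|lebesgue. indicat_real {a..t} s *R w' s)"
   using that by (intro b_integral_cong) (auto simp: indicator_def w'_def)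
  also have "... = (LINT s|lebesgue_on {a..t}. w' s)" by (rule integral_restrict_space[symmetric]) simp
  also have "... = integral {a..t} w'" by (rule lebesgue_integral_eq_integral[OF il]) simp
  finally show ?thesis .
 qed
 have cI: "continuous_on {a..b} (%t. integral {a..t} w')" by (rule indefinite_integral_continuous_1[OF w'on])
 have z: "(LINT t|?I. deriv \<theta> t * (\<alpha> t - W.cumulative t)) = 0" if \<theta>: "\<theta> : test_functions a b" for \<theta>
 proof -
  from \<theta> obtain c0 d0 where sm: "smooth \<theta>" and cd0: "a < c0" "d0 < b" "!!t. t \<notin> {c0..d0} ==> \<theta> t = 0"
   by (auto simp: test_functions_def)
  \<comment> \<open>An interval that contains the support of \<open>\<theta>\<close> in its interior
    and stays away from \<open>a\<close> and \<open>b\<close>, so that the boundary terms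
    vanish.\<close>
  define lo where "lo = (a + min c0 \<tau>) / 2"
  define hi where "hi = (b + max d0 \<tau>) / 2"
  have lohi: "a < lo" "lo < min c0 \<tau>" "hi < b" "max d0 \<tau> < hi" "lo <= hi" using ab cd0 unfolding lo_def hi_def by (auto simp: field_simps min_def max_def)
  have zo: "\<theta> t = 0" if "t \<notin> {lo<..<hi}" for t by (rule cd0(3)) (use that lohi in auto)
  have dt: "deriv \<theta> t = 0" if "t \<notin> {lo<..<hi}" for t
  proof (rule DERIV_imp_deriv)
   have "((%_. 0) has_real_derivative 0) (at t)" by simp
   then show "(\<theta> has_real_derivative 0) (at t)"
    by (rule has_field_derivative_transform_within_open[of _ _ _ "- {c0..d0}"]) (use that lohi cd0 in auto)
  qed
  have ddt: "deriv (deriv \<theta>) t = 0" if "t \<notin> {lo..hi}" for t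
  proof (rule DERIV_imp_deriv)
   have "((%_. 0) has_real_derivative 0) (at t)" by simp
   then show "(deriv \<theta> has_real_derivative 0) (at t)"
    by (rule has_field_derivative_transform_within_open[of _ _ _ "- {lo..hi}"]) (use that dt in auto)
  qed
  have sub: "{lo..hi} <= {0..T}" using lohi ab by auto
  note sm1 = smooth_real_deriv(2)[OF sm] note sm2 = smooth_real_deriv(2)[OF sm1]
  have c1: "continuous_on {lo..hi} (%t. deriv (deriv \<theta>) t * G t)"
   by (intro continuous_intros smooth_continuous[OF sm2] continuous_on_subset[OF cG sub])
  have c2: "continuous_on {lo..hi} (%t. deriv \<theta> t * \<alpha> t)"
   by (intro continuous_intros smooth_continuous[OF sm1] continuous_on_subset[OF \<alpha> sub])
  have z1: "deriv (deriv \<theta>) t * G t = 0" and z2: "deriv \<theta> t * \<alpha> t = 0" if "t \<notin> {lo..hi}" for t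
   using that ddt dt[of t] by auto
  have "((%t. deriv (deriv \<theta>) t * G t + deriv \<theta> t * \<alpha> t) has_integral deriv \<theta> hi * G hi - deriv \<theta> lo * G lo) {lo..hi}"
  proof (rule fundamental_theorem_of_calculus[OF lohi(5)])
   fix t assume "t : {lo..hi}"
   then have "t : {a<..<b}" using lohi by auto
   from DERIV_mult[OF smooth_real_deriv(1)[OF sm1] Gd[OF this]]
   show "((%t. deriv \<theta> t * G t) has_vector_derivative deriv (deriv \<theta>) t * G t + deriv \<theta> t * \<alpha> t) (at t within {lo..hi})"
    by (auto simp: has_real_derivative_iff_has_vector_derivative[symmetric] mult.commute intro: has_field_derivative_at_within)
  qed
  then have "integral {lo..hi} (%t. deriv (deriv \<theta>) t * G t + deriv \<theta> t * \<alpha> t) = 0"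
   using dt[of lo] dt[of hi] by (simp add: integral_unique)
  then have "integral {lo..hi} (%t. deriv \<theta> t * \<alpha> t) = - integral {lo..hi} (%t. deriv (deriv \<theta>) t * G t)"
   using integral_add[OF integrable_continuous_interval[OF c1] integrable_continuous_interval[OF c2]] by simp
  then have "(LINT t|?I. deriv \<theta> t * \<alpha> t) = - (LINT t|?I. deriv (deriv \<theta>) t * G t)"
   using LINT_Ioo_compact_support(2)[OF lohi(1,3) z1 c1] LINT_Ioo_compact_support(2)[OF lohi(1,3) z2 c2] by simp
  also have "... = (LINT t|?I. deriv \<theta> t * W.cumulative t)"
   using th[OF \<theta>] W.cumulative_distr(1)[OF \<theta>] by simp
  finally have e: "(LINT t|?I. deriv \<theta> t * \<alpha> t) = (LINT t|?I. deriv \<theta> t * W.cumulative t)" .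
  have i1: "integrable ?I (%t. deriv \<theta> t * \<alpha> t)" by (rule LINT_Ioo_compact_support(1)[OF lohi(1,3) z2 c2])
  have i2: "integrable ?I (%t. deriv \<theta> t * W.cumulative t)" using W.cumulative_distr(2)[OF \<theta>] by simp
  show ?thesis using e i1 i2 by (simp add: right_diff_distrib)
 qed
 have iaw: "integrable ?I (%t. \<alpha> t - W.cumulative t)"
 proof (rule b_integrable_diff)
  have ic: "integrable (lebesgue_on {a..b}) \<alpha>"
   by (intro continuous_imp_integrable_real continuous_on_subset[OF \<alpha>]) (use ab in auto)
  then have "integrable lebesgue (%t. indicat_real {a..b} t *R \<alpha> t)" by (subst (asm) integrable_restrict_space) auto
  from integrable_indicator_mult[OF this indicator_measurable_lebesgue[of "{a<..<b}"]]
  have "integrable lebesgue (%t. indicat_real {a<..<b} t *R (indicat_real {a..b} t *R \<alpha> t))" by simp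
  moreover have "(%t. indicat_real {a<..<b} t *R (indicat_real {a..b} t *R \<alpha> t)) = (%t. indicat_real {a<..<b} t * \<alpha> t)"
   by (auto simp: indicator_def)
  ultimately show "integrable ?I \<alpha>" by (simp add: integrable_Ioo_iff)
  show "integrable ?I W.cumulative" by (rule W.integrable_cumulative)
 qed
 have alt: "a < b" using ab by simp
 obtain k where k: "AE t in ?I. \<alpha> t - W.cumulative t = k"
  using du_bois_reymond[OF alt iaw z] by blast
 \<comment> \<open>The set where the two continuous functions differ is open and negligible, hence
   empty.\<close>
 have eq: "\<alpha> t = k + integral {a..t} w'" if t: "t : {a<..<b}" for t
 proof (rule ccontr)
  assume ne: "\<alpha> t ~= k + integral {a..t} w'"
  define S where "S = {t : {a<..<b}. \<alpha> t - (k + integral {a..t} w') : - {0}}"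
  have "continuous_on {a<..<b} (%t. \<alpha> t - (k + integral {a..t} w'))"
   by (intro continuous_intros continuous_on_subset[OF \<alpha>] continuous_on_subset[OF cI]) (use ab in auto)
  from continuous_open_preimage[OF this open_greaterThanLessThan open_Compl[OF closed_singleton[of 0]]]
  have "open S" unfolding S_def vimage_def Int_def mem_Collect_eq .
  moreover have "t : S" using ne t by (auto simp: S_def)
  moreover have "negligible S"
  proof -
   have "AE t in lebesgue. t \<notin> S"
    using k by (subst (asm) AE_restrict_space_iff) (auto simp: S_def Weq elim!: eventually_mono)
   moreover have "S : sets lebesgue" using \<open>open S\<close> by simp
   ultimately show ?thesis by (simp add: negligible_iff_null_sets AE_iff_null_sets)
  qed
  ultimately show False using open_not_negligible by blast
 qed
 have "((%t. integral {a..t} w') has_vector_derivative w' \<tau>) (at \<tau> within {a..b} - {})"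
 proof (rule integral_has_vector_derivative_continuous_at[OF w'on])
  have "isCont w' \<tau>"
  proof -
   have "\<forall>\<^sub>F t in nhds \<tau>. w t = w' t"
    using eventually_nhds_in_open[of "{a<..<b}" \<tau>] ab by (auto simp: w'_def elim!: eventually_mono)
   then show ?thesis using cw(1) isCont_cong by blast
  qed
  then show "continuous (at \<tau> within {a..b} - {}) w'" by (simp add: continuous_at_imp_continuous_at_within)
 qed (use ab in auto)
 then have "((%t. integral {a..t} w') has_real_derivative c) (at \<tau>)"
  using at_within_Icc_at[of a \<tau> b] ab cw(2) by (simp add: has_real_derivative_iff_has_vector_derivative w'_def)
 then have "((%t. k + integral {a..t} w') has_real_derivative c) (at \<tau>)" by (auto intro!: derivative_eq_intros)
 then show ?thesis
  by (rule has_field_derivative_transform_within_open[of _ _ _ "{a<..<b}"]) (use ab eq in auto)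
qed

section \<open>Function spaces\<close>

lemma Linf_iff:
 "u : Linf T \<longleftrightarrow> u : borel_measurable (leb T) & (EX R. AE t in leb T. norm (u t) <= R)"
proof -
 let ?M = "leb T" and ?f = "%t. ereal (norm (u t))"
 have "EX R. AE t in ?M. norm (u t) <= R" if fin: "esssup ?M ?f < \<infinity>"
 proof -
  obtain R where R: "esssup ?M ?f <= ereal R" using fin by (cases "esssup ?M ?f") auto
  have "AE t in ?M. norm (u t) <= R"
   using esssup_AE[of ?f ?M] by eventually_elim (use R in \<open>metis ereal_less_eq(3) order_trans\<close>)
  then show ?thesis by blast
 qed
 moreover have "esssup ?M ?f < \<infinity>" if "u : borel_measurable ?M" "AE t in ?M. norm (u t) <= R" for R
 proof -
  have "esssup ?M ?f <= ereal R" using that by (intro esssup_I) (auto elim: eventually_mono)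
  then show ?thesis by (rule order.strict_trans1) simp
 qed
 ultimately show ?thesis unfolding Linf_def by blast
qed

lemma AE_const_Icc:
 assumes "(T::real) > 0" "AE t in leb T. Q" shows Q
proof (rule ccontr)
 assume "~ Q"
 then have "AE t in leb T. False" using assms(2) by simp
 then have "emeasure (leb T) (space (leb T)) = 0"
  unfolding ae_filter_eq_bot_iff[symmetric] by (simp add: eventually_False)
 then show False using assms(1) by (simp add: emeasure_restrict_space)
qed

lemma Linf_norm:
 assumes "T > 0" "u : Linf T"
 shows "AE t in leb T. norm (u t) <= Linf_norm T u" "Linf_norm T u >= 0"
proof -
 let ?M = "leb T" and ?f = "%t. ereal (norm (u t))"
 have ae: "AE t in ?M. ?f t <= esssup ?M ?f" by (rule esssup_AE)
 then have "AE t in ?M. 0 <= esssup ?M ?f" by eventually_elim (meson ereal_less_eq(5) norm_ge_zero order_trans)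
 then have nn: "0 <= esssup ?M ?f" by (rule AE_const_Icc[OF assms(1)])
 moreover have "esssup ?M ?f < \<infinity>" using assms(2) by (simp add: Linf_def)
 ultimately have e: "esssup ?M ?f = ereal (Linf_norm T u)" unfolding Linf_norm_def by (cases "esssup ?M ?f") auto
 show "AE t in ?M. norm (u t) <= Linf_norm T u" using ae unfolding e by simp
 show "Linf_norm T u >= 0" using nn unfolding e by simp
qed

lemma Linf_diff: "u : Linf T ==> v : Linf T ==> (%t. u t - v t) : Linf T"
proof -
 assume "u : Linf T" "v : Linf T"
 then obtain R S where "u : borel_measurable (leb T)" "v : borel_measurable (leb T)"
  and RS: "AE t in leb T. norm (u t) <= R" "AE t in leb T. norm (v t) <= S"
  unfolding Linf_iff by blast
 moreover have "AE t in leb T. norm (u t - v t) <= R + S"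
  using RS by eventually_elim (metis add_mono norm_triangle_ineq4 order_trans)
 ultimately show ?thesis unfolding Linf_iff by auto
qed

lemma Linf_sqint: assumes "u : Linf T" shows "sqint (leb T) u"
proof -
 obtain R where u: "u : borel_measurable (leb T)" "AE t in leb T. norm (u t) <= R"
  using assms unfolding Linf_iff by blast
 have "integrable (leb T) (%t. (norm (u t))\<^sup>2)"
  by (rule b_integrable_bound[OF integrable_const_Icc[of T "R\<^sup>2"]])
   (use u in \<open>auto elim!: eventually_mono intro!: power_mono\<close>)
 then show ?thesis using u by (simp add: sqint_def)
qed

lemma L2_iff_sqint: "v : L2 T \<longleftrightarrow> sqint (leb T) v"
 by (simp add: L2_def sqint_def)

lemma has_weak_deriv_continuous:
 assumes "has_weak_deriv T y w" shows "cont T y"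
proof -
 have "cont T (%t. y 0 + (LINT s|leb t. w s))"
  using assms by (intro continuous_intros indefinite_integral_continuous) (simp add: has_weak_deriv_def)
 moreover have "y t = y 0 + (LINT s|leb t. w s)" if "t : {0..T}" for t
  using assms that unfolding has_weak_deriv_def by blast
 ultimately show ?thesis by (subst continuous_on_cong[OF refl])
qed

lemma W1inf_continuous: "y : W1inf T ==> cont T y"
 by (auto simp: W1inf_def intro: has_weak_deriv_continuous)

lemma continuous_Icc_bounded:
 fixes y :: "real => 'b::real_normed_vector"
 assumes "cont T y" obtains R where "!!t. t : {0..T} ==> norm (y t) <= R"
proof -
 have "bounded (y ` {0..T})" by (intro compact_imp_bounded compact_continuous_image assms compact_Icc)
 then obtain B where "\<forall>y\<in>y ` {0..T}. norm y <= B" unfolding bounded_iff by blast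
 then show thesis by (intro that[of B]) auto
qed

lemma continuous_imp_Linf:
 fixes y :: "real => 'b::euclidean_space"
 assumes "cont T y" shows "y : Linf T"
proof -
 obtain R where "!!t. t : {0..T} ==> norm (y t) <= R" using continuous_Icc_bounded[OF assms] by blast
 then show ?thesis unfolding Linf_iff using continuous_measurable_Icc[OF assms] by (auto intro!: exI[of _ R] AE_I2)
qed

lemma Linf_Pair:
 assumes "u : Linf T" "y : Linf T" shows "(%t. (u t, y t)) : Linf T"
proof -
 from assms obtain R S where m: "u : borel_measurable (leb T)" "y : borel_measurable (leb T)"
  and RS: "AE t in leb T. norm (u t) <= R" "AE t in leb T. norm (y t) <= S"
  unfolding Linf_iff by blast
 have "AE t in leb T. norm (u t, y t) <= R + S"
  using RS by eventually_elim (metis add_mono norm_Pair_le order_trans)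
 then show ?thesis unfolding Linf_iff using borel_measurable_Pair[OF m] by blast
qed

section \<open>Semantics of the derivation\<close>

text \<open>Dependence on the pair \<open>(u, y)\<close> only through its values up to the
  evaluation time. It permits replacing a path that moves after \<open>t0\<close> by one that is
  constant throughout.\<close>

definition causal :: "('m::finite, 'n::finite) ocp => ('m, 'n) sfun => bool" where
 "causal P h \<longleftrightarrow> (ALL t w x u y u' y'. sfun_dom P t u y --> sfun_dom P t u' y' -->
   (\<forall>s\<in>{0..t}. u s = u' s & y s = y' s) --> h t w x u y = h t w x u' y')"

text \<open>A test path that is constant up to time \<open>t0\<close> and then moves under the constant control \<open>w\<close>. Along
  such paths \<open>D\<^sup>(\<^sup>1\<^sup>)\<close> computes the right derivative at \<open>t0\<close>.\<close>

definition vel :: "('m::finite, 'n::finite) ocp => real => (real ^ 'm) => (real ^ 'n) => (real ^ 'n)" where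
 "vel P t0 w x = dyn P (t0, t0, w, x) + (LINT s|lebesgue_on {0..t0}. Dtau (dyn P) (t0, s, 0, x))"

definition path_u :: "real => (real ^ 'm) => real => (real ^ 'm)" where
 "path_u t0 w t = (if t <= t0 then 0 else w)"

definition path_y :: "('m::finite, 'n::finite) ocp => real => (real ^ 'm) => (real ^ 'n) => real => (real ^ 'n)" where
 "path_y P t0 w x t = x + max 0 (t - t0) *R vel P t0 w x"

lemma path_u_Linf: "path_u t0 w : Linf T"
proof -
 have "(%t. indicat_real {t0<..} t *R w) : borel_measurable (leb T)"
  by (intro borel_measurable_scaleR indicator_measurable_Icc) auto
 moreover have "(%t. indicat_real {t0<..} t *R w) = path_u t0 w" by (auto simp: path_u_def indicator_def)
 ultimately show ?thesis unfolding Linf_iff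
  by (auto intro!: exI[of _ "norm w"] AE_I2 simp: path_u_def)
qed

lemma path_y_continuous: "continuous_on A (path_y P t0 w x)"
 unfolding path_y_def by (intro continuous_intros)

lemma path_y_W1inf: assumes "0 <= t0" shows "path_y P t0 w x : W1inf T"
proof -
 define F where "F = vel P t0 w x"
 let ?w = "%t. indicat_real {t0<..} t *R F"
 have m: "?w : borel_measurable (leb T)"
  by (intro borel_measurable_scaleR indicator_measurable_Icc) auto
 then have L: "?w : Linf T" unfolding Linf_iff by (auto intro!: exI[of _ "norm F"] AE_I2 simp: indicator_def)
 have "path_y P t0 w x t = path_y P t0 w x 0 + (LINT s|leb t. ?w s)" if "t : {0..T}" for t
 proof -
  have "(LINT s|leb t. ?w s) = (LINT s|lebesgue. indicat_real {0..t} s *R ?w s)"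
   by (rule integral_restrict_space) simp
  also have "... = (LINT s|lebesgue. indicat_real {t0<..t} s *R F)"
   using assms by (intro b_integral_cong) (auto simp: indicator_def)
  also have "... = max 0 (t - t0) *R F"
   by (cases "t0 <= t") auto
  finally show ?thesis using assms by (simp add: path_y_def F_def)
 qed
 then have "has_weak_deriv T (path_y P t0 w x) ?w"
  unfolding has_weak_deriv_def using sqint_integrable[OF finite_measure_Icc Linf_sqint[OF L]] by blast
 then show ?thesis using L unfolding W1inf_def by blast
qed

lemma path_before: "s <= t0 ==> path_u t0 w s = 0 & path_y P t0 w x s = x"
 by (simp add: path_u_def path_y_def)

lemma sfun_dom_path: "0 <= t0 ==> t : {0..horizon P} ==> sfun_dom P t (path_u t0 w) (path_y P t0 w x)"
 by (simp add: sfun_dom_def path_u_Linf path_y_W1inf)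

text \<open>The control of the path jumps at \<open>t0\<close>, so the diagonal term is not
  continuous there. After \<open>t0\<close> it agrees with \<open>\<alpha>\<close>, where the
  control is frozen at \<open>w\<close>, and only integrals over \<open>{t0<..t}\<close> enter a
  right derivative.\<close>

lemma integral_path_derivative:
 fixes b :: "real \<times> real \<times> (real ^ 'm) \<times> (real ^ 'n) => real"
 assumes b: "smooth b" and t0: "0 <= t0" "t0 < horizon P"
 shows "((%t. LINT s|leb t. b (t, s, path_u t0 w s, path_y P t0 w x s)) has_real_derivative
  b (t0, t0, w, x) + (LINT s|lebesgue_on {0..t0}. Dtau b (t0, s, path_u t0 w s, path_y P t0 w x s)))
  (at t0 within {t0..horizon P})"
proof -
 let ?T = "horizon P" and ?Y = "%s. (path_u t0 w s, path_y P t0 w x s)"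
 have "?Y : Linf ?T" by (intro Linf_Pair path_u_Linf continuous_imp_Linf path_y_continuous)
 then obtain R where Y: "?Y : borel_measurable (lebesgue_on {0..?T})" "AE s in lebesgue_on {0..?T}. norm (?Y s) <= R"
  unfolding Linf_iff by blast
 obtain C where kb: "kernel_bound ?T b ?Y (%_. C)" using kernel_bound_bounded[OF b Y] by blast
 define I where "I r = (LINT s|leb r. Dtau b (r, s, ?Y s))" for r
 define h where "h t = (LINT s|leb t. b (t, s, ?Y s))" for t
 have cI: "continuous_on {0..?T} I" unfolding I_def by (rule kernel_integral_continuous(2)[OF kb])
 define g where "g r = b (r, r, ?Y r) + I r" for r
 have hg: "h t = (LINT r|leb t. g r)" if "t : {0..?T}" for t
  unfolding h_def g_def I_def by (rule volterra_weak_derivative[OF kb that])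
 define \<alpha> where "\<alpha> r = b (r, r, w, path_y P t0 w x r) + I r" for r
 have c\<alpha>: "continuous_on {0..?T} \<alpha>" unfolding \<alpha>_def
  by (intro continuous_intros cI continuous_on_compose2[OF smooth_continuous[OF b, of UNIV]] path_y_continuous) auto
 have ig: "integrable (lebesgue_on {0..?T}) g" unfolding g_def
  using t0 by (intro b_integrable_add kernel_integrable(3)[OF kb, of t0] continuous_imp_integrable_real cI) auto
 have i\<alpha>: "integrable (lebesgue_on {0..?T}) \<alpha>" by (rule continuous_imp_integrable_real[OF c\<alpha>])
 have eq: "h t = h t0 + ((LINT r|leb t. \<alpha> r) - (LINT r|lebesgue_on {0..t0}. \<alpha> r))" if t: "t : {t0..?T}" for t
 proof -
  have "h t - h t0 = (LINT s|lebesgue_on {0..?T}. indicat_real {t0<..t} s *R g s)"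
   using LINT_increment[OF ig, of t0 t] t t0 hg[of t] hg[of t0] by simp
  also have "... = (LINT s|lebesgue_on {0..?T}. indicat_real {t0<..t} s *R \<alpha> s)"
   by (intro b_integral_cong) (auto simp: indicator_def g_def \<alpha>_def path_u_def)
  also have "... = (LINT r|leb t. \<alpha> r) - (LINT r|lebesgue_on {0..t0}. \<alpha> r)"
   using t t0 by (intro LINT_increment[symmetric] i\<alpha>) auto
  finally show ?thesis by simp
 qed
 have "((%t. LINT r|leb t. \<alpha> r) has_real_derivative \<alpha> t0) (at t0 within {0..?T})"
  using t0 by (intro has_real_derivative_LINT c\<alpha>) auto
 note der = this
 have "((%t. h t0 + ((LINT r|leb t. \<alpha> r) - (LINT r|lebesgue_on {0..t0}. \<alpha> r))) has_real_derivative \<alpha> t0) (at t0 within {t0..?T})"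
 proof -
  have d: "((%t. LINT r|leb t. \<alpha> r) has_real_derivative \<alpha> t0) (at t0 within {t0..?T})"
   by (rule DERIV_subset[OF der]) (use t0 in auto)
  from DERIV_add[OF DERIV_const[of "h t0"] DERIV_diff[OF d DERIV_const[of "LINT r|lebesgue_on {0..t0}. \<alpha> r"]]]
  show ?thesis by simp
 qed
 then have "(h has_real_derivative \<alpha> t0) (at t0 within {t0..?T})"
 proof (rule has_field_derivative_transform_within[where d=1])
  fix t assume "t : {t0..?T}"
  from eq[OF this, symmetric]
  show "h t0 + ((LINT r|leb t. \<alpha> r) - (LINT r|lebesgue_on {0..t0}. \<alpha> r)) = h t" .
 qed (use t0 in auto)
 moreover have "\<alpha> t0 = b (t0, t0, w, x) + I t0" by (simp add: \<alpha>_def path_before)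
 ultimately show ?thesis by (simp add: h_def[abs_def] I_def)
qed

lemma point_path_derivative:
 fixes a :: "real \<times> (real ^ 'm) \<times> (real ^ 'n) => real"
 assumes a: "smooth a" and t0: "t0 <= T"
 shows "((%t. a (t, w, path_y P t0 w x t)) has_real_derivative
  Dtau a (t0, w, x) + fd (%\<xi>. a (t0, w, \<xi>)) x (vel P t0 w x)) (at t0 within {t0..T})"
proof -
 let ?F = "vel P t0 w x"
 have "((%\<theta>. a ((0, w, x - t0 *R ?F) + \<theta> *R (1, 0, ?F))) has_vector_derivative
   fd a ((0, w, x - t0 *R ?F) + t0 *R (1, 0, ?F)) (1, 0, ?F)) (at t0)"
  by (rule smooth_line_derivative[OF a])
 then have "((%\<theta>. a (\<theta>, w, x - t0 *R ?F + \<theta> *R ?F)) has_real_derivative fd a (t0, w, x) (1, 0, ?F)) (at t0 within {t0..T})"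
  by (auto simp: has_real_derivative_iff_has_vector_derivative intro: has_vector_derivative_at_within)
 then have "((%t. a (t, w, path_y P t0 w x t)) has_real_derivative fd a (t0, w, x) (1, 0, ?F)) (at t0 within {t0..T})"
  by (rule has_field_derivative_transform_within[where d=1]) (use t0 in \<open>auto simp: path_y_def algebra_simps\<close>)
 moreover have "fd a (t0, w, x) (1, 0, ?F) = Dtau a (t0, w, x) + fd (%\<xi>. a (t0, w, \<xi>)) x ?F"
  using linear_add[OF linear_fd[OF a, of "(t0, w, x)"], of "(1, 0, 0)" "(0, 0, ?F)"]
  by (simp add: Dtau_eq_fd(1)[OF a] fd_partial[OF a] zero_prod_def)
 ultimately show ?thesis by simp
qed

lemma S_deriv_causal:
 fixes P :: "('m::finite, 'n::finite) ocp"
 shows "S_deriv P h h' ==> causal P h & causal P h'"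
proof (induction rule: S_deriv.induct)
 case (point a)
 have "(LINT s|leb t. Dtau (dyn P) (t, s, u s, y s)) = (LINT s|leb t. Dtau (dyn P) (t, s, u' s, y' s))"
  if "\<forall>s\<in>{0..t}. u s = u' s & y s = y' s" for t u y u' y'
  by (rule b_integral_cong) (use that in auto)
 note e = this
 show ?case unfolding causal_def by (intro conjI allI impI) (simp_all only: e)
next
 case (integral b)
 have "(LINT s|leb t. F (t, s, u s, y s)) = (LINT s|leb t. F (t, s, u' s, y' s))"
  if "\<forall>s\<in>{0..t}. u s = u' s & y s = y' s" for t u y u' y' and F :: "_ => real"
  by (rule b_integral_cong) (use that in auto)
 note e = this
 show ?case unfolding causal_def
 proof (intro conjI allI impI)
  fix t :: real and w x u y u' y'
  assume h: "\<forall>s\<in>{0..t}. u s = (u' s :: real ^ 'm) & y s = (y' s :: real ^ 'n)"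
  show "(LINT s|leb t. b (t, s, u s, y s)) = (LINT s|leb t. b (t, s, u' s, y' s))"
   by (rule e[OF h])
  show "b (t, t, w, x) + (LINT s|leb t. Dtau b (t, s, u s, y s)) =
    b (t, t, w, x) + (LINT s|leb t. Dtau b (t, s, u' s, y' s))"
   by (rule arg_cong[OF e[OF h]])
 qed
next
 case (add h h' k k')
 have "causal P (%t w x u y. h t w x u y + k t w x u y)" if "causal P h" "causal P k" for h k :: "('m, 'n) sfun"
  using that unfolding causal_def by (intro allI impI arg_cong2[of _ _ _ _ "(+)"]) blast+
 then show ?case using add by blast
next
 case (mult h h' k k')
 have p: "causal P (%t w x u y. h t w x u y * k t w x u y)" if "causal P h" "causal P k" for h k :: "('m, 'n) sfun"
  using that unfolding causal_def by (intro allI impI arg_cong2[of _ _ _ _ "(*)"]) blast+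
 have "causal P (%t w x u y. h t w x u y + k t w x u y)" if "causal P h" "causal P k" for h k :: "('m, 'n) sfun"
  using that unfolding causal_def by (intro allI impI arg_cong2[of _ _ _ _ "(+)"]) blast+
 from this[OF p p] p show ?case using mult by blast
next
 case (cong h h' k k')
 have "causal P k" if c: "causal P h" and e: "sfun_eq P h k" for h k
  unfolding causal_def
 proof (intro allI impI)
  fix t w x u y u' y'
  assume d: "sfun_dom P t u y" "sfun_dom P t u' y'" and s: "\<forall>s\<in>{0..t}. u s = u' s & y s = y' s"
  have "h t w x u y = h t w x u' y'" using c d s unfolding causal_def by blast
  moreover have "h t w x u y = k t w x u y" "h t w x u' y' = k t w x u' y'"
   using e d unfolding sfun_eq_def by blast+
  ultimately show "k t w x u y = k t w x u' y'" by simp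
 qed
 then show ?case using cong by blast
qed

text \<open>Right derivatives are unique, so this pins down whatever value the choice operator in
  \<open>D1\<close> selects, at least along the test paths.\<close>

lemma S_deriv_path:
 assumes "0 <= t0" "t0 < horizon P"
 shows "S_deriv P h h' ==> ((%t. h t w (path_y P t0 w x t) (path_u t0 w) (path_y P t0 w x)) has_real_derivative
   h' t0 w x (path_u t0 w) (path_y P t0 w x)) (at t0 within {t0..horizon P})"
proof (induction rule: S_deriv.induct)
 case (point a)
 have "(LINT s|lebesgue_on {0..t0}. Dtau (dyn P) (t0, s, path_u t0 w s, path_y P t0 w x s)) = (LINT s|lebesgue_on {0..t0}. Dtau (dyn P) (t0, s, 0, x))"
  by (rule b_integral_cong) (auto simp: path_before)
 then show ?case using point_path_derivative[OF point less_imp_le[OF assms(2)], of w P x] by (simp add: vel_def)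
next
 case (integral b)
 show ?case by (rule integral_path_derivative[OF integral assms])
next
 case (add h h' k k')
 show ?case by (rule DERIV_add[OF add.IH])
next
 case (mult h h' k k')
 have "path_y P t0 w x t0 = x" by (simp add: path_before)
 then show ?case using DERIV_mult[OF mult.IH] by (simp add: mult.commute)
next
 case (cong h h' k k')
 have d: "sfun_dom P t (path_u t0 w) (path_y P t0 w x)" if "t : {t0..horizon P}" for t
  using that assms by (intro sfun_dom_path) auto
 have "h' t0 w x (path_u t0 w) (path_y P t0 w x) = k' t0 w x (path_u t0 w) (path_y P t0 w x)"
  using cong.hyps(3) d[of t0] assms by (simp add: sfun_eq_def)
 moreover have "((%t. k t w (path_y P t0 w x t) (path_u t0 w) (path_y P t0 w x)) has_real_derivative
   h' t0 w x (path_u t0 w) (path_y P t0 w x)) (at t0 within {t0..horizon P})"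
  by (rule has_field_derivative_transform_within[OF cong.IH, where d=1])
   (use assms d cong.hyps(2) in \<open>auto simp: sfun_eq_def\<close>)
 ultimately show ?case by simp
qed

lemma fd_zero_imp_const:
 fixes q :: "real ^ 'm => real"
 assumes "smooth q" "!!x. grad q x = 0" shows "q x = q y"
proof -
 have "fd q x = (%_. 0)" for x
 proof
  fix h
  have "fd q x (axis j 1) = 0" for j using assms(2)[of x] by (simp add: grad_def vec_eq_iff)
  then have "fd q x b = 0" if "b : Basis" for b using that by (auto simp: Basis_vec_def)
  then show "fd q x h = 0" unfolding fd_basis[OF assms(1), of x h] by simp
 qed
 then have "!!x. (q has_derivative (%_. 0)) (at x)" using smooth_has_derivative[OF assms(1)] by metis
 then show ?thesis using has_derivative_zero_unique[of UNIV q x y] by auto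
qed

text \<open>A constraint numbered from \<open>nord1\<close> on has an order different from 1, hence
  at least 2, so its first derivative \<open>h'\<close> has zero gradient in the control. Along test
  paths \<open>h'\<close> is the chain rule expression, whose only term with the control is the one
  in the statement; a smooth function with zero gradient is constant.\<close>

lemma con_dyn_indep:
 fixes P :: "('m::finite, 'n::finite) ocp"
 assumes T: "horizon P > 0" and A0: "A0 P" and nb: "numbered_by_order P" and A2: "A2 P"
  and i: "i : {nord1 P..<ncon P}" and t: "t : {0..horizon P}"
 shows "fd (con P i) x (dyn P (t, t, w, x)) = fd (con P i) x (dyn P (t, t, 0, x))"
proof -
 have sc: "smooth (con P i)" and sd: "smooth (dyn P)" using A0 i by (auto simp: A0_def)
 obtain q where q: "has_order P i q" using A2 i by (auto simp: A2_def)
 have "q ~= 1" using nb i q by (auto simp: numbered_by_order_def)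
 then have "1 < q" using q by (auto simp: has_order_def)
 then have Du: "Du_vanishes P (gder P i 1)" using q by (auto simp: has_order_def)
 define h' where "h' = gder P i 1"
 have "smooth (%q::real \<times> (real ^ 'm) \<times> (real ^ 'n). con P i (snd (snd q)))"
  by (intro smooth_compose_linear[OF _ sc] bounded_linear_compose[OF bounded_linear_snd] bounded_linear_snd)
 from S_deriv.point[OF this, of P] have "EX h'. S_deriv P (%t w x u y. con P i x) h'" by auto
 then have Sd: "S_deriv P (%t w x u y. con P i x) h'"
  unfolding h'_def gder_def D1_def by (simp add: someI_ex)
 have main: "fd (con P i) x (dyn P (t0, t0, w, x)) = fd (con P i) x (dyn P (t0, t0, w', x))"
  if t0: "0 <= t0" "t0 < horizon P" for t0 w w'
 proof -
  let ?\<kappa> = "fd (con P i) x (LINT s|lebesgue_on {0..t0}. Dtau (dyn P) (t0, s, 0, x))"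
  \<comment> \<open>Up to time \<open>t0\<close> the path coincides with the constant pair
    \<open>(0, x)\<close>. By causality the derivative may be evaluated at this pair, which does not
    depend on \<open>w\<close>, and only then does the partial derivative in the control become
    accessible.\<close>
  have eq: "h' t0 w x (%_. 0) (%_. x) = fd (con P i) x (dyn P (t0, t0, w, x)) + ?\<kappa>" for w
  proof -
   have d1: "((%t. con P i (path_y P t0 w x t)) has_real_derivative h' t0 w x (path_u t0 w) (path_y P t0 w x)) (at t0 within {t0..horizon P})"
    using S_deriv_path[OF t0 Sd] by simp
   have "smooth (%q::real \<times> (real ^ 'm) \<times> (real ^ 'n). con P i (snd (snd q)))"
    by (intro smooth_compose_linear[OF _ sc] bounded_linear_compose[OF bounded_linear_snd] bounded_linear_snd)
   from point_path_derivative[OF this less_imp_le[OF t0(2)], of w P x]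
   have d2: "((%t. con P i (path_y P t0 w x t)) has_real_derivative fd (con P i) x (vel P t0 w x)) (at t0 within {t0..horizon P})"
    by (simp add: Dtau_def)
   have nb: "at t0 within {t0..horizon P} ~= bot" using t0 by (simp add: at_within_Icc_at_right trivial_limit_at_right_real)
   have "h' t0 w x (path_u t0 w) (path_y P t0 w x) = fd (con P i) x (vel P t0 w x)"
    using d1 d2 nb vector_derivative_unique_within unfolding has_real_derivative_iff_has_vector_derivative by blast
   also have "... = fd (con P i) x (dyn P (t0, t0, w, x)) + ?\<kappa>"
    unfolding vel_def by (rule linear_add[OF linear_fd[OF sc]])
   finally have 1: "h' t0 w x (path_u t0 w) (path_y P t0 w x) = fd (con P i) x (dyn P (t0, t0, w, x)) + ?\<kappa>" .
   have "(%_. x) : W1inf (horizon P)"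
    unfolding W1inf_def has_weak_deriv_def
    by (auto intro!: bexI[of _ "%_. 0"] continuous_imp_Linf)
   moreover have "(%_. 0) : Linf (horizon P)" by (intro continuous_imp_Linf continuous_intros)
   ultimately have "sfun_dom P t0 (%_. 0) (%_. x)" using t0 by (simp add: sfun_dom_def)
   moreover have "sfun_dom P t0 (path_u t0 w) (path_y P t0 w x)" using t0 by (intro sfun_dom_path) auto
   moreover have "\<forall>s\<in>{0..t0}. (%_. 0) s = path_u t0 w s & (%_. x) s = path_y P t0 w x s" by (simp add: path_before)
   ultimately have "h' t0 w x (%_. 0) (%_. x) = h' t0 w x (path_u t0 w) (path_y P t0 w x)"
    using S_deriv_causal[OF Sd] unfolding causal_def by blast
   then show ?thesis using 1 by simp
  qed
  define q where "q \<omega> = fd (con P i) x (dyn P (t0, t0, \<omega>, x)) + ?\<kappa>" for \<omega>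
  have dom: "sfun_dom P t0 (%_. 0) (%_. x)"
  proof -
   have "(%_. x) : W1inf (horizon P)"
    unfolding W1inf_def has_weak_deriv_def
    by (auto intro!: bexI[of _ "%_. 0"] continuous_imp_Linf)
   moreover have "(%_. 0) : Linf (horizon P)" by (intro continuous_imp_Linf continuous_intros)
   ultimately show ?thesis using t0 by (simp add: sfun_dom_def)
  qed
  have "grad q \<omega> = 0" for \<omega>
  proof -
   have "grad (%\<omega>. h' t0 \<omega> x (%_. 0) (%_. x)) \<omega> = 0"
    using Du dom unfolding Du_vanishes_def h'_def by blast
   moreover have "(%\<omega>. h' t0 \<omega> x (%_. 0) (%_. x)) = q" by (rule ext) (simp only: eq q_def)
   ultimately show ?thesis by simp
  qed
  moreover have "smooth q" unfolding q_def
  proof (intro smooth_add smooth_const smooth_linear_compose[OF bounded_linear_fd[OF sc]])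
   show "smooth (%\<omega>. dyn P (t0, t0, \<omega>, x))"
    using smooth_compose_affine[of "%\<omega>. (0, 0, \<omega>, 0)" "dyn P" "(t0, t0, 0, x)"] sd
    by (simp add: bounded_linear_Pair bounded_linear_zero bounded_linear_ident)
  qed
  ultimately have "q w = q w'" by (intro fd_zero_imp_const)
  then show ?thesis by (simp add: q_def)
 qed
 \<comment> \<open>Right derivatives exist only before the horizon; the final time is reached by
   continuity.\<close>
 define \<rho> where "\<rho> t = fd (con P i) x (dyn P (t, t, w, x)) - fd (con P i) x (dyn P (t, t, 0, x))" for t
 have c1: "continuous_on A (%t. dyn P (t, t, w, x))" for A w
  by (rule continuous_on_compose2[OF smooth_continuous[OF sd, of UNIV]]) (auto intro!: continuous_intros)
 have "continuous_on (closure {0..<horizon P}) \<rho>" unfolding \<rho>_def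
  by (intro continuous_intros bounded_linear.continuous_on[OF bounded_linear_fd[OF sc]] c1)
 then have "\<rho> t = 0"
  by (rule continuous_constant_on_closure) (use main[of _ w 0] t T in \<open>auto simp: \<rho>_def\<close>)
 then show ?thesis by (simp add: \<rho>_def)
qed

section \<open>Weakly convergent controls\<close>

definition weakly_converges :: "'x measure => (nat => 'x => 'b::euclidean_space) => ('x => 'b) => bool" where
 "weakly_converges M v w \<longleftrightarrow> (ALL k. sqint M (v k)) & sqint M w & (EX B. ALL k. ip M (v k) (v k) <= B) &
   (ALL h. sqint M h --> (%k. ip M (v k) h) ~~> ip M w h)"

lemma bounded_sqint:
 assumes "finite_measure M" "f : borel_measurable M" "AE x in M. norm (f x) <= C" shows "sqint M f"
proof -
 have "integrable M (%x. (norm (f x))\<^sup>2)"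
  by (rule b_integrable_bound[OF finite_measure.integrable_const[OF assms(1), of "C\<^sup>2"]])
   (use assms in \<open>auto elim!: eventually_mono intro!: power_mono\<close>)
 then show ?thesis using assms by (simp add: sqint_def)
qed

text \<open>Bounded pointwise convergence on a finite measure space is strong convergence in L2, and
  the pairing of weakly and strongly convergent sequences converges.\<close>

lemma weak_strong_ip:
 assumes fin: "finite_measure M" and v: "weakly_converges M v w"
  and B: "!!k. b k : borel_measurable M" "bl : borel_measurable M"
  and bd: "!!k. AE x in M. norm (b k x) <= C" and lim: "AE x in M. (%k. b k x) ~~> bl x"
 shows "(%k. ip M (v k) (b k)) ~~> ip M w bl"
proof -
 obtain D where D: "!!k. ip M (v k) (v k) <= D" and sv: "!!k. sqint M (v k)" and sw: "sqint M w"
  and wk: "!!h. sqint M h ==> (%k. ip M (v k) h) ~~> ip M w h"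
  using v unfolding weakly_converges_def by blast
 have "AE x in M. ALL k. norm (b k x) <= C" using bd by (simp add: AE_all_countable)
 then have bdl: "AE x in M. norm (bl x) <= C"
  using lim by eventually_elim (rule Lim_bounded[OF tendsto_norm], auto)
 have sb: "sqint M (b k)" for k by (rule bounded_sqint[OF fin B(1) bd])
 have sl: "sqint M bl" by (rule bounded_sqint[OF fin B(2) bdl])
 have z: "(%k. ip M (%x. b k x - bl x) (%x. b k x - bl x)) ~~> 0"
 proof -
  have "(%k. LINT x|M. (norm (b k x - bl x))\<^sup>2) ~~> (LINT x|M. 0)"
  proof (rule integral_dominated_convergence[where w="%_. (2 * C)\<^sup>2"])
   show "AE x in M. (%k. (norm (b k x - bl x))\<^sup>2) ~~> 0"
    using lim by eventually_elim (auto intro!: tendsto_eq_intros)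
   show "AE x in M. norm ((norm (b k x - bl x))\<^sup>2) <= (2 * C)\<^sup>2" for k
    using bd[of k] bdl
   proof eventually_elim
    case (elim x)
    have "norm (b k x - bl x) <= 2 * C" using elim norm_triangle_ineq4[of "b k x" "bl x"] by simp
    from power_mono[OF this norm_ge_zero, of 2] show ?case by simp
   qed
  qed (use B finite_measure.integrable_const[OF fin] in auto)
  then show ?thesis by (simp add: ip_self)
 qed
 have "(%k. ip M (v k) (%x. b k x - bl x)) ~~> 0"
 proof (rule tendsto_rabs_zero_cancel, rule tendsto_sandwich)
  show "\<forall>\<^sub>F k in sequentially. 0 <= \<bar>ip M (v k) (%x. b k x - bl x)\<bar>" by simp
  show "\<forall>\<^sub>F k in sequentially. \<bar>ip M (v k) (%x. b k x - bl x)\<bar> <= sqrt D * sqrt (ip M (%x. b k x - bl x) (%x. b k x - bl x))"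
   by (intro always_eventually allI ip_bounded sv D sqint_diff sb sl)
  show "(%k. sqrt D * sqrt (ip M (%x. b k x - bl x) (%x. b k x - bl x))) ~~> 0"
   using tendsto_mult_left[OF tendsto_real_sqrt[OF z], of "sqrt D"] by simp
 qed simp
 from tendsto_add[OF this wk[OF sl]]
 have "(%k. ip M (v k) (%x. b k x - bl x) + ip M (v k) bl) ~~> ip M w bl" by simp
 moreover have "ip M (v k) (%x. b k x - bl x) + ip M (v k) bl = ip M (v k) (b k)" for k
  by (simp add: ip_commute[of _ "v k"] ip_diff sb sl sv)
 ultimately show ?thesis by simp
qed

lemma indicator_Icc_tendsto:
 assumes "t ~~> \<tau>" "(s::real) ~= \<tau>"
 shows "(%k. indicat_real {0..t k} s) ~~> indicat_real {0..\<tau>} s"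
proof (rule tendsto_eventually, cases "s < \<tau>")
 case True
 then have "\<forall>\<^sub>F k in sequentially. s < t k" by (rule order_tendstoD(1)[OF assms(1)])
 then show "\<forall>\<^sub>F k in sequentially. indicat_real {0..t k} s = indicat_real {0..\<tau>} s"
  by eventually_elim (use True in \<open>auto simp: indicator_def\<close>)
next
 case False
 then have "\<forall>\<^sub>F k in sequentially. t k < s" using assms(2) by (intro order_tendstoD(2)[OF assms(1)]) auto
 then show "\<forall>\<^sub>F k in sequentially. indicat_real {0..t k} s = indicat_real {0..\<tau>} s"
  by eventually_elim (use False assms(2) in \<open>auto simp: indicator_def\<close>)
qed

lemma linear_lin_kernel: "smooth k ==> linear (%h. lin_kernel k (t, s, x, h))"
 for k :: "real \<times> real \<times> 'x::euclidean_space => 'b::real_normed_vector"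
 unfolding lin_kernel_def
 using linear_compose[OF _ linear_fd, of "%h. (0, 0, h)" k "(t, s, x)"]
 by (simp add: o_def linear_iff)

text \<open>This is the regularizing effect of the integral. The linear integrand splits into a
  state part, treated by dominated convergence, and a control part, which is a pairing of the weakly
  convergent controls with bounded functions that converge pointwise.\<close>

lemma weak_lin_kernel_tendsto:
 fixes F :: "real \<times> real \<times> ('u::euclidean_space \<times> 'y::euclidean_space) => 'b::euclidean_space"
 assumes F: "smooth F" and X: "X : Linf T"
  and v: "weakly_converges (leb T) v w"
  and Z: "!!k. Z k : borel_measurable (leb T)" "Zl : borel_measurable (leb T)"
   "!!k t. t : {0..T} ==> norm (Z k t) <= D" "!!t. t : {0..T} ==> (%k. Z k t) ~~> Zl t"
  and t: "!!k. t k : {0..T}" "\<tau> : {0..T}" "t ~~> \<tau>"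
 shows "(%k. LINT r|lebesgue_on {0..t k}. lin_kernel F (t k, r, X r, (v k r, Z k r))) ~~>
   (LINT r|lebesgue_on {0..\<tau>}. lin_kernel F (\<tau>, r, X r, (w r, Zl r)))"
proof -
 let ?M = "leb T"
 obtain R where Xm: "X : borel_measurable ?M" and XR: "AE s in ?M. norm (X s) <= R"
  using X unfolding Linf_iff by blast
 have sv: "!!k. sqint ?M (v k)" and sw: "sqint ?M w" using v by (auto simp: weakly_converges_def)
 have Zli: "norm (Zl t) <= D" if "t : {0..T}" for t
  by (rule Lim_bounded[OF tendsto_norm[OF Z(4)[OF that]]]) (use Z(3)[OF that] in auto)
 have iZ: "integrable ?M z" if "z : borel_measurable ?M" "!!t. t : {0..T} ==> norm (z t) <= D" for z :: "real => 'y"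
  by (rule sqint_integrable[OF finite_measure_Icc bounded_sqint[OF finite_measure_Icc that(1), where C=D]]) (use that(2) in \<open>auto intro!: AE_I2\<close>)
 have iv: "integrable ?M h" if "sqint ?M h" for h :: "real => 'u" by (rule sqint_integrable[OF finite_measure_Icc that])
 have ik: "integrable (leb r) (%s. lin_kernel F (r, s, X s, H s))"
  and im: "(%s. lin_kernel F (r, s, X s, H s)) : borel_measurable ?M"
  if H: "integrable ?M H" and r: "r : {0..T}" for H r
 proof -
  obtain C where "kernel_bound T (lin_kernel F) (%s. (X s, H s)) (%s. C * norm (H s))"
   using kernel_bound_linear[OF F Xm XR H] by blast
  from kernel_integrable(1)[OF this r] show "integrable (leb r) (%s. lin_kernel F (r, s, X s, H s))"
   "(%s. lin_kernel F (r, s, X s, H s)) : borel_measurable ?M"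
   using r by (auto intro: integrable_sub)
 qed
 have iP1: "integrable ?M (%r. (h r, 0 :: 'y))" if "sqint ?M h" for h :: "real => 'u"
  using integrable_bounded_linear[OF bounded_linear_Pair[OF bounded_linear_ident bounded_linear_zero] iv[OF that]] .
 have iP2: "integrable ?M (%r. (0 :: 'u, z r))" if "integrable ?M z" for z :: "real => 'y"
  using integrable_bounded_linear[OF bounded_linear_Pair[OF bounded_linear_zero bounded_linear_ident] that] .
 obtain C where C: "C >= 0" "!!t s x h. norm (t, s, x) <= 2 * T + R ==> norm (lin_kernel F (t, s, x, h)) <= C * norm h"
  using lin_kernel_bound[OF F] by metis
 have split: "(LINT r|lebesgue_on {0..\<sigma>}. lin_kernel F (\<sigma>, r, X r, (h r, z r))) =
   (LINT r|lebesgue_on {0..\<sigma>}. lin_kernel F (\<sigma>, r, X r, (h r, 0))) + (LINT r|lebesgue_on {0..\<sigma>}. lin_kernel F (\<sigma>, r, X r, (0, z r)))"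
  if "sqint ?M h" "integrable ?M z" "\<sigma> : {0..T}" for h z \<sigma>
 proof -
  have "lin_kernel F (\<sigma>, r, X r, (h r, z r)) = lin_kernel F (\<sigma>, r, X r, (h r, 0)) + lin_kernel F (\<sigma>, r, X r, (0, z r))" for r
   using linear_add[OF linear_lin_kernel[OF F, of \<sigma> r "X r"], of "(h r, 0)" "(0, z r)"] by simp
  then show ?thesis using ik[OF iP1[OF that(1)] that(3)] ik[OF iP2[OF that(2)] that(3)] by simp
 qed
 have cF: "isCont (%t. lin_kernel F (t, r, x, h)) \<sigma>" for r x h \<sigma>
 proof -
  have "continuous_on UNIV (%t. lin_kernel F (t, r, x, h))"
   by (rule continuous_on_compose2[OF smooth_continuous[OF smooth_lin_kernel[OF F], of UNIV]]) (auto intro!: continuous_intros)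
  then show ?thesis by (simp add: continuous_on_eq_continuous_at)
 qed
 have jc: "(%k. lin_kernel F (t k, r, x, h k)) ~~> lin_kernel F (\<tau>, r, x, hl)" if "h ~~> hl" for r x h hl
 proof (rule continuous_on_tendsto_compose[OF smooth_continuous[OF smooth_lin_kernel[OF F], of UNIV]])
  show "(%k. (t k, r, x, h k)) ~~> (\<tau>, r, x, hl)" by (intro tendsto_intros t that)
 qed auto
 have bdAE: "AE r in ?M. ALL h. norm (lin_kernel F (t k, r, X r, h)) <= C * norm h" for k
  using AE_time_bound[OF XR] by eventually_elim (use C(2) t(1) in blast)
 have A: "(%k. LINT r|lebesgue_on {0..t k}. lin_kernel F (t k, r, X r, (0, Z k r))) ~~>
   (LINT r|lebesgue_on {0..\<tau>}. lin_kernel F (\<tau>, r, X r, (0, Zl r)))"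
 proof (rule volterra_tendsto[where T=T and \<beta>="%_. C * D"])
  show "AE r in ?M. norm (lin_kernel F (t k, r, X r, (0, Z k r))) <= C * D" for k
   using bdAE[of k] AE_space
  proof eventually_elim
   case (elim r)
   have "norm (lin_kernel F (t k, r, X r, (0, Z k r))) <= C * norm (0 :: 'u, Z k r)" using elim(1) by blast
   also have "... = C * norm (Z k r)" by (simp add: norm_Pair2)
   also have "... <= C * D" using elim Z(3) C(1) by (intro mult_left_mono) auto
   finally show ?case .
  qed
  show "AE r in ?M. (%k. lin_kernel F (t k, r, X r, (0, Z k r))) ~~> lin_kernel F (\<tau>, r, X r, (0, Zl r))"
   using AE_space by eventually_elim (auto intro!: jc tendsto_Pair Z)
 qed (use t im[OF iP2[OF iZ[OF Z(1,3)]]] im[OF iP2[OF iZ[OF Z(2) Zli]]] in \<open>auto simp: integrable_const_Icc\<close>)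
 have B: "(%k. LINT r|lebesgue_on {0..t k}. lin_kernel F (t k, r, X r, (v k r, 0))) ~~>
   (LINT r|lebesgue_on {0..\<tau>}. lin_kernel F (\<tau>, r, X r, (w r, 0)))"
 proof (subst tendsto_componentwise_iff, intro ballI)
  fix b :: 'b assume b: "b : Basis"
  \<comment> \<open>Represents component \<open>b\<close> of the Volterra integral as an inner
    product with the control; the indicator of the moving interval is absorbed into it.\<close>
  define bb where "bb \<sigma> r = indicat_real {0..\<sigma>} r *R (\<Sum>e\<in>Basis. (lin_kernel F (\<sigma>, r, X r, (e, 0)) \<bullet> b) *R e)" for \<sigma> r
  have bm: "bb \<sigma> : borel_measurable ?M" if "\<sigma> : {0..T}" for \<sigma>
  proof -
   have "(%r. lin_kernel F (\<sigma>, r, X r, (e, 0))) : borel_measurable ?M" for e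
    by (rule im[OF _ that]) (rule integrable_const_Icc)
   then show ?thesis unfolding bb_def
    by (intro borel_measurable_scaleR borel_measurable_sum borel_measurable_inner indicator_measurable_Icc) auto
  qed
  have eq: "(LINT r|lebesgue_on {0..\<sigma>}. lin_kernel F (\<sigma>, r, X r, (h r, 0))) \<bullet> b = ip ?M h (bb \<sigma>)"
   if h: "sqint ?M h" and \<sigma>: "\<sigma> : {0..T}" for h \<sigma>
  proof -
   have i: "integrable ?M (%r. indicat_real {0..\<sigma>} r *R lin_kernel F (\<sigma>, r, X r, (h r, 0)))"
   proof (rule integrable_indicator_mult)
    obtain C where "kernel_bound T (lin_kernel F) (%s. (X s, (h s, 0 :: 'y))) (%s. C * norm (h s, 0 :: 'y))"
    using kernel_bound_linear[OF F Xm XR iP1[OF h]] by blast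
    from kernel_integrable(1)[OF this \<sigma>] show "integrable ?M (%r. lin_kernel F (\<sigma>, r, X r, (h r, 0)))" .
   qed simp
   have "(LINT r|lebesgue_on {0..\<sigma>}. lin_kernel F (\<sigma>, r, X r, (h r, 0))) \<bullet> b =
    (LINT r|?M. indicat_real {0..\<sigma>} r *R lin_kernel F (\<sigma>, r, X r, (h r, 0))) \<bullet> b"
    using \<sigma> by (subst LINT_sub[of \<sigma> T]) auto
   also have "... = (LINT r|?M. (indicat_real {0..\<sigma>} r *R lin_kernel F (\<sigma>, r, X r, (h r, 0))) \<bullet> b)"
    by (rule integral_inner_left[symmetric]) (use i in simp)
   also have "... = (LINT r|?M. h r \<bullet> bb \<sigma> r)"
   proof (rule b_integral_cong[OF refl])
    fix r
    have l: "linear (%e. lin_kernel F (\<sigma>, r, X r, (e, 0 :: 'y)))"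
    using linear_compose[OF _ linear_lin_kernel[OF F, of \<sigma> r "X r"], of "%e. (e, 0)"] by (simp add: o_def linear_iff)
    have "lin_kernel F (\<sigma>, r, X r, (h r, 0)) \<bullet> b = (\<Sum>e\<in>Basis. (h r \<bullet> e) * (lin_kernel F (\<sigma>, r, X r, (e, 0)) \<bullet> b))"
    by (subst linear_basis_expansion[OF l]) (simp add: inner_sum_left)
    also have "... = h r \<bullet> (\<Sum>e\<in>Basis. (lin_kernel F (\<sigma>, r, X r, (e, 0)) \<bullet> b) *R e)"
    by (simp add: inner_sum_right mult.commute)
    finally show "(indicat_real {0..\<sigma>} r *R lin_kernel F (\<sigma>, r, X r, (h r, 0))) \<bullet> b = h r \<bullet> bb \<sigma> r"
    by (simp add: bb_def)
   qed
   finally show ?thesis by (simp add: ip_def)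
  qed
  have "(%k. ip ?M (v k) (bb (t k))) ~~> ip ?M w (bb \<tau>)"
  proof (rule weak_strong_ip[OF finite_measure_Icc v])
   show "AE r in ?M. norm (bb (t k) r) <= (\<Sum>e\<in>(Basis::'u set). C)" for k
    using bdAE[of k]
   proof eventually_elim
    case (elim r)
    have "norm (\<Sum>e\<in>Basis. (lin_kernel F (t k, r, X r, (e, 0)) \<bullet> b) *R (e::'u)) <= (\<Sum>e\<in>(Basis::'u set). C)"
    proof (rule sum_norm_le)
    fix e :: 'u assume e: "e : Basis"
    have "\<bar>lin_kernel F (t k, r, X r, (e, 0)) \<bullet> b\<bar> <= norm (lin_kernel F (t k, r, X r, (e, 0)))"
    using b by (rule Basis_le_norm)
    also have "... <= C * norm (e, 0 :: 'y)" using elim by blast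
    finally show "norm ((lin_kernel F (t k, r, X r, (e, 0)) \<bullet> b) *R e) <= C" using e by simp
    qed
    moreover have "0 <= (\<Sum>e\<in>(Basis::'u set). C)" using C(1) by (simp add: sum_nonneg)
    ultimately show ?case by (auto simp: bb_def indicator_def)
   qed
   show "AE r in ?M. (%k. bb (t k) r) ~~> bb \<tau> r"
    using AE_neq_lebesgue_on[where T=T and t=\<tau>]
    by eventually_elim (auto simp: bb_def intro!: tendsto_intros jc indicator_Icc_tendsto t)
  qed (use bm t in auto)
  then show "(%k. (LINT r|lebesgue_on {0..t k}. lin_kernel F (t k, r, X r, (v k r, 0))) \<bullet> b) ~~>
    (LINT r|lebesgue_on {0..\<tau>}. lin_kernel F (\<tau>, r, X r, (w r, 0))) \<bullet> b"
   using eq[OF sv t(1)] eq[OF sw t(2)] by simp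
 qed
 show ?thesis
  using tendsto_add[OF B A] split[OF sv iZ[OF Z(1,3)] t(1)] split[OF sw iZ[OF Z(2) Zli] t(2)] by simp
qed

lemma LINT_point: "(LINT s|lebesgue_on {0..0::real}. F s) = (0 :: 'b::euclidean_space)"
proof (rule integral_eq_zero_AE)
 show "AE s in lebesgue_on {0..0::real}. F s = 0"
  using AE_neq_lebesgue_on[where T=0 and t=0] AE_space by eventually_elim auto
qed

section \<open>States and linearized states\<close>

locale control_problem =
 fixes P :: "('m::finite, 'n::finite) ocp"
 assumes T_pos: "horizon P > 0" and A0: "A0 P"
begin

abbreviation "T \<equiv> horizon P"
abbreviation "f \<equiv> dyn P"
abbreviation "M \<equiv> lebesgue_on {0..horizon P}"

lemma smooth_f: "smooth f" using A0 by (simp add: A0_def)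
lemma smooth_con: "i < ncon P ==> smooth (con P i)" using A0 by (simp add: A0_def)

text \<open>The part of the time derivative of a state that stems from the past. It is continuous in
  time, whereas the remaining part \<open>f (t, t, u t, y t)\<close> is only measurable.\<close>

definition memory :: "(real => (real ^ 'm)) => (real => (real ^ 'n)) => real => (real ^ 'n)" where
 "memory u y t = (LINT s|leb t. Dtau f (t, s, u s, y s))"

definition memory_lin :: "(real => (real ^ 'm)) => (real => (real ^ 'n)) => (real => (real ^ 'm)) => (real => (real ^ 'n)) => real => (real ^ 'n)" where
 "memory_lin u y v z t = (LINT s|leb t. lin_kernel (Dtau f) (t, s, (u s, y s), (v s, z s)))"

lemma traj:
 assumes "trajectory P u y"
 shows "u : Linf T" "cont T y" "(%s. (u s, y s)) : Linf T"
  "cont T (memory u y)"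
  "!!t. t : {0..T} ==> y t = y 0 + (LINT s|leb t. f (t, s, u s, y s))"
  "!!t. t : {0..T} ==> y t = y 0 + (LINT s|leb t. f (s, s, u s, y s) + memory u y s)"
  "sqint M (%s. f (s, s, u s, y s) + memory u y s)"
  "!!F t. smooth F ==> t : {0..T} ==> integrable M (%s. (F :: _ => real ^ 'n) (t, s, u s, y s))"
proof -
 show u: "u : Linf T" and y: "cont T y" using assms by (auto simp: trajectory_def W1inf_continuous)
 show L: "(%s. (u s, y s)) : Linf T" by (rule Linf_Pair[OF u continuous_imp_Linf[OF y]])
 then obtain R where X: "(%s. (u s, y s)) : borel_measurable M" "AE s in M. norm (u s, y s) <= R"
  unfolding Linf_iff by blast
 obtain C where kb: "kernel_bound T f (%s. (u s, y s)) (%_. C)" using kernel_bound_bounded[OF smooth_f X] by blast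
 show c: "cont T (memory u y)"
  using kernel_integral_continuous(2)[OF kb] by (simp add: memory_def[abs_def])
 show e: "!!t. t : {0..T} ==> y t = y 0 + (LINT s|leb t. f (t, s, u s, y s))"
  using assms unfolding trajectory_def by blast
 show "y t = y 0 + (LINT s|leb t. f (s, s, u s, y s) + memory u y s)" if "t : {0..T}" for t
  unfolding memory_def volterra_weak_derivative[OF kb that, symmetric] by (rule e[OF that])
 have "sqint M (%s. f (s, s, u s, y s))"
 proof (rule bounded_sqint[OF finite_measure_Icc, where C=C])
  show "(%s. f (s, s, u s, y s)) : borel_measurable M" by (rule kernel_measurable(2)[OF smooth_f X(1)]) simp
  have "AE s in M. \<forall>r\<in>{0..T}. norm (f (r, s, u s, y s)) <= C & norm (Dtau f (r, s, u s, y s)) <= C"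
   using kb by (simp add: kernel_bound_def)
  then show "AE s in M. norm (f (s, s, u s, y s)) <= C" using AE_space by eventually_elim auto
 qed
 then show "sqint M (%s. f (s, s, u s, y s) + memory u y s)"
  by (intro sqint_add Linf_sqint[OF continuous_imp_Linf[OF c]])
 fix F :: "real \<times> real \<times> (real ^ 'm) \<times> (real ^ 'n) => real ^ 'n" and t assume F: "smooth F" and t: "t : {0..T}"
 obtain C where "kernel_bound T F (%s. (u s, y s)) (%_. C)" using kernel_bound_bounded[OF F X] by blast
 from kernel_integrable(1)[OF this t] show "integrable M (%s. F (t, s, u s, y s))" .
qed

text \<open>The linearized equation as a relation on continuous functions, which separates its
  analysis from the choice operator in \<open>lin_state\<close>.\<close>

definition zlin :: "(real => (real ^ 'm)) => (real => (real ^ 'n)) => (real => (real ^ 'm)) => (real ^ 'n) => (real => (real ^ 'n)) => bool" where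
 "zlin u y v z0 z \<longleftrightarrow> cont T z &
   (\<forall>t\<in>{0..T}. z t = z0 + (LINT s|leb t. lin_kernel f (t, s, (u s, y s), (v s, z s))))"

lemma integrable_control_state:
 fixes v :: "real => real ^ 'm" and z :: "real => real ^ 'n"
 assumes v: "sqint M v" and z: "cont T z"
 shows "sqint M (%s. (v s, z s))" "integrable M (%s. (v s, z s))"
proof -
 have sz: "sqint M z" by (rule Linf_sqint[OF continuous_imp_Linf[OF z]])
 show sq: "sqint M (%s. (v s, z s))" using v sz by (auto simp: sqint_def norm_Pair intro!: borel_measurable_Pair)
 show "integrable M (%s. (v s, z s))" by (rule sqint_integrable[OF finite_measure_Icc sq])
qed

lemma zlin_exists:
 assumes tr: "trajectory P u y" and v: "sqint M v"
 obtains z where "zlin u y v z0 z"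
proof -
 obtain R where X: "(%s. (u s, y s)) : borel_measurable M" "AE s in M. norm (u s, y s) <= R"
  using traj(3)[OF tr] unfolding Linf_iff by blast
 note iH = integrable_control_state(2)[OF v]
 define Kf where "Kf t s z = lin_kernel f (t, s, (u s, y s), (v s, z))" for t s z
 have kb: "EX C. kernel_bound T (lin_kernel f) (%s. ((u s, y s), (v s, z s))) (%s. C * norm (v s, z s))"
  if "cont T z" for z
  using kernel_bound_linear[OF smooth_f X iH[OF that]] by metis
 obtain C where C: "C >= 0" "!!t s x h. norm (t, s, x) <= 2 * T + R ==> norm (lin_kernel f (t, s, x, h)) <= C * norm h"
  using lin_kernel_bound[OF smooth_f] by metis
 have h1: "cont T (%t. LINT s|leb t. Kf t s (z s))" if c: "cont T z" for z
 proof -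
  obtain C where k: "kernel_bound T (lin_kernel f) (%s. ((u s, y s), (v s, z s))) (%s. C * norm (v s, z s))" using kb[OF c] by blast
  show ?thesis unfolding Kf_def by (rule kernel_integral_continuous(1)[OF k])
 qed
 have h2: "integrable (leb t) (%s. Kf t s (z s))" if c: "cont T z" and t: "t : {0..T}" for z t
 proof -
  obtain C where k: "kernel_bound T (lin_kernel f) (%s. ((u s, y s), (v s, z s))) (%s. C * norm (v s, z s))" using kb[OF c] by blast
  show ?thesis unfolding Kf_def using t by (intro integrable_sub[OF kernel_integrable(1)[OF k t]]) auto
 qed
 have h3: "AE s in M. ALL z z'. norm (Kf t s z - Kf t s z') <= C * norm (z - z')" if t: "t : {0..T}" for t
  using AE_time_bound[OF X(2)]
 proof eventually_elim
  case (elim s)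
  have "Kf t s z - Kf t s z' = lin_kernel f (t, s, (u s, y s), (0, z - z'))" for z z'
   unfolding Kf_def using linear_diff[OF linear_lin_kernel[OF smooth_f], of t s "(u s, y s)" "(v s, z)" "(v s, z')"] by simp
  then show ?case using C(2)[of t s "(u s, y s)" "(0, _)"] elim t by (simp add: norm_Pair2)
 qed
 obtain z where z: "cont T z" "!!t. t : {0..T} ==> z t = z0 + (LINT s|leb t. Kf t s (z s))"
  using volterra_exists[OF less_imp_le[OF T_pos] h1 h2 h3, of z0] by blast
 then show thesis by (intro that[of z]) (simp add: zlin_def Kf_def)
qed

lemma zlin_weak_derivative:
 assumes tr: "trajectory P u y" and v: "sqint M v" and zl: "zlin u y v z0 z"
 shows "z 0 = z0" "cont T (memory_lin u y v z)"
  "!!t. t : {0..T} ==> z t = z 0 + (LINT s|leb t. lin_kernel f (s, s, (u s, y s), (v s, z s)) + memory_lin u y v z s)"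
  "sqint M (%s. lin_kernel f (s, s, (u s, y s), (v s, z s)) + memory_lin u y v z s)"
proof -
 obtain R where X: "(%s. (u s, y s)) : borel_measurable M" "AE s in M. norm (u s, y s) <= R"
  using traj(3)[OF tr] unfolding Linf_iff by blast
 have z: "cont T z" "!!t. t : {0..T} ==> z t = z0 + (LINT s|leb t. lin_kernel f (t, s, (u s, y s), (v s, z s)))"
  using zl unfolding zlin_def by blast+
 obtain C where C: "C >= 0" "!!t s x h. norm (t, s, x) <= 2 * T + R ==> norm (lin_kernel f (t, s, x, h)) <= C * norm h"
  using lin_kernel_bound[OF smooth_f] by metis
 obtain C' where k: "kernel_bound T (lin_kernel f) (%s. ((u s, y s), (v s, z s))) (%s. C' * norm (v s, z s))"
  using kernel_bound_linear[OF smooth_f X integrable_control_state(2)[OF v z(1)]] by blast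
 have ml: "(%r. LINT s|leb r. Dtau (lin_kernel f) (r, s, (u s, y s), (v s, z s))) = memory_lin u y v z"
  by (simp add: memory_lin_def fun_eq_iff Dtau_lin_kernel[OF smooth_f])
 show cm: "cont T (memory_lin u y v z)" using kernel_integral_continuous(2)[OF k] unfolding ml .
 show z0: "z 0 = z0" using z(2)[of 0] T_pos by (simp add: LINT_point[simplified])
 show "z t = z 0 + (LINT s|leb t. lin_kernel f (s, s, (u s, y s), (v s, z s)) + memory_lin u y v z s)" if "t : {0..T}" for t
  unfolding z0 ml[symmetric] volterra_weak_derivative[OF k that, symmetric] by (rule z(2)[OF that])
 have sH: "sqint M (%s. (v s, z s))" by (rule integrable_control_state(1)[OF v z(1)])
 show "sqint M (%s. lin_kernel f (s, s, (u s, y s), (v s, z s)) + memory_lin u y v z s)"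
 proof (rule sqint_add[OF _ Linf_sqint[OF continuous_imp_Linf[OF cm]]])
  show "sqint M (%r. lin_kernel f (r, r, (u r, y r), v r, z r))"
   unfolding sqint_def
  proof
   show m: "(%r. lin_kernel f (r, r, (u r, y r), v r, z r)) : borel_measurable M"
    using kernel_integrable(3)[OF k, of 0] T_pos by auto
   have "integrable M (%s. C\<^sup>2 * (norm (v s, z s))\<^sup>2)" using sH by (simp add: sqint_def)
   then show "integrable M (%r. (norm (lin_kernel f (r, r, (u r, y r), v r, z r)))\<^sup>2)"
   proof (rule b_integrable_bound)
    show "AE r in M. norm ((norm (lin_kernel f (r, r, (u r, y r), v r, z r)))\<^sup>2) <= norm (C\<^sup>2 * (norm (v r, z r))\<^sup>2)"
    using AE_time_bound[OF X(2)] AE_space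
    proof eventually_elim
    case (elim r)
    then have "norm (lin_kernel f (r, r, (u r, y r), v r, z r)) <= C * norm (v r, z r)" by (intro C(2)) auto
    then have "(norm (lin_kernel f (r, r, (u r, y r), v r, z r)))\<^sup>2 <= (C * norm (v r, z r))\<^sup>2" by (rule power_mono) simp
    then show ?case by (simp add: power_mult_distrib)
    qed
   qed (use m in auto)
  qed
 qed
qed

lemma lin_state_exists:
 assumes tr: "trajectory P u y" and v: "sqint M v"
 obtains z where "z : W12 T" "\<forall>t\<in>{0..T}. z t = z0 + (LINT s|leb t. fd (%x. f (t, s, x)) (u s, y s) (v s, z s))"
proof -
 obtain z where z: "zlin u y v z0 z" using zlin_exists[OF tr v] by blast
 note w = zlin_weak_derivative[OF tr v z]
 have "has_weak_deriv T z (%s. lin_kernel f (s, s, (u s, y s), (v s, z s)) + memory_lin u y v z s)"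
  unfolding has_weak_deriv_def by (intro conjI ballI sqint_integrable[OF finite_measure_Icc w(4)] w(3))
 then have "z : W12 T" unfolding W12_def using w(4) L2_iff_sqint by blast
 moreover have "\<forall>t\<in>{0..T}. z t = z0 + (LINT s|leb t. fd (%x. f (t, s, x)) (u s, y s) (v s, z s))"
  using z by (simp add: zlin_def lin_kernel_def fd_partial[OF smooth_f])
 ultimately show thesis by (rule that)
qed

lemma zlin_lin_state:
 assumes tr: "trajectory P u y" and v: "sqint M v" shows "zlin u y v z0 (lin_state P u y v z0)"
proof -
 let ?Q = "%z. z : W12 T & (\<forall>t\<in>{0..T}. z t = z0 + (LINT s|leb t. fd (%x. f (t, s, x)) (u s, y s) (v s, z s)))"
 have "EX z. ?Q z" by (rule lin_state_exists[OF tr v, of z0], rule exI, rule conjI)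
 then have "?Q (lin_state P u y v z0)" unfolding lin_state_def by (rule someI_ex)
 then show ?thesis
  unfolding zlin_def W12_def by (auto intro: has_weak_deriv_continuous simp: lin_kernel_def fd_partial[OF smooth_f])
qed

end

lemma vector_derivative_unique_at:
 "(F has_vector_derivative a) (at x) ==> (F has_vector_derivative b) (at x) ==> a = (b :: 'b::real_normed_vector)"
 by (metis vector_derivative_at)

lemma fd_pair:
 fixes g :: "'a::euclidean_space => 'b::real_normed_vector"
 assumes g: "smooth g" shows "fd (%(x, h). fd g x h) (x, h) (a, b) = D2v g x h a + fd g x b"
proof -
 let ?G = "%(x, h). fd g x h"
 have sG: "smooth ?G" by (rule smooth_fd_pair[OF g])
 have "((%\<theta>. fd g (x + \<theta> *R a) h) has_vector_derivative fd ?G (x, h) (a, 0)) (at 0)"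
  using smooth_line_derivative[OF sG, of "(x, h)" "(a, 0)" 0] by simp
 moreover have "((%\<theta>. fd g (x + \<theta> *R a) h) has_vector_derivative D2v g x h a) (at 0)"
  using smooth_line_derivative[OF smooth_fd[OF g, of h], of x a 0] by (simp add: D2v_def)
 ultimately have 1: "fd ?G (x, h) (a, 0) = D2v g x h a" by (rule vector_derivative_unique_at)
 have "((%\<theta>. fd g x (h + \<theta> *R b)) has_vector_derivative fd ?G (x, h) (0, b)) (at 0)"
  using smooth_line_derivative[OF sG, of "(x, h)" "(0, b)" 0] by simp
 moreover have "((%\<theta>. fd g x (h + \<theta> *R b)) has_vector_derivative fd g x b) (at 0)"
  unfolding linear_add[OF linear_fd[OF g]] linear_scale[OF linear_fd[OF g]]
  by (auto simp: has_vector_derivative_def intro!: derivative_eq_intros)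
 ultimately have 2: "fd ?G (x, h) (0, b) = fd g x b" by (rule vector_derivative_unique_at)
 show ?thesis using linear_add[OF linear_fd[OF sG, of "(x, h)"], of "(a, 0)" "(0, b)"] 1 2 by simp
qed

text \<open>The base points vary with \<open>k\<close>, so plain differentiability at the limit is
  not enough; the second order Taylor bound, uniform on a ball, provides the strict form.\<close>

lemma strict_difference_quotient:
 fixes G :: "'a::euclidean_space => 'b::real_normed_vector"
 assumes G: "smooth G" and e: "!!k. e k > (0::real)" "e ~~> 0" and x: "x ~~> xl" and h: "h ~~> hl"
 shows "(%k. (1 / e k) *R (G (x k + e k *R h k) - G (x k))) ~~> fd G xl hl"
proof -
 have lim: "(%k. x k + e k *R h k) ~~> xl + 0 *R hl" by (intro tendsto_intros x e h)
 obtain R1 where R1: "!!k. norm (x k) <= R1" using convergent_imp_Bseq[of x] x by (auto simp: convergent_def Bseq_def)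
 obtain R2 where R2: "!!k. norm (x k + e k *R h k) <= R2"
  using convergent_imp_Bseq[of "%k. x k + e k *R h k"] lim by (auto simp: convergent_def Bseq_def)
 obtain C where C: "C >= 0" "!!x h. norm x <= max R1 R2 ==> norm (x + h) <= max R1 R2 ==> norm (G (x + h) - G x - fd G x h) <= C * (norm h)\<^sup>2"
  using taylor1[OF G] by metis
 have fdl: "(%k. fd G (x k) (h k)) ~~> fd G xl hl"
  using continuous_on_tendsto_compose[OF smooth_continuous[OF smooth_fd_pair[OF G], of UNIV] tendsto_Pair[OF x h]] by simp
 have "(%k. (1 / e k) *R (G (x k + e k *R h k) - G (x k)) - fd G (x k) (h k)) ~~> 0"
 proof (rule Lim_null_comparison)
  show "\<forall>\<^sub>F k in sequentially. norm ((1 / e k) *R (G (x k + e k *R h k) - G (x k)) - fd G (x k) (h k)) <= C * e k * (norm (h k))\<^sup>2"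
  proof (intro always_eventually allI)
   fix k
   have "(1 / e k) *R (G (x k + e k *R h k) - G (x k)) - fd G (x k) (h k) =
    (1 / e k) *R (G (x k + e k *R h k) - G (x k) - fd G (x k) (e k *R h k))"
    using e(1)[of k] by (simp add: linear_scale[OF linear_fd[OF G]] scaleR_diff_right)
   also have "norm ... <= (1 / e k) * (C * (norm (e k *R h k))\<^sup>2)"
   proof -
    have "norm (G (x k + e k *R h k) - G (x k) - fd G (x k) (e k *R h k)) <= C * (norm (e k *R h k))\<^sup>2"
    by (rule C(2)) (use R1[of k] R2[of k] in \<open>simp_all only: le_max_iff_disj simp_thms\<close>)
    from mult_left_mono[OF this, of "1 / e k"] show ?thesis using e(1)[of k] unfolding norm_scaleR by simp
   qed
   also have "... = C * e k * (norm (h k))\<^sup>2" using e(1)[of k] by (simp add: power_mult_distrib power2_eq_square)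
   finally show "norm ((1 / e k) *R (G (x k + e k *R h k) - G (x k)) - fd G (x k) (h k)) <= C * e k * (norm (h k))\<^sup>2" .
  qed
  have "(%k. C * e k * (norm (h k))\<^sup>2) ~~> C * 0 * (norm hl)\<^sup>2" by (intro tendsto_intros e h)
  then show "(%k. C * e k * (norm (h k))\<^sup>2) ~~> 0" by simp
 qed
 from tendsto_add[OF this fdl] show ?thesis by simp
qed

locale numbered_problem = control_problem P for P :: "('m::finite, 'n::finite) ocp" +
 assumes numbered: "numbered_by_order P" and A2: "A2 P"
begin

text \<open>The derivative of a constraint along the instantaneous dynamics, with the control set to
  the arbitrary value 0. By \<open>con_dyn_indep\<close> every control gives the same value, so this
  is a smooth function of time and state alone.\<close>

definition drift :: "nat => real \<times> (real ^ 'n) => real" where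
 "drift i = (%(t, x). fd (con P i) x (f (t, t, 0, x)))"

lemma smooth_con': "i : {nord1 P..<ncon P} ==> smooth (con P i)" using smooth_con by simp

lemma smooth_drift:
 assumes "i : {nord1 P..<ncon P}" shows "smooth (drift i)"
proof -
 have s1: "smooth (%q::real \<times> (real ^ 'n). f (fst q, fst q, 0, snd q))"
  by (rule smooth_compose_linear[OF _ smooth_f]) (intro bounded_linear_intros)
 have "smooth (%q::real \<times> (real ^ 'n). \<Sum>b\<in>Basis. (f (fst q, fst q, 0, snd q) \<bullet> b) *R fd (con P i) (snd q) b)"
  by (intro smooth_sum smooth_scaleR smooth_inner[OF s1 smooth_const]
    smooth_compose_linear[OF bounded_linear_snd smooth_fd[OF smooth_con'[OF assms]]])
 moreover have "drift i = (%q. \<Sum>b\<in>Basis. (f (fst q, fst q, 0, snd q) \<bullet> b) *R fd (con P i) (snd q) b)"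
  unfolding drift_def case_prod_beta by (rule ext) (rule fd_basis[OF smooth_con'[OF assms]])
 ultimately show ?thesis by simp
qed

lemma drift_eq: "i : {nord1 P..<ncon P} ==> t : {0..T} ==> drift i (t, x) = fd (con P i) x (f (t, t, w, x))"
 unfolding drift_def case_prod_conv by (rule con_dyn_indep[OF T_pos A0 numbered A2, symmetric])

text \<open>Differentiates the identity \<open>drift_eq\<close> along a line on which the control
  moves in direction \<open>\<omega>\<close> as well; the left-hand side does not see
  \<open>\<omega>\<close>, which shows that the control direction cancels in the
  linearization.\<close>

lemma fd_drift:
 assumes i: "i : {nord1 P..<ncon P}" and t: "t : {0..T}"
 shows "fd (drift i) (t, x) (0, \<zeta>) = D2v (con P i) x \<zeta> (f (t, t, w, x)) + fd (con P i) x (lin_kernel f (t, t, (w, x), (\<omega>, \<zeta>)))"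
proof -
 let ?g = "con P i" and ?G = "%(x, h). fd (con P i) x h"
 note g = smooth_con'[OF i]
 have 1: "((%\<theta>. drift i (t, x + \<theta> *R \<zeta>)) has_vector_derivative fd (drift i) (t, x) (0, \<zeta>)) (at 0)"
  using smooth_line_derivative[OF smooth_drift[OF i], of "(t, x)" "(0, \<zeta>)" 0] by simp
 have "((%\<theta>. f (t, t, w + \<theta> *R \<omega>, x + \<theta> *R \<zeta>)) has_vector_derivative fd f (t, t, w, x) (0, 0, \<omega>, \<zeta>)) (at 0)"
  using smooth_line_derivative[OF smooth_f, of "(t, t, w, x)" "(0, 0, \<omega>, \<zeta>)" 0] by simp
 then have d: "((%\<theta>. (x + \<theta> *R \<zeta>, f (t, t, w + \<theta> *R \<omega>, x + \<theta> *R \<zeta>))) has_derivative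
   (%h. (h *R \<zeta>, h *R fd f (t, t, w, x) (0, 0, \<omega>, \<zeta>)))) (at 0)"
  unfolding has_vector_derivative_def by (intro has_derivative_Pair) (auto intro!: derivative_eq_intros)
 have "((%\<theta>. ?G (x + \<theta> *R \<zeta>, f (t, t, w + \<theta> *R \<omega>, x + \<theta> *R \<zeta>))) has_derivative
   (%h. fd ?G (x + 0 *R \<zeta>, f (t, t, w + 0 *R \<omega>, x + 0 *R \<zeta>)) (h *R \<zeta>, h *R fd f (t, t, w, x) (0, 0, \<omega>, \<zeta>)))) (at 0)"
  by (rule has_derivative_compose[OF d smooth_has_derivative[OF smooth_fd_pair[OF g]]])
 moreover have "(h *R \<zeta>, h *R fd f (t, t, w, x) (0, 0, \<omega>, \<zeta>)) = h *R (\<zeta>, fd f (t, t, w, x) (0, 0, \<omega>, \<zeta>))" for h by simp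
 ultimately have A: "((%\<theta>. fd ?g (x + \<theta> *R \<zeta>) (f (t, t, w + \<theta> *R \<omega>, x + \<theta> *R \<zeta>))) has_vector_derivative
   fd ?G (x, f (t, t, w, x)) (\<zeta>, fd f (t, t, w, x) (0, 0, \<omega>, \<zeta>))) (at 0)"
  by (simp add: has_vector_derivative_def linear_scale[OF linear_fd[OF smooth_fd_pair[OF g]]] del: scaleR_Pair)
 have B: "(%\<theta>. fd ?g (x + \<theta> *R \<zeta>) (f (t, t, w + \<theta> *R \<omega>, x + \<theta> *R \<zeta>))) = (%\<theta>. drift i (t, x + \<theta> *R \<zeta>))"
  by (intro ext) (rule drift_eq[OF i t, symmetric])
 have "fd (drift i) (t, x) (0, \<zeta>) = fd ?G (x, f (t, t, w, x)) (\<zeta>, fd f (t, t, w, x) (0, 0, \<omega>, \<zeta>))"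
  by (rule vector_derivative_unique_at[OF 1 A[unfolded B]])
 then show ?thesis by (simp add: fd_pair[OF g] D2v_symmetric[OF g, of x \<zeta>] lin_kernel_def)
qed

text \<open>The continuous representative of the time derivative of the constraint along a state;
  controls enter it only through the memory integral. Its linearization in direction
  \<open>(v, z)\<close> is \<open>zdot\<close> below.\<close>

definition gdot :: "nat => (real => (real ^ 'm)) => (real => (real ^ 'n)) => real => real" where
 "gdot i u y t = drift i (t, y t) + fd (con P i) (y t) (memory u y t)"

lemma con_derivative:
 assumes i: "i : {nord1 P..<ncon P}" and tr: "trajectory P u y"
 shows "cont T (gdot i u y)"
  "!!t. t : {0..T} ==> ((%t. con P i (y t)) has_real_derivative gdot i u y t) (at t within {0..T})"
proof -
 note g = smooth_con'[OF i] and tj = traj[OF tr]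
 have c1: "cont T (%t. drift i (t, y t))"
  by (rule continuous_on_compose2[OF smooth_continuous[OF smooth_drift[OF i], of UNIV]]) (auto intro!: continuous_intros tj)
 have c2: "cont T (%t. (%(x, h). fd (con P i) x h) (y t, memory u y t))"
  by (rule continuous_on_compose2[OF smooth_continuous[OF smooth_fd_pair[OF g], of UNIV]]) (auto intro!: continuous_intros tj)
 show c: "cont T (gdot i u y)"
  unfolding gdot_def[abs_def] using continuous_on_add[OF c1 c2] by simp
 have ae: "AE s in M. fd (con P i) (y s) (f (s, s, u s, y s) + memory u y s) = gdot i u y s"
  using AE_space by eventually_elim (simp add: gdot_def drift_eq[OF i, symmetric] linear_add[OF linear_fd[OF g]])
 show "((%t. con P i (y t)) has_real_derivative gdot i u y t) (at t within {0..T})" if t: "t : {0..T}" for t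
  by (rule composite_derivative[OF tj(7) tj(6) g c ae t])
qed

definition zdot :: "nat => (real => (real ^ 'm)) => (real => (real ^ 'n)) => (real => (real ^ 'm)) => (real => (real ^ 'n)) => real => real" where
 "zdot i u y v z t = fd (drift i) (t, y t) (0, z t) + D2v (con P i) (y t) (z t) (memory u y t) + fd (con P i) (y t) (memory_lin u y v z t)"

text \<open>The chain rule for states, applied to the joint state \<open>(y, z)\<close> and the
  function \<open>fd (con P i) x h\<close> of the pair \<open>(x, h)\<close>. The values of
  \<open>u\<close> and \<open>v\<close> at the current time drop out by
  \<open>fd_drift\<close>.\<close>

lemma dcon_derivative:
 assumes i: "i : {nord1 P..<ncon P}" and tr: "trajectory P u y" and v: "sqint M v" and zl: "zlin u y v z0 z" and t: "t : {0<..<T}"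
 shows "deriv (dcon P y z i) t = zdot i u y v z t"
proof -
 note g = smooth_con'[OF i] and tj = traj[OF tr] and zw = zlin_weak_derivative[OF tr v zl]
 have cz: "cont T z" using zl by (simp add: zlin_def)
 let ?G = "%(x, h). fd (con P i) x h"
 let ?a = "%s. f (s, s, u s, y s) + memory u y s" and ?b = "%s. lin_kernel f (s, s, (u s, y s), (v s, z s)) + memory_lin u y v z s"
 have sw: "sqint M (%s. (?a s, ?b s))" using tj(7) zw(4) by (auto simp: sqint_def norm_Pair intro!: borel_measurable_Pair)
 have ia: "integrable M ?a" and ib: "integrable M ?b" using sqint_integrable[OF finite_measure_Icc] tj(7) zw(4) by auto
 have X: "(y t, z t) = (y 0, z 0) + (LINT s|leb t. (?a s, ?b s))" if t: "t : {0..T}" for t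
 proof -
  have iab: "integrable (leb t) (%s. (?a s, ?b s))"
   using t by (intro integrable_sub[OF sqint_integrable[OF finite_measure_Icc sw]]) auto
  have "(LINT s|leb t. (?a s, ?b s)) = (LINT s|leb t. ?a s, LINT s|leb t. ?b s)"
   using integral_bounded_linear[OF bounded_linear_fst iab] integral_bounded_linear[OF bounded_linear_snd iab]
   by (simp add: prod_eq_iff)
  then show ?thesis using tj(6)[OF t] zw(3)[OF t] by simp
 qed
 have c1: "cont T (%t. (%(x, h). fd (drift i) x h) ((t, y t), (0, z t)))"
  by (rule continuous_on_compose2[OF smooth_continuous[OF smooth_fd_pair[OF smooth_drift[OF i]], of UNIV]]) (auto intro!: continuous_intros tj cz)
 have c2: "cont T (%t. (%(x, h, k). D2v (con P i) x h k) (y t, z t, memory u y t))"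
  by (rule continuous_on_compose2[OF smooth_continuous[OF smooth_D2v_pair[OF g], of UNIV]]) (auto intro!: continuous_intros tj cz)
 have c3: "cont T (%t. (%(x, h). fd (con P i) x h) (y t, memory_lin u y v z t))"
  by (rule continuous_on_compose2[OF smooth_continuous[OF smooth_fd_pair[OF g], of UNIV]]) (auto intro!: continuous_intros tj zw)
 have c: "cont T (zdot i u y v z)"
  unfolding zdot_def[abs_def] using continuous_on_add[OF continuous_on_add[OF c1 c2] c3] by simp
 have ae: "AE s in M. fd ?G (y s, z s) (?a s, ?b s) = zdot i u y v z s"
  using AE_space
 proof eventually_elim
  case (elim s)
  then have s: "s : {0..T}" by simp
  show ?case
   unfolding zdot_def fd_pair[OF g] fd_drift[OF i s, of "y s" "z s" "u s" "v s"]
   by (simp add: linear_add[OF linear_fd[OF g]] linear_add[OF D2v_linear2[OF g]])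
 qed
 have "((%t. ?G (y t, z t)) has_real_derivative zdot i u y v z t) (at t within {0..T})"
  by (rule composite_derivative[OF sw X smooth_fd_pair[OF g] c ae]) (use t in auto)
 then have "(dcon P y z i has_real_derivative zdot i u y v z t) (at t)"
  using at_within_Icc_at[of 0 t T] t by (simp add: dcon_def[abs_def])
 then show ?thesis by (rule DERIV_imp_deriv)
qed

end

section \<open>Sequences of perturbed trajectories\<close>

lemma tendsto_real_bound:
 fixes X :: "nat => real"
 assumes "X ~~> l" obtains B where "!!k. X k <= B"
proof -
 have "Bseq X" by (rule convergent_imp_Bseq[OF convergentI[OF assms]])
 then obtain K where "!!n. norm (X n) <= K" unfolding Bseq_def by blast
 then have "X n <= K" for n by (metis abs_le_D1 real_norm_def)
 then show thesis by (rule that)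
qed

lemma LINT_sub_mono:
 fixes g :: "real => real"
 assumes "t <= T" "integrable (leb T) g" "!!s. g s >= 0"
 shows "(LINT s|leb t. g s) <= (LINT s|leb T. g s)"
proof -
 have "(LINT s|leb T. indicat_real {0..t} s *R g s) <= (LINT s|leb T. g s)"
 proof (rule integral_mono)
  show "integrable (leb T) (%s. indicat_real {0..t} s *R g s)"
   by (rule integrable_indicator_mult[OF assms(2)]) simp
 qed (use assms in \<open>auto simp: indicator_def\<close>)
 then show ?thesis by (simp only: LINT_sub[OF assms(1)])
qed

text \<open>Here \<open>v\<close> and \<open>zh\<close> are the exact difference quotients of
  control and state, \<open>zk\<close> the linearized states with the data of \<open>zh\<close>, and
  \<open>zl\<close> the linearized state of the weak limit. The null sequence \<open>rho\<close>
  bounds the perturbation of the control uniformly, in addition to the L2 normalization.\<close>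

locale perturbation = control_problem P for P :: "('m::finite, 'n::finite) ocp" +
 fixes ub :: "real => (real ^ 'm)" and yb :: "real => (real ^ 'n)"
  and u :: "nat => real => (real ^ 'm)" and y :: "nat => real => (real ^ 'n)"
  and e rho :: "nat => real"
  and v :: "nat => real => (real ^ 'm)" and zh :: "nat => real => (real ^ 'n)"
  and w :: "real => (real ^ 'm)" and z0 :: "real ^ 'n"
  and zl :: "real => (real ^ 'n)" and zk :: "nat => real => (real ^ 'n)"
 assumes trb: "trajectory P ub yb" and tr: "!!k. trajectory P (u k) (y k)"
  and e: "!!k. e k > 0" "e ~~> 0"
  and u_eq: "!!k t. u k t = ub t + e k *R v k t" and y_eq: "!!k t. y k t = yb t + e k *R zh k t"
  and rho: "rho ~~> 0" and small: "!!k. AE t in M. norm (e k *R v k t) <= rho k"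
  and unit: "!!k. ip M (v k) (v k) <= 1" "!!k. norm (zh k 0) <= 1"
  and weak: "weakly_converges M v w" and init: "(%k. zh k 0) ~~> z0"
  and zl: "zlin ub yb w z0 zl" and zk: "!!k. zlin ub yb (v k) (zh k 0) (zk k)"
begin

lemma sqv: "sqint M (v k)" and sqw: "sqint M w"
 using weak by (auto simp: weakly_converges_def)

lemma cz: "cont T zl" "cont T (zk k)" "cont T (zh k)"
proof -
 show "cont T zl" "cont T (zk k)" using zl zk by (auto simp: zlin_def)
 have "cont T (%t. (1 / e k) *R (y k t - yb t))"
  by (intro continuous_intros traj(2)[OF tr] traj(2)[OF trb])
 then show "cont T (zh k)" using e(1)[of k] by (simp add: y_eq)
qed

lemma v_L1: "(LINT s|M. norm (v k s)) <= 1 + T"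
proof -
 have i: "integrable M (%s. (norm (v k s))\<^sup>2)" "integrable M (%s. norm (v k s))"
  using sqv[of k] sqint_integrable[OF finite_measure_Icc sqv[of k]] by (auto simp: sqint_def)
 have "(LINT s|M. norm (v k s)) <= (LINT s|M. (norm (v k s))\<^sup>2 + 1)"
 proof (rule integral_mono)
  fix s
  have "2 * norm (v k s) <= (norm (v k s))\<^sup>2 + 1" using sum_squares_bound[of "norm (v k s)" 1] by simp
  then show "norm (v k s) <= (norm (v k s))\<^sup>2 + 1" using norm_ge_zero[of "v k s"] by linarith
 qed (use i integrable_const_Icc[of T "1::real"] in auto)
 also have "... = ip M (v k) (v k) + T"
  using i integrable_const_Icc[of T "1::real"] T_pos by (simp add: ip_self measure_restrict_space)
 finally show ?thesis using unit(1)[of k] by simp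
qed

text \<open>Difference quotient of a Volterra integral with kernel \<open>F\<close>; its linear
  counterpart is \<open>LK\<close>. The kernel stays general because the state equation uses
  \<open>f\<close> and the memory uses \<open>Dtau f\<close>.\<close>

definition DQ :: "(real \<times> real \<times> (real ^ 'm) \<times> (real ^ 'n) => (real ^ 'n)) => nat => real => real ^ 'n" where
 "DQ F k t = (1 / e k) *R ((LINT s|leb t. F (t, s, u k s, y k s)) - (LINT s|leb t. F (t, s, ub s, yb s)))"

definition LK :: "(real \<times> real \<times> (real ^ 'm) \<times> (real ^ 'n) => (real ^ 'n)) => real => (real => real ^ 'm) => (real => real ^ 'n) => real ^ 'n" where
 "LK F t a b = (LINT s|leb t. lin_kernel F (t, s, (ub s, yb s), (a s, b s)))"

lemma zh_eq: "t : {0..T} ==> zh k t = zh k 0 + DQ f k t"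
proof -
 assume t: "t : {0..T}"
 have "y k t - yb t - (y k 0 - yb 0) = (LINT s|leb t. f (t, s, u k s, y k s)) - (LINT s|leb t. f (t, s, ub s, yb s))"
  unfolding traj(5)[OF tr[of k] t] traj(5)[OF trb t] by simp
 then have "e k *R (zh k t - zh k 0) = (LINT s|leb t. f (t, s, u k s, y k s)) - (LINT s|leb t. f (t, s, ub s, yb s))"
  by (simp add: y_eq scaleR_diff_right)
 then show ?thesis using e(1)[of k] by (simp add: DQ_def flip: \<open>e k *R (zh k t - zh k 0) = _\<close>)
qed

lemma DQ_eq:
 assumes F: "smooth F" and t: "t : {0..T}"
 shows "DQ F k t = (LINT s|leb t. (1 / e k) *R (F (t, s, u k s, y k s) - F (t, s, ub s, yb s)))"
  "integrable (leb t) (%s. (1 / e k) *R (F (t, s, u k s, y k s) - F (t, s, ub s, yb s)))"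
proof -
 have i: "integrable (leb t) (%s. F (t, s, u k s, y k s))" "integrable (leb t) (%s. F (t, s, ub s, yb s))"
  using t by (auto intro!: integrable_sub[OF traj(8)[OF tr F t]] integrable_sub[OF traj(8)[OF trb F t]])
 then show "DQ F k t = (LINT s|leb t. (1 / e k) *R (F (t, s, u k s, y k s) - F (t, s, ub s, yb s)))"
  "integrable (leb t) (%s. (1 / e k) *R (F (t, s, u k s, y k s) - F (t, s, ub s, yb s)))"
  by (auto simp: DQ_def)
qed

text \<open>Gronwall's inequality with the global Lipschitz constant of the dynamics. A local
  constant would not do at this point, since the uniform bound on the perturbed states is derived
  from this lemma.\<close>

lemma zh_bounded: obtains D where "D >= 0" "!!k t. t : {0..T} ==> norm (zh k t) <= D"
proof -
 obtain L0 where L0: "L0-lipschitz_on UNIV f" using A0 by (auto simp: A0_def)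
 define L where "L = max L0 1"
 have L: "norm (f a - f b) <= L * norm (a - b)" for a b
  using order.trans[OF lipschitz_onD[OF L0, of a b, unfolded dist_norm] mult_right_mono[OF max.cobounded1[of L0 1]]]
  by (simp add: L_def)
 have "norm (zh k t) <= 2 * (1 + L * (1 + T)) * exp (2 * L * T)" if t: "t : {0..T}" for k t
 proof (rule gronwall[OF _ _ _ _ t])
  show cn: "cont T (%t. norm (zh k t))" by (intro continuous_intros cz)
  show "1 + L * (1 + T) >= 0" "L > 0" using T_pos by (auto simp: L_def)
  fix t assume t: "t : {0..T}"
  have iv: "integrable (leb t) (%s. norm (v k s))"
   using t by (intro integrable_sub[OF b_integrable_norm[OF sqint_integrable[OF finite_measure_Icc sqv]]]) auto
  have iz: "integrable (leb t) (%s. norm (zh k s))"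
   using t by (intro continuous_imp_integrable_real continuous_on_subset[OF cn]) auto
  have "norm (DQ f k t) <= (LINT s|leb t. norm ((1 / e k) *R (f (t, s, u k s, y k s) - f (t, s, ub s, yb s))))"
   unfolding DQ_eq(1)[OF smooth_f t] by (rule integral_norm_bound)
  also have "... <= (LINT s|leb t. L * (norm (v k s) + norm (zh k s)))"
  proof (rule integral_mono)
   fix s
   have "norm (f (t, s, u k s, y k s) - f (t, s, ub s, yb s)) <= L * norm ((0::real, 0::real, e k *R v k s, e k *R zh k s))"
    using L[of "(t, s, u k s, y k s)" "(t, s, ub s, yb s)"] by (simp add: u_eq y_eq)
   also have "... <= L * (e k * (norm (v k s) + norm (zh k s)))"
   proof (rule mult_left_mono)
    have "norm ((0::real, 0::real, e k *R v k s, e k *R zh k s)) = norm (e k *R (v k s, zh k s))"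
    by (simp add: norm_Pair)
    also have "... = e k * norm (v k s, zh k s)" unfolding norm_scaleR using e(1)[of k] by simp
    also have "... <= e k * (norm (v k s) + norm (zh k s))"
    by (rule mult_left_mono[OF norm_Pair_le less_imp_le[OF e(1)]])
    finally show "norm ((0::real, 0::real, e k *R v k s, e k *R zh k s)) <= e k * (norm (v k s) + norm (zh k s))" .
   qed (simp add: L_def)
   finally have "norm (f (t, s, u k s, y k s) - f (t, s, ub s, yb s)) <= L * (e k * (norm (v k s) + norm (zh k s)))" .
   from this show "norm ((1 / e k) *R (f (t, s, u k s, y k s) - f (t, s, ub s, yb s))) <= L * (norm (v k s) + norm (zh k s))"
   proof -
    assume le: "norm (f (t, s, u k s, y k s) - f (t, s, ub s, yb s)) <= L * (e k * (norm (v k s) + norm (zh k s)))"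
    have "(1 / e k) * norm (f (t, s, u k s, y k s) - f (t, s, ub s, yb s)) <= (1 / e k) * (L * (e k * (norm (v k s) + norm (zh k s))))"
    by (rule mult_left_mono[OF le]) (use e(1)[of k] in simp)
    also have "... = L * (norm (v k s) + norm (zh k s))" using e(1)[of k] by simp
    finally show ?thesis unfolding norm_scaleR using e(1)[of k] by simp
   qed
   show "integrable (leb t) (%s. norm ((1 / e k) *R (f (t, s, u k s, y k s) - f (t, s, ub s, yb s))))"
    by (rule b_integrable_norm[OF DQ_eq(2)[OF smooth_f t]])
  qed (use iv iz in auto)
  also have "... = L * (LINT s|leb t. norm (v k s)) + L * (LINT s|leb t. norm (zh k s))"
   using iv iz by (simp add: distrib_left)
  finally have 1: "norm (DQ f k t) <= L * (LINT s|leb t. norm (v k s)) + L * (LINT s|leb t. norm (zh k s))" .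
  have "(LINT s|leb t. norm (v k s)) <= (LINT s|M. norm (v k s))"
   using t by (intro LINT_sub_mono b_integrable_norm sqint_integrable[OF finite_measure_Icc sqv]) auto
  then have "L * (LINT s|leb t. norm (v k s)) <= L * (1 + T)"
   using v_L1[of k] by (intro mult_left_mono) (auto simp: L_def)
  then show "norm (zh k t) <= 1 + L * (1 + T) + L * (LINT s|leb t. norm (zh k s))"
   using 1 unit(2)[of k] norm_triangle_ineq[of "zh k 0" "DQ f k t"] zh_eq[OF t, of k] by simp
 qed
 moreover have "2 * (1 + L * (1 + T)) * exp (2 * L * T) >= 0" using T_pos by (auto simp: L_def intro!: mult_nonneg_nonneg add_nonneg_nonneg)
 ultimately show thesis using that by blast
qed

lemma perturbed_bounded:
 obtains R where "!!k. AE s in M. norm (u k s, y k s) <= R" "AE s in M. norm (ub s, yb s) <= R"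
  "!!k t. t : {0..T} ==> norm (y k t) <= R" "!!t. t : {0..T} ==> norm (yb t) <= R"
proof -
 obtain R0 where R0: "AE s in M. norm (ub s, yb s) <= R0" using traj(3)[OF trb] unfolding Linf_iff by blast
 obtain R1 where R1: "!!t. t : {0..T} ==> norm (yb t) <= R1" using continuous_Icc_bounded[OF traj(2)[OF trb]] by blast
 obtain D where D: "D >= 0" "!!k t. t : {0..T} ==> norm (zh k t) <= D" using zh_bounded by blast
 obtain B where B: "!!k. rho k <= B" using tendsto_real_bound[OF rho] by blast
 obtain E where E: "!!k. e k <= E" using tendsto_real_bound[OF e(2)] by blast
 have E0: "E >= 0" using E[of 0] e(1)[of 0] by simp
 define R where "R = \<bar>R0\<bar> + \<bar>R1\<bar> + \<bar>B\<bar> + E * D"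
 have ED: "norm (e k *R zh k t) <= E * D" if "t : {0..T}" for k t
  using D(2)[OF that, of k] E[of k] e(1)[of k] E0 by (auto intro!: mult_mono)
 have ED0: "E * D >= 0" using E0 D by simp
 show thesis
 proof (rule that[of R])
  show "AE s in M. norm (u k s, y k s) <= R" for k
   using R0 small[of k] AE_space
  proof eventually_elim
   case (elim s)
   have "norm (u k s, y k s) <= norm (ub s, yb s) + norm (e k *R v k s, e k *R zh k s)"
    using norm_triangle_ineq[of "(ub s, yb s)" "(e k *R v k s, e k *R zh k s)"] by (simp add: u_eq y_eq)
   also have "... <= R0 + (norm (e k *R v k s) + norm (e k *R zh k s))"
    by (rule add_mono[OF elim(1) norm_Pair_le])
   also have "... <= R" using elim ED[of s k] B[of k] unfolding R_def by simp
   finally show ?case .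
  qed
  show "AE s in M. norm (ub s, yb s) <= R" using R0 by eventually_elim (use ED0 in \<open>auto simp: R_def\<close>)
  show "norm (yb t) <= R" if "t : {0..T}" for t using R1[OF that] ED0 by (auto simp: R_def)
  show "norm (y k t) <= R" if "t : {0..T}" for k t
   using R1[OF that] ED[OF that, of k] norm_triangle_ineq[of "yb t" "e k *R zh k t"] by (auto simp: R_def y_eq)
 qed
qed

lemma lin_kernel_integrable:
 assumes F: "smooth (F :: _ => real ^ 'n)" and a: "sqint M a" and b: "cont T b" and t: "t : {0..T}"
 shows "integrable (leb t) (%s. lin_kernel F (t, s, (ub s, yb s), (a s, b s)))"
  "cont T (%t. LK F t a b)"
proof -
 obtain R where X: "(%s. (ub s, yb s)) : borel_measurable M" "AE s in M. norm (ub s, yb s) <= R"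
  using traj(3)[OF trb] unfolding Linf_iff by blast
 obtain C where k: "kernel_bound T (lin_kernel F) (%s. ((ub s, yb s), (a s, b s))) (%s. C * norm (a s, b s))"
  using kernel_bound_linear[OF F X integrable_control_state(2)[OF a b]] by blast
 show "integrable (leb t) (%s. lin_kernel F (t, s, (ub s, yb s), (a s, b s)))"
  using integrable_sub[OF kernel_integrable(1)[OF k t], of t] t by simp
 show "cont T (%t. LK F t a b)" unfolding LK_def using kernel_integral_continuous(1)[OF k] by simp
qed

lemma LK_diff:
 assumes F: "smooth F" and a: "sqint M a" "sqint M a'" and b: "cont T b" "cont T b'" and t: "t : {0..T}"
 shows "LK F t a b - LK F t a' b' = LK F t (%s. a s - a' s) (%s. b s - b' s)"
proof -
 have "lin_kernel F (t, s, (ub s, yb s), (a s, b s)) - lin_kernel F (t, s, (ub s, yb s), (a' s, b' s)) =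
   lin_kernel F (t, s, (ub s, yb s), (a s - a' s, b s - b' s))" for s
  using linear_diff[OF linear_lin_kernel[OF F], of t s "(ub s, yb s)" "(a s, b s)" "(a' s, b' s)"] by simp
 then show ?thesis
  using lin_kernel_integrable(1)[OF F a(1) b(1) t] lin_kernel_integrable(1)[OF F a(2) b(2) t]
  by (simp add: LK_def b_integral_diff[symmetric])
qed

lemma LK_state_bound:
 assumes F: "smooth F"
 obtains C where "C > 0" "!!t b. t : {0..T} ==> cont T b ==>
  norm (LK F t (%_. 0) b) <= C * (LINT s|leb t. norm (b s))"
proof -
 obtain R where XR: "AE s in M. norm (ub s, yb s) <= R" using traj(3)[OF trb] unfolding Linf_iff by blast
 obtain C where C: "C >= 0" "!!t s x h. norm (t, s, x) <= 2 * T + R ==> norm (lin_kernel F (t, s, x, h)) <= C * norm h"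
  using lin_kernel_bound[OF F, of "2 * T + R"] by metis
 show thesis
 proof (rule that[of "C + 1"])
  fix t b assume t: "t : {0..T}" and b: "cont T (b :: real => real ^ 'n)"
  have ib: "integrable (leb t) (%s. norm (b s))"
   using t by (intro continuous_imp_integrable_real continuous_on_norm continuous_on_subset[OF b]) auto
  have s0: "sqint M (%_. 0 :: real ^ 'm)" by (simp add: sqint_def)
  have "norm (LK F t (%_. 0) b) <= (LINT s|leb t. norm (lin_kernel F (t, s, (ub s, yb s), (0, b s))))"
   unfolding LK_def by (rule integral_norm_bound)
  also have "... <= (LINT s|leb t. (C + 1) * norm (b s))"
  proof (rule integral_mono_AE)
   show "AE s in leb t. norm (lin_kernel F (t, s, (ub s, yb s), (0, b s))) <= (C + 1) * norm (b s)"
    using AE_sub[OF AE_time_bound[OF XR], of t]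
   proof (rule eventually_mono)
    show "t <= T" using t by simp
    fix s assume "\<forall>r\<in>{0..T}. norm (r, s, ub s, yb s) <= 2 * T + R"
    then have "norm (lin_kernel F (t, s, (ub s, yb s), (0 :: real ^ 'm, b s))) <= C * norm (0 :: real ^ 'm, b s)" using t by (intro C(2)) auto
    then show "norm (lin_kernel F (t, s, (ub s, yb s), (0, b s))) <= (C + 1) * norm (b s)"
    by (simp add: norm_Pair2 distrib_right add_increasing2)
   qed
  qed (use ib lin_kernel_integrable(1)[OF F s0 b t] in auto)
  finally show "norm (LK F t (%_. 0) b) <= (C + 1) * (LINT s|leb t. norm (b s))" by simp
 qed (use C in simp)
qed

text \<open>The quadratic Taylor remainder contributes \<open>e k\<close> times the integral of
  \<open>(norm (v k s))\<^sup>2 + D\<^sup>2\<close>, which the normalization in L2 keeps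
  bounded.\<close>

lemma DQ_LK:
 assumes F: "smooth F"
 obtains C where "C >= 0" "!!k t. t : {0..T} ==> norm (DQ F k t - LK F t (v k) (zh k)) <= C * e k"
proof -
 obtain R where R: "!!k. AE s in M. norm (u k s, y k s) <= R" "AE s in M. norm (ub s, yb s) <= R"
  by (rule perturbed_bounded) (rule that)
 obtain D where D: "D >= 0" "!!k t. t : {0..T} ==> norm (zh k t) <= D" using zh_bounded by blast
 obtain C where C: "C >= 0" "!!x h. norm x <= 2 * T + R ==> norm (x + h) <= 2 * T + R ==> norm (F (x + h) - F x - fd F x h) <= C * (norm h)\<^sup>2"
  using taylor1[OF F] by metis
 have "norm (DQ F k t - LK F t (v k) (zh k)) <= (C * (1 + T * D\<^sup>2)) * e k" if t: "t : {0..T}" for k t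
 proof -
  have iv: "integrable M (%s. (norm (v k s))\<^sup>2)" using sqv[of k] by (simp add: sqint_def)
  note il = lin_kernel_integrable(1)[OF F sqv cz(3) t, of k k]
  have iB: "integrable M (%s. C * e k * ((norm (v k s))\<^sup>2 + D\<^sup>2))"
   using iv integrable_const_Icc[of T "D\<^sup>2"] by simp
  have eq: "DQ F k t - LK F t (v k) (zh k) = (LINT s|leb t. (1 / e k) *R (F (t, s, u k s, y k s) - F (t, s, ub s, yb s)) - lin_kernel F (t, s, (ub s, yb s), (v k s, zh k s)))"
   unfolding DQ_eq(1)[OF F t] LK_def by (rule b_integral_diff[OF DQ_eq(2)[OF F t] il, symmetric])
  have "norm (DQ F k t - LK F t (v k) (zh k)) <= (LINT s|leb t. norm ((1 / e k) *R (F (t, s, u k s, y k s) - F (t, s, ub s, yb s)) - lin_kernel F (t, s, (ub s, yb s), (v k s, zh k s))))"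
   unfolding eq by (rule integral_norm_bound)
  also have "... <= (LINT s|leb t. C * e k * ((norm (v k s))\<^sup>2 + D\<^sup>2))"
  proof (rule integral_mono_AE)
   have "AE s in M. norm ((1 / e k) *R (F (t, s, u k s, y k s) - F (t, s, ub s, yb s)) - lin_kernel F (t, s, (ub s, yb s), (v k s, zh k s))) <= C * e k * ((norm (v k s))\<^sup>2 + D\<^sup>2)"
    using AE_time_bound[OF R(1)[of k]] AE_time_bound[OF R(2)] AE_space
   proof eventually_elim
    case (elim s)
    let ?x = "(t, s, ub s, yb s)" and ?h = "(0::real, 0::real, v k s, zh k s)"
    have xe: "(t, s, u k s, y k s) = ?x + e k *R ?h" by (simp add: u_eq y_eq)
    have "norm (F (?x + e k *R ?h) - F ?x - fd F ?x (e k *R ?h)) <= C * (norm (e k *R ?h))\<^sup>2"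
    by (rule C(2)) (use elim t in \<open>simp_all only: xe[symmetric]\<close>)
    from mult_left_mono[OF this, of "1 / e k"]
    have r: "norm ((1 / e k) *R (F (?x + e k *R ?h) - F ?x - fd F ?x (e k *R ?h))) <= (1 / e k) * (C * (norm (e k *R ?h))\<^sup>2)"
    unfolding norm_scaleR using e(1)[of k] by simp
    have "(1 / e k) * (C * (norm (e k *R ?h))\<^sup>2) = C * e k * (norm ?h)\<^sup>2"
    unfolding norm_scaleR using e(1)[of k] by (simp add: power2_eq_square)
    also have "... = C * e k * ((norm (v k s))\<^sup>2 + (norm (zh k s))\<^sup>2)" by (simp add: norm_Pair)
    also have "... <= C * e k * ((norm (v k s))\<^sup>2 + D\<^sup>2)"
    using elim D(2)[of s k] C(1) e(1)[of k] by (intro mult_left_mono add_left_mono power_mono) auto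
    finally have r2: "(1 / e k) * (C * (norm (e k *R ?h))\<^sup>2) <= C * e k * ((norm (v k s))\<^sup>2 + D\<^sup>2)" .
    have eq: "(1 / e k) *R (F (?x + e k *R ?h) - F ?x - fd F ?x (e k *R ?h)) =
    (1 / e k) *R (F (t, s, u k s, y k s) - F ?x) - lin_kernel F (t, s, (ub s, yb s), (v k s, zh k s))"
    unfolding xe[symmetric] linear_scale[OF linear_fd[OF F]] using e(1)[of k] by (simp add: lin_kernel_def scaleR_diff_right)
    show ?case using order.trans[OF r r2] unfolding eq .
   qed
   then show "AE s in leb t. norm ((1 / e k) *R (F (t, s, u k s, y k s) - F (t, s, ub s, yb s)) - lin_kernel F (t, s, (ub s, yb s), (v k s, zh k s))) <= C * e k * ((norm (v k s))\<^sup>2 + D\<^sup>2)"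
    by (rule AE_sub) (use t in simp)
  qed (use il DQ_eq(2)[OF F t] integrable_sub[OF iB, of t] t in auto)
  also have "... <= (LINT s|M. C * e k * ((norm (v k s))\<^sup>2 + D\<^sup>2))"
   using t C(1) e(1)[of k] by (intro LINT_sub_mono iB) auto
  also have "... = C * e k * (ip M (v k) (v k) + T * D\<^sup>2)"
   using iv integrable_const_Icc[of T "D\<^sup>2"] T_pos by (simp add: ip_self measure_restrict_space)
  also have "... <= C * e k * (1 + T * D\<^sup>2)" using unit(1)[of k] C(1) e(1)[of k] by (intro mult_left_mono) auto
  finally show ?thesis by (simp add: mult_ac)
 qed
 moreover have "C * (1 + T * D\<^sup>2) >= 0" using C T_pos by simp
 ultimately show thesis using that by blast
qed

lemma zlin_LK: "t : {0..T} ==> zl t = z0 + LK f t w zl" "t : {0..T} ==> zk k t = zh k 0 + LK f t (v k) (zk k)"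
 using zl zk[of k] unfolding zlin_def LK_def by blast+

lemma LK_weak:
 assumes F: "smooth F"
  and Z: "!!k. cont T (Z k)" "cont T Zl"
   "!!k t. t : {0..T} ==> norm (Z k t) <= D" "!!t. t : {0..T} ==> (%k. Z k t) ~~> Zl t"
  and t: "!!k. t k : {0..T}" "\<tau> : {0..T}" "t ~~> \<tau>"
 shows "(%k. LK F (t k) (v k) (Z k)) ~~> LK F \<tau> w Zl"
 unfolding LK_def
 by (rule weak_lin_kernel_tendsto[OF F traj(3)[OF trb] weak continuous_measurable_Icc[OF Z(1)] continuous_measurable_Icc[OF Z(2)] Z(3,4) t])

text \<open>The error \<open>d\<close> solves a linear Volterra inequality with inhomogeneity
  \<open>a\<close>, which is known to vanish only pointwise, by weak convergence. Gronwall's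
  inequality is therefore applied to the integral of \<open>norm d\<close>, whose inhomogeneity is
  the integral \<open>A\<close> of \<open>norm a\<close> and tends to zero by domination.\<close>

lemma zh_tendsto:
 assumes t: "t : {0..T}" shows "(%k. zh k t) ~~> zl t"
proof -
 define d where "d k t = zh k t - zl t" for k t
 define a where "a k t = d k t - LK f t (%_. 0) (d k)" for k t
 have s0: "sqint M (%_. 0 :: real ^ 'm)" by (simp add: sqint_def)
 have cd: "cont T (d k)" for k unfolding d_def by (intro continuous_intros cz)
 have TT: "T : {0..T}" using T_pos by simp
 have ca: "cont T (a k)" for k
  unfolding a_def by (rule continuous_on_diff[OF cd lin_kernel_integrable(2)[OF smooth_f s0 cd TT]])
 obtain D where D: "D >= 0" "!!k t. t : {0..T} ==> norm (zh k t) <= D" using zh_bounded by blast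
 obtain Dz where Dz: "!!t. t : {0..T} ==> norm (zl t) <= Dz" using continuous_Icc_bounded[OF cz(1)] by blast
 obtain C where C: "C > 0" "!!t b. t : {0..T} ==> cont T b ==> norm (LK f t (%_. 0) b) <= C * (LINT s|leb t. norm (b s))"
  using LK_state_bound[OF smooth_f] by blast
 obtain C1 where C1: "C1 >= 0" "!!k t. t : {0..T} ==> norm (DQ f k t - LK f t (v k) (zh k)) <= C1 * e k"
  using DQ_LK[OF smooth_f] by blast
 have a_eq: "a k t = (zh k 0 - z0) + (DQ f k t - LK f t (v k) (zh k)) + (LK f t (v k) zl - LK f t w zl)" if t: "t : {0..T}" for k t
 proof -
  have "LK f t (v k) (zh k) - LK f t (v k) zl = LK f t (%_. 0) (d k)"
   using LK_diff[OF smooth_f sqv sqv cz(3) cz(1) t, of k k k] by (simp add: d_def[abs_def])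
  then show ?thesis unfolding a_def d_def using zh_eq[OF t, of k] zlin_LK(1)[OF t] by (simp add: algebra_simps)
 qed
 have al: "(%k. a k t) ~~> 0" if t: "t : {0..T}" for t
 proof -
  have 1: "(%k. DQ f k t - LK f t (v k) (zh k)) ~~> 0"
   by (rule Lim_null_comparison[where g="%k. C1 * e k"])
    (use C1(2)[OF t] tendsto_mult_left[OF e(2), of C1] in auto)
  have 2: "(%k. LK f t (v k) zl) ~~> LK f t w zl"
   by (rule LK_weak[OF smooth_f cz(1) cz(1) Dz tendsto_const]) (use t in auto)
  have "(%k. (zh k 0 - z0) + (DQ f k t - LK f t (v k) (zh k)) + (LK f t (v k) zl - LK f t w zl)) ~~> (z0 - z0) + 0 + (LK f t w zl - LK f t w zl)"
   by (intro tendsto_intros init 1 2)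
  then show ?thesis by (simp add: a_eq[OF t])
 qed
 have db: "norm (d k t) <= D + Dz" if "t : {0..T}" for k t
  unfolding d_def using D(2)[OF that, of k] Dz[OF that] norm_triangle_ineq4[of "zh k t" "zl t"] by simp
 have id: "integrable (leb t) (%s. norm (d k s))" if "t : {0..T}" for k t
  using that by (intro continuous_imp_integrable_real continuous_on_norm continuous_on_subset[OF cd]) auto
 have ia: "integrable (leb t) (%s. norm (a k s))" if "t : {0..T}" for k t
  using that by (intro continuous_imp_integrable_real continuous_on_norm continuous_on_subset[OF ca]) auto
 have mono: "(LINT s|leb t. g s) <= (LINT s|M. g s)"
  if "t : {0..T}" "integrable M g" "!!s. g s >= 0" for t and g :: "real => real"
  using that by (intro LINT_sub_mono) auto
 have ab: "norm (a k t) <= (D + Dz) + C * (T * (D + Dz))" if t: "t : {0..T}" for k t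
 proof -
  have "(LINT s|leb t. norm (d k s)) <= (LINT s|M. norm (d k s))" by (rule mono[OF t id[OF TT]]) simp
  also have "... <= (LINT s|M. D + Dz)" using id[OF TT] db integrable_const_Icc[of T "D + Dz"] by (intro integral_mono) auto
  also have "... = T * (D + Dz)" using T_pos by (simp add: measure_restrict_space)
  finally have "norm (LK f t (%_. 0) (d k)) <= C * (T * (D + Dz))"
   using C(2)[OF t cd, of k] C(1) by (smt (verit) mult_left_mono)
  then show ?thesis unfolding a_def using db[OF t, of k] by (intro order.trans[OF norm_triangle_ineq4] add_mono)
 qed
 define A where "A k = (LINT s|M. norm (a k s))" for k
 have Al: "A ~~> 0"
 proof -
  have "A ~~> (LINT s|M. 0)" unfolding A_def
  proof (rule integral_dominated_convergence[where w="%_. (D + Dz) + C * (T * (D + Dz))"])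
   show "AE s in M. (%k. norm (a k s)) ~~> 0"
    using AE_space by eventually_elim (auto intro!: tendsto_norm_zero al)
   show "AE s in M. norm (norm (a k s)) <= (D + Dz) + C * (T * (D + Dz))" for k
    using AE_space by eventually_elim (use ab in auto)
  qed (use ia[OF TT] integrable_const_Icc in auto)
  then show ?thesis by simp
 qed
 have A0': "A k >= 0" for k unfolding A_def by simp
 define \<psi> where "\<psi> k t = (LINT s|leb t. norm (d k s))" for k t
 have c\<psi>: "cont T (\<psi> k)" for k unfolding \<psi>_def by (rule indefinite_integral_continuous[OF id[OF TT]])
 have dle: "norm (d k t) <= norm (a k t) + C * \<psi> k t" if t: "t : {0..T}" for k t
 proof -
  have "norm (d k t) = norm (a k t + LK f t (%_. 0) (d k))" by (simp add: a_def)
  also have "... <= norm (a k t) + C * \<psi> k t" unfolding \<psi>_def using C(2)[OF t cd] by (intro order.trans[OF norm_triangle_ineq] add_left_mono)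
  finally show ?thesis .
 qed
 have \<psi>b: "\<psi> k t <= 2 * A k * exp (2 * C * T)" if t: "t : {0..T}" for k t
 proof (rule gronwall[OF c\<psi> A0' C(1) _ t])
  fix t assume t: "t : {0..T}"
  have i\<psi>: "integrable (leb t) (\<psi> k)"
   using t by (intro continuous_imp_integrable_real continuous_on_subset[OF c\<psi>]) auto
  have "\<psi> k t <= (LINT s|leb t. norm (a k s) + C * \<psi> k s)"
   unfolding \<psi>_def[of k t] using t dle id[OF t] ia[OF t] i\<psi> by (intro integral_mono) auto
  also have "... = (LINT s|leb t. norm (a k s)) + C * (LINT s|leb t. \<psi> k s)"
   using ia[OF t] i\<psi> by simp
  finally have "\<psi> k t <= (LINT s|leb t. norm (a k s)) + C * (LINT s|leb t. \<psi> k s)" .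
  moreover have "(LINT s|leb t. norm (a k s)) <= A k" unfolding A_def by (rule mono[OF t ia[OF TT]]) simp
  ultimately show "\<psi> k t <= A k + C * (LINT s|leb t. \<psi> k s)" by simp
 qed
 have "(%k. d k t) ~~> 0"
 proof (rule Lim_null_comparison)
  show "\<forall>\<^sub>F k in sequentially. norm (d k t) <= norm (a k t) + C * (2 * A k * exp (2 * C * T))"
   using dle[OF t] \<psi>b[OF t] C(1) by (intro always_eventually allI) (smt (verit) mult_left_mono)
  have "(%k. norm (a k t) + C * (2 * A k * exp (2 * C * T))) ~~> norm (0 :: real ^ 'n) + C * (2 * 0 * exp (2 * C * T))"
   by (intro tendsto_intros al t Al)
  then show "(%k. norm (a k t) + C * (2 * A k * exp (2 * C * T))) ~~> 0" by simp
 qed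
 then show ?thesis unfolding d_def using LIM_zero_iff by blast
qed

text \<open>Both functions belong to the same control direction \<open>v k\<close>, so weak
  convergence plays no part and the estimate is of order \<open>e k\<close> uniformly in time. It
  lets the Hessian be evaluated at the linearized states.\<close>

lemma zh_zk: obtains C where "C >= 0" "!!k t. t : {0..T} ==> norm (zh k t - zk k t) <= C * e k"
proof -
 obtain C where C: "C > 0" "!!t b. t : {0..T} ==> cont T b ==> norm (LK f t (%_. 0) b) <= C * (LINT s|leb t. norm (b s))"
  using LK_state_bound[OF smooth_f] by blast
 obtain C1 where C1: "C1 >= 0" "!!k t. t : {0..T} ==> norm (DQ f k t - LK f t (v k) (zh k)) <= C1 * e k"
  using DQ_LK[OF smooth_f] by blast
 have "norm (zh k t - zk k t) <= 2 * (C1 * e k) * exp (2 * C * T)" if t: "t : {0..T}" for k t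
 proof (rule gronwall[OF _ _ C(1) _ t])
  have cd: "cont T (%t. zh k t - zk k t)" by (intro continuous_intros cz)
  then show "cont T (%t. norm (zh k t - zk k t))" by (rule continuous_on_norm)
  show "C1 * e k >= 0" using C1(1) e(1)[of k] by simp
  fix t assume t: "t : {0..T}"
  have "zh k t - zk k t = (DQ f k t - LK f t (v k) (zh k)) + LK f t (%_. 0) (%t. zh k t - zk k t)"
   using LK_diff[OF smooth_f sqv sqv cz(3) cz(2) t, of k k k k] zh_eq[OF t, of k] zlin_LK(2)[OF t, of k] by (simp add: algebra_simps)
  then show "norm (zh k t - zk k t) <= C1 * e k + C * (LINT s|leb t. norm (zh k s - zk k s))"
   using C1(2)[OF t, of k] C(2)[OF t cd] norm_triangle_ineq[of "DQ f k t - LK f t (v k) (zh k)" "LK f t (%_. 0) (%t. zh k t - zk k t)"] by simp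
 qed
 then show thesis using C1(1) by (intro that[of "2 * C1 * exp (2 * C * T)"]) (auto simp: mult_ac)
qed

lemma zk_tendsto: assumes t: "t : {0..T}" shows "(%k. zk k t) ~~> zl t"
proof -
 obtain C where C: "C >= 0" "!!k t. t : {0..T} ==> norm (zh k t - zk k t) <= C * e k" using zh_zk by blast
 have "(%k. zh k t - zk k t) ~~> 0"
  by (rule Lim_null_comparison[where g="%k. C * e k"]) (use C(2)[OF t] tendsto_mult_left[OF e(2), of C] in auto)
 from tendsto_diff[OF zh_tendsto[OF t] this] show ?thesis by simp
qed

lemma zk_bounded: obtains D where "D >= 0" "!!k t. t : {0..T} ==> norm (zk k t) <= D" "!!k t. t : {0..T} ==> norm (zh k t) <= D"
proof -
 obtain C where C: "C >= 0" "!!k t. t : {0..T} ==> norm (zh k t - zk k t) <= C * e k" using zh_zk by blast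
 obtain D where D: "D >= 0" "!!k t. t : {0..T} ==> norm (zh k t) <= D" using zh_bounded by blast
 obtain E where E: "!!k. e k <= E" using tendsto_real_bound[OF e(2)] by blast
 have E0: "E >= 0" using E[of 0] e(1)[of 0] by simp
 have "norm (zk k t) <= D + C * E" if t: "t : {0..T}" for k t
 proof -
  have "norm (zk k t) <= norm (zh k t) + norm (zh k t - zk k t)" using norm_triangle_ineq4[of "zh k t" "zh k t - zk k t"] by simp
  also have "... <= D + C * E" using C D(2)[OF t, of k] E[of k] by (intro add_mono order.trans[OF C(2)[OF t] mult_left_mono]) auto
  finally show ?thesis .
 qed
 then show thesis using D C(1) E0 by (intro that[of "D + C * E"]) (auto intro: add_increasing2)
qed

lemma DQ_tendsto:
 assumes F: "smooth F" and t: "!!k. t k : {0..T}" "\<tau> : {0..T}" "t ~~> \<tau>"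
 shows "(%k. DQ F k (t k)) ~~> LK F \<tau> w zl"
proof -
 obtain C where C: "C >= 0" "!!k t. t : {0..T} ==> norm (DQ F k t - LK F t (v k) (zh k)) <= C * e k"
  using DQ_LK[OF F] by blast
 obtain D where D: "D >= 0" "!!k t. t : {0..T} ==> norm (zh k t) <= D" using zh_bounded by blast
 have "(%k. DQ F k (t k) - LK F (t k) (v k) (zh k)) ~~> 0"
  by (rule Lim_null_comparison[where g="%k. C * e k"]) (use C(2)[OF t(1)] tendsto_mult_left[OF e(2), of C] in auto)
 moreover have "(%k. LK F (t k) (v k) (zh k)) ~~> LK F \<tau> w zl"
  by (rule LK_weak[OF F cz(3) cz(1) D(2) zh_tendsto t])
 ultimately show ?thesis using tendsto_add by fastforce
qed

text \<open>The moving times serve the mean value points that occur at touch points.\<close>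

lemma zh_tendsto_seq:
 assumes t: "!!k. t k : {0..T}" "\<tau> : {0..T}" "t ~~> \<tau>"
 shows "(%k. zh k (t k)) ~~> zl \<tau>"
 unfolding zh_eq[OF t(1)] zlin_LK(1)[OF t(2)] by (intro tendsto_add init DQ_tendsto[OF smooth_f] t)

end

section \<open>Touch points\<close>

lemma mvt_within:
 assumes d: "!!t. t : {0..T} ==> (\<phi> has_real_derivative \<phi>' t) (at t within {0..T})"
  and ab: "a : {0..T}" "b : {0..T}"
 shows "\<exists>\<xi>. \<xi> : {0..T} & \<bar>\<xi> - a\<bar> <= \<bar>b - a\<bar> & \<phi> b - \<phi> a = \<phi>' \<xi> * (b - a)"
proof -
 have m: "\<exists>\<xi>\<in>{c<..<e}. \<phi> e - \<phi> c = \<phi>' \<xi> * (e - c)" if "c < e" "c : {0..T}" "e : {0..T}" for c e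
 proof (rule mvt_simple[OF that(1)])
  fix x assume "c <= x" "x <= e"
  then have "(\<phi> has_real_derivative \<phi>' x) (at x within {c..e})" using that by (intro DERIV_subset[OF d]) auto
  then show "(\<phi> has_derivative (%h. \<phi>' x * h)) (at x within {c..e})" by (simp add: has_field_derivative_def)
 qed
 consider "a = b" | "a < b" | "b < a" by linarith
 then show ?thesis
 proof cases
  case 1 then show ?thesis using ab by (intro exI[of _ a]) auto
 next
  case 2
  then obtain \<xi> where "\<xi> : {a<..<b}" "\<phi> b - \<phi> a = \<phi>' \<xi> * (b - a)" using m ab by blast
  then show ?thesis using ab by (intro exI[of _ \<xi>]) auto
 next
  case 3
  then obtain \<xi> where x: "\<xi> : {b<..<a}" "\<phi> a - \<phi> b = \<phi>' \<xi> * (a - b)" using m ab by blast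
  then have "\<phi> b - \<phi> a = \<phi>' \<xi> * (b - a)" by (simp add: algebra_simps)
  then show ?thesis using ab x(1) by (intro exI[of _ \<xi>]) auto
 qed
qed

locale numbered_perturbation = perturbation P ub yb u y e rho v zh w z0 zl zk
 for P :: "('m::finite, 'n::finite) ocp" and ub yb u y e rho v zh w z0 zl zk +
 assumes numbered': "numbered_by_order P" and A2': "A2 P"
begin

sublocale numbered_problem P
 by unfold_locales (rule numbered' A2')+

text \<open>\<open>gdot\<close> is a smooth function of time, state and memory, and the difference
  quotients of state and memory converge along moving times. As it contains no instantaneous control
  value, weak convergence of the controls is enough.\<close>

lemma gdot_quotient:
 assumes i: "i : {nord1 P..<ncon P}" and t: "!!k. t k : {0..T}" "\<tau> : {0..T}" "t ~~> \<tau>"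
 shows "(%k. (1 / e k) * (gdot i (u k) (y k) (t k) - gdot i ub yb (t k))) ~~> zdot i ub yb w zl \<tau>"
proof -
 note g = smooth_con'[OF i]
 let ?G = "%(x, h). fd (con P i) x h"
 have yl: "(%k. yb (t k)) ~~> yb \<tau>"
  using continuous_on_tendsto_compose[OF traj(2)[OF trb] t(3) t(2)] t(1) by simp
 have ml: "(%k. memory ub yb (t k)) ~~> memory ub yb \<tau>"
  using continuous_on_tendsto_compose[OF traj(4)[OF trb] t(3) t(2)] t(1) by simp
 have sDf: "smooth (Dtau f)" by (rule smooth_Dtau[OF smooth_f])
 have 1: "(%k. (1 / e k) *R (drift i ((t k, yb (t k)) + e k *R (0, zh k (t k))) - drift i (t k, yb (t k)))) ~~> fd (drift i) (\<tau>, yb \<tau>) (0, zl \<tau>)"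
  by (rule strict_difference_quotient[OF smooth_drift[OF i] e]) (intro tendsto_Pair t yl tendsto_const zh_tendsto_seq)+
 have 2: "(%k. (1 / e k) *R (?G ((yb (t k), memory ub yb (t k)) + e k *R (zh k (t k), DQ (Dtau f) k (t k))) - ?G (yb (t k), memory ub yb (t k))))
   ~~> fd ?G (yb \<tau>, memory ub yb \<tau>) (zl \<tau>, LK (Dtau f) \<tau> w zl)"
  by (rule strict_difference_quotient[OF smooth_fd_pair[OF g] e]) (intro tendsto_Pair t yl ml zh_tendsto_seq DQ_tendsto[OF sDf])+
 have m: "memory ub yb (t k) + e k *R DQ (Dtau f) k (t k) = memory (u k) (y k) (t k)" for k
  using e(1)[of k] by (simp add: DQ_def memory_def)
 have lim: "fd (drift i) (\<tau>, yb \<tau>) (0, zl \<tau>) + fd ?G (yb \<tau>, memory ub yb \<tau>) (zl \<tau>, LK (Dtau f) \<tau> w zl) = zdot i ub yb w zl \<tau>"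
  unfolding zdot_def fd_pair[OF g] by (simp add: LK_def memory_lin_def D2v_symmetric[OF g, of _ "memory ub yb \<tau>"])
 have eq: "(1 / e k) * (gdot i (u k) (y k) (t k) - gdot i ub yb (t k)) =
   (1 / e k) *R (drift i ((t k, yb (t k)) + e k *R (0, zh k (t k))) - drift i (t k, yb (t k))) +
   (1 / e k) *R (?G ((yb (t k), memory ub yb (t k)) + e k *R (zh k (t k), DQ (Dtau f) k (t k))) - ?G (yb (t k), memory ub yb (t k)))" for k
  by (simp add: gdot_def m y_eq algebra_simps)
 show ?thesis using tendsto_add[OF 1 2] unfolding eq lim .
qed

text \<open>The bound comes from evaluating \<open>g\<^sub>i(y\<^sub>k)\<close> at the approximate maximizer
  \<open>\<tau> - \<epsilon>\<^sub>k \<zeta> / c\<close> instead of at \<open>\<tau>\<close>.\<close>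

lemma touch_inequality:
 assumes i: "i : {nord1 P..<ncon P}" and \<tau>: "\<tau> : {0<..<T}" and z: "con P i (yb \<tau>) = 0"
  and nb: "!!t. t : {0..T} ==> con P i (yb t) <= 0" and nk: "!!k t. t : {0..T} ==> con P i (y k t) <= 0"
  and wd: "has_weak_deriv2_at T (%t. con P i (yb t)) \<tau> c" and c: "c < 0"
 obtains X where "X ~~> (zdot i ub yb w zl \<tau>)\<^sup>2 / (2 * c)" "!!k. con P i (y k \<tau>) <= (e k)\<^sup>2 * X k"
proof -
 let ?\<zeta> = "zdot i ub yb w zl \<tau>"
 \<comment> \<open>The maximizer of \<open>\<zeta> s + c s\<^sup>2 / 2\<close>, the quadratic model
   of the perturbed constraint near the touch point in the time scale \<open>e k\<close>.\<close>
 define \<sigma> where "\<sigma> = - ?\<zeta> / c"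
 \<comment> \<open>For the first indices the shifted time may leave the interval; the fallback
   \<open>\<tau>\<close> keeps the final inequality true for every \<open>k\<close>, while the
   limits see only the shifted times.\<close>
 define s where "s k = (if \<tau> + e k * \<sigma> : {0..T} then \<tau> + e k * \<sigma> else \<tau>)" for k
 have \<tau>T: "\<tau> : {0..T}" using \<tau> by auto
 have s: "s k : {0..T}" for k using \<tau>T by (simp add: s_def)
 have l: "(%k. \<tau> + e k * \<sigma>) ~~> \<tau> + 0 * \<sigma>" by (intro tendsto_intros e)
 have ev: "\<forall>\<^sub>F k in sequentially. s k = \<tau> + e k * \<sigma>"
  using topological_tendstoD[OF l, of "{0<..<T}"] \<tau> by (auto simp: s_def elim!: eventually_mono)
 have sl: "s ~~> \<tau>"
  using tendsto_cong[OF ev] l by simp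
 have sq: "(%k. (s k - \<tau>) / e k) ~~> \<sigma>"
  by (rule tendsto_eventually) (use ev in eventually_elim, use e(1) in \<open>simp add: less_imp_neq[THEN not_sym]\<close>)
 note cb = con_derivative[OF i trb] and ck = con_derivative[OF i tr]
 \<comment> \<open>The mean value theorem is applied to the difference of perturbed and reference
   constraint: its derivative divided by \<open>e k\<close> converges to \<open>\<zeta>\<close>, and
   the time increment supplies a second factor \<open>e k\<close>.\<close>
 have "\<exists>\<xi>. \<xi> : {0..T} & \<bar>\<xi> - \<tau>\<bar> <= \<bar>s k - \<tau>\<bar> &
   (con P i (y k (s k)) - con P i (yb (s k))) - (con P i (y k \<tau>) - con P i (yb \<tau>)) = (gdot i (u k) (y k) \<xi> - gdot i ub yb \<xi>) * (s k - \<tau>)" for k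
  by (rule mvt_within[OF _ \<tau>T s, where \<phi>="%t. con P i (y k t) - con P i (yb t)"]) (intro DERIV_diff ck cb; assumption)
 then obtain \<xi> where \<xi>: "!!k. \<xi> k : {0..T}" "!!k. \<bar>\<xi> k - \<tau>\<bar> <= \<bar>s k - \<tau>\<bar>"
  "!!k. (con P i (y k (s k)) - con P i (yb (s k))) - (con P i (y k \<tau>) - con P i (yb \<tau>)) = (gdot i (u k) (y k) (\<xi> k) - gdot i ub yb (\<xi> k)) * (s k - \<tau>)"
  by metis
 have to\<tau>: "x ~~> \<tau>" if "!!k. \<bar>x k - \<tau>\<bar> <= \<bar>s k - \<tau>\<bar>" for x
 proof (rule LIM_zero_cancel, rule Lim_null_comparison[where g="%k. \<bar>s k - \<tau>\<bar>"])
  show "(%k. \<bar>s k - \<tau>\<bar>) ~~> 0" using tendsto_rabs[OF LIM_zero[OF sl]] by simp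
 qed (use that in auto)
 have q: "(%k. (1 / e k) * (gdot i (u k) (y k) (\<xi> k) - gdot i ub yb (\<xi> k))) ~~> ?\<zeta>"
  by (rule gdot_quotient[OF i \<xi>(1) \<tau>T to\<tau>[OF \<xi>(2)]])
 have gc: "(gdot i ub yb has_real_derivative c) (at \<tau>)"
  by (rule weak_deriv2_imp_derivative[OF cb(2) cb(1) wd])
 have d\<tau>: "((%t. con P i (yb t)) has_real_derivative gdot i ub yb \<tau>) (at \<tau>)"
  using cb(2)[OF \<tau>T] at_within_Icc_at[of 0 \<tau> T] \<tau> by simp
 have g0: "gdot i ub yb \<tau> = 0"
 proof (rule DERIV_local_max[OF d\<tau>, of "min \<tau> (T - \<tau>)"])
  show "ALL t. \<bar>\<tau> - t\<bar> < min \<tau> (T - \<tau>) --> con P i (yb t) <= con P i (yb \<tau>)"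
  proof (intro allI impI)
   fix t assume "\<bar>\<tau> - t\<bar> < min \<tau> (T - \<tau>)"
   then have "t : {0..T}" by (auto simp: abs_if split: if_splits)
   then show "con P i (yb t) <= con P i (yb \<tau>)" using nb z by simp
  qed
 qed (use \<tau> in auto)
 \<comment> \<open>Deviation of the reference constraint from its quadratic model. Since
   \<open>gdot\<close> vanishes at the interior maximum \<open>\<tau>\<close> and has derivative
   \<open>c\<close> there, the increments of \<open>H\<close> are of smaller order than
   \<open>(e k)\<^sup>2\<close>.\<close>
 define H where "H t = con P i (yb t) - c / 2 * (t - \<tau>)\<^sup>2" for t
 have dH: "(H has_real_derivative gdot i ub yb t - c * (t - \<tau>)) (at t within {0..T})" if "t : {0..T}" for t
  unfolding H_def by (auto intro!: derivative_eq_intros cb(2) that)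
 have "\<exists>\<xi>. \<xi> : {0..T} & \<bar>\<xi> - \<tau>\<bar> <= \<bar>s k - \<tau>\<bar> & H (s k) - H \<tau> = (gdot i ub yb \<xi> - c * (\<xi> - \<tau>)) * (s k - \<tau>)" for k
  by (rule mvt_within[OF dH \<tau>T s])
 then obtain \<xi>' where \<xi>': "!!k. \<xi>' k : {0..T}" "!!k. \<bar>\<xi>' k - \<tau>\<bar> <= \<bar>s k - \<tau>\<bar>"
  "!!k. H (s k) - H \<tau> = (gdot i ub yb (\<xi>' k) - c * (\<xi>' k - \<tau>)) * (s k - \<tau>)" by metis
 have Hl: "(%k. (H (s k) - H \<tau>) / (e k)\<^sup>2) ~~> 0"
 proof (rule LIMSEQ_I)
  fix r :: real assume r: "r > 0"
  define \<delta> where "\<delta> = r / (2 * (\<sigma>\<^sup>2 + 1))"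
  have s1: "\<sigma>\<^sup>2 + 1 > 0" by (simp add: add_nonneg_pos)
  have \<delta>: "\<delta> > 0" using r s1 by (simp add: \<delta>_def)
  obtain d where d: "d > 0" "!!t. \<bar>t - \<tau>\<bar> < d ==> \<bar>gdot i ub yb t - c * (t - \<tau>)\<bar> <= \<delta> * \<bar>t - \<tau>\<bar>"
   using gc \<delta> g0 unfolding has_field_derivative_def has_derivative_at_alt by (auto simp: algebra_simps)
  have "\<forall>\<^sub>F k in sequentially. \<bar>s k - \<tau>\<bar> < d" using tendstoD[OF sl d(1)] by (simp add: dist_real_def)
  with ev have "\<forall>\<^sub>F k in sequentially. norm ((H (s k) - H \<tau>) / (e k)\<^sup>2 - 0) < r"
  proof eventually_elim
   case (elim k)
   have "\<bar>gdot i ub yb (\<xi>' k) - c * (\<xi>' k - \<tau>)\<bar> <= \<delta> * \<bar>s k - \<tau>\<bar>"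
    using d(2)[of "\<xi>' k"] \<xi>'(2)[of k] elim(2) \<delta> by (smt (verit) mult_left_mono)
   then have "\<bar>H (s k) - H \<tau>\<bar> <= \<delta> * \<bar>s k - \<tau>\<bar> * \<bar>s k - \<tau>\<bar>"
    unfolding \<xi>'(3) abs_mult by (rule mult_right_mono) simp
   also have "... = \<delta> * ((e k)\<^sup>2 * \<sigma>\<^sup>2)" using elim(1) e(1)[of k] by (simp add: abs_mult power2_eq_square)
   finally have "\<bar>H (s k) - H \<tau>\<bar> <= (\<delta> * \<sigma>\<^sup>2) * (e k)\<^sup>2" by (simp add: mult_ac)
   then have "\<bar>H (s k) - H \<tau>\<bar> / (e k)\<^sup>2 <= \<delta> * \<sigma>\<^sup>2" using e(1)[of k] by (simp add: pos_divide_le_eq)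
   also have "... <= \<delta> * (\<sigma>\<^sup>2 + 1)" using \<delta> by (intro mult_left_mono) auto
   also have "... = r / 2" using s1 unfolding \<delta>_def by (simp add: field_simps)
   also have "... < r" using r by simp
   finally show ?case by (simp add: abs_divide)
  qed
  then show "EX no. \<forall>k\<ge>no. norm ((H (s k) - H \<tau>) / (e k)\<^sup>2 - 0) < r" by (simp add: eventually_sequentially)
 qed
 define X where "X k = - ((H (s k) - H \<tau>) / (e k)\<^sup>2) - c / 2 * ((s k - \<tau>) / e k)\<^sup>2
  - ((1 / e k) * (gdot i (u k) (y k) (\<xi> k) - gdot i ub yb (\<xi> k))) * ((s k - \<tau>) / e k)" for k
 show thesis
 proof (rule that[of X])
  have "X ~~> - 0 - c / 2 * \<sigma>\<^sup>2 - ?\<zeta> * \<sigma>" unfolding X_def by (intro tendsto_intros Hl sq q)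
  also have "- 0 - c / 2 * \<sigma>\<^sup>2 - ?\<zeta> * \<sigma> = ?\<zeta>\<^sup>2 / (2 * c)" using c by (simp add: \<sigma>_def power2_eq_square field_simps)
  finally show "X ~~> ?\<zeta>\<^sup>2 / (2 * c)" .
  fix k
  have ek: "e k > 0" by (rule e)
  have "con P i (y k \<tau>) = con P i (y k (s k)) - con P i (yb (s k)) - (gdot i (u k) (y k) (\<xi> k) - gdot i ub yb (\<xi> k)) * (s k - \<tau>)"
   using \<xi>(3)[of k] z by simp
  also have "... <= - con P i (yb (s k)) - (gdot i (u k) (y k) (\<xi> k) - gdot i ub yb (\<xi> k)) * (s k - \<tau>)"
   using nk[OF s, of k k] by simp
  also have "con P i (yb (s k)) = (H (s k) - H \<tau>) + c / 2 * (s k - \<tau>)\<^sup>2" by (simp add: H_def z)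
  finally have le: "con P i (y k \<tau>) <= - ((H (s k) - H \<tau>) + c / 2 * (s k - \<tau>)\<^sup>2) - (gdot i (u k) (y k) (\<xi> k) - gdot i ub yb (\<xi> k)) * (s k - \<tau>)" .
  have "(e k)\<^sup>2 * X k = - ((H (s k) - H \<tau>) + c / 2 * (s k - \<tau>)\<^sup>2) - (gdot i (u k) (y k) (\<xi> k) - gdot i ub yb (\<xi> k)) * (s k - \<tau>)"
   using ek by (simp add: X_def power2_eq_square field_simps)
  then show "con P i (y k \<tau>) <= (e k)\<^sup>2 * X k" using le by simp
 qed
qed

lemma zdot_tendsto:
 assumes i: "i : {nord1 P..<ncon P}" and \<tau>: "\<tau> : {0..T}"
 shows "(%k. zdot i ub yb (v k) (zk k) \<tau>) ~~> zdot i ub yb w zl \<tau>"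
proof -
 note g = smooth_con'[OF i]
 obtain D where D: "!!k t. t : {0..T} ==> norm (zk k t) <= D" using zk_bounded by metis
 have 1: "(%k. (%(x, h). fd (drift i) x h) ((\<tau>, yb \<tau>), (0, zk k \<tau>))) ~~> (%(x, h). fd (drift i) x h) ((\<tau>, yb \<tau>), (0, zl \<tau>))"
  by (rule continuous_on_tendsto_compose[OF smooth_continuous[OF smooth_fd_pair[OF smooth_drift[OF i]], of UNIV]])
   (auto intro!: tendsto_Pair tendsto_const zk_tendsto \<tau>)
 have 2: "(%k. (%(x, h, k). D2v (con P i) x h k) (yb \<tau>, zk k \<tau>, memory ub yb \<tau>)) ~~> (%(x, h, k). D2v (con P i) x h k) (yb \<tau>, zl \<tau>, memory ub yb \<tau>)"
  by (rule continuous_on_tendsto_compose[OF smooth_continuous[OF smooth_D2v_pair[OF g], of UNIV]])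
   (auto intro!: tendsto_Pair tendsto_const zk_tendsto \<tau>)
 have "(%k. LK (Dtau f) \<tau> (v k) (zk k)) ~~> LK (Dtau f) \<tau> w zl"
  by (rule LK_weak[OF smooth_Dtau[OF smooth_f] cz(2) cz(1) D zk_tendsto _ \<tau> tendsto_const]) (use \<tau> in auto)
 then have 3: "(%k. fd (con P i) (yb \<tau>) (memory_lin ub yb (v k) (zk k) \<tau>)) ~~> fd (con P i) (yb \<tau>) (memory_lin ub yb w zl \<tau>)"
  unfolding LK_def memory_lin_def by (rule bounded_linear.tendsto[OF bounded_linear_fd[OF g]])
 show ?thesis unfolding zdot_def using tendsto_add[OF tendsto_add[OF 1 2] 3] by simp
qed

end

section \<open>Smoothness, integrals and Taylor expansion of the Hamiltonian\<close>

lemma bounded_linear_embed3: "bounded_linear (%x. (0::'a::real_normed_vector, 0::'b::real_normed_vector, x :: 'c::real_normed_vector))"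
 by (simp add: bounded_linear_Pair bounded_linear_zero bounded_linear_ident)

text \<open>The directional derivative as a kernel with the direction fixed, so that it can be
  iterated; \<open>lin_kernel\<close> keeps the direction as an argument instead.\<close>

definition pd :: "(real \<times> real \<times> 'x::euclidean_space => 'b::real_normed_vector) => 'x => real \<times> real \<times> 'x => 'b" where
 "pd k h = (%q. fd k q (0, 0, h))"

lemma smooth_pd: "smooth k ==> smooth (pd k h)"
 unfolding pd_def by (rule smooth_fd)

lemma pd_lin_kernel: "pd k h (s, t, x) = lin_kernel k (s, t, x, h)"
 by (simp add: pd_def lin_kernel_def)

lemma pd_pd: "pd (pd k h) h' q = D2v k q (0, 0, h) (0, 0, h')"
 by (simp add: pd_def D2v_def)

definition quad_kernel :: "(real \<times> real \<times> 'x::euclidean_space => 'b::real_normed_vector) => real \<times> real \<times> 'x \<times> 'x => 'b" where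
 "quad_kernel k = (%(t, s, x, h). D2v k (t, s, x) (0, 0, h) (0, 0, h))"

lemma smooth_quad_kernel: "smooth k ==> smooth (quad_kernel k)"
 using smooth_compose_linear[OF _ smooth_D2v_pair, of "%(t, s, x, h). ((t, s, x), (0, 0, h), (0, 0, h))" k]
 unfolding quad_kernel_def case_prod_beta
 by (simp add: bounded_linear_intros bounded_linear_Pair bounded_linear_zero
   bounded_linear_compose[OF bounded_linear_fst] bounded_linear_compose[OF bounded_linear_snd] bounded_linear_fst bounded_linear_snd)

lemma integrable_inner_continuous:
 fixes p g :: "real => 'b::euclidean_space"
 assumes p: "integrable (lebesgue_on {a..b}) p" and g: "continuous_on {a..b} g"
 shows "integrable (lebesgue_on {a..b}) (%s. p s \<bullet> g s)"
proof -
 have "bounded (g ` {a..b})" by (intro compact_imp_bounded compact_continuous_image g compact_Icc)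
 then obtain C where C: "!!s. s : {a..b} ==> norm (g s) <= C" unfolding bounded_iff by blast
 have gm: "g : borel_measurable (lebesgue_on {a..b})" by (rule continuous_imp_measurable_on_sets_lebesgue[OF g]) simp
 show ?thesis
 proof (rule b_integrable_bound)
  show "integrable (lebesgue_on {a..b}) (%s. C * norm (p s))" using p by simp
  show "(%s. p s \<bullet> g s) : borel_measurable (lebesgue_on {a..b})"
   by (rule borel_measurable_inner[OF borel_measurable_integrable[OF p] gm])
  show "AE s in lebesgue_on {a..b}. norm (p s \<bullet> g s) <= norm (C * norm (p s))"
  proof (rule AE_I2)
   fix s assume "s : space (lebesgue_on {a..b})"
   then have "norm (g s) <= C" using C by simp
   then have "norm (p s) * norm (g s) <= norm (p s) * C" by (rule mult_left_mono) simp
   then show "norm (p s \<bullet> g s) <= norm (C * norm (p s))"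
    using Cauchy_Schwarz_ineq2[of "p s" "g s"] by (simp add: mult.commute)
  qed
 qed
qed

lemma LINT_inner_bound:
 fixes p g :: "real => 'b::euclidean_space"
 assumes p: "integrable (lebesgue_on {a..b}) p" and g: "continuous_on {a..b} g" and C: "!!s. s : {a..b} ==> norm (g s) <= C"
 shows "\<bar>LINT s|lebesgue_on {a..b}. p s \<bullet> g s\<bar> <= C * (LINT s|lebesgue_on {a..b}. norm (p s))"
proof -
 have "norm (LINT s|lebesgue_on {a..b}. p s \<bullet> g s) <= (LINT s|lebesgue_on {a..b}. C * norm (p s))"
 proof (rule b_integral_norm_bound_integral[OF integrable_inner_continuous[OF p g]])
  show "integrable (lebesgue_on {a..b}) (%s. C * norm (p s))" using p by simp
  fix s assume "s : space (lebesgue_on {a..b})"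
  then have "norm (g s) <= C" using C by simp
  then have "norm (p s) * norm (g s) <= norm (p s) * C" by (rule mult_left_mono) simp
  then show "norm (p s \<bullet> g s) <= C * norm (p s)"
   using Cauchy_Schwarz_ineq2[of "p s" "g s"] by (simp add: mult.commute)
 qed
 then show ?thesis by simp
qed

locale adjoint_state = control_problem P for P :: "('m::finite, 'n::finite) ocp" +
 fixes p :: "real => real ^ 'n"
 assumes p_int: "integrable M p"
begin

definition ptail :: "(real \<times> real \<times> 'x => real ^ 'n) => real => 'x => real" where
 "ptail c t x = (LINT s|lebesgue_on {t..T}. p s \<bullet> c (s, t, x))"

text \<open>The shape of the Hamiltonian with arbitrary smooth data in place of
  \<open>ell P\<close>, \<open>f\<close> and \<open>Dtau f\<close>. Derivatives have the same shape
  with differentiated data, so smoothness follows by an induction that generalizes over the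
  data.\<close>

definition hamk :: "('x => real) => (real \<times> real \<times> 'x => real ^ 'n) => (real \<times> real \<times> 'x => real ^ 'n) => real => 'x => real" where
 "hamk a b c t x = a x + p t \<bullet> b (t, t, x) + ptail c t x"

lemma ham_hamk: "ham P p t = hamk (ell P) f (Dtau f) t"
 by (simp add: fun_eq_iff ham_def hamk_def ptail_def)

lemma p_tail: assumes "t >= 0" shows "integrable (lebesgue_on {t..T}) p"
proof -
 have "integrable M (%s. indicat_real {t..T} s *R p s)"
  by (rule integrable_indicator_mult[OF p_int]) simp
 then have "integrable lebesgue (%s. indicat_real {0..T} s *R (indicat_real {t..T} s *R p s))"
  by (subst (asm) integrable_restrict_space) auto
 also have "(%s. indicat_real {0..T} s *R (indicat_real {t..T} s *R p s)) = (%s. indicat_real {t..T} s *R p s)"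
  using assms by (auto simp: indicator_def)
 finally show ?thesis by (subst integrable_restrict_space) auto
qed

lemma p_tail_le: "t >= 0 ==> (LINT s|lebesgue_on {t..T}. norm (p s)) <= (LINT s|M. norm (p s))"
 unfolding LINT_super[of t, where F="%s. norm (p s)"]
 by (intro integral_mono integrable_indicator_mult b_integrable_norm p_int) (auto simp: indicator_def)

lemma continuous_kernel:
 fixes c :: "real \<times> real \<times> 'x::euclidean_space => 'b::real_normed_vector"
 assumes "smooth c" shows "continuous_on S (%s. c (s, t, x))"
 by (rule continuous_on_compose2[OF smooth_continuous[OF assms, of UNIV]]) (auto intro!: continuous_intros)

lemma ptail_integrand:
 fixes c :: "real \<times> real \<times> 'x::euclidean_space => real ^ 'n"
 assumes "smooth c" "t >= 0" shows "integrable (lebesgue_on {t..T}) (%s. p s \<bullet> c (s, t, x))"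
 by (rule integrable_inner_continuous[OF p_tail[OF assms(2)] continuous_kernel[OF assms(1)]])

lemma ptail_bound:
 fixes g :: "real => real ^ 'n"
 assumes t: "t : {0..T}" and g: "continuous_on {t..T} g" and C: "C >= 0" "!!s. s : {0..T} ==> norm (g s) <= C"
 shows "\<bar>LINT s|lebesgue_on {t..T}. p s \<bullet> g s\<bar> <= C * (LINT s|M. norm (p s))"
proof -
 have "\<bar>LINT s|lebesgue_on {t..T}. p s \<bullet> g s\<bar> <= C * (LINT s|lebesgue_on {t..T}. norm (p s))"
  using t by (intro LINT_inner_bound p_tail g C(2)) auto
 also have "C * (LINT s|lebesgue_on {t..T}. norm (p s)) <= C * (LINT s|M. norm (p s))"
  using t by (intro mult_left_mono p_tail_le C(1)) auto
 finally show ?thesis .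
qed

lemma kernel_point_norm: "t : {0..T} ==> s : {0..T} ==> norm x <= R ==> norm (s, t, x) <= 2 * T + R"
 using norm_triple_le[of s t x] by auto

lemma pd_linear: "smooth c ==> linear (%h. pd c h q)"
 using linear_compose[OF bounded_linear.linear[OF bounded_linear_embed3] linear_fd[of c q]] by (simp add: o_def pd_def)

text \<open>Differentiation under the integral: \<open>p\<close> is merely integrable, but the
  Taylor remainder of \<open>c\<close> is uniform in \<open>s\<close> because all arguments stay in
  one ball of radius \<open>R\<close>.\<close>

lemma ptail_has_derivative:
 fixes c :: "real \<times> real \<times> 'x::euclidean_space => real ^ 'n"
 assumes c: "smooth c" and t: "t : {0..T}"
 shows "(ptail c t has_derivative (%h. ptail (pd c h) t x)) (at x)"
proof -
 have t0: "t >= 0" using t by simp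
 define Ip where "Ip = (LINT s|M. norm (p s))"
 have Ip: "Ip >= 0" by (simp add: Ip_def)
 define R where "R = 2 * T + (norm x + 1)"
 obtain C1 where C1: "C1 >= 0" "!!q h. norm q <= R ==> norm (fd c q h) <= C1 * norm h" using fd_bound[OF c] by metis
 obtain C2 where C2: "C2 >= 0" "!!q h. norm q <= R ==> norm (q + h) <= R ==> norm (c (q + h) - c q - fd c q h) <= C2 * (norm h)\<^sup>2"
  using taylor1[OF c] by metis
 have q: "norm (s, t, z) <= R" if "s : {0..T}" "norm z <= norm x + 1" for s z
  unfolding R_def by (rule kernel_point_norm[OF t that])
 have bl: "bounded_linear (%h. ptail (pd c h) t x)"
 proof (rule bounded_linear_intro)
  fix h h' :: 'x and r :: real
  show "ptail (pd c (h + h')) t x = ptail (pd c h) t x + ptail (pd c h') t x"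
   using ptail_integrand[OF smooth_pd[OF c] t0, of h x] ptail_integrand[OF smooth_pd[OF c] t0, of h' x]
   by (simp add: ptail_def linear_add[OF pd_linear[OF c]] inner_add_right)
  show "ptail (pd c (r *R h)) t x = r *R ptail (pd c h) t x"
   by (simp add: ptail_def linear_scale[OF pd_linear[OF c]])
  have "\<bar>ptail (pd c h) t x\<bar> <= (C1 * norm h) * Ip"
   unfolding ptail_def Ip_def
   by (rule ptail_bound[OF t continuous_kernel[OF smooth_pd[OF c]]])
    (use C1(1) C1(2)[OF q, of _ x "(0, 0, h)"] in \<open>auto simp: pd_def norm_Pair\<close>)
  then show "norm (ptail (pd c h) t x) <= norm h * (C1 * Ip)" by (simp add: mult_ac)
 qed
 show ?thesis
  unfolding has_derivative_at_alt
 proof (intro conjI bl allI impI)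
  fix \<epsilon> :: real assume \<epsilon>: "\<epsilon> > 0"
  define K where "K = C2 * Ip + 1"
  have K: "K > 0" using C2(1) Ip by (auto simp: K_def intro: add_nonneg_pos)
  show "EX d>0. ALL y. norm (y - x) < d --> norm (ptail c t y - ptail c t x - ptail (pd c (y - x)) t x) <= \<epsilon> * norm (y - x)"
  proof (intro exI[of _ "min 1 (\<epsilon> / K)"] conjI allI impI)
   show "min 1 (\<epsilon> / K) > 0" using \<epsilon> K by simp
   fix y assume y: "norm (y - x) < min 1 (\<epsilon> / K)"
   have ny: "norm y <= norm x + 1" using y norm_triangle_ineq2[of y x] by simp
   have eq: "ptail c t y - ptail c t x - ptail (pd c (y - x)) t x = (LINT s|lebesgue_on {t..T}. p s \<bullet> (c (s, t, y) - c (s, t, x) - pd c (y - x) (s, t, x)))"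
    using ptail_integrand[OF c t0] ptail_integrand[OF smooth_pd[OF c] t0] by (simp add: ptail_def inner_diff_right)
   have "\<bar>LINT s|lebesgue_on {t..T}. p s \<bullet> (c (s, t, y) - c (s, t, x) - pd c (y - x) (s, t, x))\<bar> <= (C2 * (norm (y - x))\<^sup>2) * Ip"
    unfolding Ip_def
   proof (rule ptail_bound[OF t])
    show "continuous_on {t..T} (%s. c (s, t, y) - c (s, t, x) - pd c (y - x) (s, t, x))"
    by (intro continuous_on_diff continuous_kernel c smooth_pd)
    fix s assume s: "s : {0..T}"
    show "norm (c (s, t, y) - c (s, t, x) - pd c (y - x) (s, t, x)) <= C2 * (norm (y - x))\<^sup>2"
    using C2(2)[OF q[OF s, of x], of "(0, 0, y - x)"] q[OF s ny] by (simp add: pd_def norm_Pair)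
   qed (use C2 in simp)
   also have "(C2 * (norm (y - x))\<^sup>2) * Ip <= K * norm (y - x) * norm (y - x)"
   proof -
    have "C2 * Ip * (norm (y - x))\<^sup>2 <= K * (norm (y - x))\<^sup>2" by (rule mult_right_mono) (auto simp: K_def)
    then show ?thesis by (simp add: power2_eq_square mult_ac)
   qed
   also have "K * norm (y - x) * norm (y - x) <= \<epsilon> * norm (y - x)"
    using y K by (intro mult_right_mono) (auto simp: field_simps)
   finally show "norm (ptail c t y - ptail c t x - ptail (pd c (y - x)) t x) <= \<epsilon> * norm (y - x)" unfolding eq by simp
  qed
 qed
qed

lemma hamk_has_derivative:
 fixes a :: "'x::euclidean_space => real"
 assumes a: "smooth a" and b: "smooth b" and c: "smooth c" and t: "t : {0..T}"
 shows "(hamk a b c t has_derivative (%h. hamk (%x. fd a x h) (pd b h) (pd c h) t x)) (at x)"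
proof -
 have "((%x. b (t, t, x)) has_derivative (%h. pd b h (t, t, x))) (at x)"
  using smooth_has_derivative[OF smooth_partial[OF b], of t t x]
  by (rule back_subst[of "%D. (_ has_derivative D) _"]) (simp add: fun_eq_iff fd_partial[OF b] pd_def)
 note b' = bounded_linear.has_derivative[OF bounded_linear_inner_right this, of "p t"]
 show ?thesis
  unfolding hamk_def by (intro has_derivative_add smooth_has_derivative a b' ptail_has_derivative c t)
qed

lemma fd_hamk:
 fixes a :: "'x::euclidean_space => real"
 assumes "smooth a" "smooth b" "smooth c" "t : {0..T}"
 shows "fd (hamk a b c t) x h = hamk (%x. fd a x h) (pd b h) (pd c h) t x"
 using fdI[OF hamk_has_derivative[OF assms]] by simp

lemma smooth_hamk:
 fixes a :: "'x::euclidean_space => real"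
 assumes "smooth a" "smooth b" "smooth c" and t: "t : {0..T}"
 shows "smooth (hamk a b c t)"
proof -
 have "Ck k (hamk a b c t)" for k
  using assms(1-3)
 proof (induction k arbitrary: a b c)
  case 0
  have "continuous (at x) (hamk a b c t)" for x
   using hamk_has_derivative[OF 0 t] by (rule has_derivative_continuous)
  then show ?case by (simp add: continuous_at_imp_continuous_on)
 next
  case (Suc k)
  have "hamk a b c t differentiable at x" for x
   using hamk_has_derivative[OF Suc.prems t] by (auto simp: differentiable_def)
  then show ?case
   using Suc.IH[OF smooth_fd[OF Suc.prems(1)] smooth_pd[OF Suc.prems(2)] smooth_pd[OF Suc.prems(3)]]
   by (simp add: fd_hamk[OF Suc.prems t])
 qed
 then show ?thesis by (simp add: smooth_def)
qed

lemma smooth_ell: "smooth (ell P)" using A0 by (simp add: A0_def)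

lemma smooth_ham: "t : {0..T} ==> smooth (ham P p t)"
 unfolding ham_hamk by (intro smooth_hamk smooth_ell smooth_f smooth_Dtau)

lemma fd_ham:
 assumes t: "t : {0..T}"
 shows "fd (ham P p t) x h = hamk (%(x, h). fd (ell P) x h) (lin_kernel f) (lin_kernel (Dtau f)) t (x, h)"
 unfolding ham_hamk fd_hamk[OF smooth_ell smooth_f smooth_Dtau[OF smooth_f] t]
 by (simp add: hamk_def ptail_def pd_lin_kernel)

lemma D2v_ham_eq:
 assumes t: "t : {0..T}"
 shows "D2v (ham P p t) x h k = hamk (%x. D2v (ell P) x h k) (%q. D2v f q (0, 0, h) (0, 0, k)) (%q. D2v (Dtau f) q (0, 0, h) (0, 0, k)) t x"
proof -
 note s = smooth_ell smooth_f smooth_Dtau[OF smooth_f]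
 show ?thesis
  unfolding D2v_def ham_hamk fd_hamk[OF s t] fd_hamk[OF smooth_fd[OF s(1)] smooth_pd[OF s(2)] smooth_pd[OF s(3)] t]
  by (simp add: hamk_def ptail_def pd_pd D2v_def)
qed

lemma D2v_ham:
 assumes t: "t : {0..T}"
 shows "D2v (ham P p t) x h h = hamk (%(x, h). D2v (ell P) x h h) (quad_kernel f) (quad_kernel (Dtau f)) t (x, h)"
 unfolding D2v_ham_eq[OF t] by (simp add: hamk_def ptail_def quad_kernel_def)

text \<open>Fubini exchanges the roles of the two times: integrating over \<open>t\<close> the
  future weighted by \<open>p\<close> equals pairing \<open>p\<close> with the past. In this way the
  integral term of the Hamiltonian matches the memory of the state equation.\<close>

lemma ptail_integrable:
 fixes c :: "real \<times> real \<times> 'x::euclidean_space => real ^ 'n"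
 assumes c: "smooth c" and Y: "Y : borel_measurable M" and \<beta>: "integrable M \<beta>"
  and bd: "AE t in M. \<forall>s\<in>{0..T}. norm (c (s, t, Y t)) <= \<beta> t"
 shows "integrable M (%t. ptail c t (Y t))"
  "(LINT t|M. ptail c t (Y t)) = (LINT s|M. p s \<bullet> (LINT t|leb s. c (s, t, Y t)))"
  "integrable M (%s. p s \<bullet> (LINT t|leb s. c (s, t, Y t)))"
proof -
 define F where "F s t = indicat_real {q. snd q <= fst q} (s, t) *R (p s \<bullet> c (s, t, Y t))" for s t
 have m1: "(%q. p (fst q)) : borel_measurable (M \<Otimes>\<^sub>M M)"
  using measurable_compose[OF measurable_fst borel_measurable_integrable[OF p_int]] .
 have m2: "(%q. (fst q, snd q, Y (snd q))) : borel_measurable (M \<Otimes>\<^sub>M M)"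
  using measurable_compose[OF measurable_fst measurable_id_Icc[of 0 T]] measurable_compose[OF measurable_snd measurable_id_Icc[of 0 T]]
   measurable_compose[OF measurable_snd Y] by (intro borel_measurable_Pair) auto
 have m3: "(%q. indicat_real {q. snd q <= fst q} q) : borel_measurable (M \<Otimes>\<^sub>M M)"
 proof -
  have "{q :: real \<times> real. snd q <= fst q} : sets borel" by (intro borel_closed closed_Collect_le continuous_intros)
  then have "indicat_real {q :: real \<times> real. snd q <= fst q} : borel_measurable borel" by simp
  from measurable_compose[OF _ this, of "%q. (fst q, snd q)" "M \<Otimes>\<^sub>M M"]
  show ?thesis
   using measurable_compose[OF measurable_fst measurable_id_Icc[of 0 T]] measurable_compose[OF measurable_snd measurable_id_Icc[of 0 T]]
   by (auto intro!: borel_measurable_Pair)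
 qed
 have Fm: "case_prod F : borel_measurable (M \<Otimes>\<^sub>M M)"
  unfolding F_def case_prod_beta prod.collapse
  by (intro borel_measurable_scaleR m3 borel_measurable_inner m1 continuous_compose_measurable[OF smooth_continuous[OF c] m2])
 have "AE s in M. AE t in M. norm (F s t) <= norm (p s) * \<beta> t"
 proof (rule AE_I2)
  fix s assume "s : space M"
  then have s: "s : {0..T}" by simp
  show "AE t in M. norm (F s t) <= norm (p s) * \<beta> t"
   using bd
  proof eventually_elim
   case (elim t)
   then have n: "norm (c (s, t, Y t)) <= \<beta> t" using s by blast
   have "norm (F s t) <= \<bar>p s \<bullet> c (s, t, Y t)\<bar>" by (simp add: F_def indicator_def)
   also have "\<bar>p s \<bullet> c (s, t, Y t)\<bar> <= norm (p s) * norm (c (s, t, Y t))" by (rule Cauchy_Schwarz_ineq2)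
   also have "norm (p s) * norm (c (s, t, Y t)) <= norm (p s) * \<beta> t" by (rule mult_left_mono[OF n]) simp
   finally show ?case .
  qed
 qed
 note fb = fubini_swap[OF sigma_finite_Icc sigma_finite_Icc Fm b_integrable_norm[OF p_int] \<beta> this]
 have e1: "(LINT s|M. F s t) = ptail c t (Y t)" if "t : {0..T}" for t
  unfolding ptail_def LINT_super[of t, where F="%s. p s \<bullet> c (s, t, Y t)", OF that[THEN atLeastAtMost_iff[THEN iffD1], THEN conjunct1]]
  by (rule b_integral_cong) (auto simp: F_def indicator_def)
 have e2: "(LINT t|M. F s t) = p s \<bullet> (LINT t|leb s. c (s, t, Y t))" if s: "s : {0..T}" for s
 proof -
  have ic: "integrable M (%t. c (s, t, Y t))"
   by (rule b_integrable_bound[OF \<beta> kernel_measurable(1)[OF c Y measurable_id_Icc]])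
    (use bd s in \<open>auto elim!: eventually_mono intro: order.trans[OF _ abs_ge_self]\<close>)
  have s0: "s <= T" using s by simp
  have ii: "integrable M (%t. indicat_real {0..s} t *R c (s, t, Y t))" by (rule integrable_indicator_mult[OF ic]) simp
  have "(LINT t|M. F s t) = (LINT t|M. p s \<bullet> (indicat_real {0..s} t *R c (s, t, Y t)))"
   by (rule b_integral_cong) (auto simp: F_def indicator_def)
  also have "(LINT t|M. p s \<bullet> (indicat_real {0..s} t *R c (s, t, Y t))) = p s \<bullet> (LINT t|M. indicat_real {0..s} t *R c (s, t, Y t))"
   by (rule Bochner_Integration.integral_inner_right) (use ii in simp)
  finally show ?thesis unfolding LINT_sub[OF s0] .
 qed
 show "integrable M (%t. ptail c t (Y t))"
  using fb(3) by (rule b_integrable_cong[THEN iffD1, rotated -1]) (auto simp: e1)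
 show "integrable M (%s. p s \<bullet> (LINT t|leb s. c (s, t, Y t)))"
  using fb(2) by (rule b_integrable_cong[THEN iffD1, rotated -1]) (auto simp: e2)
 have "(LINT t|M. ptail c t (Y t)) = (LINT t|M. LINT s|M. F s t)"
  by (rule b_integral_cong) (auto simp: e1)
 moreover have "(LINT s|M. p s \<bullet> (LINT t|leb s. c (s, t, Y t))) = (LINT s|M. LINT t|M. F s t)"
  by (rule b_integral_cong) (auto simp: e2)
 ultimately show "(LINT t|M. ptail c t (Y t)) = (LINT s|M. p s \<bullet> (LINT t|leb s. c (s, t, Y t)))"
  using fb(1) by simp
qed

lemma inner_p_integrable:
 assumes p_bound: "AE t in M. norm (p t) <= B" and g: "g : borel_measurable M" and \<beta>: "integrable M \<beta>" and b: "AE t in M. norm (g t) <= \<beta> t"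
 shows "integrable M (%t. p t \<bullet> g t)"
proof (rule b_integrable_bound)
 show "integrable M (%t. B * \<beta> t)" using \<beta> by simp
 show "(%t. p t \<bullet> g t) : borel_measurable M" by (rule borel_measurable_inner[OF borel_measurable_integrable[OF p_int] g])
 show "AE t in M. norm (p t \<bullet> g t) <= norm (B * \<beta> t)"
  using b p_bound
 proof eventually_elim
  case (elim t)
  have "\<bar>p t \<bullet> g t\<bar> <= norm (p t) * norm (g t)" by (rule Cauchy_Schwarz_ineq2)
  also have "norm (p t) * norm (g t) <= B * \<beta> t" using elim order.trans[OF norm_ge_zero, of "p t" B] by (intro mult_mono) auto
  finally show ?case by simp
 qed
qed

lemma inner_p_integrable_bounded:
 assumes g: "g : borel_measurable M" and b: "AE t in M. norm (g t) <= C"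
 shows "integrable M (%t. p t \<bullet> g t)"
proof (rule b_integrable_bound)
 show "integrable M (%t. C * norm (p t))" using p_int by simp
 show "(%t. p t \<bullet> g t) : borel_measurable M" by (rule borel_measurable_inner[OF borel_measurable_integrable[OF p_int] g])
 show "AE t in M. norm (p t \<bullet> g t) <= norm (C * norm (p t))"
  using b
 proof eventually_elim
  case (elim t)
  have "\<bar>p t \<bullet> g t\<bar> <= norm (p t) * norm (g t)" by (rule Cauchy_Schwarz_ineq2)
  also have "norm (p t) * norm (g t) <= norm (p t) * C" by (rule mult_left_mono[OF elim]) simp
  finally show ?case by (simp add: mult.commute)
 qed
qed

lemma hamk_integrable:
 fixes a :: "'x::euclidean_space => real"
 assumes a: "smooth a" and c: "smooth c" and Y: "Y : borel_measurable M" and \<beta>: "integrable M \<beta>"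
  and ba: "AE t in M. \<bar>a (Y t)\<bar> <= \<beta> t" and b: "integrable M (%t. p t \<bullet> b (t, t, Y t))"
  and bc: "AE t in M. \<forall>s\<in>{0..T}. norm (c (s, t, Y t)) <= \<beta> t"
 shows "integrable M (%t. a (Y t))" "integrable M (%t. hamk a b c t (Y t))"
proof -
 show 1: "integrable M (%t. a (Y t))"
  by (rule b_integrable_bound[OF \<beta> continuous_compose_measurable[OF smooth_continuous[OF a] Y]])
   (use ba in \<open>auto elim!: eventually_mono intro: order.trans[OF _ abs_ge_self]\<close>)
 show "integrable M (%t. hamk a b c t (Y t))"
  unfolding hamk_def by (intro b_integrable_add 1 b ptail_integrable(1)[OF c Y \<beta> bc])
qed

text \<open>By the last identity, integrating the Hamiltonian along a trajectory gives the running
  cost plus the pairing of \<open>p\<close> with the weak derivative of the state.\<close>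

lemma ham_integral:
 assumes X: "X : Linf T"
 shows "integrable M (%t. ell P (X t))" "integrable M (%t. ham P p t (X t))"
  "integrable M (%t. p t \<bullet> f (t, t, X t))" "integrable M (%t. p t \<bullet> (LINT s|leb t. Dtau f (t, s, X s)))"
  "(LINT t|M. ham P p t (X t)) = (LINT t|M. ell P (X t)) + (LINT t|M. p t \<bullet> f (t, t, X t)) + (LINT t|M. p t \<bullet> (LINT s|leb t. Dtau f (t, s, X s)))"
proof -
 obtain R where X: "X : borel_measurable M" and R: "AE t in M. norm (X t) <= R" using X unfolding Linf_iff by blast
 obtain C where C: "C >= 0" and kb: "kernel_bound T f X (%_. C)" using kernel_bound_bounded[OF smooth_f X R] by blast
 then have ae: "AE t in M. \<forall>s\<in>{0..T}. norm (f (s, t, X t)) <= C & norm (Dtau f (s, t, X t)) <= C" by (simp add: kernel_bound_def)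
 obtain C' where C': "C' >= 0" "!!x. norm x <= R ==> norm (ell P x) <= C'" using smooth_bounded_on_ball[OF smooth_ell] by metis
 have 1: "AE t in M. \<bar>ell P (X t)\<bar> <= max C C'" using R by eventually_elim (use C'(2) in fastforce)
 have 2: "AE t in M. \<forall>s\<in>{0..T}. norm (Dtau f (s, t, X t)) <= max C C'" using ae by eventually_elim (auto intro: max.coboundedI1)
 have "AE t in M. norm (f (t, t, X t)) <= C" using ae AE_space by eventually_elim auto
 then show 3: "integrable M (%t. p t \<bullet> f (t, t, X t))"
  by (rule inner_p_integrable_bounded[OF kernel_measurable(2)[OF smooth_f X measurable_id_Icc]])
 note hi = hamk_integrable[where b = f, OF smooth_ell smooth_Dtau[OF smooth_f] X integrable_const_Icc 1 3 2]
 show i1: "integrable M (%t. ell P (X t))" by (rule hi(1))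
 show "integrable M (%t. ham P p t (X t))" using hi(2) by (simp add: ham_hamk)
 note bi = ptail_integrable[OF smooth_Dtau[OF smooth_f] X integrable_const_Icc 2]
 show "integrable M (%t. p t \<bullet> (LINT s|leb t. Dtau f (t, s, X s)))" by (rule bi(3))
 show "(LINT t|M. ham P p t (X t)) = (LINT t|M. ell P (X t)) + (LINT t|M. p t \<bullet> f (t, t, X t)) + (LINT t|M. p t \<bullet> (LINT s|leb t. Dtau f (t, s, X s)))"
  unfolding ham_hamk hamk_def bi(2)[symmetric] using i1 3 bi(1) by simp
qed

lemma fd_ham_integrable:
 assumes X: "X : Linf T" and H: "H : Linf T"
 shows "integrable M (%t. fd (ham P p t) (X t) (H t))"
proof -
 obtain R where X: "X : borel_measurable M" and R: "AE t in M. norm (X t) <= R" using X unfolding Linf_iff by blast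
 obtain K where H: "H : borel_measurable M" and K: "AE t in M. norm (H t) <= K" using H unfolding Linf_iff by blast
 have Y: "(%t. (X t, H t)) : borel_measurable M" using X H by (rule borel_measurable_Pair)
 obtain C1 where C1: "C1 >= 0" "!!x h. norm x <= R ==> norm (fd (ell P) x h) <= C1 * norm h" using fd_bound[OF smooth_ell] by metis
 obtain C2 where C2: "C2 >= 0" "!!t s x h. norm (t, s, x) <= 2 * T + R ==> norm (lin_kernel f (t, s, x, h)) <= C2 * norm h"
  using lin_kernel_bound[OF smooth_f, of "2 * T + R"] by metis
 obtain C3 where C3: "C3 >= 0" "!!t s x h. norm (t, s, x) <= 2 * T + R ==> norm (lin_kernel (Dtau f) (t, s, x, h)) <= C3 * norm h"
  using lin_kernel_bound[OF smooth_Dtau[OF smooth_f], of "2 * T + R"] by metis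
 define C where "C = C1 + C2 + C3"
 have CC: "C1 <= C" "C2 <= C" "C3 <= C" "C >= 0" using C1 C2 C3 by (auto simp: C_def)
 have le: "norm z <= C * K" if "norm z <= c * norm h" "c <= C" "norm h <= K" for z :: "'z::real_normed_vector" and c and h :: "(real ^ 'm) \<times> (real ^ 'n)"
  by (rule order.trans[OF that(1)]) (use that CC in \<open>auto intro: mult_mono\<close>)
 have ae: "AE t in M. \<bar>fd (ell P) (X t) (H t)\<bar> <= C * K &
  (\<forall>s\<in>{0..T}. norm (lin_kernel f (s, t, X t, H t)) <= C * K & norm (lin_kernel (Dtau f) (s, t, X t, H t)) <= C * K)"
  using R K AE_time_bound[OF R]
 proof eventually_elim
  case (elim t)
  then show ?case
   using le[OF C1(2) CC(1), of "X t" "H t"] le[OF C2(2) CC(2), of _ _ "X t" "H t"] le[OF C3(2) CC(3), of _ _ "X t" "H t"] by auto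
 qed
 have 1: "AE t in M. \<bar>(%(x, h). fd (ell P) x h) (X t, H t)\<bar> <= C * K" using ae by eventually_elim simp
 have 2: "AE t in M. \<forall>s\<in>{0..T}. norm (lin_kernel (Dtau f) (s, t, X t, H t)) <= C * K" using ae by eventually_elim simp
 have "AE t in M. norm (lin_kernel f (t, t, X t, H t)) <= C * K" using ae AE_space by eventually_elim auto
 then have 3: "integrable M (%t. p t \<bullet> lin_kernel f (t, t, X t, H t))"
  by (rule inner_p_integrable_bounded[OF kernel_measurable(2)[OF smooth_lin_kernel[OF smooth_f] Y measurable_id_Icc]])
 show ?thesis
  using hamk_integrable(2)[OF smooth_fd_pair[OF smooth_ell] smooth_lin_kernel[OF smooth_Dtau[OF smooth_f]] Y integrable_const_Icc 1 3 2]
  by (rule b_integrable_cong[THEN iffD1, rotated -1]) (auto simp: fd_ham)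
qed

lemma quad_kernel_bound:
 fixes k :: "real \<times> real \<times> 'x::euclidean_space => 'b::euclidean_space"
 assumes "smooth k" obtains C where "C >= 0"
  "!!t s x h. norm (t, s, x) <= R ==> norm (quad_kernel k (t, s, x, h)) <= C * (norm h)\<^sup>2"
proof -
 obtain C where C: "C >= 0" "!!q h k'. norm q <= R ==> norm (D2v k q h k') <= C * norm h * norm k'" using D2v_bound[OF assms] by metis
 show thesis
 proof (rule that[OF C(1)])
  fix t s :: real and x h :: 'x assume "norm (t, s, x) <= R"
  then show "norm (quad_kernel k (t, s, x, h)) <= C * (norm h)\<^sup>2"
   using C(2)[of "(t, s, x)" "(0, 0, h)" "(0, 0, h)"] by (simp add: quad_kernel_def norm_Pair power2_eq_square mult.assoc)
 qed
qed

lemma D2v_ham_integrable: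
 assumes p_bound: "AE t in M. norm (p t) <= B" and X: "X : Linf T" and H: "sqint M H"
 shows "integrable M (%t. D2v (ham P p t) (X t) (H t) (H t))"
proof -
 obtain R where X: "X : borel_measurable M" and R: "AE t in M. norm (X t) <= R" using X unfolding Linf_iff by blast
 have Hm: "H : borel_measurable M" and H2: "integrable M (%t. (norm (H t))\<^sup>2)" using H by (auto simp: sqint_def)
 have Y: "(%t. (X t, H t)) : borel_measurable M" using X Hm by (rule borel_measurable_Pair)
 obtain C1 where C1: "C1 >= 0" "!!x h k. norm x <= R ==> norm (D2v (ell P) x h k) <= C1 * norm h * norm k" using D2v_bound[OF smooth_ell] by metis
 obtain C2 where C2: "C2 >= 0" "!!t s x h. norm (t, s, x) <= 2 * T + R ==> norm (quad_kernel f (t, s, x, h)) <= C2 * (norm h)\<^sup>2"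
  using quad_kernel_bound[OF smooth_f, of "2 * T + R"] by metis
 obtain C3 where C3: "C3 >= 0" "!!t s x h. norm (t, s, x) <= 2 * T + R ==> norm (quad_kernel (Dtau f) (t, s, x, h)) <= C3 * (norm h)\<^sup>2"
  using quad_kernel_bound[OF smooth_Dtau[OF smooth_f], of "2 * T + R"] by metis
 define C where "C = C1 + C2 + C3"
 have CC: "C1 <= C" "C2 <= C" "C3 <= C" "C >= 0" using C1 C2 C3 by (auto simp: C_def)
 have le: "norm z <= C * (norm h)\<^sup>2" if "norm z <= c * (norm h)\<^sup>2" "c <= C" for z :: "'z::real_normed_vector" and c and h :: "(real ^ 'm) \<times> (real ^ 'n)"
  by (rule order.trans[OF that(1)]) (use that CC in \<open>auto intro: mult_mono\<close>)
 have C1': "norm (D2v (ell P) x h h) <= C1 * (norm h)\<^sup>2" if "norm x <= R" for x h using C1(2)[OF that, of h h] by (simp add: power2_eq_square mult.assoc)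
 have ae: "AE t in M. \<bar>D2v (ell P) (X t) (H t) (H t)\<bar> <= C * (norm (H t))\<^sup>2 &
  (\<forall>s\<in>{0..T}. norm (quad_kernel f (s, t, X t, H t)) <= C * (norm (H t))\<^sup>2 & norm (quad_kernel (Dtau f) (s, t, X t, H t)) <= C * (norm (H t))\<^sup>2)"
  using R AE_time_bound[OF R]
 proof eventually_elim
  case (elim t)
  then show ?case
   using le[OF C1' CC(1), of "X t" "H t"] le[OF C2(2) CC(2), of _ _ "X t" "H t"] le[OF C3(2) CC(3), of _ _ "X t" "H t"] by auto
 qed
 have sq: "smooth (%(x, h). D2v (ell P) x h h)"
  using smooth_compose_linear[OF _ smooth_D2v_pair[OF smooth_ell], of "%(x, h). (x, h, h)"]
  unfolding case_prod_beta by (simp add: bounded_linear_Pair bounded_linear_fst bounded_linear_snd)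
 have \<beta>: "integrable M (%t. C * (norm (H t))\<^sup>2)" using H2 by simp
 have 1: "AE t in M. \<bar>(%(x, h). D2v (ell P) x h h) (X t, H t)\<bar> <= C * (norm (H t))\<^sup>2" using ae by eventually_elim simp
 have 2: "AE t in M. \<forall>s\<in>{0..T}. norm (quad_kernel (Dtau f) (s, t, X t, H t)) <= C * (norm (H t))\<^sup>2" using ae by eventually_elim simp
 have "AE t in M. norm (quad_kernel f (t, t, X t, H t)) <= C * (norm (H t))\<^sup>2" using ae AE_space by eventually_elim auto
 then have 3: "integrable M (%t. p t \<bullet> quad_kernel f (t, t, X t, H t))"
  by (rule inner_p_integrable[OF p_bound kernel_measurable(2)[OF smooth_quad_kernel[OF smooth_f] Y measurable_id_Icc] \<beta>])
 show ?thesis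
  using hamk_integrable(2)[OF sq smooth_quad_kernel[OF smooth_Dtau[OF smooth_f]] Y \<beta> 1 3 2]
  by (rule b_integrable_cong[THEN iffD1, rotated -1]) (auto simp: D2v_ham)
qed

text \<open>The constant is the same for almost all times, since \<open>p\<close> is essentially
  bounded and integrable; this is where boundedness of the adjoint state enters.\<close>

lemma ham_taylor:
 assumes p_bound: "AE t in M. norm (p t) <= B"
 obtains C where "C >= 0"
  "AE t in M. ALL x h. norm x <= R --> norm (x + h) <= R -->
   \<bar>ham P p t (x + h) - ham P p t x - fd (ham P p t) x h - (1/2) * D2v (ham P p t) x h h\<bar> <= C * norm h ^ 3"
  "AE t in M. ALL x h k. norm x <= R --> \<bar>D2v (ham P p t) x h k\<bar> <= C * norm h * norm k"
proof -
 note sD = smooth_Dtau[OF smooth_f]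
 define Ip where "Ip = (LINT s|M. norm (p s))"
 have Ip: "Ip >= 0" by (simp add: Ip_def)
 obtain C1 where C1: "C1 >= 0" "!!x h. norm x <= R ==> norm (x + h) <= R ==> norm (ell P (x + h) - ell P x - fd (ell P) x h - (1/2) *R D2v (ell P) x h h) <= C1 * norm h ^ 3"
  using taylor2[OF smooth_ell] by metis
 obtain C2 where C2: "C2 >= 0" "!!x h. norm x <= 2 * T + R ==> norm (x + h) <= 2 * T + R ==> norm (f (x + h) - f x - fd f x h - (1/2) *R D2v f x h h) <= C2 * norm h ^ 3"
  using taylor2[OF smooth_f] by metis
 obtain C3 where C3: "C3 >= 0" "!!x h. norm x <= 2 * T + R ==> norm (x + h) <= 2 * T + R ==> norm (Dtau f (x + h) - Dtau f x - fd (Dtau f) x h - (1/2) *R D2v (Dtau f) x h h) <= C3 * norm h ^ 3"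
  using taylor2[OF sD] by metis
 obtain E1 where E1: "E1 >= 0" "!!x h k. norm x <= R ==> norm (D2v (ell P) x h k) <= E1 * norm h * norm k" using D2v_bound[OF smooth_ell] by metis
 obtain E2 where E2: "E2 >= 0" "!!x h k. norm x <= 2 * T + R ==> norm (D2v f x h k) <= E2 * norm h * norm k" using D2v_bound[OF smooth_f] by metis
 obtain E3 where E3: "E3 >= 0" "!!x h k. norm x <= 2 * T + R ==> norm (D2v (Dtau f) x h k) <= E3 * norm h * norm k" using D2v_bound[OF sD] by metis
 \<comment> \<open>Combines bounds for the three summands of a function of Hamiltonian shape; it is
   used once for the cubic remainder and once for the second derivative.\<close>
 have sum3: "\<bar>a + p t \<bullet> b + (LINT s|lebesgue_on {t..T}. p s \<bullet> c s)\<bar> <= (K1 + \<bar>B\<bar> * K2 + K3 * Ip) * r"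
  if t: "t : {0..T}" and pt: "norm (p t) <= B" and a: "\<bar>a\<bar> <= K1 * r" and b: "norm b <= K2 * r"
   and c: "continuous_on {t..T} c" "!!s. s : {0..T} ==> norm (c s) <= K3 * r" and K: "K3 >= 0" "r >= 0"
  for t a b c K1 K2 K3 r
 proof -
  have "\<bar>p t \<bullet> b\<bar> <= norm (p t) * norm b" by (rule Cauchy_Schwarz_ineq2)
  also have "norm (p t) * norm b <= \<bar>B\<bar> * (K2 * r)" using pt b by (intro mult_mono) auto
  finally have 1: "\<bar>p t \<bullet> b\<bar> <= \<bar>B\<bar> * (K2 * r)" .
  have 2: "\<bar>LINT s|lebesgue_on {t..T}. p s \<bullet> c s\<bar> <= K3 * r * Ip"
   unfolding Ip_def by (rule ptail_bound[OF t c(1) _ c(2)]) (use K in auto)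
  have "\<bar>a + p t \<bullet> b + (LINT s|lebesgue_on {t..T}. p s \<bullet> c s)\<bar> <= K1 * r + \<bar>B\<bar> * (K2 * r) + K3 * r * Ip"
   using 1 2 a by linarith
  then show ?thesis by (simp add: algebra_simps)
 qed
 define C where "C = (C1 + \<bar>B\<bar> * C2 + C3 * Ip) + (E1 + \<bar>B\<bar> * E2 + E3 * Ip)"
 have CC: "C1 + \<bar>B\<bar> * C2 + C3 * Ip <= C" "E1 + \<bar>B\<bar> * E2 + E3 * Ip <= C" "C >= 0" using C1 C2 C3 E1 E2 E3 Ip by (auto simp: C_def)
 show thesis
 proof (rule that[OF CC(3)])
  show "AE t in M. ALL x h. norm x <= R --> norm (x + h) <= R -->
   \<bar>ham P p t (x + h) - ham P p t x - fd (ham P p t) x h - (1/2) * D2v (ham P p t) x h h\<bar> <= C * norm h ^ 3"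
   using p_bound AE_space
  proof eventually_elim
   case (elim t)
   then have t: "t : {0..T}" by simp
   then have t0: "t >= 0" by simp
   show ?case
   proof (intro allI impI)
    fix x h :: "(real ^ 'm) \<times> (real ^ 'n)" assume x: "norm x <= R" "norm (x + h) <= R"
    note pn = kernel_point_norm[OF t _ x(1)] kernel_point_norm[OF t _ x(2)]
    have cD: "smooth (%q. D2v (Dtau f) q (0, 0, h) (0, 0, h))" unfolding D2v_def by (intro smooth_fd sD)
    define c where "c s = Dtau f (s, t, x + h) - Dtau f (s, t, x) - pd (Dtau f) h (s, t, x) - (1/2) *R D2v (Dtau f) (s, t, x) (0, 0, h) (0, 0, h)" for s
    have i: "integrable (lebesgue_on {t..T}) (%s. p s \<bullet> Dtau f (s, t, x + h))" "integrable (lebesgue_on {t..T}) (%s. p s \<bullet> Dtau f (s, t, x))"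
    "integrable (lebesgue_on {t..T}) (%s. p s \<bullet> pd (Dtau f) h (s, t, x))" "integrable (lebesgue_on {t..T}) (%s. p s \<bullet> D2v (Dtau f) (s, t, x) (0, 0, h) (0, 0, h))"
    by (rule ptail_integrand[OF sD t0] ptail_integrand[OF smooth_pd[OF sD] t0] ptail_integrand[OF cD t0])+
    have eq: "ham P p t (x + h) - ham P p t x - fd (ham P p t) x h - (1/2) * D2v (ham P p t) x h h =
    (ell P (x + h) - ell P x - fd (ell P) x h - (1/2) *R D2v (ell P) x h h) +
    p t \<bullet> (f (t, t, x + h) - f (t, t, x) - pd f h (t, t, x) - (1/2) *R D2v f (t, t, x) (0, 0, h) (0, 0, h)) +
    (LINT s|lebesgue_on {t..T}. p s \<bullet> c s)"
    unfolding D2v_ham_eq[OF t] unfolding ham_hamk fd_hamk[OF smooth_ell smooth_f sD t] unfolding hamk_def ptail_def c_def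
    using i by (simp add: inner_diff_right inner_scaleR_right add_divide_distrib)
    show "\<bar>ham P p t (x + h) - ham P p t x - fd (ham P p t) x h - (1/2) * D2v (ham P p t) x h h\<bar> <= C * norm h ^ 3"
    unfolding eq
    proof (rule order.trans[OF sum3[OF t elim(1)]])
    show "\<bar>ell P (x + h) - ell P x - fd (ell P) x h - (1/2) *R D2v (ell P) x h h\<bar> <= C1 * norm h ^ 3" using C1(2)[OF x] by simp
    show "norm (f (t, t, x + h) - f (t, t, x) - pd f h (t, t, x) - (1/2) *R D2v f (t, t, x) (0, 0, h) (0, 0, h)) <= C2 * norm h ^ 3"
    using C2(2)[of "(t, t, x)" "(0, 0, h)"] pn[OF t] by (simp add: pd_def norm_Pair)
    show "continuous_on {t..T} c" unfolding c_def
    by (intro continuous_on_diff continuous_on_scaleR continuous_on_const continuous_kernel sD smooth_pd cD)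
    show "norm (c s) <= C3 * norm h ^ 3" if "s : {0..T}" for s
    using C3(2)[of "(s, t, x)" "(0, 0, h)"] pn[OF that] by (simp add: c_def pd_def norm_Pair)
    show "(C1 + \<bar>B\<bar> * C2 + C3 * Ip) * norm h ^ 3 <= C * norm h ^ 3" by (rule mult_right_mono[OF CC(1)]) simp
    qed (use C3 in auto)
   qed
  qed
  show "AE t in M. ALL x h k. norm x <= R --> \<bar>D2v (ham P p t) x h k\<bar> <= C * norm h * norm k"
   using p_bound AE_space
  proof eventually_elim
   case (elim t)
   then have t: "t : {0..T}" by simp
   show ?case
   proof (intro allI impI)
    fix x h k :: "(real ^ 'm) \<times> (real ^ 'n)" assume x: "norm x <= R"
    note pn = kernel_point_norm[OF t _ x]
    have cD: "smooth (%q. D2v (Dtau f) q (0, 0, h) (0, 0, k))" unfolding D2v_def by (intro smooth_fd sD)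
    have "\<bar>D2v (ham P p t) x h k\<bar> <= C * (norm h * norm k)"
    unfolding D2v_ham_eq[OF t] hamk_def ptail_def
    proof (rule order.trans[OF sum3[OF t elim(1)]])
    show "\<bar>D2v (ell P) x h k\<bar> <= E1 * (norm h * norm k)" using E1(2)[OF x, of h k] by (simp add: mult.assoc)
    show "norm (D2v f (t, t, x) (0, 0, h) (0, 0, k)) <= E2 * (norm h * norm k)"
    using E2(2)[OF pn[OF t], of "(0, 0, h)" "(0, 0, k)"] by (simp add: norm_Pair mult.assoc)
    show "continuous_on {t..T} (%s. D2v (Dtau f) (s, t, x) (0, 0, h) (0, 0, k))" by (rule continuous_kernel[OF cD])
    show "norm (D2v (Dtau f) (s, t, x) (0, 0, h) (0, 0, k)) <= E3 * (norm h * norm k)" if "s : {0..T}" for s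
    using E3(2)[OF pn[OF that], of "(0, 0, h)" "(0, 0, k)"] by (simp add: norm_Pair mult.assoc)
    show "(E1 + \<bar>B\<bar> * E2 + E3 * Ip) * (norm h * norm k) <= C * (norm h * norm k)" by (rule mult_right_mono[OF CC(2)]) simp
    qed (use E3 in auto)
    then show "\<bar>D2v (ham P p t) x h k\<bar> <= C * norm h * norm k" by (simp add: mult.assoc)
   qed
  qed
 qed
qed

end

section \<open>The Lagrangian identity and second order remainders\<close>

lemma grad_inner:
 fixes F :: "real ^ 'k => real"
 assumes "linear (fd F x)" shows "grad F x \<bullet> h = fd F x h"
proof -
 have "fd F x h = fd F x (\<Sum>i\<in>UNIV. h $ i *R axis i 1)"
  using basis_expansion[of h] by (simp add: scalar_mult_eq_scaleR)
 also have "fd F x (\<Sum>i\<in>UNIV. h $ i *R axis i 1) = (\<Sum>i\<in>UNIV. h $ i * fd F x (axis i 1))"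
  by (simp add: linear_sum[OF assms] linear_scale[OF assms])
 finally show ?thesis by (simp add: inner_vec_def grad_def mult.commute)
qed

lemma vec_eq_sum_axis: "(x :: real ^ 'k) = (\<Sum>i\<in>UNIV. x $ i *R axis i 1)"
 using basis_expansion[of x] by (simp add: scalar_mult_eq_scaleR)

lemma fd_second:
 assumes "smooth H" shows "fd (%x. H (w, x)) y h = fd H (w, y) (0, h)" "smooth (%x. H (w, x))"
 using fd_compose_affine[of "%x. (0, x)" H "(w, 0)" y h] smooth_compose_affine[of "%x. (0, x)" H "(w, 0)"] assms
 by (simp_all add: bounded_linear_Pair bounded_linear_zero bounded_linear_ident)

lemma fd_first:
 assumes "smooth H" shows "fd (%x. H (x, w)) y h = fd H (y, w) (h, 0)" "smooth (%x. H (x, w))"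
 using fd_compose_affine[of "%x. (x, 0)" H "(0, w)" y h] smooth_compose_affine[of "%x. (x, 0)" H "(0, w)"] assms
 by (simp_all add: bounded_linear_Pair bounded_linear_zero bounded_linear_ident)

lemma finite_measure_on_integrable:
 fixes g :: "real => 'b::euclidean_space"
 assumes \<mu>: "finite_measure_on T \<mu>" and g: "cont T g"
 shows "integrable \<mu> g" "space \<mu> = {0..T}"
proof -
 from \<mu> have fin: "finite_measure \<mu>" and s: "sets \<mu> = sets (restrict_space borel {0..T})" by (auto simp: finite_measure_on_def)
 show sp: "space \<mu> = {0..T}" using sets_eq_imp_space_eq[OF s] by (simp add: space_restrict_space)
 have m: "g : borel_measurable \<mu>"
  using borel_measurable_continuous_on_restrict[OF g] by (simp cong: measurable_cong_sets[OF s refl])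
 obtain R where "!!t. t : {0..T} ==> norm (g t) <= R" using continuous_Icc_bounded[OF g] by blast
 then show "integrable \<mu> g" by (intro finite_measure.integrable_const_bound[OF fin _ m, of R] AE_I2) (simp add: sp)
qed

context control_problem begin

lemma smooth_Phi: "i < dimPhi P ==> smooth (%x. Phi P x i)"
 using A0 by (cases "i < nE P") (auto simp: Phi_def dimPhi_def A0_def)

lemma smooth_endpoint_lagrangian: "smooth (endpoint_lagrangian P \<Psi>)"
proof -
 have "smooth (%x. phi P x + (\<Sum>i<dimPhi P. \<Psi> i * Phi P x i))"
  using A0 by (intro smooth_add smooth_sum smooth_mult smooth_const smooth_Phi) (auto simp: A0_def)
 then show ?thesis by (simp add: endpoint_lagrangian_def[abs_def])
qed

lemma con_state_continuous: "i < ncon P ==> cont T y ==> cont T (%t. con P i (y t))"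
 by (rule continuous_on_compose2[OF smooth_continuous[OF smooth_con, of i UNIV]]) auto

lemma fd_con_continuous:
 "i < ncon P ==> cont T y ==> cont T z ==> cont T (%t. fd (con P i) (y t) (z t))"
 using continuous_on_compose2[OF smooth_continuous[OF smooth_fd_pair[OF smooth_con[of i]], of UNIV], of "{0..T}" "%t. (y t, z t)"]
 by (auto intro: continuous_on_Pair)

text \<open>Translates the conditions on a multiplier into the form used later: \<open>p\<close> is
  essentially bounded, the adjoint equation holds integrated by parts with the outer values of
  \<open>p\<close> expressed by the endpoint Lagrangian, and stationarity in the control holds in
  every direction.\<close>

lemma multiplier_adjoint:
 assumes trb: "trajectory P ub yb" and lam: "(\<eta>, \<Psi>, p) : multipliers P ub yb"
 shows "adjoint_state P p" "EX B. AE t in M. norm (p t) <= B"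
  "!!\<delta> om. integrable M om ==> (!!t. t : {0..T} ==> \<delta> t = \<delta> 0 + (LINT s|leb t. om s)) ==>
   (LINT t|M. p t \<bullet> om t) = fd (endpoint_lagrangian P \<Psi>) (yb 0, yb T) (\<delta> 0, \<delta> T) +
    (LINT t|M. fd (ham P p t) (ub t, yb t) (0, \<delta> t)) + (\<Sum>i<ncon P. LINT t|\<eta> i. fd (con P i) (yb t) (\<delta> t))"
  "AE t in M. ALL h. fd (ham P p t) (ub t, yb t) (h, 0) = 0"
proof -
 have \<eta>: "!!i. i < ncon P ==> finite_measure_on T (\<eta> i)" and BV: "p : BV T"
  and dp: "has_distr_deriv T p (%\<theta>. - ((LINT t|M. \<theta> t *R grad (%x. ham P p t (ub t, x)) (yb t)) +
    (\<Sum>i<ncon P. LINT t|\<eta> i. \<theta> t *R grad (con P i) (yb t))))"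
  and E: "!!a b. fd (endpoint_lagrangian P \<Psi>) (yb 0, yb T) (a, b) = - left_val p \<bullet> a + right_val T p \<bullet> b"
  and Du: "AE t in M. grad (%\<omega>. ham P p t (\<omega>, yb t)) (ub t) = 0"
  using lam by (simp_all add: multipliers_def)
 have pI: "integrable (lebesgue_on {-1<..<T + 1}) p" using BV by (simp add: BV_def)
 have pM: "integrable M p"
 proof -
  have 1: "integrable lebesgue (%s. indicat_real {-1<..<T + 1} s *R p s)" using pI by (subst (asm) integrable_restrict_space) auto
  have "integrable lebesgue (%s. indicat_real {0..T} s *R (indicat_real {-1<..<T + 1} s *R p s))"
   by (intro integrable_indicator_mult[OF 1] borel_measurable_indicator) simp
  also have "(%s. indicat_real {0..T} s *R (indicat_real {-1<..<T + 1} s *R p s)) = (%s. indicat_real {0..T} s *R p s)"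
   by (auto simp: indicator_def)
  finally show ?thesis by (subst integrable_restrict_space) auto
 qed
 show ad: "adjoint_state P p" by unfold_locales (rule pM)
 interpret adjoint_state P p by (rule ad)
 note tj = traj[OF trb]
 define q where "q t = grad (%x. ham P p t (ub t, x)) (yb t)" for t
 define \<gamma> where "\<gamma> i t = grad (con P i) (yb t)" for i t
 have qd: "q t \<bullet> h = fd (ham P p t) (ub t, yb t) (0, h)" if "t : {0..T}" for t h
  unfolding q_def grad_inner[OF linear_fd[OF fd_second(2)[OF smooth_ham[OF that]]]] fd_second(1)[OF smooth_ham[OF that]] ..
 have \<gamma>d: "\<gamma> i t \<bullet> h = fd (con P i) (yb t) h" if "i < ncon P" for i t h
  unfolding \<gamma>_def by (rule grad_inner[OF linear_fd[OF smooth_con[OF that]]])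
 have qi: "integrable M q"
 proof -
  have "integrable M (%t. \<Sum>j\<in>UNIV. fd (ham P p t) (ub t, yb t) (0, axis j 1) *R axis j 1)"
   by (intro b_integrable_sum integrable_scaleR_left fd_ham_integrable tj(3) continuous_imp_Linf continuous_on_const)
  moreover have "(\<Sum>j\<in>UNIV. fd (ham P p t) (ub t, yb t) (0, axis j 1) *R axis j 1) = q t" if "t : {0..T}" for t
   unfolding qd[OF that, symmetric] by (subst (2) vec_eq_sum_axis) (simp add: inner_axis)
  ultimately show ?thesis by (subst b_integrable_cong[OF refl, of M q]) auto
 qed
 have \<gamma>i: "integrable (\<eta> i) (\<gamma> i)" if i: "i < ncon P" for i
 proof (rule finite_measure_on_integrable(1)[OF \<eta>[OF i]])
  show "cont T (\<gamma> i)" unfolding \<gamma>_def grad_def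
   by (intro continuous_on_vec_lambda fd_con_continuous i tj(2) continuous_on_const)
 qed
 note ibp = adjoint_by_parts[where \<gamma> = \<gamma> and N = "ncon P", OF T_pos pI qi \<eta> \<gamma>i dp[folded q_def \<gamma>_def]]
 show "EX B. AE t in M. norm (p t) <= B" by (rule ibp(1))
 show "(LINT t|M. p t \<bullet> om t) = fd (endpoint_lagrangian P \<Psi>) (yb 0, yb T) (\<delta> 0, \<delta> T) +
    (LINT t|M. fd (ham P p t) (ub t, yb t) (0, \<delta> t)) + (\<Sum>i<ncon P. LINT t|\<eta> i. fd (con P i) (yb t) (\<delta> t))"
  if "integrable M om" "!!t. t : {0..T} ==> \<delta> t = \<delta> 0 + (LINT s|leb t. om s)" for \<delta> om
 proof -
  have 1: "(LINT t|M. q t \<bullet> \<delta> t) = (LINT t|M. fd (ham P p t) (ub t, yb t) (0, \<delta> t))"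
   by (rule b_integral_cong) (auto simp: qd)
  have 2: "(\<Sum>i<ncon P. LINT t|\<eta> i. \<gamma> i t \<bullet> \<delta> t) = (\<Sum>i<ncon P. LINT t|\<eta> i. fd (con P i) (yb t) (\<delta> t))"
   by (rule sum.cong) (auto simp: \<gamma>d)
  have "(LINT t|M. p t \<bullet> om t) = right_val T p \<bullet> \<delta> T - left_val p \<bullet> \<delta> 0 + (LINT t|M. q t \<bullet> \<delta> t) + (\<Sum>i<ncon P. LINT t|\<eta> i. \<gamma> i t \<bullet> \<delta> t)"
   by (rule ibp(3)[OF _ _ that])
  then show ?thesis unfolding 1 2 E by simp
 qed
 show "AE t in M. ALL h. fd (ham P p t) (ub t, yb t) (h, 0) = 0"
  using Du AE_space
 proof eventually_elim
  case (elim t)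
  then have t: "t : {0..T}" by simp
  show ?case
   using elim(1) grad_inner[OF linear_fd[OF fd_first(2)[OF smooth_ham[OF t]]], of "yb t" "ub t"]
   by (simp add: fd_first(1)[OF smooth_ham[OF t]])
 qed
qed

text \<open>The pairing of \<open>p\<close> with the difference of the state derivatives is computed
  twice: from integrals of the Hamiltonian along both trajectories, and from the adjoint equation.
  Stationarity permits adding the control direction to the linear term, so that each line on the
  right is a complete first order remainder and no error is left over.\<close>

lemma lagrangian_identity:
 assumes trb: "trajectory P ub yb" and tr: "trajectory P u y" and lam: "(\<eta>, \<Psi>, p) : multipliers P ub yb"
 shows "cost P u y - cost P ub yb + (\<Sum>i<dimPhi P. \<Psi> i * (Phi P (y 0, y T) i - Phi P (yb 0, yb T) i)) +
   (\<Sum>i<ncon P. (LINT t|\<eta> i. con P i (y t)) - (LINT t|\<eta> i. con P i (yb t))) =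
  (LINT t|M. ham P p t (u t, y t) - ham P p t (ub t, yb t) - fd (ham P p t) (ub t, yb t) (u t - ub t, y t - yb t)) +
  (endpoint_lagrangian P \<Psi> (y 0, y T) - endpoint_lagrangian P \<Psi> (yb 0, yb T) - fd (endpoint_lagrangian P \<Psi>) (yb 0, yb T) (y 0 - yb 0, y T - yb T)) +
  (\<Sum>i<ncon P. LINT t|\<eta> i. con P i (y t) - con P i (yb t) - fd (con P i) (yb t) (y t - yb t))"
proof -
 note ma = multiplier_adjoint[OF trb lam] and tb = traj[OF trb] and tk = traj[OF tr]
 interpret adjoint_state P p by (rule ma(1))
 have \<eta>: "finite_measure_on T (\<eta> i)" if "i < ncon P" for i using lam that by (simp add: multipliers_def)
 define om where "om s = (f (s, s, u s, y s) + memory u y s) - (f (s, s, ub s, yb s) + memory ub yb s)" for s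
 have ia: "integrable M (%s. f (s, s, u s, y s) + memory u y s)" "integrable M (%s. f (s, s, ub s, yb s) + memory ub yb s)"
  by (rule sqint_integrable[OF finite_measure_Icc tk(7)], rule sqint_integrable[OF finite_measure_Icc tb(7)])
 have iom: "integrable M om" unfolding om_def by (intro b_integrable_diff ia)
 have \<delta>: "y t - yb t = (y 0 - yb 0) + (LINT s|leb t. om s)" if t: "t : {0..T}" for t
 proof -
  have "(LINT s|leb t. om s) = (LINT s|leb t. f (s, s, u s, y s) + memory u y s) - (LINT s|leb t. f (s, s, ub s, yb s) + memory ub yb s)"
   unfolding om_def using t by (intro b_integral_diff integrable_sub[OF ia(1)] integrable_sub[OF ia(2)]) auto
  then show ?thesis unfolding tk(6)[OF t] tb(6)[OF t] by simp
 qed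
 note ibp = ma(3)[OF iom, of "%t. y t - yb t", OF \<delta>]
 note hk = ham_integral[OF tk(3)] and hb = ham_integral[OF tb(3)]
 have eom: "(LINT t|M. p t \<bullet> om t) = (LINT t|M. p t \<bullet> f (t, t, u t, y t)) + (LINT t|M. p t \<bullet> memory u y t) -
   ((LINT t|M. p t \<bullet> f (t, t, ub t, yb t)) + (LINT t|M. p t \<bullet> memory ub yb t))"
  using hk(3,4) hb(3,4) unfolding om_def memory_def by (simp add: inner_diff_right inner_add_right)
 have H: "(%t. (u t - ub t, y t - yb t)) : Linf T"
  by (intro Linf_Pair Linf_diff tk(1) tb(1) continuous_imp_Linf continuous_on_diff tk(2) tb(2))
 note i1 = fd_ham_integrable[OF tb(3) H]
 have e1: "(LINT t|M. fd (ham P p t) (ub t, yb t) (u t - ub t, y t - yb t)) = (LINT t|M. fd (ham P p t) (ub t, yb t) (0, y t - yb t))"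
 proof (rule integral_cong_AE)
  show "(%t. fd (ham P p t) (ub t, yb t) (u t - ub t, y t - yb t)) : borel_measurable M" by (rule borel_measurable_integrable[OF i1])
  have "(%t. (0 :: real ^ 'm, y t - yb t)) : Linf T"
   by (intro continuous_imp_Linf continuous_on_Pair continuous_on_const continuous_on_diff tk(2) tb(2))
  then show "(%t. fd (ham P p t) (ub t, yb t) (0, y t - yb t)) : borel_measurable M"
   by (rule borel_measurable_integrable[OF fd_ham_integrable[OF tb(3)]])
  show "AE t in M. fd (ham P p t) (ub t, yb t) (u t - ub t, y t - yb t) = fd (ham P p t) (ub t, yb t) (0, y t - yb t)"
   using ma(4) AE_space
  proof eventually_elim
   case (elim t)
   then have t: "t : {0..T}" by simp
   show ?case
    using linear_add[OF linear_fd[OF smooth_ham[OF t]], of "(ub t, yb t)" "(u t - ub t, 0)" "(0, y t - yb t)"] elim(1) by simp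
  qed
 qed
 have e2: "(LINT t|M. ham P p t (u t, y t) - ham P p t (ub t, yb t) - fd (ham P p t) (ub t, yb t) (u t - ub t, y t - yb t)) =
   (LINT t|M. ham P p t (u t, y t)) - (LINT t|M. ham P p t (ub t, yb t)) - (LINT t|M. fd (ham P p t) (ub t, yb t) (0, y t - yb t))"
  using hk(2) hb(2) i1 by (simp add: e1)
 have e3: "(\<Sum>i<ncon P. LINT t|\<eta> i. con P i (y t) - con P i (yb t) - fd (con P i) (yb t) (y t - yb t)) =
   (\<Sum>i<ncon P. (LINT t|\<eta> i. con P i (y t)) - (LINT t|\<eta> i. con P i (yb t))) - (\<Sum>i<ncon P. LINT t|\<eta> i. fd (con P i) (yb t) (y t - yb t))"
 proof -
  have "(LINT t|\<eta> i. con P i (y t) - con P i (yb t) - fd (con P i) (yb t) (y t - yb t)) =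
    (LINT t|\<eta> i. con P i (y t)) - (LINT t|\<eta> i. con P i (yb t)) - (LINT t|\<eta> i. fd (con P i) (yb t) (y t - yb t))" if i: "i < ncon P" for i
  proof -
   note fm = finite_measure_on_integrable(1)[OF \<eta>[OF i]]
   have "integrable (\<eta> i) (%t. con P i (y t))" "integrable (\<eta> i) (%t. con P i (yb t))" "integrable (\<eta> i) (%t. fd (con P i) (yb t) (y t - yb t))"
    by (intro fm con_state_continuous fd_con_continuous i tk(2) tb(2) continuous_on_diff)+
   then show ?thesis by simp
  qed
  then have "(\<Sum>i<ncon P. LINT t|\<eta> i. con P i (y t) - con P i (yb t) - fd (con P i) (yb t) (y t - yb t)) =
   (\<Sum>i<ncon P. (LINT t|\<eta> i. con P i (y t)) - (LINT t|\<eta> i. con P i (yb t)) - (LINT t|\<eta> i. fd (con P i) (yb t) (y t - yb t)))"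
   by (intro sum.cong) auto
  then show ?thesis by (simp add: sum_subtractf)
 qed
 have e4: "endpoint_lagrangian P \<Psi> (y 0, y T) - endpoint_lagrangian P \<Psi> (yb 0, yb T) =
   phi P (y 0, y T) - phi P (yb 0, yb T) + (\<Sum>i<dimPhi P. \<Psi> i * (Phi P (y 0, y T) i - Phi P (yb 0, yb T) i))"
  by (simp add: endpoint_lagrangian_def algebra_simps sum_subtractf)
 show ?thesis
  unfolding e2 e3 e4 hk(5) hb(5) cost_def using ibp eom unfolding memory_def by simp
qed

text \<open>\<open>V\<close> is meant as the exact difference quotient and \<open>V'\<close> as the
  linearized direction. One factor \<open>norm (e V)\<close> of the cubic error is kept apart, so
  that a uniform bound can be used for it while the others are only square integrable.\<close>

lemma second_order_remainder:
 fixes V V' :: "'x::real_normed_vector" and Bf :: "'x => 'x => real"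
 assumes e: "e > 0" and l1: "!!k. linear (%h. Bf h k)" and l2: "!!h. linear (Bf h)"
  and C: "C >= 0" and bd: "!!h k. \<bar>Bf h k\<bar> <= C * norm h * norm k" and D: "\<bar>\<Delta> - (1/2) * Bf (e *R V) (e *R V)\<bar> <= C * norm (e *R V) ^ 3"
 shows "\<bar>\<Delta> / e\<^sup>2 - (1/2) * Bf V' V'\<bar> <= C * (norm (e *R V) * (norm V)\<^sup>2 + norm (V - V') * (norm V + norm V'))"
proof -
 have sc: "Bf (e *R V) (e *R V) = e\<^sup>2 * Bf V V"
  using linear_scale[OF l1[of "e *R V"], of e V] linear_scale[OF l2[of V], of e V] by (simp add: power2_eq_square)
 have e2: "e\<^sup>2 > 0" using e by simp
 have "\<Delta> / e\<^sup>2 - (1/2) * Bf V V = (\<Delta> - (1/2) * Bf (e *R V) (e *R V)) / e\<^sup>2"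
  unfolding sc using e2 by (simp add: field_simps)
 then have "\<bar>\<Delta> / e\<^sup>2 - (1/2) * Bf V V\<bar> = \<bar>\<Delta> - (1/2) * Bf (e *R V) (e *R V)\<bar> / e\<^sup>2" by (simp add: abs_divide)
 also have "\<bar>\<Delta> - (1/2) * Bf (e *R V) (e *R V)\<bar> / e\<^sup>2 <= C * norm (e *R V) ^ 3 / e\<^sup>2" by (rule divide_right_mono[OF D]) simp
 also have "C * norm (e *R V) ^ 3 / e\<^sup>2 = C * (norm (e *R V) * (norm V)\<^sup>2)"
  using e by (simp add: power3_eq_cube power2_eq_square)
 finally have 1: "\<bar>\<Delta> / e\<^sup>2 - (1/2) * Bf V V\<bar> <= C * (norm (e *R V) * (norm V)\<^sup>2)" .
 have "Bf V V - Bf V' V' = Bf (V - V') V + Bf V' (V - V')"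
  using linear_diff[OF l1[of V], of V V'] linear_diff[OF l2[of V'], of V V'] by simp
 also have "\<bar>Bf (V - V') V + Bf V' (V - V')\<bar> <= C * norm (V - V') * norm V + C * norm V' * norm (V - V')"
  by (rule order.trans[OF abs_triangle_ineq add_mono[OF bd bd]])
 finally have 2: "\<bar>Bf V V - Bf V' V'\<bar> <= C * (norm (V - V') * (norm V + norm V'))" by (simp add: algebra_simps)
 have "\<Delta> / e\<^sup>2 - (1/2) * Bf V' V' = (\<Delta> / e\<^sup>2 - (1/2) * Bf V V) + (1/2) * (Bf V V - Bf V' V')" by (simp add: algebra_simps)
 then have "\<bar>\<Delta> / e\<^sup>2 - (1/2) * Bf V' V'\<bar> <= \<bar>\<Delta> / e\<^sup>2 - (1/2) * Bf V V\<bar> + \<bar>Bf V V - Bf V' V'\<bar>" by simp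
 then show ?thesis using 1 2 by (simp add: distrib_left)
qed

text \<open>Version with uniformly bounded directions, which fits the endpoint and constraint terms
  because they involve only the states.\<close>

lemma smooth_second_order:
 fixes F :: "'x::euclidean_space => real"
 assumes F: "smooth F"
 obtains C where "C >= 0" "!!X V V' e K c. norm X <= R ==> norm (X + e *R V) <= R ==> e > 0 ==> norm V <= K ==> norm V' <= K ==> norm (V - V') <= c * e ==>
  \<bar>(F (X + e *R V) - F X - fd F X (e *R V)) / e\<^sup>2 - (1/2) * D2v F X V' V'\<bar> <= C * (K ^ 3 + 2 * c * K) * e"
proof -
 obtain C1 where C1: "C1 >= 0" "!!x h. norm x <= R ==> norm (x + h) <= R ==> norm (F (x + h) - F x - fd F x h - (1/2) *R D2v F x h h) <= C1 * norm h ^ 3"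
  using taylor2[OF F] by metis
 obtain C2 where C2: "C2 >= 0" "!!x h k. norm x <= R ==> norm (D2v F x h k) <= C2 * norm h * norm k" using D2v_bound[OF F] by metis
 define C where "C = max C1 C2"
 have C: "C >= 0" "C1 <= C" "C2 <= C" using C1(1) by (auto simp: C_def)
 show thesis
 proof (rule that[OF C(1)])
  fix X V V' :: 'x and e K c :: real
  assume X: "norm X <= R" "norm (X + e *R V) <= R" and e: "e > 0" and K: "norm V <= K" "norm V' <= K" and c: "norm (V - V') <= c * e"
  have K0: "K >= 0" using K(1) norm_ge_zero order.trans by blast
  have "\<bar>(F (X + e *R V) - F X - fd F X (e *R V)) / e\<^sup>2 - (1/2) * D2v F X V' V'\<bar> <= C * (norm (e *R V) * (norm V)\<^sup>2 + norm (V - V') * (norm V + norm V'))"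
  proof (rule second_order_remainder[OF e D2v_linear1[OF F] D2v_linear2[OF F] C(1)])
   show "\<bar>D2v F X h k\<bar> <= C * norm h * norm k" for h k
    using order.trans[OF C2(2)[OF X(1), of h k] mult_right_mono[OF mult_right_mono[OF C(3)]]] by simp
   show "\<bar>F (X + e *R V) - F X - fd F X (e *R V) - 1 / 2 * D2v F X (e *R V) (e *R V)\<bar> <= C * norm (e *R V) ^ 3"
    using order.trans[OF C1(2)[OF X] mult_right_mono[OF C(2)]] by simp
  qed
  also have "C * (norm (e *R V) * (norm V)\<^sup>2 + norm (V - V') * (norm V + norm V')) <= C * ((e * K) * K\<^sup>2 + (c * e) * (K + K))"
   using K K0 c e order.trans[OF norm_ge_zero c] by (intro mult_left_mono C(1) add_mono mult_mono power_mono) auto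
  also have "C * ((e * K) * K\<^sup>2 + (c * e) * (K + K)) = C * (K ^ 3 + 2 * c * K) * e" by (simp add: power3_eq_cube power2_eq_square algebra_simps)
  finally show "\<bar>(F (X + e *R V) - F X - fd F X (e *R V)) / e\<^sup>2 - (1/2) * D2v F X V' V'\<bar> <= C * (K ^ 3 + 2 * c * K) * e" .
 qed
qed

end

section \<open>Second order expansion of the Lagrangian along the perturbations\<close>

context perturbation begin

definition lag_increment :: "(nat => real measure) => (nat => real) => nat => real" where
 "lag_increment \<eta> \<Psi> k = cost P (u k) (y k) - cost P ub yb + (\<Sum>i<dimPhi P. \<Psi> i * (Phi P (y k 0, y k T) i - Phi P (yb 0, yb T) i)) +
   (\<Sum>i<ncon P. (LINT t|\<eta> i. con P i (y k t)) - (LINT t|\<eta> i. con P i (yb t)))"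

text \<open>The Hessian without the curvature sum over touch points; the Taylor expansion of the
  Lagrangian yields only this part.\<close>

definition lag_hessian :: "(nat => real measure) => (nat => real) => (real => real ^ 'n) => (real => real ^ 'm) => (real => real ^ 'n) => real" where
 "lag_hessian \<eta> \<Psi> p a z = (LINT t|M. D2v (ham P p t) (ub t, yb t) (a t, z t) (a t, z t)) +
  D2v (endpoint_lagrangian P \<Psi>) (yb 0, yb T) (z 0, z T) (z 0, z T) + (\<Sum>i<ncon P. LINT t|\<eta> i. D2v (con P i) (yb t) (z t) (z t))"

lemma T_mem: "0 : {0..T}" "T : {0..T}" using T_pos by auto

lemma perturbed_pair: "(u k t, y k t) = (ub t, yb t) + e k *R (v k t, zh k t)"
 by (simp add: u_eq y_eq)

text \<open>The majorant \<open>g\<close> separates the two error sources. The cubic remainder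
  carries the uniform factor \<open>rho k + e k * D\<close> against a function bounded in L1;
  passing from \<open>zh\<close> to \<open>zk\<close> costs \<open>C' * e k\<close> times a function
  bounded in L1.\<close>

lemma hamiltonian_expansion:
 assumes lam: "(\<eta>, \<Psi>, p) : multipliers P ub yb"
 shows "(%k. (LINT t|M. ham P p t (u k t, y k t) - ham P p t (ub t, yb t) - fd (ham P p t) (ub t, yb t) (e k *R (v k t, zh k t))) / (e k)\<^sup>2
   - (1/2) * (LINT t|M. D2v (ham P p t) (ub t, yb t) (v k t, zk k t) (v k t, zk k t))) ~~> 0"
proof -
 note ma = multiplier_adjoint[OF trb lam]
 interpret adjoint_state P p by (rule ma(1))
 obtain B where B: "AE t in M. norm (p t) <= B" using ma(2) by blast
 obtain R where R: "!!k. AE s in M. norm (u k s, y k s) <= R" "AE s in M. norm (ub s, yb s) <= R" by (rule perturbed_bounded) (rule that)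
 obtain D where D: "D >= 0" "!!k t. t : {0..T} ==> norm (zk k t) <= D" "!!k t. t : {0..T} ==> norm (zh k t) <= D" using zk_bounded by blast
 obtain C' where C': "C' >= 0" "!!k t. t : {0..T} ==> norm (zh k t - zk k t) <= C' * e k" using zh_zk by blast
 obtain C where C: "C >= 0"
  "AE t in M. ALL x h. norm x <= R --> norm (x + h) <= R -->
   \<bar>ham P p t (x + h) - ham P p t x - fd (ham P p t) x h - (1/2) * D2v (ham P p t) x h h\<bar> <= C * norm h ^ 3"
  "AE t in M. ALL x h k. norm x <= R --> \<bar>D2v (ham P p t) x h k\<bar> <= C * norm h * norm k"
  by (rule ham_taylor[OF B])
 define \<Delta> where "\<Delta> k t = ham P p t (u k t, y k t) - ham P p t (ub t, yb t) - fd (ham P p t) (ub t, yb t) (e k *R (v k t, zh k t))" for k t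
 define q where "q k t = D2v (ham P p t) (ub t, yb t) (v k t, zk k t) (v k t, zk k t)" for k t
 define g where "g k t = C * ((rho k + e k * D) * ((norm (v k t))\<^sup>2 + D\<^sup>2) + (C' * e k) * (2 * norm (v k t) + 2 * D))" for k t
 have HL: "(%t. e k *R (v k t, zh k t)) : Linf T" for k
 proof -
  have "(%t. (u k t - ub t, y k t - yb t)) : Linf T"
   by (intro Linf_Pair Linf_diff traj(1)[OF tr] traj(1)[OF trb] continuous_imp_Linf continuous_on_diff traj(2)[OF tr] traj(2)[OF trb])
  then show ?thesis by (simp add: u_eq y_eq)
 qed
 have i\<Delta>: "integrable M (\<Delta> k)" for k
  unfolding \<Delta>_def by (intro b_integrable_diff ham_integral(2) traj(3)[OF tr] traj(3)[OF trb] fd_ham_integrable HL)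
 have iq: "integrable M (q k)" for k
  unfolding q_def by (rule D2v_ham_integrable[OF B traj(3)[OF trb] integrable_control_state(1)[OF sqv cz(2)]])
 have iv: "integrable M (%t. (norm (v k t))\<^sup>2)" "integrable M (%t. norm (v k t))" for k
  using sqv[of k] sqint_integrable[OF finite_measure_Icc sqv[of k]] by (auto simp: sqint_def)
 have ig: "integrable M (g k)" for k unfolding g_def
  by (intro integrable_mult_right b_integrable_add iv integrable_const_Icc)
 have ae: "AE t in M. \<bar>\<Delta> k t / (e k)\<^sup>2 - (1/2) * q k t\<bar> <= g k t" for k
  using C(2) C(3) R(1)[of k] R(2) small[of k] AE_space
 proof eventually_elim
  case (elim t)
  then have t: "t : {0..T}" by simp
  let ?X = "(ub t, yb t)" and ?V = "(v k t, zh k t)" and ?V' = "(v k t, zk k t)"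
  have "\<bar>\<Delta> k t / (e k)\<^sup>2 - (1/2) * q k t\<bar> <= C * (norm (e k *R ?V) * (norm ?V)\<^sup>2 + norm (?V - ?V') * (norm ?V + norm ?V'))"
   unfolding q_def
  proof (rule second_order_remainder[OF e(1) D2v_linear1[OF smooth_ham[OF t]] D2v_linear2[OF smooth_ham[OF t]] C(1)])
   show "\<bar>D2v (ham P p t) ?X h h'\<bar> <= C * norm h * norm h'" for h h' using elim by blast
   show "\<bar>\<Delta> k t - 1 / 2 * D2v (ham P p t) ?X (e k *R ?V) (e k *R ?V)\<bar> <= C * norm (e k *R ?V) ^ 3"
    using elim unfolding \<Delta>_def perturbed_pair by blast
  qed
  also have "... <= C * ((rho k + e k * D) * ((norm (v k t))\<^sup>2 + D\<^sup>2) + (C' * e k) * (2 * norm (v k t) + 2 * D))"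
  proof (rule mult_left_mono[OF add_mono[OF mult_mono mult_mono] C(1)])
   have "norm (e k *R ?V) <= norm (e k *R v k t) + norm (e k *R zh k t)" by (simp only: scaleR_Pair norm_Pair_le)
   moreover have "norm (e k *R zh k t) <= e k * D" using D(3)[OF t, of k] e(1)[of k] by simp
   ultimately show 1: "norm (e k *R ?V) <= rho k + e k * D" using elim(5) by linarith
   show "0 <= rho k + e k * D" by (rule order.trans[OF norm_ge_zero 1])
   show "(norm ?V)\<^sup>2 <= (norm (v k t))\<^sup>2 + D\<^sup>2" using power_mono[OF D(3)[OF t, of k], of 2] by (simp add: norm_Pair)
   show "norm (?V - ?V') <= C' * e k" using C'(2)[OF t, of k] by (simp add: norm_Pair)
   show "0 <= C' * e k" using C'(1) e(1)[of k] by simp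
   show "norm ?V + norm ?V' <= 2 * norm (v k t) + 2 * D"
    using norm_Pair_le[of "v k t" "zh k t"] norm_Pair_le[of "v k t" "zk k t"] D(2,3)[OF t, of k] by linarith
  qed auto
  finally show ?case unfolding g_def .
 qed
 have bnd: "\<bar>(LINT t|M. \<Delta> k t) / (e k)\<^sup>2 - (1/2) * (LINT t|M. q k t)\<bar> <= C * ((rho k + e k * D) * (1 + T * D\<^sup>2) + (C' * e k) * (2 * (1 + T) + 2 * D * T))" for k
 proof -
  have "norm (LINT t|M. \<Delta> k t / (e k)\<^sup>2 - (1/2) * q k t) <= (LINT t|M. norm (\<Delta> k t / (e k)\<^sup>2 - (1/2) * q k t))"
   by (rule integral_norm_bound)
  also have "(LINT t|M. norm (\<Delta> k t / (e k)\<^sup>2 - (1/2) * q k t)) <= (LINT t|M. g k t)"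
   using ae i\<Delta> iq ig by (intro integral_mono_AE) auto
  also have "(LINT t|M. g k t) = C * ((rho k + e k * D) * (ip M (v k) (v k) + T * D\<^sup>2) + (C' * e k) * (2 * (LINT t|M. norm (v k t)) + 2 * D * T))"
   using iv[of k] T_pos unfolding g_def ip_self
   by (simp add: integrable_const_Icc measure_restrict_space)
  also have "... <= C * ((rho k + e k * D) * (1 + T * D\<^sup>2) + (C' * e k) * (2 * (1 + T) + 2 * D * T))"
  proof (rule mult_left_mono[OF add_mono[OF mult_left_mono mult_left_mono] C(1)])
   have "AE t in M. 0 <= rho k" using small[of k] by eventually_elim (rule order.trans[OF norm_ge_zero])
   then have "0 <= rho k" using AE_const_Icc T_pos by blast
   then show "0 <= rho k + e k * D" using D(1) e(1)[of k] by simp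
   show "0 <= C' * e k" using C'(1) e(1)[of k] by simp
  qed (use unit(1)[of k] v_L1[of k] in auto)
  finally show ?thesis using i\<Delta>[of k] iq[of k] by simp
 qed
 have "(%k. (LINT t|M. \<Delta> k t) / (e k)\<^sup>2 - (1/2) * (LINT t|M. q k t)) ~~> 0"
 proof (rule Lim_null_comparison)
  show "\<forall>\<^sub>F k in sequentially. norm ((LINT t|M. \<Delta> k t) / (e k)\<^sup>2 - (1/2) * (LINT t|M. q k t)) <= C * ((rho k + e k * D) * (1 + T * D\<^sup>2) + (C' * e k) * (2 * (1 + T) + 2 * D * T))"
   using bnd by simp
  have "(%k. C * ((rho k + e k * D) * (1 + T * D\<^sup>2) + (C' * e k) * (2 * (1 + T) + 2 * D * T))) ~~> C * ((0 + 0 * D) * (1 + T * D\<^sup>2) + (C' * 0) * (2 * (1 + T) + 2 * D * T))"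
   by (intro tendsto_intros rho e(2))
  then show "(%k. C * ((rho k + e k * D) * (1 + T * D\<^sup>2) + (C' * e k) * (2 * (1 + T) + 2 * D * T))) ~~> 0" by simp
 qed
 then show ?thesis unfolding \<Delta>_def q_def .
qed

end

context perturbation begin

lemma second_order_expansion:
 assumes lam: "(\<eta>, \<Psi>, p) : multipliers P ub yb"
 shows "(%k. lag_increment \<eta> \<Psi> k / (e k)\<^sup>2 - (1/2) * lag_hessian \<eta> \<Psi> p (v k) (zk k)) ~~> 0"
proof -
 have \<eta>: "finite_measure_on T (\<eta> i)" if "i < ncon P" for i using lam that by (simp add: multipliers_def)
 obtain R where R: "!!k t. t : {0..T} ==> norm (y k t) <= R" "!!t. t : {0..T} ==> norm (yb t) <= R" by (rule perturbed_bounded) (rule that)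
 obtain D where D: "D >= 0" "!!k t. t : {0..T} ==> norm (zk k t) <= D" "!!k t. t : {0..T} ==> norm (zh k t) <= D" using zk_bounded by blast
 obtain C' where C': "C' >= 0" "!!k t. t : {0..T} ==> norm (zh k t - zk k t) <= C' * e k" using zh_zk by blast
 let ?E = "endpoint_lagrangian P \<Psi>" and ?b = "(yb 0, yb T)"
 define a2 where "a2 k = (?E (y k 0, y k T) - ?E ?b - fd ?E ?b (e k *R (zh k 0, zh k T))) / (e k)\<^sup>2 - (1/2) * D2v ?E ?b (zk k 0, zk k T) (zk k 0, zk k T)" for k
 define d3 where "d3 i k t = (con P i (y k t) - con P i (yb t) - fd (con P i) (yb t) (e k *R zh k t)) / (e k)\<^sup>2 - (1/2) * D2v (con P i) (yb t) (zk k t) (zk k t)" for i k t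
 have P2: "norm (a, b) <= 2 * r" if "norm a <= r" "norm b <= r" for a b :: "real ^ 'n" and r
  using norm_Pair_le[of a b] that by linarith
 have l2: "a2 ~~> 0"
 proof -
  obtain C where C: "!!X V V' e K c. norm X <= 2 * R ==> norm (X + e *R V) <= 2 * R ==> e > 0 ==> norm V <= K ==> norm V' <= K ==> norm (V - V') <= c * e ==>
   \<bar>(?E (X + e *R V) - ?E X - fd ?E X (e *R V)) / e\<^sup>2 - (1/2) * D2v ?E X V' V'\<bar> <= C * (K ^ 3 + 2 * c * K) * e"
   using smooth_second_order[OF smooth_endpoint_lagrangian, of "2 * R" \<Psi>] by metis
  have pk: "(y k 0, y k T) = ?b + e k *R (zh k 0, zh k T)" for k by (simp add: y_eq)
  define K where "K = C * ((2 * D) ^ 3 + 2 * (2 * C') * (2 * D))"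
  have bd: "\<bar>a2 k\<bar> <= K * e k" for k
  proof -
   have 1: "norm ?b <= 2 * R" by (rule P2[OF R(2)[OF T_mem(1)] R(2)[OF T_mem(2)]])
   have 2: "norm (?b + e k *R (zh k 0, zh k T)) <= 2 * R" unfolding pk[symmetric] by (rule P2[OF R(1)[OF T_mem(1)] R(1)[OF T_mem(2)]])
   have 3: "norm (zh k 0, zh k T) <= 2 * D" by (rule P2[OF D(3)[OF T_mem(1)] D(3)[OF T_mem(2)]])
   have 4: "norm (zk k 0, zk k T) <= 2 * D" by (rule P2[OF D(2)[OF T_mem(1)] D(2)[OF T_mem(2)]])
   have "norm ((zh k 0, zh k T) - (zk k 0, zk k T)) <= 2 * (C' * e k)"
    unfolding diff_Pair by (rule P2[OF C'(2)[OF T_mem(1)] C'(2)[OF T_mem(2)]])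
   then have 5: "norm ((zh k 0, zh k T) - (zk k 0, zk k T)) <= 2 * C' * e k" by simp
   show ?thesis unfolding a2_def pk K_def by (rule C[OF 1 2 e(1) 3 4 5])
  qed
  show ?thesis
  proof (rule Lim_null_comparison)
   show "\<forall>\<^sub>F k in sequentially. norm (a2 k) <= K * e k" using bd by simp
   show "(%k. K * e k) ~~> 0" using tendsto_mult_left[OF e(2), of K] by simp
  qed
 qed
 have l3: "(%k. LINT t|\<eta> i. d3 i k t) ~~> 0" and
  i3: "!!k. integrable (\<eta> i) (%t. con P i (y k t) - con P i (yb t) - fd (con P i) (yb t) (e k *R zh k t))"
  "!!k. integrable (\<eta> i) (%t. D2v (con P i) (yb t) (zk k t) (zk k t))" if i: "i < ncon P" for i
 proof -
  obtain C where C: "!!X V V' e K c. norm X <= R ==> norm (X + e *R V) <= R ==> e > 0 ==> norm V <= K ==> norm V' <= K ==> norm (V - V') <= c * e ==>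
   \<bar>(con P i (X + e *R V) - con P i X - fd (con P i) X (e *R V)) / e\<^sup>2 - (1/2) * D2v (con P i) X V' V'\<bar> <= C * (K ^ 3 + 2 * c * K) * e"
   using smooth_second_order[OF smooth_con[OF i], of R] by metis
  note fm = finite_measure_on_integrable[OF \<eta>[OF i]]
  have sp: "space (\<eta> i) = {0..T}" by (rule fm(2)[OF continuous_on_const])
  have fin: "finite_measure (\<eta> i)" using \<eta>[OF i] by (simp add: finite_measure_on_def)
  have "cont T (%t. (%(x, h, k). D2v (con P i) x h k) (yb t, zk k t, zk k t))" for k
   by (rule continuous_on_compose2[OF smooth_continuous[OF smooth_D2v_pair[OF smooth_con[OF i]], of UNIV]])
    (auto intro!: continuous_on_Pair cz traj(2)[OF trb])
  then show i32: "integrable (\<eta> i) (%t. D2v (con P i) (yb t) (zk k t) (zk k t))" for k by (intro fm(1)) simp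
  show i31: "integrable (\<eta> i) (%t. con P i (y k t) - con P i (yb t) - fd (con P i) (yb t) (e k *R zh k t))" for k
   by (intro fm(1) continuous_on_diff con_state_continuous fd_con_continuous continuous_on_scaleR continuous_on_const i cz traj(2)[OF trb] traj(2)[OF tr])
  define K where "K = C * (D ^ 3 + 2 * C' * D)"
  have pt: "\<bar>d3 i k t\<bar> <= K * e k" if t: "t : {0..T}" for k t
   unfolding d3_def y_eq[of k t] K_def by (rule C[OF R(2)[OF t] _ e(1) D(3)[OF t] D(2)[OF t] C'(2)[OF t]]) (use R(1)[OF t, of k] in \<open>simp add: y_eq\<close>)
  have "norm (LINT t|\<eta> i. d3 i k t) <= (LINT t|\<eta> i. K * e k)" for k
  proof (rule b_integral_norm_bound_integral)
   show "integrable (\<eta> i) (d3 i k)" unfolding d3_def using i31[of k] i32[of k] by simp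
   show "integrable (\<eta> i) (%t. K * e k)" by (rule finite_measure.integrable_const[OF fin])
  qed (use pt sp in auto)
  then have "norm (LINT t|\<eta> i. d3 i k t) <= (measure (\<eta> i) {0..T} * K) * e k" for k by (simp add: sp mult.assoc)
  then have bd: "\<forall>\<^sub>F k in sequentially. norm (LINT t|\<eta> i. d3 i k t) <= (measure (\<eta> i) {0..T} * K) * e k" by (simp add: mult.assoc)
  show "(%k. LINT t|\<eta> i. d3 i k t) ~~> 0"
   by (rule Lim_null_comparison[OF bd]) (use tendsto_mult_left[OF e(2), of "measure (\<eta> i) {0..T} * K"] in simp)
 qed
 have eq: "lag_increment \<eta> \<Psi> k / (e k)\<^sup>2 - (1/2) * lag_hessian \<eta> \<Psi> p (v k) (zk k) =
  ((LINT t|M. ham P p t (u k t, y k t) - ham P p t (ub t, yb t) - fd (ham P p t) (ub t, yb t) (e k *R (v k t, zh k t))) / (e k)\<^sup>2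
   - (1/2) * (LINT t|M. D2v (ham P p t) (ub t, yb t) (v k t, zk k t) (v k t, zk k t))) + a2 k + (\<Sum>i<ncon P. LINT t|\<eta> i. d3 i k t)" for k
 proof -
  have du: "u k t - ub t = e k *R v k t" "y k t - yb t = e k *R zh k t" for t by (simp_all add: u_eq y_eq)
  note id = lagrangian_identity[OF trb tr[of k] lam, folded lag_increment_def, unfolded du]
  have "(\<Sum>i<ncon P. LINT t|\<eta> i. d3 i k t) = (\<Sum>i<ncon P. (LINT t|\<eta> i. con P i (y k t) - con P i (yb t) - fd (con P i) (yb t) (e k *R zh k t)) / (e k)\<^sup>2
    - (1/2) * (LINT t|\<eta> i. D2v (con P i) (yb t) (zk k t) (zk k t)))"
   unfolding d3_def using i3 by (intro sum.cong refl) simp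
  then have s3: "(\<Sum>i<ncon P. LINT t|\<eta> i. d3 i k t) = (\<Sum>i<ncon P. LINT t|\<eta> i. con P i (y k t) - con P i (yb t) - fd (con P i) (yb t) (e k *R zh k t)) / (e k)\<^sup>2
    - (1/2) * (\<Sum>i<ncon P. LINT t|\<eta> i. D2v (con P i) (yb t) (zk k t) (zk k t))"
   by (simp add: sum_subtractf sum_divide_distrib sum_distrib_left)
  show ?thesis unfolding s3 id lag_hessian_def a2_def by (simp add: add_divide_distrib diff_divide_distrib algebra_simps)
 qed
 have "(%k. \<Sum>i<ncon P. LINT t|\<eta> i. d3 i k t) ~~> (\<Sum>i<ncon P. 0)"
  by (rule tendsto_sum) (rule l3, simp)
 from tendsto_add[OF tendsto_add[OF hamiltonian_expansion[OF lam] l2] this]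
 show ?thesis unfolding eq by simp
qed

text \<open>Needed to divide the second order expansion by one power of \<open>e k\<close> less: the
  quadratic term is then of order \<open>e k\<close>.\<close>

lemma lag_hessian_bounded:
 assumes lam: "(\<eta>, \<Psi>, p) : multipliers P ub yb"
 obtains K where "!!k. \<bar>lag_hessian \<eta> \<Psi> p (v k) (zk k)\<bar> <= K"
proof -
 note ma = multiplier_adjoint[OF trb lam]
 interpret adjoint_state P p by (rule ma(1))
 have \<eta>: "finite_measure_on T (\<eta> i)" if "i < ncon P" for i using lam that by (simp add: multipliers_def)
 obtain B where B: "AE t in M. norm (p t) <= B" using ma(2) by blast
 obtain R where R: "!!k. AE s in M. norm (u k s, y k s) <= R" "AE s in M. norm (ub s, yb s) <= R" "!!t. t : {0..T} ==> norm (yb t) <= R"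
  by (rule perturbed_bounded) (rule that)
 obtain D where D: "D >= 0" "!!k t. t : {0..T} ==> norm (zk k t) <= D" by (rule zk_bounded) (rule that)
 obtain C where C: "C >= 0"
  "AE t in M. ALL x h. norm x <= R --> norm (x + h) <= R -->
   \<bar>ham P p t (x + h) - ham P p t x - fd (ham P p t) x h - (1/2) * D2v (ham P p t) x h h\<bar> <= C * norm h ^ 3"
  "AE t in M. ALL x h k. norm x <= R --> \<bar>D2v (ham P p t) x h k\<bar> <= C * norm h * norm k"
  by (rule ham_taylor[OF B])
 let ?q = "%k t. D2v (ham P p t) (ub t, yb t) (v k t, zk k t) (v k t, zk k t)"
 have iv: "integrable M (%t. (norm (v k t))\<^sup>2)" for k using sqv[of k] by (simp add: sqint_def)
 have b1: "\<bar>LINT t|M. ?q k t\<bar> <= C * (1 + T * D\<^sup>2)" for k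
 proof -
  have "norm (LINT t|M. ?q k t) <= (LINT t|M. norm (?q k t))" by (rule integral_norm_bound)
  also have "(LINT t|M. norm (?q k t)) <= (LINT t|M. C * ((norm (v k t))\<^sup>2 + D\<^sup>2))"
  proof (rule integral_mono_AE)
   show "integrable M (%t. norm (?q k t))"
    by (intro b_integrable_norm D2v_ham_integrable[OF B traj(3)[OF trb] integrable_control_state(1)[OF sqv cz(2)]])
   show "integrable M (%t. C * ((norm (v k t))\<^sup>2 + D\<^sup>2))"
    by (intro integrable_mult_right b_integrable_add iv integrable_const_Icc)
   show "AE t in M. norm (?q k t) <= C * ((norm (v k t))\<^sup>2 + D\<^sup>2)"
    using C(3) R(2) AE_space
   proof eventually_elim
    case (elim t)
    then have t: "t : {0..T}" by simp
    have "\<bar>?q k t\<bar> <= C * norm (v k t, zk k t) * norm (v k t, zk k t)" by (rule elim(1)[rule_format, OF elim(2)])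
    also have "C * norm (v k t, zk k t) * norm (v k t, zk k t) = C * ((norm (v k t))\<^sup>2 + (norm (zk k t))\<^sup>2)"
    by (simp add: norm_Pair mult.assoc)
    also have "... <= C * ((norm (v k t))\<^sup>2 + D\<^sup>2)"
    by (intro mult_left_mono C(1) add_left_mono power_mono D(2)[OF t]) simp
    finally show ?case by simp
   qed
  qed
  also have "(LINT t|M. C * ((norm (v k t))\<^sup>2 + D\<^sup>2)) = C * (ip M (v k) (v k) + T * D\<^sup>2)"
   using iv[of k] T_pos unfolding ip_self by (simp add: integrable_const_Icc measure_restrict_space)
  also have "... <= C * (1 + T * D\<^sup>2)" by (intro mult_left_mono C(1) add_right_mono unit(1))
  finally show ?thesis by simp
 qed
 obtain K2 where K2: "K2 >= 0" "!!x h k. norm x <= norm (yb 0, yb T) ==> norm (D2v (endpoint_lagrangian P \<Psi>) x h k) <= K2 * norm h * norm k"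
  using D2v_bound[OF smooth_endpoint_lagrangian] by metis
 have b2: "\<bar>D2v (endpoint_lagrangian P \<Psi>) (yb 0, yb T) (zk k 0, zk k T) (zk k 0, zk k T)\<bar> <= K2 * (2 * D) * (2 * D)" for k
 proof -
  have n: "norm (zk k 0, zk k T) <= 2 * D"
   using norm_Pair_le[of "zk k 0" "zk k T"] D(2)[OF T_mem(1), of k] D(2)[OF T_mem(2), of k] by linarith
  show ?thesis
   using K2(2)[OF order.refl, of "(zk k 0, zk k T)" "(zk k 0, zk k T)"] mult_mono[OF mult_left_mono[OF n K2(1)] n] K2(1) D(1) by simp
 qed
 have "EX K. ALL k. \<bar>LINT t|\<eta> i. D2v (con P i) (yb t) (zk k t) (zk k t)\<bar> <= K" if i: "i < ncon P" for i
 proof -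
  obtain K3 where K3: "K3 >= 0" "!!x h k. norm x <= R ==> norm (D2v (con P i) x h k) <= K3 * norm h * norm k" using D2v_bound[OF smooth_con[OF i]] by metis
  note fm = finite_measure_on_integrable[OF \<eta>[OF i]]
  have sp: "space (\<eta> i) = {0..T}" by (rule fm(2)[OF continuous_on_const])
  have fin: "finite_measure (\<eta> i)" using \<eta>[OF i] by (simp add: finite_measure_on_def)
  have "norm (LINT t|\<eta> i. D2v (con P i) (yb t) (zk k t) (zk k t)) <= (LINT t|\<eta> i. K3 * D * D)" for k
  proof (rule b_integral_norm_bound_integral)
   have "cont T (%t. (%(x, h, k). D2v (con P i) x h k) (yb t, zk k t, zk k t))"
    by (rule continuous_on_compose2[OF smooth_continuous[OF smooth_D2v_pair[OF smooth_con[OF i]], of UNIV]])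
    (auto intro!: continuous_on_Pair cz traj(2)[OF trb])
   then show "integrable (\<eta> i) (%t. D2v (con P i) (yb t) (zk k t) (zk k t))" by (intro fm(1)) simp
   show "integrable (\<eta> i) (%t. K3 * D * D)" by (rule finite_measure.integrable_const[OF fin])
   fix t assume "t : space (\<eta> i)"
   then have t: "t : {0..T}" by (simp add: sp)
   show "norm (D2v (con P i) (yb t) (zk k t) (zk k t)) <= K3 * D * D"
    by (rule order.trans[OF K3(2)[OF R(3)[OF t]]]) (intro mult_mono D(2)[OF t] K3(1) mult_nonneg_nonneg D(1) order.refl norm_ge_zero)
  qed
  then show ?thesis by (intro exI[of _ "LINT t|\<eta> i. K3 * D * D"]) simp
 qed
 then obtain K4 where K4: "!!i k. i < ncon P ==> \<bar>LINT t|\<eta> i. D2v (con P i) (yb t) (zk k t) (zk k t)\<bar> <= K4 i" by metis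
 have b3: "\<bar>\<Sum>i<ncon P. LINT t|\<eta> i. D2v (con P i) (yb t) (zk k t) (zk k t)\<bar> <= (\<Sum>i<ncon P. K4 i)" for k
  by (rule order.trans[OF sum_abs sum_mono]) (simp add: K4)
 have "\<bar>lag_hessian \<eta> \<Psi> p (v k) (zk k)\<bar> <= C * (1 + T * D\<^sup>2) + K2 * (2 * D) * (2 * D) + (\<Sum>i<ncon P. K4 i)" for k
  unfolding lag_hessian_def by (rule order.trans[OF abs_triangle_ineq add_mono[OF order.trans[OF abs_triangle_ineq add_mono[OF b1 b2]] b3]])
 then show thesis by (rule that)
qed

lemma lag_increment_first_order:
 assumes lam: "(\<eta>, \<Psi>, p) : multipliers P ub yb"
 shows "(%k. lag_increment \<eta> \<Psi> k / e k) ~~> 0"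
proof -
 obtain K where K: "!!k. \<bar>lag_hessian \<eta> \<Psi> p (v k) (zk k)\<bar> <= K" using lag_hessian_bounded[OF lam] by blast
 define d where "d k = lag_increment \<eta> \<Psi> k / (e k)\<^sup>2 - (1/2) * lag_hessian \<eta> \<Psi> p (v k) (zk k)" for k
 have d: "d ~~> 0" using second_order_expansion[OF lam] unfolding d_def .
 have 1: "(%k. e k * d k) ~~> 0" using tendsto_mult[OF e(2) d] by simp
 have 2: "(%k. e k * lag_hessian \<eta> \<Psi> p (v k) (zk k)) ~~> 0"
 proof (rule Lim_null_comparison)
  show "\<forall>\<^sub>F k in sequentially. norm (e k * lag_hessian \<eta> \<Psi> p (v k) (zk k)) <= K * e k"
  proof (intro always_eventually allI)
   fix k show "norm (e k * lag_hessian \<eta> \<Psi> p (v k) (zk k)) <= K * e k"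
    using mult_left_mono[OF K[of k], of "e k"] e(1)[of k] by (simp add: abs_mult mult.commute)
  qed
  show "(%k. K * e k) ~~> 0" using tendsto_mult_left[OF e(2), of K] by simp
 qed
 have "lag_increment \<eta> \<Psi> k / e k = e k * d k + (1/2) * (e k * lag_hessian \<eta> \<Psi> p (v k) (zk k))" for k
  using e(1)[of k] by (simp add: d_def power2_eq_square field_simps)
 then show ?thesis using tendsto_add[OF 1 tendsto_mult_left[OF 2, of "1/2"]] by simp
qed

end

section \<open>Choice operators, null sets and touch points\<close>

lemma Linf_norm_nonneg: assumes "T > 0" shows "Linf_norm T u >= 0"
proof -
 let ?M = "leb T" and ?f = "%t. ereal (norm (u t))"
 have "AE t in ?M. ?f t <= esssup ?M ?f" by (rule esssup_AE)
 then have "AE t in ?M. 0 <= esssup ?M ?f" by eventually_elim (meson ereal_less_eq(5) norm_ge_zero order_trans)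
 then have "0 <= esssup ?M ?f" by (rule AE_const_Icc[OF assms])
 then show ?thesis unfolding Linf_norm_def by (rule real_of_ereal_pos)
qed

text \<open>If the bound failed at time 0, continuity would violate it on a whole initial interval,
  which has positive measure.\<close>

lemma continuous_AE_le_at_0:
 fixes d :: "real => 'b::real_normed_vector"
 assumes T: "T > 0" and c: "cont T d" and ae: "AE t in leb T. norm (d t) <= L"
 shows "norm (d 0) <= L"
proof (rule ccontr)
 assume "~ norm (d 0) <= L"
 then have pos: "norm (d 0) - L > 0" by simp
 have "cont T (%t. norm (d t))" by (rule continuous_on_norm[OF c])
 from this[unfolded continuous_on_iff, rule_format, of 0 "norm (d 0) - L"] pos T
 obtain r where r: "r > 0" "!!t. t : {0..T} ==> dist t 0 < r ==> dist (norm (d t)) (norm (d 0)) < norm (d 0) - L" by auto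
 define T' where "T' = min T (r / 2)"
 have T': "T' > 0" "T' <= T" using r(1) T by (auto simp: T'_def)
 have "AE t in leb T'. False"
  using AE_sub[OF ae T'(2)] AE_space[of "leb T'"]
 proof eventually_elim
  case (elim t)
  then have "t : {0..T}" "dist t 0 < r" using T' r(1) by (auto simp: T'_def dist_real_def)
  from r(2)[OF this] elim(1) show ?case by (simp add: dist_real_def)
 qed
 then show False by (rule AE_const_Icc[OF T'(1)])
qed

context control_problem begin

text \<open>Identifies the state picked by the choice operator in \<open>state\<close> with the
  given one on the time interval, so that \<open>Jcost\<close> and \<open>cost\<close>
  agree.\<close>

lemma state_unique:
 assumes tr: "trajectory P u y" and c: "cont T y'" "y' : W1inf T"
  and eq: "!!t. t : {0..T} ==> y' t = y 0 + (LINT s|leb t. f (t, s, u s, y' s))" and t: "t : {0..T}"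
 shows "y' t = y t"
proof -
 have "y' 0 = y 0" using eq[of 0, unfolded LINT_point] T_pos by simp
 then have "y' t = y' 0 + (LINT s|leb t. f (t, s, u s, y' s))" if "t : {0..T}" for t
  using eq[OF that] by argo
 then have tr': "trajectory P u y'"
  unfolding trajectory_def by (intro conjI ballI traj(1)[OF tr] c(2))
 obtain L where L: "L-lipschitz_on UNIV f" using A0 by (auto simp: A0_def)
 show ?thesis
 proof (rule volterra_unique[where Kf="%t s z. f (t, s, u s, z)" and C=L and ?z0.0="y 0"])
  show "AE s in M. ALL z z'. norm (f (t, s, u s, z) - f (t, s, u s, z')) <= L * norm (z - z')" for t
  proof (intro AE_I2 allI)
   fix s z z'
   show "norm (f (t, s, u s, z) - f (t, s, u s, z')) <= L * norm (z - z')"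
    using lipschitz_onD[OF L, of "(t, s, u s, z)" "(t, s, u s, z')"] by (simp add: dist_norm norm_Pair)
  qed
  show "integrable (leb t) (%s. f (t, s, u s, y' s))" if "t : {0..T}" for t
   using that by (intro integrable_sub[OF traj(8)[OF tr' smooth_f that]]) simp
  show "integrable (leb t) (%s. f (t, s, u s, y s))" if "t : {0..T}" for t
   using that by (intro integrable_sub[OF traj(8)[OF tr smooth_f that]]) simp
 qed (rule c(1) traj(2)[OF tr] eq traj(5)[OF tr] t; assumption?)+
qed

lemma Jcost_eq_cost:
 assumes tr: "trajectory P u y" shows "Jcost P u (y 0) = cost P u y"
proof -
 let ?Q = "%z. z : W1inf T & (\<forall>t\<in>{0..T}. z t = y 0 + (LINT s|leb t. f (t, s, u s, z s)))"
 have "?Q y" using tr unfolding trajectory_def by blast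
 then have Q: "?Q (state P u (y 0))" unfolding state_def by (rule someI[of ?Q])
 have s: "state P u (y 0) t = y t" if "t : {0..T}" for t
  by (rule state_unique[OF tr W1inf_continuous _ _ that]) (use Q in blast)+
 have "(LINT t|M. ell P (u t, state P u (y 0) t)) = (LINT t|M. ell P (u t, y t))"
  by (rule b_integral_cong) (auto simp: s)
 then show ?thesis unfolding Jcost_def cost_def using s[of T] T_pos by simp
qed

text \<open>Excludes that a trajectory violating growth has L2 distance zero from the reference, in
  which case it could not be normalized.\<close>

lemma cost_cong_AE:
 assumes tr: "trajectory P u y" and trb: "trajectory P ub yb" and ae: "AE t in M. u t = ub t" and y0: "y 0 = yb 0"
 shows "cost P u y = cost P ub yb"
proof -
 have um: "u : borel_measurable M" "ub : borel_measurable M" using traj(1)[OF tr] traj(1)[OF trb] by (simp_all add: Linf_iff)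
 note ym = continuous_measurable_Icc[OF traj(2)[OF tr]] continuous_measurable_Icc[OF traj(2)[OF trb]]
 have yeq: "y t = yb t" if t: "t : {0..T}" for t
 proof (rule state_unique[OF trb traj(2)[OF tr] _ _ t])
  show "y : W1inf T" using tr by (simp add: trajectory_def)
  fix t assume t: "t : {0..T}"
  then have tT: "t <= T" by simp
  have eqI: "(LINT s|leb t. f (t, s, u s, y s)) = (LINT s|leb t. f (t, s, ub s, y s))"
  proof (rule integral_cong_AE)
   show "(%s. f (t, s, u s, y s)) : borel_measurable (leb t)"
    by (rule measurable_sub[OF kernel_measurable(1)[OF smooth_f borel_measurable_Pair[OF um(1) ym(1)] measurable_id_Icc] tT])
   show "(%s. f (t, s, ub s, y s)) : borel_measurable (leb t)"
    by (rule measurable_sub[OF kernel_measurable(1)[OF smooth_f borel_measurable_Pair[OF um(2) ym(1)] measurable_id_Icc] tT])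
   show "AE s in leb t. f (t, s, u s, y s) = f (t, s, ub s, y s)"
    using AE_sub[OF ae tT] by eventually_elim simp
  qed
  show "y t = yb 0 + (LINT s|leb t. f (t, s, ub s, y s))" using traj(5)[OF tr t] unfolding y0 eqI .
 qed
 have "(LINT t|M. ell P (u t, y t)) = (LINT t|M. ell P (ub t, yb t))"
 proof (rule integral_cong_AE)
  have sl: "smooth (ell P)" using A0 by (simp add: A0_def)
  show "(%t. ell P (u t, y t)) : borel_measurable M" "(%t. ell P (ub t, yb t)) : borel_measurable M"
   by (rule continuous_compose_measurable[OF smooth_continuous[OF sl] borel_measurable_Pair[OF um(1) ym(1)]]
    continuous_compose_measurable[OF smooth_continuous[OF sl] borel_measurable_Pair[OF um(2) ym(2)]])+
  show "AE t in M. ell P (u t, y t) = ell P (ub t, yb t)" using ae AE_space by eventually_elim (simp add: yeq)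
 qed
 then show ?thesis unfolding cost_def using yeq[of T] T_pos y0 by simp
qed

lemma lin_state_zero:
 assumes tr: "trajectory P u y" and t: "t : {0..T}" shows "lin_state P u y (%_. 0) 0 t = 0"
proof -
 have s0: "sqint M (%_. 0 :: real ^ 'm)" by (simp add: sqint_def)
 let ?z = "lin_state P u y (%_. 0) 0"
 have z: "zlin u y (%_. 0) 0 ?z" by (rule zlin_lin_state[OF tr s0])
 then have c: "cont T ?z" by (simp add: zlin_def)
 obtain R where X: "(%s. (u s, y s)) : borel_measurable M" and R: "AE s in M. norm (u s, y s) <= R"
  using traj(3)[OF tr] unfolding Linf_iff by blast
 obtain C where C: "C >= 0" "!!t s x h. norm (t, s, x) <= 2 * T + R ==> norm (lin_kernel f (t, s, x, h)) <= C * norm h"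
  using lin_kernel_bound[OF smooth_f, of "2 * T + R"] by metis
 have l0: "lin_kernel f (t, s, x, 0) = 0" for t s x using linear_0[OF linear_lin_kernel[OF smooth_f]] by simp
 show ?thesis
 proof (rule volterra_unique[where z'="%_. 0" and Kf="%t s z. lin_kernel f (t, s, (u s, y s), (0, z))" and C=C and ?z0.0=0, OF _ c _ _ _ _ _ t])
  fix t assume t: "t : {0..T}"
  show "AE s in M. ALL z z'. norm (lin_kernel f (t, s, (u s, y s), (0, z)) - lin_kernel f (t, s, (u s, y s), (0, z'))) <= C * norm (z - z')"
   using AE_time_bound[OF R]
  proof eventually_elim
   case (elim s)
   show ?case
   proof (intro allI)
    fix z z'
    show "norm (lin_kernel f (t, s, (u s, y s), (0, z)) - lin_kernel f (t, s, (u s, y s), (0, z'))) <= C * norm (z - z')"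
    using C(2)[OF elim[rule_format, OF t], of "(0, z - z')"] linear_diff[OF linear_lin_kernel[OF smooth_f], of t s "(u s, y s)" "(0, z)" "(0, z')"]
    by (simp add: norm_Pair)
   qed
  qed
  obtain C' where k: "kernel_bound T (lin_kernel f) (%s. ((u s, y s), (0, ?z s))) (%s. C' * norm (0 :: real ^ 'm, ?z s))"
   using kernel_bound_linear[OF smooth_f X R integrable_control_state(2)[OF s0 c]] by blast
  show "integrable (leb t) (%s. lin_kernel f (t, s, (u s, y s), (0, ?z s)))"
   using integrable_sub[OF kernel_integrable(1)[OF k t], of t] t by simp
  show "?z t = 0 + (LINT s|leb t. lin_kernel f (t, s, (u s, y s), (0, ?z s)))"
   using z t unfolding zlin_def by blast
 qed (auto simp: l0[of _ _ _, folded zero_prod_def] zero_prod_def[symmetric])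
qed

text \<open>The weak second derivative is taken on an open interval inside the time horizon, so
  reducible touch points are interior times.\<close>

lemma touch_point_props:
 assumes A1: "A1 P yb" and i: "i : {nord1 P..<ncon P}" and \<tau>: "\<tau> : touch_points P yb i"
 shows "\<tau> : {0<..<T}" "con P i (yb \<tau>) = 0" "\<exists>c<0. has_weak_deriv2_at T (%t. con P i (yb t)) \<tau> c"
proof -
 show w: "\<exists>c<0. has_weak_deriv2_at T (%t. con P i (yb t)) \<tau> c"
  using A1 i \<tau> by (auto simp: A1_def reducible_touch_point_def)
 then show "\<tau> : {0<..<T}" by (auto simp: has_weak_deriv2_at_def)
 show "con P i (yb \<tau>) = 0" using \<tau> by (auto simp: touch_points_def entry_point_def)
qed

text \<open>Touch points are junction times: an arc through \<open>\<tau>\<close> would have the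
  constraint active throughout, yet being relatively open it meets the interior arc that ends at
  \<open>\<tau>\<close>.\<close>

lemma finite_touch_points:
 assumes A1: "A1 P yb" and i: "i : {nord1 P..<ncon P}"
 shows "finite (touch_points P yb i)"
proof (rule finite_subset)
 show "finite (junction_times P yb)" using A1 by (simp add: A1_def)
 show "touch_points P yb i <= junction_times P yb"
 proof
  fix \<tau> assume \<tau>: "\<tau> : touch_points P yb i"
  note tp = touch_point_props[OF A1 i \<tau>]
  have False if B: "arc P yb B" "\<tau> : B" for B
  proof -
   from \<tau> obtain A where A: "interior_arc P yb i A" "\<tau> = Sup A" unfolding touch_points_def entry_point_def by blast
   have cA: "const_active P yb A" using A(1) by (simp add: interior_arc_def arc_def)
   have cB: "const_active P yb B" using B(1) by (simp add: arc_def)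
   have A': "A ~= {}" "A <= {0..T}" "!!t. t : A ==> i \<notin> active P yb t"
    using cA A(1) openin_imp_subset unfolding const_active_def interior_arc_def by blast+
   have iB: "i : active P yb t" if "t : B" for t
   proof -
    have "i : active P yb \<tau>" using tp(2) i by (simp add: active_def)
    moreover have "active P yb t = active P yb \<tau>" using cB that B(2) unfolding const_active_def by blast
    ultimately show ?thesis by simp
   qed
   obtain U where U: "open U" "B = {0..T} \<inter> U" using cB unfolding const_active_def openin_open by blast
   then obtain r where r: "r > 0" "ball \<tau> r <= U" using B(2) by (metis IntE openE)
   have "\<tau> - r < Sup A" using A(2) r(1) by simp
   then obtain a where a: "a : A" "\<tau> - r < a" using less_cSupE[OF _ A'(1)] by blast
   have "a <= \<tau>" unfolding A(2) by (rule cSup_upper[OF a(1)]) (rule bdd_above_mono[OF _ A'(2)], simp)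
   then have "a : ball \<tau> r" using a(2) by (simp add: dist_real_def)
   then have "a : B" using r(2) U(2) a(1) A'(2) by blast
   then show False using iB A'(3)[OF a(1)] by blast
  qed
  then show "\<tau> : junction_times P yb" using tp(1) by (auto simp: junction_times_def)
 qed
qed

end

text \<open>Any such value is the classical derivative of \<open>gdot\<close> at
  \<open>\<tau>\<close>, hence unique; this justifies the definite description.\<close>

lemma (in numbered_problem) weak_deriv2_at_eq:
 assumes i: "i : {nord1 P..<ncon P}" and tr: "trajectory P u y" and c: "has_weak_deriv2_at T (%t. con P i (y t)) \<tau> c"
 shows "weak_deriv2_at T (%t. con P i (y t)) \<tau> = c"
 unfolding weak_deriv2_at_def
proof (rule the_equality)
 show "has_weak_deriv2_at T (%t. con P i (y t)) \<tau> c" by (rule c)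
 fix c' assume c': "has_weak_deriv2_at T (%t. con P i (y t)) \<tau> c'"
 note cd = con_derivative[OF i tr]
 show "c' = c"
  by (rule DERIV_unique[OF weak_deriv2_imp_derivative[OF cd(2) cd(1) c'] weak_deriv2_imp_derivative[OF cd(2) cd(1) c]])
qed

lemma AE_zero_emeasure:
 assumes "AE x in M. g x = 0" "A <= space M" "!!x. x : A ==> g x ~= 0" shows "emeasure M A = 0"
proof -
 obtain N where N: "{x : space M. ~ g x = 0} <= N" "emeasure M N = 0" "N : sets M" using assms(1) by (rule AE_E)
 then have "emeasure M A <= emeasure M N" using assms(2,3) by (intro emeasure_mono) auto
 then show ?thesis using N(2) by simp
qed

text \<open>The integrand is nonpositive, so discarding everything except the selected atoms can
  only increase the integral, which is the direction required for an upper bound.\<close>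

lemma integral_le_atoms:
 assumes \<mu>: "finite_measure_on T \<mu>" and F: "finite F" "F <= {0..T}" and g: "integrable \<mu> g" "!!t. t : {0..T} ==> g t <= (0::real)"
 shows "(LINT t|\<mu>. g t) <= (\<Sum>\<tau>\<in>F. measure \<mu> {\<tau>} * g \<tau>)"
proof -
 have fin: "finite_measure \<mu>" and st: "sets \<mu> = sets (restrict_space borel {0..T})" using \<mu> by (auto simp: finite_measure_on_def)
 have sp: "space \<mu> = {0..T}" by (rule finite_measure_on_integrable(2)[OF \<mu> continuous_on_const])
 have s: "{\<tau>} : sets \<mu>" if "\<tau> : F" for \<tau>
  using that F(2) unfolding st sets_restrict_space by (intro image_eqI[of _ _ "{\<tau>}"]) auto
 have i: "integrable \<mu> (%t. g \<tau> * indicat_real {\<tau>} t)" if "\<tau> : F" for \<tau>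
  using s[OF that] finite_measure.emeasure_finite[OF fin, of "{\<tau>}"]
  by (intro integrable_mult_right integrable_real_indicator) (auto simp: top.not_eq_extremum)
 have "(LINT t|\<mu>. g t) <= (LINT t|\<mu>. (\<Sum>\<tau>\<in>F. g \<tau> * indicat_real {\<tau>} t))"
 proof (rule integral_mono[OF g(1)])
  show "integrable \<mu> (%t. \<Sum>\<tau>\<in>F. g \<tau> * indicat_real {\<tau>} t)" by (rule b_integrable_sum) (rule i)
  fix t assume "t : space \<mu>"
  then have t: "g t <= 0" using g(2) sp by simp
  have "(\<Sum>\<tau>\<in>F. g \<tau> * indicat_real {\<tau>} t) = (\<Sum>\<tau>\<in>F. if \<tau> = t then g t else 0)"
   by (rule sum.cong) (auto simp: indicator_def)
  then have "(\<Sum>\<tau>\<in>F. g \<tau> * indicat_real {\<tau>} t) = (if t : F then g t else 0)"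
   by (simp only: sum.delta[OF F(1)])
  then show "g t <= (\<Sum>\<tau>\<in>F. g \<tau> * indicat_real {\<tau>} t)" using t by simp
 qed
 also have "(LINT t|\<mu>. (\<Sum>\<tau>\<in>F. g \<tau> * indicat_real {\<tau>} t)) = (\<Sum>\<tau>\<in>F. LINT t|\<mu>. g \<tau> * indicat_real {\<tau>} t)"
  by (rule Bochner_Integration.integral_sum) (rule i)
 also have "(\<Sum>\<tau>\<in>F. LINT t|\<mu>. g \<tau> * indicat_real {\<tau>} t) = (\<Sum>\<tau>\<in>F. measure \<mu> {\<tau>} * g \<tau>)"
 proof (rule sum.cong[OF refl])
  fix \<tau> assume "\<tau> : F"
  then have "{\<tau>} \<inter> space \<mu> = {\<tau>}" using F(2) sp by auto
  then show "(LINT t|\<mu>. g \<tau> * indicat_real {\<tau>} t) = measure \<mu> {\<tau>} * g \<tau>" by simp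
 qed
 finally show ?thesis .
qed

section \<open>Sequences violating the growth condition\<close>

text \<open>Adds feasibility and the failure of quadratic growth: the cost exceeds its reference
  value by at most \<open>c k * (e k)\<^sup>2\<close> with \<open>c\<close> tending to zero.\<close>

locale critical_sequence = numbered_perturbation P ub yb u y e rho v zh w z0 zl zk
 for P :: "('m::finite, 'n::finite) ocp" and ub yb u y e rho v zh w z0 zl zk +
 fixes c :: "nat => real"
 assumes fb: "feasible P ub yb" and fk: "!!k. feasible P (u k) (y k)" and A1P: "A1 P yb"
  and c: "c ~~> 0" and growth: "!!k. cost P (u k) (y k) - cost P ub yb <= c k * (e k)\<^sup>2"
  and zl_eq: "zl = lin_state P ub yb w z0" and zk_eq: "!!k. zk k = lin_state P ub yb (v k) (zh k 0)"
begin

lemma con_nonpos: "t : {0..T} ==> i < ncon P ==> con P i (yb t) <= 0" "t : {0..T} ==> i < ncon P ==> con P i (y k t) <= 0"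
 using fb fk[of k] unfolding feasible_def by blast+

lemma initial_values: "zl 0 = z0" "zk k 0 = zh k 0"
 by (rule zlin_weak_derivative(1)[OF trb sqw zl], rule zlin_weak_derivative(1)[OF trb sqv zk])

lemma con_quotient:
 assumes i: "i < ncon P" and t: "t : {0..T}"
 shows "(%k. (con P i (y k t) - con P i (yb t)) / e k) ~~> dcon P yb zl i t"
 using strict_difference_quotient[OF smooth_con[OF i] e tendsto_const zh_tendsto[OF t], of "yb t"]
 by (simp add: y_eq dcon_def)

lemma Phi_quotient:
 assumes i: "i < dimPhi P"
 shows "(%k. (Phi P (y k 0, y k T) i - Phi P (yb 0, yb T) i) / e k) ~~> dPhi P (yb 0, yb T) (zl 0, zl T) i"
 using strict_difference_quotient[OF smooth_Phi[OF i] e tendsto_const tendsto_Pair[OF zh_tendsto[OF T_mem(1)] zh_tendsto[OF T_mem(2)]], of "(yb 0, yb T)"]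
 by (simp add: y_eq dPhi_def)

lemma dcon_nonpos:
 assumes i: "i < ncon P" and t: "t : {0..T}" and z: "con P i (yb t) = 0"
 shows "dcon P yb zl i t <= 0"
proof (rule LIMSEQ_le_const2[OF con_quotient[OF i t]])
 show "EX N. \<forall>k\<ge>N. (con P i (y k t) - con P i (yb t)) / e k <= 0"
 proof (intro exI allI impI)
  fix k show "(con P i (y k t) - con P i (yb t)) / e k <= 0"
   using con_nonpos(2)[OF t i, of k] e(1)[of k] z by (simp add: divide_nonpos_pos)
 qed
qed

lemma dcon_continuous: "i < ncon P ==> cont T (dcon P yb zl i)"
 using fd_con_continuous[OF _ traj(2)[OF trb] cz(1), of i] by (simp add: dcon_def[abs_def])

context
 fixes \<eta> \<Psi> p assumes lam: "(\<eta>, \<Psi>, p) : multipliers P ub yb"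
begin

lemma finite_eta: "i < ncon P ==> finite_measure_on T (\<eta> i)"
 using lam by (simp add: multipliers_def)

lemma space_eta: "i < ncon P ==> space (\<eta> i) = {0..T}"
 by (rule finite_measure_on_integrable(2)[OF finite_eta continuous_on_const])

lemma integrable_con:
 "i < ncon P ==> integrable (\<eta> i) (%t. con P i (yb t))" "i < ncon P ==> integrable (\<eta> i) (%t. con P i (y k t))"
 by (intro finite_measure_on_integrable(1)[OF finite_eta con_state_continuous] traj(2)[OF trb] traj(2)[OF tr]; assumption)+

text \<open>Complementarity is part of a multiplier only for the sum over all constraints; the
  summands have a common sign, so each one vanishes.\<close>

lemma eta_complementary:
 assumes i: "i < ncon P"
 shows "(LINT t|\<eta> i. con P i (yb t)) = 0" "AE t in \<eta> i. con P i (yb t) = 0"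
proof -
 have nn: "(LINT t|\<eta> j. - con P j (yb t)) >= 0" if "j < ncon P" for j
  using con_nonpos(1)[OF _ that] space_eta[OF that] by (intro integral_nonneg_AE AE_I2) auto
 have "(\<Sum>j<ncon P. LINT t|\<eta> j. - con P j (yb t)) = 0"
  using lam by (simp add: multipliers_def sum_negf)
 then have z: "(LINT t|\<eta> i. - con P i (yb t)) = 0"
  using sum_nonneg_eq_0_iff[of "{..<ncon P}" "%j. LINT t|\<eta> j. - con P j (yb t)"] nn i by blast
 then show "(LINT t|\<eta> i. con P i (yb t)) = 0" by simp
 have "AE t in \<eta> i. - con P i (yb t) = 0"
 proof (subst integral_nonneg_eq_0_iff_AE[symmetric])
  show "integrable (\<eta> i) (%t. - con P i (yb t))" using integrable_con(1)[OF i] by simp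
  show "AE t in \<eta> i. 0 <= - con P i (yb t)" using con_nonpos(1)[OF _ i] space_eta[OF i] by (intro AE_I2) auto
 qed (rule z)
 then show "AE t in \<eta> i. con P i (yb t) = 0" by simp
qed

lemma Psi_nonpos: "(\<Sum>i<dimPhi P. \<Psi> i * (Phi P (y k 0, y k T) i - Phi P (yb 0, yb T) i)) <= 0"
proof -
 have "Phi P (y k 0, y k T) : coneK P" using fk[of k] unfolding feasible_def by blast
 moreover have "\<Psi> : normal_cone (dimPhi P) (coneK P) (Phi P (yb 0, yb T))" using lam by (simp add: multipliers_def)
 ultimately show ?thesis unfolding normal_cone_def by blast
qed

lemma con_integral_quotient:
 assumes i: "i < ncon P"
 shows "(%k. (LINT t|\<eta> i. con P i (y k t)) / e k) ~~> (LINT t|\<eta> i. dcon P yb zl i t)"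
proof -
 obtain R where R: "!!k t. t : {0..T} ==> norm (y k t) <= R" "!!t. t : {0..T} ==> norm (yb t) <= R" by (rule perturbed_bounded) (rule that)
 obtain D where D: "D >= 0" "!!k t. t : {0..T} ==> norm (zh k t) <= D" by (rule zk_bounded) (rule that)
 obtain C where C: "C >= 0" "!!x h. norm x <= R ==> norm (x + h) <= R ==> norm (con P i (x + h) - con P i x) <= C * norm h"
  using smooth_lipschitz[OF smooth_con[OF i]] by metis
 have fin: "finite_measure (\<eta> i)" using finite_eta[OF i] by (simp add: finite_measure_on_def)
 have "(%k. LINT t|\<eta> i. (con P i (y k t) - con P i (yb t)) / e k) ~~> (LINT t|\<eta> i. dcon P yb zl i t)"
 proof (rule integral_dominated_convergence)
  show "dcon P yb zl i : borel_measurable (\<eta> i)"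
   by (rule borel_measurable_integrable[OF finite_measure_on_integrable(1)[OF finite_eta[OF i] dcon_continuous[OF i]]])
  show "(%t. (con P i (y k t) - con P i (yb t)) / e k) : borel_measurable (\<eta> i)" for k
   by (intro borel_measurable_divide borel_measurable_diff borel_measurable_const borel_measurable_integrable[OF integrable_con(1)[OF i]] borel_measurable_integrable[OF integrable_con(2)[OF i]])
  show "integrable (\<eta> i) (%t. C * D)" by (rule finite_measure.integrable_const[OF fin])
  show "AE t in \<eta> i. (%k. (con P i (y k t) - con P i (yb t)) / e k) ~~> dcon P yb zl i t"
   using con_quotient[OF i] by (intro AE_I2) (simp add: space_eta[OF i])
  show "AE t in \<eta> i. norm ((con P i (y k t) - con P i (yb t)) / e k) <= C * D" for k
  proof (rule AE_I2)
   fix t assume "t : space (\<eta> i)"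
   then have t: "t : {0..T}" by (simp add: space_eta[OF i])
   have ek: "e k > 0" by (rule e)
   have "norm (yb t + e k *R zh k t) <= R" using R(1)[OF t, of k] by (simp add: y_eq)
   then have "\<bar>con P i (y k t) - con P i (yb t)\<bar> <= C * norm (e k *R zh k t)"
    using C(2)[OF R(2)[OF t], of "e k *R zh k t"] by (simp add: y_eq)
   also have "C * norm (e k *R zh k t) <= (C * D) * e k"
    using mult_left_mono[OF D(2)[OF t, of k], of "C * e k"] C(1) ek by (simp add: mult_ac)
   finally show "norm ((con P i (y k t) - con P i (yb t)) / e k) <= C * D" using ek by (simp add: abs_divide pos_divide_le_eq)
  qed
 qed
 moreover have eq: "(LINT t|\<eta> i. (con P i (y k t) - con P i (yb t)) / e k) = (LINT t|\<eta> i. con P i (y k t)) / e k" for k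
  using integrable_con[OF i] eta_complementary(1)[OF i] by simp
 ultimately show ?thesis unfolding eq by blast
qed

text \<open>The Lagrangian increment divided by \<open>e k\<close> tends to zero and is at most
  \<open>c k * e k\<close> plus endpoint and constraint quotients, whose limits \<open>a\<close> and
  \<open>b i\<close> are nonpositive. Hence all these limits vanish. On the times charged by
  \<open>\<eta> i\<close> the constraint is active, so the limit integrand is nonpositive and
  therefore zero almost everywhere.\<close>

lemma first_order_conditions:
 shows "(\<Sum>i<dimPhi P. \<Psi> i * dPhi P (yb 0, yb T) (zl 0, zl T) i) = 0"
  "!!i. i < ncon P ==> AE t in \<eta> i. dcon P yb zl i t = 0"
proof -
 define a where "a = (\<Sum>i<dimPhi P. \<Psi> i * dPhi P (yb 0, yb T) (zl 0, zl T) i)"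
 define A where "A k = (\<Sum>i<dimPhi P. \<Psi> i * ((Phi P (y k 0, y k T) i - Phi P (yb 0, yb T) i) / e k))" for k
 define b where "b i = (LINT t|\<eta> i. dcon P yb zl i t)" for i
 define B where "B k = (\<Sum>i<ncon P. (LINT t|\<eta> i. con P i (y k t)) / e k)" for k
 have Al: "A ~~> a" unfolding A_def a_def by (intro tendsto_sum tendsto_mult tendsto_const Phi_quotient) simp
 have Bl: "B ~~> (\<Sum>i<ncon P. b i)" unfolding B_def b_def by (intro tendsto_sum con_integral_quotient) simp
 have A_eq: "A k = (\<Sum>i<dimPhi P. \<Psi> i * (Phi P (y k 0, y k T) i - Phi P (yb 0, yb T) i)) / e k" for k
  unfolding A_def by (simp add: sum_divide_distrib)
 have a0: "a <= 0"
  by (rule LIMSEQ_le_const2[OF Al]) (use Psi_nonpos e(1) in \<open>auto simp: A_eq intro!: divide_nonpos_pos\<close>)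
 have b0: "b i <= 0" if i: "i < ncon P" for i
 proof -
  have "(LINT t|\<eta> i. con P i (y k t)) <= 0" for k
  proof -
   have "(LINT t|\<eta> i. - con P i (y k t)) >= 0"
    using con_nonpos(2)[OF _ i] space_eta[OF i] by (intro integral_nonneg_AE AE_I2) auto
   then show ?thesis by simp
  qed
  then show ?thesis unfolding b_def
   by (intro LIMSEQ_le_const2[OF con_integral_quotient[OF i]] exI allI impI divide_nonpos_pos e)
 qed
 have "0 <= a + (\<Sum>i<ncon P. b i)"
 proof (rule LIMSEQ_le[OF lag_increment_first_order[OF lam]])
  show "(%k. c k * e k + A k + B k) ~~> a + (\<Sum>i<ncon P. b i)"
   using tendsto_add[OF tendsto_add[OF tendsto_mult[OF c e(2)] Al] Bl] by simp
  show "EX N. \<forall>k\<ge>N. lag_increment \<eta> \<Psi> k / e k <= c k * e k + A k + B k"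
  proof (intro exI allI impI)
   fix k
   have ek: "e k > 0" by (rule e)
   have "lag_increment \<eta> \<Psi> k = (cost P (u k) (y k) - cost P ub yb) + (\<Sum>i<dimPhi P. \<Psi> i * (Phi P (y k 0, y k T) i - Phi P (yb 0, yb T) i)) + (\<Sum>i<ncon P. LINT t|\<eta> i. con P i (y k t))"
    unfolding lag_increment_def by (simp add: eta_complementary(1))
   then have "lag_increment \<eta> \<Psi> k / e k = (cost P (u k) (y k) - cost P ub yb) / e k + A k + B k"
    unfolding A_eq B_def by (simp add: add_divide_distrib sum_divide_distrib)
   moreover have "(cost P (u k) (y k) - cost P ub yb) / e k <= c k * e k"
    using growth[of k] ek by (simp add: pos_divide_le_eq power2_eq_square mult.assoc)
   ultimately show "lag_increment \<eta> \<Psi> k / e k <= c k * e k + A k + B k" by simp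
  qed
 qed
 moreover have bs: "(\<Sum>i<ncon P. b i) <= 0" by (rule sum_nonpos) (simp add: b0)
 ultimately have "a = 0" "(\<Sum>i<ncon P. b i) = 0" using a0 by linarith+
 then show "(\<Sum>i<dimPhi P. \<Psi> i * dPhi P (yb 0, yb T) (zl 0, zl T) i) = 0" by (simp add: a_def)
 fix i assume i: "i < ncon P"
 have "(\<Sum>i<ncon P. - b i) = 0" using \<open>(\<Sum>i<ncon P. b i) = 0\<close> by (simp add: sum_negf)
 then have bi: "b i = 0"
  using sum_nonneg_eq_0_iff[of "{..<ncon P}" "%i. - b i"] b0 i by auto
 have "AE t in \<eta> i. - dcon P yb zl i t = 0"
 proof (subst integral_nonneg_eq_0_iff_AE[symmetric])
  show "integrable (\<eta> i) (%t. - dcon P yb zl i t)"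
   using finite_measure_on_integrable(1)[OF finite_eta[OF i] dcon_continuous[OF i]] by simp
  show "AE t in \<eta> i. 0 <= - dcon P yb zl i t"
   using eta_complementary(2)[OF i] AE_space
  proof eventually_elim
   case (elim t)
   then show ?case using dcon_nonpos[OF i, of t] space_eta[OF i] by simp
  qed
  show "(LINT t|\<eta> i. - dcon P yb zl i t) = 0" using bi by (simp add: b_def)
 qed
 then show "AE t in \<eta> i. dcon P yb zl i t = 0" by simp
qed

lemma limit_critical: "(w, z0) : critical_cone P ub yb (\<eta>, \<Psi>, p)"
 unfolding critical_cone.simps mem_Collect_eq case_prod_conv Let_def zl_eq[symmetric]
proof (intro conjI allI impI ballI)
 show "w : L2 T" using sqw by (simp add: L2_iff_sqint)
 show "dcon P yb zl i t <= 0" if "i < ncon P" "t : Icon P yb i" for i t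
  using that by (intro dcon_nonpos) (auto simp: Icon_def split: if_splits)
 \<comment> \<open>A nonzero value would persist on a relatively open set around \<open>t\<close>.
   That set is null for \<open>\<eta> i\<close>, which contradicts \<open>t\<close> being in the
   support.\<close>
 show "dcon P yb zl i t = 0" if i: "i < ncon P" and t: "t : supp (\<eta> i) \<inter> Icon P yb i" for i t
 proof (rule ccontr)
  assume nz: "dcon P yb zl i t ~= 0"
  have tT: "t : {0..T}" using t by (auto simp: Icon_def split: if_splits)
  have "openin (top_of_set {0..T}) ({0..T} \<inter> dcon P yb zl i -` (- {0}))"
   by (rule continuous_openin_preimage_gen[OF dcon_continuous[OF i]]) (simp add: open_Compl)
  then obtain U where U: "open U" "{0..T} \<inter> dcon P yb zl i -` (- {0}) = {0..T} \<inter> U" by (auto simp: openin_open)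
  have "t : {0..T} \<inter> dcon P yb zl i -` (- {0})" using nz tT by simp
  then have tU: "t : U" unfolding U(2) by simp
  have "emeasure (\<eta> i) (U \<inter> space (\<eta> i)) = 0"
  proof (rule AE_zero_emeasure[OF first_order_conditions(2)[OF i]])
   show "U \<inter> space (\<eta> i) <= space (\<eta> i)" by simp
   fix x assume "x : U \<inter> space (\<eta> i)"
   then have "x : {0..T} \<inter> dcon P yb zl i -` (- {0})" unfolding U(2) by (simp add: space_eta[OF i])
   then show "dcon P yb zl i x ~= 0" by simp
  qed
  then show False using t U(1) tU by (auto simp: supp_def)
 qed
 show "dcon P yb zl i \<tau> <= 0" if i: "i : {nord1 P..<ncon P}" and \<tau>: "\<tau> : touch_points P yb i" for i \<tau>
  using touch_point_props[OF A1P i \<tau>] i by (intro dcon_nonpos) auto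
 show "measure (\<eta> i) {\<tau>} * dcon P yb zl i \<tau> = 0" if i: "i : {nord1 P..<ncon P}" and \<tau>: "\<tau> : touch_points P yb i" for i \<tau>
 proof (cases "dcon P yb zl i \<tau> = 0")
  case False
  have iN: "i < ncon P" using i by simp
  have "emeasure (\<eta> i) {\<tau>} = 0"
   by (rule AE_zero_emeasure[OF first_order_conditions(2)[OF iN]])
    (use touch_point_props(1)[OF A1P i \<tau>] space_eta[OF iN] False in auto)
  then show ?thesis by (simp add: measure_def)
 qed simp
 show "(\<Sum>i<dimPhi P. \<Psi> i * dPhi P (yb 0, yb T) (z0, zl T) i) = 0" using first_order_conditions(1) by (simp add: initial_values)
 \<comment> \<open>The perturbed endpoints witness tangency themselves, with step sizes
   \<open>e k\<close> and the difference quotients as directions.\<close>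
 show "dPhi P (yb 0, yb T) (z0, zl T) : tangent_cone (dimPhi P) (coneK P) (Phi P (yb 0, yb T))"
  unfolding tangent_cone_def mem_Collect_eq
 proof (intro conjI exI[of _ e] exI[of _ "%k i. (Phi P (y k 0, y k T) i - Phi P (yb 0, yb T) i) / e k"] allI impI)
  have "fd (%x. Phi P x i) x h = 0" if "dimPhi P <= i" for i x h
  proof -
   have "(%x. Phi P x i) = (%_. 0)" using that by (auto simp: Phi_def dimPhi_def)
   then show ?thesis by simp
  qed
  then show "dPhi P (yb 0, yb T) (z0, zl T) : Rd (dimPhi P)" by (simp add: Rd_def dPhi_def)
  show "(%k. (Phi P (y k 0, y k T) i - Phi P (yb 0, yb T) i) / e k) ~~> dPhi P (yb 0, yb T) (z0, zl T) i" if "i < dimPhi P" for i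
   using Phi_quotient[OF that] by (simp add: initial_values)
  show "(%i. Phi P (yb 0, yb T) i + e k * ((Phi P (y k 0, y k T) i - Phi P (yb 0, yb T) i) / e k)) : coneK P" for k
  proof -
   have "(%i. Phi P (yb 0, yb T) i + e k * ((Phi P (y k 0, y k T) i - Phi P (yb 0, yb T) i) / e k)) = Phi P (y k 0, y k T)"
    using e(1)[of k] by (simp add: fun_eq_iff)
   then show ?thesis using fk[of k] unfolding feasible_def by simp
  qed
 qed (rule e)+
qed

text \<open>Twice the increment divided by \<open>(e k)\<^sup>2\<close> differs from the Hessian
  without curvature by a null sequence. The increment quotient is at most \<open>c k + SX k\<close>,
  where \<open>SX\<close> collects the atoms at touch points. Twice the limit of \<open>SX\<close>
  equals the limit of the curvature sum \<open>S\<close>, so the two cancel.\<close>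

lemma hessian_upper_bound:
 obtains Y where "Y ~~> 0" "!!k. hessian P ub yb (\<eta>, \<Psi>, p) (v k, zh k 0) <= Y k"
proof -
 let ?I = "{nord1 P..<ncon P}" and ?TP = "touch_points P yb"
 define W where "W i \<tau> = weak_deriv2_at T (%t. con P i (yb t)) \<tau>" for i \<tau>
 define m where "m i \<tau> = measure (\<eta> i) {\<tau>}" for i \<tau>
 define \<zeta> where "\<zeta> i \<tau> = zdot i ub yb w zl \<tau>" for i \<tau>
 have "EX X. X ~~> (\<zeta> i \<tau>)\<^sup>2 / (2 * W i \<tau>) & (ALL k. con P i (y k \<tau>) <= (e k)\<^sup>2 * X k)" if i: "i : ?I" and \<tau>: "\<tau> : ?TP i" for i \<tau>
 proof -
  note tp = touch_point_props[OF A1P i \<tau>]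
  obtain c' where c': "c' < 0" "has_weak_deriv2_at T (%t. con P i (yb t)) \<tau> c'" using tp(3) by blast
  have iN: "i < ncon P" using i by simp
  obtain X where X: "X ~~> (zdot i ub yb w zl \<tau>)\<^sup>2 / (2 * c')" "!!k. con P i (y k \<tau>) <= (e k)\<^sup>2 * X k"
   by (rule touch_inequality[OF i tp(1,2) con_nonpos(1)[OF _ iN] con_nonpos(2)[OF _ iN] c'(2,1)];
    (assumption | (rule that; assumption)))
  then show ?thesis unfolding \<zeta>_def W_def weak_deriv2_at_eq[OF i trb c'(2)] by blast
 qed
 then have "\<forall>i \<tau>. EX X. i : ?I --> \<tau> : ?TP i --> X ~~> (\<zeta> i \<tau>)\<^sup>2 / (2 * W i \<tau>) & (ALL k. con P i (y k \<tau>) <= (e k)\<^sup>2 * X k)" by blast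
 from choice[OF allI[OF choice[OF this[rule_format, THEN allI]]]]
 obtain X where X: "\<forall>i \<tau>. i : ?I --> \<tau> : ?TP i --> X i \<tau> ~~> (\<zeta> i \<tau>)\<^sup>2 / (2 * W i \<tau>) & (ALL k. con P i (y k \<tau>) <= (e k)\<^sup>2 * X i \<tau> k)" ..
 define S where "S k = (\<Sum>i\<in>?I. \<Sum>\<tau>\<in>?TP i. m i \<tau> * ((zdot i ub yb (v k) (zk k) \<tau>)\<^sup>2 / W i \<tau>))" for k
 define SX where "SX k = (\<Sum>i\<in>?I. \<Sum>\<tau>\<in>?TP i. m i \<tau> * X i \<tau> k)" for k
 define d where "d k = lag_increment \<eta> \<Psi> k / (e k)\<^sup>2 - (1/2) * lag_hessian \<eta> \<Psi> p (v k) (zk k)" for k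
 have d: "d ~~> 0" using second_order_expansion[OF lam] unfolding d_def .
 have hess: "hessian P ub yb (\<eta>, \<Psi>, p) (v k, zh k 0) = lag_hessian \<eta> \<Psi> p (v k) (zk k) - S k" for k
 proof -
  have "deriv (dcon P yb (zk k) i) \<tau> = zdot i ub yb (v k) (zk k) \<tau>" if i: "i : ?I" and \<tau>: "\<tau> : ?TP i" for i \<tau>
   by (rule dcon_derivative[OF i trb sqv zk touch_point_props(1)[OF A1P i \<tau>]])
  then have "(\<Sum>i\<in>?I. \<Sum>\<tau>\<in>?TP i. m i \<tau> * ((deriv (dcon P yb (zk k) i) \<tau>)\<^sup>2 / W i \<tau>)) = S k"
   unfolding S_def by (intro sum.cong refl) simp
  then show ?thesis
   unfolding hessian.simps Let_def zk_eq[symmetric] D2_eq_D2v lag_hessian_def initial_values(2) m_def W_def by simp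
 qed
 have Sl: "S ~~> (\<Sum>i\<in>?I. \<Sum>\<tau>\<in>?TP i. m i \<tau> * ((\<zeta> i \<tau>)\<^sup>2 / W i \<tau>))"
 proof -
  have "(%k. m i \<tau> * ((zdot i ub yb (v k) (zk k) \<tau>)\<^sup>2 / W i \<tau>)) ~~> m i \<tau> * ((\<zeta> i \<tau>)\<^sup>2 / W i \<tau>)" if i: "i : ?I" and \<tau>: "\<tau> : ?TP i" for i \<tau>
  proof -
   have "\<tau> : {0..T}" using touch_point_props(1)[OF A1P i \<tau>] by simp
   from tendsto_mult_left[OF tendsto_mult_right[OF tendsto_power[OF zdot_tendsto[OF i this], of 2], of "inverse (W i \<tau>)"], of "m i \<tau>"]
   show ?thesis by (simp add: \<zeta>_def divide_inverse)
  qed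
  then show ?thesis unfolding S_def by (intro tendsto_sum)
 qed
 have SXl: "SX ~~> (\<Sum>i\<in>?I. \<Sum>\<tau>\<in>?TP i. m i \<tau> * ((\<zeta> i \<tau>)\<^sup>2 / (2 * W i \<tau>)))"
  unfolding SX_def by (intro tendsto_sum tendsto_mult_left) (use X in blast)
 have half: "2 * (\<Sum>i\<in>?I. \<Sum>\<tau>\<in>?TP i. m i \<tau> * ((\<zeta> i \<tau>)\<^sup>2 / (2 * W i \<tau>))) = (\<Sum>i\<in>?I. \<Sum>\<tau>\<in>?TP i. m i \<tau> * ((\<zeta> i \<tau>)\<^sup>2 / W i \<tau>))"
  unfolding sum_distrib_left by (intro sum.cong refl) simp
 \<comment> \<open>The endpoint term is nonpositive by the normal cone condition. Among the
   nonpositive constraint integrals, those of order one are dropped and the others are estimated by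
   their atoms at touch points, where the refined bound \<open>X\<close> is available.\<close>
 have upper: "lag_increment \<eta> \<Psi> k / (e k)\<^sup>2 <= c k + SX k" for k
 proof -
  define G where "G i = (LINT t|\<eta> i. con P i (y k t))" for i
  have G0: "G i <= 0" if i: "i < ncon P" for i
  proof -
   have "(LINT t|\<eta> i. - con P i (y k t)) >= 0"
    using con_nonpos(2)[OF _ i] space_eta[OF i] by (intro integral_nonneg_AE AE_I2) auto
   then show ?thesis by (simp add: G_def)
  qed
  have "(\<Sum>i\<in>?I. - G i) <= (\<Sum>i<ncon P. - G i)" by (rule sum_mono2) (auto simp: G0)
  then have "(\<Sum>i<ncon P. G i) <= (\<Sum>i\<in>?I. G i)" by (simp add: sum_negf)
  also have "(\<Sum>i\<in>?I. G i) <= (\<Sum>i\<in>?I. \<Sum>\<tau>\<in>?TP i. (e k)\<^sup>2 * (m i \<tau> * X i \<tau> k))"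
  proof (rule sum_mono)
   fix i assume i: "i : ?I"
   then have iN: "i < ncon P" by simp
   have "?TP i <= {0..T}" using touch_point_props(1)[OF A1P i] by fastforce
   then have "G i <= (\<Sum>\<tau>\<in>?TP i. measure (\<eta> i) {\<tau>} * con P i (y k \<tau>))"
    unfolding G_def using con_nonpos(2)[OF _ iN]
    by (intro integral_le_atoms[OF finite_eta[OF iN] finite_touch_points[OF A1P i] _ integrable_con(2)[OF iN]])
   also have "... <= (\<Sum>\<tau>\<in>?TP i. (e k)\<^sup>2 * (m i \<tau> * X i \<tau> k))"
   proof (rule sum_mono)
    fix \<tau> assume "\<tau> : ?TP i"
    then have "con P i (y k \<tau>) <= (e k)\<^sup>2 * X i \<tau> k" using X i by blast
    then have "measure (\<eta> i) {\<tau>} * con P i (y k \<tau>) <= measure (\<eta> i) {\<tau>} * ((e k)\<^sup>2 * X i \<tau> k)" by (rule mult_left_mono) simp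
    then show "measure (\<eta> i) {\<tau>} * con P i (y k \<tau>) <= (e k)\<^sup>2 * (m i \<tau> * X i \<tau> k)" by (simp add: m_def mult_ac)
   qed
   finally show "G i <= (\<Sum>\<tau>\<in>?TP i. (e k)\<^sup>2 * (m i \<tau> * X i \<tau> k))" .
  qed
  also have "(\<Sum>i\<in>?I. \<Sum>\<tau>\<in>?TP i. (e k)\<^sup>2 * (m i \<tau> * X i \<tau> k)) = (e k)\<^sup>2 * SX k"
   by (simp only: SX_def sum_distrib_left)
  finally have 1: "(\<Sum>i<ncon P. G i) <= (e k)\<^sup>2 * SX k" .
  have "lag_increment \<eta> \<Psi> k = (cost P (u k) (y k) - cost P ub yb) + (\<Sum>i<dimPhi P. \<Psi> i * (Phi P (y k 0, y k T) i - Phi P (yb 0, yb T) i)) + (\<Sum>i<ncon P. G i)"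
   unfolding lag_increment_def G_def by (simp add: eta_complementary(1))
  then have "lag_increment \<eta> \<Psi> k <= (c k + SX k) * (e k)\<^sup>2"
   using 1 growth[of k] Psi_nonpos[of k] unfolding distrib_right by (simp only: mult.commute[of "SX k"])
  then show ?thesis using e(1)[of k] by (simp add: pos_divide_le_eq)
 qed
 show thesis
 proof (rule that[of "%k. 2 * (c k + SX k - d k) - S k"])
  have "(%k. 2 * (c k + SX k - d k) - S k) ~~> 2 * (0 + (\<Sum>i\<in>?I. \<Sum>\<tau>\<in>?TP i. m i \<tau> * ((\<zeta> i \<tau>)\<^sup>2 / (2 * W i \<tau>))) - 0) - (\<Sum>i\<in>?I. \<Sum>\<tau>\<in>?TP i. m i \<tau> * ((\<zeta> i \<tau>)\<^sup>2 / W i \<tau>))"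
   by (intro tendsto_diff tendsto_mult tendsto_const tendsto_add c SXl d Sl)
  then show "(%k. 2 * (c k + SX k - d k) - S k) ~~> 0" using half by simp
  show "hessian P ub yb (\<eta>, \<Psi>, p) (v k, zh k 0) <= 2 * (c k + SX k - d k) - S k" for k
   using upper[of k] unfolding hess d_def by simp
 qed
qed

text \<open>Not a matter of substitution only: \<open>lin_state\<close> is known to vanish just on
  \<open>{0..T}\<close>, so its derivatives at touch points are computed on the open
  interval.\<close>

lemma hessian_zero: "hessian P ub yb (\<eta>, \<Psi>, p) (%_. 0, 0) = 0"
proof -
 define z where "z = lin_state P ub yb (%_. 0) 0"
 have z: "z t = 0" if "t : {0..T}" for t unfolding z_def by (rule lin_state_zero[OF trb that])
 interpret adjoint_state P p by (rule multiplier_adjoint(1)[OF trb lam])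
 have q0: "D2v F x 0 0 = 0" if "smooth F" for F :: "'x::euclidean_space => real" and x
  by (rule linear_0[OF D2v_linear2[OF that]])
 have 1: "(LINT t|M. D2v (ham P p t) (ub t, yb t) (0, z t) (0, z t)) = 0"
 proof (rule integral_eq_zero_AE[OF AE_I2])
  fix t assume "t : space M"
  then have t: "t : {0..T}" by simp
  show "D2v (ham P p t) (ub t, yb t) (0, z t) (0, z t) = 0"
   using q0[OF smooth_ham[OF t]] by (simp add: z[OF t] zero_prod_def)
 qed
 have 2: "D2v (endpoint_lagrangian P \<Psi>) (yb 0, yb T) (0, z T) (0, z T) = 0"
  using q0[OF smooth_endpoint_lagrangian] by (simp add: z[OF T_mem(2)] zero_prod_def)
 have 3: "(LINT t|\<eta> i. D2v (con P i) (yb t) (z t) (z t)) = 0" if i: "i < ncon P" for i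
  by (rule integral_eq_zero_AE[OF AE_I2]) (simp add: space_eta[OF i] z q0[OF smooth_con[OF i]])
 have 4: "deriv (dcon P yb z i) \<tau> = 0" if i: "i : {nord1 P..<ncon P}" and \<tau>: "\<tau> : touch_points P yb i" for i \<tau>
 proof (rule DERIV_imp_deriv, rule has_field_derivative_transform_within_open[where f="%_. 0" and S="{0<..<T}"])
  show "\<tau> : {0<..<T}" by (rule touch_point_props(1)[OF A1P i \<tau>])
  fix t assume "t : {0<..<T}"
  then have "z t = 0" using z by simp
  moreover have "i < ncon P" using i by simp
  ultimately show "0 = dcon P yb z i t" using linear_0[OF linear_fd[OF smooth_con]] by (simp add: dcon_def)
 qed auto
 show ?thesis
  unfolding hessian.simps Let_def z_def[symmetric] D2_eq_D2v using 1 2 3 4 by simp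
qed

text \<open>Weak lower semicontinuity with the upper bound makes the Hessian nonpositive at the weak
  limit, which is thus the zero direction. Lower and upper bound then force the values to converge
  to zero, the value at that limit, and strong convergence contradicts the unit norms.\<close>

lemma legendre_contradiction:
 assumes nrm: "!!k. ip M (v k) (v k) + (norm (zh k 0))\<^sup>2 = 1"
  and L: "legendre_form T (hessian P ub yb (\<eta>, \<Psi>, p))"
  and pos: "~ X2_is_zero T (w, z0) ==> hessian P ub yb (\<eta>, \<Psi>, p) (w, z0) > 0"
 shows False
proof -
 let ?Q = "hessian P ub yb (\<eta>, \<Psi>, p)"
 define xs where "xs k = (v k, zh k 0)" for k
 obtain Y where Y: "Y ~~> 0" "!!k. ?Q (xs k) <= Y k" using hessian_upper_bound unfolding xs_def by blast
 have xs: "xs k : X2 T" for k using sqv[of k] by (simp add: xs_def X2_def L2_iff_sqint)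
 have wc: "X2_weakly_converges T xs (w, z0)"
  unfolding X2_weakly_converges_def
 proof
  fix h :: "('m, 'n) dir" assume h: "h : X2 T"
  obtain h1 h2 where hh: "h = (h1, h2)" by (cases h)
  have "sqint M h1" using h by (simp add: hh X2_def L2_iff_sqint)
  then have "(%k. ip M (v k) h1) ~~> ip M w h1" using weak by (simp add: weakly_converges_def)
  from tendsto_add[OF this tendsto_inner[OF init tendsto_const[of h2]]]
  show "(%k. X2_inner T (xs k) h) ~~> X2_inner T (w, z0) h" by (simp add: hh xs_def ip_def)
 qed
 have lsc: "ereal (?Q x) <= liminf (%k. ereal (?Q (xs k)))" and strong: "(%k. ?Q (xs k)) ~~> ?Q x --> (%k. X2_dist T (xs k) x) ~~> 0"
  if "x : X2 T" "X2_weakly_converges T xs x" for x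
  using L xs that unfolding legendre_form_def by blast+
 have upper: "liminf (%k. ereal (?Q (xs k))) <= 0"
 proof -
  have "liminf (%k. ereal (?Q (xs k))) <= liminf (%k. ereal (Y k))" by (rule Liminf_mono) (simp add: Y(2))
  also have "liminf (%k. ereal (Y k)) = ereal 0" by (rule lim_imp_Liminf) (use Y(1) in auto)
  finally show ?thesis by (simp add: zero_ereal_def)
 qed
 have "(w, z0) : X2 T" using sqw by (simp add: X2_def L2_iff_sqint)
 from order.trans[OF lsc[OF this wc] upper] have "?Q (w, z0) <= 0" by simp
 then have "X2_is_zero T (w, z0)" using pos by fastforce
 then have w0: "AE t in M. w t = 0" "z0 = 0" by auto
 \<comment> \<open>The weak limit vanishes only almost everywhere, whereas
   \<open>hessian_zero\<close> is about the function that is zero everywhere. Inner products do not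
   distinguish them, so the weak convergence is transferred to the latter.\<close>
 have x0: "(%_. 0, 0) : (X2 T :: ('m, 'n) dir set)" by (simp add: X2_def L2_iff_sqint sqint_def)
 have inner0: "X2_inner T (w, z0) h = X2_inner T (%_. 0, 0) h" for h
 proof (cases h)
  case (Pair h1 h2)
  have "(LINT t|M. w t \<bullet> h1 t) = 0" by (rule integral_eq_zero_AE) (use w0(1) in eventually_elim, simp)
  then show ?thesis by (simp add: Pair w0(2))
 qed
 have wc0: "X2_weakly_converges T xs (%_. 0, 0)" using wc unfolding X2_weakly_converges_def inner0 .
 have low: "0 <= liminf (%k. ereal (?Q (xs k)))" using lsc[OF x0 wc0] unfolding hessian_zero by (simp add: zero_ereal_def)
 have Q0: "(%k. ?Q (xs k)) ~~> 0"
 proof (rule order_tendstoI)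
  fix a :: real
  show "\<forall>\<^sub>F k in sequentially. a < ?Q (xs k)" if "a < 0"
  proof -
   have "ereal a < 0" using that by (simp add: zero_ereal_def)
   then have "\<forall>\<^sub>F k in sequentially. ereal a < ereal (?Q (xs k))" using low unfolding le_Liminf_iff by blast
   then show ?thesis by simp
  qed
  show "\<forall>\<^sub>F k in sequentially. ?Q (xs k) < a" if "0 < a"
   using order_tendstoD(2)[OF Y(1) that] by eventually_elim (rule le_less_trans[OF Y(2)])
 qed
 have "(%k. X2_dist T (xs k) (%_. 0, 0)) ~~> 0" by (rule strong[OF x0 wc0, unfolded hessian_zero, THEN mp, OF Q0])
 moreover have "X2_dist T (xs k) (%_. 0, 0) = 1" for k
  using nrm[of k] by (simp add: xs_def ip_def power2_norm_eq_inner)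
 ultimately show False using LIMSEQ_unique[OF _ tendsto_const[of "1::real" sequentially]] by fastforce
qed

end

end

section \<open>Normalization and conclusion\<close>

lemma sqint_L2_norm: "L2_norm T d = sqrt (ip (leb T) d d)"
 by (simp add: L2_norm_def ip_self)

lemma (in control_problem) L2_le_Linf:
 assumes d: "d : Linf T" and L: "Linf_norm T d <= r" shows "ip M d d <= r\<^sup>2 * T"
proof -
 have "AE t in M. norm (d t) <= r" using Linf_norm(1)[OF T_pos d] by eventually_elim (use L in linarith)
 then have "AE t in M. (norm (d t))\<^sup>2 <= r\<^sup>2" by eventually_elim (rule power_mono, auto)
 then have "(LINT t|M. (norm (d t))\<^sup>2) <= (LINT t|M. r\<^sup>2)"
  using Linf_sqint[OF d] by (intro integral_mono_AE) (auto simp: sqint_def integrable_const_Icc)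
 then show ?thesis using T_pos by (simp add: ip_self measure_restrict_space mult.commute)
qed

theorem theorem33:
  fixes P :: "('m::finite, 'n::finite) ocp"
    and ubar :: "real \<Rightarrow> (real ^ 'm)" and ybar :: "real \<Rightarrow> (real ^ 'n)"
    and lam0 :: "'n multiplier"
  assumes "horizon P > 0"
    and "A0 P" and "numbered_by_order P"
    and "feasible P ubar ybar"
    and "A1 P ybar" and "A2 P" and "A3 P ubar ybar" and "A4 P ybar"
    and "lam0 \<in> multipliers P ubar ybar"
    and "\<forall>x\<in>critical_cone P ubar ybar lam0. \<exists>lam\<in>multipliers P ubar ybar.
           legendre_form (horizon P) (hessian P ubar ybar lam) \<and>
           (\<not> X2_is_zero (horizon P) x \<longrightarrow> hessian P ubar ybar lam x > 0)"
  shows "local_solution P ubar ybar \<and>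
    (\<exists>\<beta>>0. \<exists>\<alpha>>0. \<forall>u y. feasible P u y \<and>
       Linf_norm (horizon P) (\<lambda>t. u t - ubar t) + norm (y 0 - ybar 0) \<le> \<alpha> \<longrightarrow>
       Jcost P u (y 0) \<ge> Jcost P ubar (ybar 0) +
         1 / 2 * \<beta> * (L2_norm (horizon P) (\<lambda>t. u t - ubar t) + norm (y 0 - ybar 0))\<^sup>2)"
proof -
 interpret control_problem P by unfold_locales (rule assms(1,2))+
 have trb: "trajectory P ubar ybar" using assms(4) by (simp add: feasible_def)
 have trf: "trajectory P u y" if "feasible P u y" for u y using that by (simp add: feasible_def)
 define gr where "gr \<beta> \<alpha> \<longleftrightarrow> (ALL u y. feasible P u y &
    Linf_norm (horizon P) (%t. u t - ubar t) + norm (y 0 - ybar 0) <= \<alpha> -->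
    Jcost P u (y 0) >= Jcost P ubar (ybar 0) +
    1 / 2 * \<beta> * (L2_norm (horizon P) (%t. u t - ubar t) + norm (y 0 - ybar 0))\<^sup>2)" for \<beta> \<alpha> :: real
 have ex: "\<exists>\<beta>>0. \<exists>\<alpha>>0. gr \<beta> \<alpha>"
 proof (rule ccontr)
  assume neg: "~ (\<exists>\<beta>>0. \<exists>\<alpha>>0. gr \<beta> \<alpha>)"
  \<comment> \<open>The same null sequence is used for the growth constant and for the radius of the
    neighbourhood.\<close>
  define \<epsilon> where "\<epsilon> k = 1 / real (Suc k)" for k
  have \<epsilon>: "\<epsilon> k > 0" for k by (simp add: \<epsilon>_def)
  have \<epsilon>0: "\<epsilon> ~~> 0" using LIMSEQ_inverse_real_of_nat by (simp add: \<epsilon>_def[abs_def] inverse_eq_divide)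
  define Q where "Q k u y \<longleftrightarrow> feasible P u y & Linf_norm T (%t. u t - ubar t) + norm (y 0 - ybar 0) <= \<epsilon> k &
    Jcost P u (y 0) < Jcost P ubar (ybar 0) + 1 / 2 * \<epsilon> k * (L2_norm T (%t. u t - ubar t) + norm (y 0 - ybar 0))\<^sup>2" for k u y
  have "ALL k. EX u y. Q k u y"
  proof
   fix k
   have "~ gr (\<epsilon> k) (\<epsilon> k)" using neg \<epsilon> by blast
   then show "EX u y. Q k u y" unfolding gr_def Q_def not_all not_imp not_le by blast
  qed
  from choice[OF this] obtain U where "ALL k. EX y. Q k (U k) y" ..
  from choice[OF this] obtain Y where Q: "ALL k. Q k (U k) (Y k)" ..
  have fe: "!!k. feasible P (U k) (Y k)"
   and near: "!!k. Linf_norm T (%t. U k t - ubar t) + norm (Y k 0 - ybar 0) <= \<epsilon> k"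
   and less: "!!k. Jcost P (U k) (Y k 0) < Jcost P ubar (ybar 0) + 1 / 2 * \<epsilon> k * (L2_norm T (%t. U k t - ubar t) + norm (Y k 0 - ybar 0))\<^sup>2"
   using Q unfolding Q_def by blast+
  note tr = trf[OF fe]
  define du where "du k t = U k t - ubar t" for k t
  define dy where "dy k t = Y k t - ybar t" for k t
  have duL: "du k : Linf T" for k unfolding du_def by (rule Linf_diff[OF traj(1)[OF tr] traj(1)[OF trb]])
  have dus: "sqint M (du k)" for k by (rule Linf_sqint[OF duL])
  have near': "Linf_norm T (du k) <= \<epsilon> k" "norm (dy k 0) <= \<epsilon> k" for k
   using near[of k] Linf_norm_nonneg[OF T_pos, of "du k"] norm_ge_zero[of "dy k 0"] unfolding du_def dy_def by linarith+
  \<comment> \<open>Squared Hilbert norm of the increment. The growth condition uses the sum of the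
    two norms instead; its square is at most twice \<open>S\<close>, which the factor one half in
    front of the growth constant absorbs.\<close>
  define S where "S k = ip M (du k) (du k) + (norm (dy k 0))\<^sup>2" for k
  have S0: "S k >= 0" for k by (simp add: S_def ip_nonneg)
  have cost_less: "cost P (U k) (Y k) - cost P ubar ybar < 1 / 2 * \<epsilon> k * (L2_norm T (du k) + norm (dy k 0))\<^sup>2" for k
   using less[of k] unfolding Jcost_eq_cost[OF tr] Jcost_eq_cost[OF trb] du_def dy_def by simp
  have cost_le: "cost P (U k) (Y k) - cost P ubar ybar <= \<epsilon> k * S k" for k
  proof -
   have "(L2_norm T (du k) + norm (dy k 0))\<^sup>2 <= 2 * ((L2_norm T (du k))\<^sup>2 + (norm (dy k 0))\<^sup>2)"
    using sum_squares_bound[of "L2_norm T (du k)" "norm (dy k 0)"] by (simp add: power2_sum)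
   also have "2 * ((L2_norm T (du k))\<^sup>2 + (norm (dy k 0))\<^sup>2) = 2 * S k" by (simp add: S_def sqint_L2_norm ip_nonneg)
   finally have "1 / 2 * \<epsilon> k * (L2_norm T (du k) + norm (dy k 0))\<^sup>2 <= 1 / 2 * \<epsilon> k * (2 * S k)"
    using \<epsilon>[of k] by (intro mult_left_mono) auto
   then show ?thesis using cost_less[of k] by simp
  qed
  \<comment> \<open>Distance zero would give equal costs, against the strict inequality in the
    failure of growth.\<close>
  have Spos: "S k > 0" for k
  proof (rule ccontr)
   assume "~ S k > 0"
   then have z: "ip M (du k) (du k) = 0" "norm (dy k 0) = 0"
    using S0[of k] ip_nonneg[of M "du k"] zero_le_power2[of "norm (dy k 0)"] unfolding S_def by (simp_all add: add_nonneg_eq_0_iff)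
   have "AE t in M. U k t = ubar t" using ip_zero_AE[OF dus z(1)] by eventually_elim (simp add: du_def)
   moreover have "Y k 0 = ybar 0" using z(2) by (simp add: dy_def)
   ultimately have "cost P (U k) (Y k) = cost P ubar ybar" by (rule cost_cong_AE[OF tr trb])
   then show False using cost_less[of k] z by (simp add: sqint_L2_norm)
  qed
  define E where "E k = sqrt (S k)" for k
  have Epos: "E k > 0" and E2: "(E k)\<^sup>2 = S k" for k using Spos[of k] by (simp_all add: E_def)
  have E0: "E ~~> 0"
  proof (rule Lim_null_comparison)
   show "\<forall>\<^sub>F k in sequentially. norm (E k) <= sqrt (T + 1) * \<epsilon> k"
   proof (intro always_eventually allI)
    fix k
    have "(norm (dy k 0))\<^sup>2 <= (\<epsilon> k)\<^sup>2" by (rule power_mono[OF near'(2)]) simp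
    then have "S k <= (T + 1) * (\<epsilon> k)\<^sup>2"
    using L2_le_Linf[OF duL near'(1), of k] by (simp add: S_def distrib_right mult.commute)
    then have "E k <= sqrt ((T + 1) * (\<epsilon> k)\<^sup>2)" unfolding E_def by (rule real_sqrt_le_mono)
    then show "norm (E k) <= sqrt (T + 1) * \<epsilon> k" using Epos[of k] \<epsilon>[of k] by (simp add: real_sqrt_mult)
   qed
   show "(%k. sqrt (T + 1) * \<epsilon> k) ~~> 0" using tendsto_mult_left[OF \<epsilon>0, of "sqrt (T + 1)"] by simp
  qed
  define V where "V k t = (1 / E k) *R du k t" for k t
  define Z where "Z k t = (1 / E k) *R dy k t" for k t
  have Vs: "sqint M (V k)" for k unfolding V_def by (rule sqint_scale[OF dus])
  have unit: "ip M (V k) (V k) + (norm (Z k 0))\<^sup>2 = 1" for k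
  proof -
   have "ip M (V k) (V k) = (1 / E k)\<^sup>2 * ip M (du k) (du k)"
    by (simp add: ip_def V_def power2_eq_square)
   moreover have "(norm (Z k 0))\<^sup>2 = (1 / E k)\<^sup>2 * (norm (dy k 0))\<^sup>2"
    by (simp add: Z_def power_mult_distrib power_divide)
   ultimately have "ip M (V k) (V k) + (norm (Z k 0))\<^sup>2 = (1 / E k)\<^sup>2 * S k" by (simp add: S_def distrib_left)
   then show ?thesis using Epos[of k] by (simp add: power_divide E2[symmetric])
  qed
  have unit1: "ip M (V k) (V k) <= 1" and unit2: "norm (Z k 0) <= 1" for k
  proof -
   show "ip M (V k) (V k) <= 1" using unit[of k] zero_le_power2[of "norm (Z k 0)"] by linarith
   have "(norm (Z k 0))\<^sup>2 <= 1\<^sup>2" using unit[of k] ip_nonneg[of M "V k"] by simp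
   then show "norm (Z k 0) <= 1" by (rule power2_le_imp_le) simp
  qed
  obtain r1 w where r1: "strict_mono r1" and w: "sqint M w" "!!h. sqint M h ==> (%k. ip M (V (r1 k)) h) ~~> ip M w h"
   by (rule weak_compactness[OF Vs unit1]) (rule that)
  \<comment> \<open>Initial values are finite dimensional, so a further subsequence makes them
    converge strongly.\<close>
  have "\<exists>l\<in>cball 0 1. EX r. strict_mono r & ((%k. Z (r1 k) 0) \<circ> r) ~~> l"
   by (rule compact_cball[unfolded compact_def, rule_format]) (simp add: unit2)
  then obtain z0 r2 where r2: "strict_mono r2" "((%k. Z (r1 k) 0) \<circ> r2) ~~> z0" by blast
  define R where "R = r1 \<circ> r2"
  have R: "strict_mono R" unfolding R_def by (rule strict_mono_o[OF r1 r2(1)])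
  have ER: "(%k. E (R k)) ~~> 0" and \<epsilon>R: "(%k. \<epsilon> (R k)) ~~> 0"
   using LIMSEQ_subseq_LIMSEQ[OF E0 R] LIMSEQ_subseq_LIMSEQ[OF \<epsilon>0 R] by (simp_all add: o_def)
  have weak: "weakly_converges M (%k. V (R k)) w"
   unfolding weakly_converges_def
  proof (intro conjI allI impI exI[of _ 1] Vs w(1) unit1)
   fix h :: "real => real ^ 'm" assume h: "sqint M h"
   show "(%k. ip M (V (R k)) h) ~~> ip M w h"
    using LIMSEQ_subseq_LIMSEQ[OF w(2)[OF h] r2(1)] by (simp add: R_def o_def)
  qed
  \<comment> \<open>The sequence \<open>\<epsilon> (R k)\<close> serves twice: as the uniform bound
    on the control perturbation and as the rate in the failure of growth.\<close>
  have cs: "critical_sequence P ubar ybar (%k. U (R k)) (%k. Y (R k)) (%k. E (R k)) (%k. \<epsilon> (R k)) (%k. V (R k)) (%k. Z (R k)) w z0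
    (lin_state P ubar ybar w z0) (%k. lin_state P ubar ybar (V (R k)) (Z (R k) 0)) (%k. \<epsilon> (R k))"
  proof unfold_locales
   show "trajectory P ubar ybar" "!!k. trajectory P (U (R k)) (Y (R k))" by (rule trb, rule tr)
   show "!!k. E (R k) > 0" "(%k. E (R k)) ~~> 0" "(%k. \<epsilon> (R k)) ~~> 0" by (rule Epos, rule ER, rule \<epsilon>R)
   show "U (R k) t = ubar t + E (R k) *R V (R k) t" for k t using Epos[of "R k"] by (simp add: V_def du_def)
   show "Y (R k) t = ybar t + E (R k) *R Z (R k) t" for k t using Epos[of "R k"] by (simp add: Z_def dy_def)
   show "AE t in M. norm (E (R k) *R V (R k) t) <= \<epsilon> (R k)" for k
    using Linf_norm(1)[OF T_pos duL[of "R k"]]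
   proof eventually_elim
    case (elim t)
    then show ?case using near'(1)[of "R k"] Epos[of "R k"] by (simp add: V_def)
   qed
   show "!!k. ip M (V (R k)) (V (R k)) <= 1" "!!k. norm (Z (R k) 0) <= 1" by (rule unit1, rule unit2)
   show "weakly_converges M (%k. V (R k)) w" by (rule weak)
   show "(%k. Z (R k) 0) ~~> z0" using r2(2) by (simp add: R_def o_def)
   show "zlin ubar ybar w z0 (lin_state P ubar ybar w z0)" by (rule zlin_lin_state[OF trb w(1)])
   show "zlin ubar ybar (V (R k)) (Z (R k) 0) (lin_state P ubar ybar (V (R k)) (Z (R k) 0))" for k by (rule zlin_lin_state[OF trb Vs])
   show "cost P (U (R k)) (Y (R k)) - cost P ubar ybar <= \<epsilon> (R k) * (E (R k))\<^sup>2" for k unfolding E2 by (rule cost_le)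
  qed (rule assms fe refl)+
  obtain \<eta>0 \<Psi>0 p0 where l0: "lam0 = (\<eta>0, \<Psi>0, p0)" by (cases lam0)
  \<comment> \<open>Criticality is needed for the multiplier \<open>lam0\<close> that defines the
    cone; the contradiction is then drawn with the multiplier \<open>lam\<close> that the hypothesis
    attaches to this particular direction.\<close>
  have "(w, z0) : critical_cone P ubar ybar lam0"
   unfolding l0 by (rule critical_sequence.limit_critical[OF cs]) (use assms(9) in \<open>simp only: l0\<close>)
  then obtain lam where lam: "lam : multipliers P ubar ybar" "legendre_form T (hessian P ubar ybar lam)"
   "~ X2_is_zero T (w, z0) --> hessian P ubar ybar lam (w, z0) > 0" using assms(10) by blast
  obtain \<eta> \<Psi> p where l: "lam = (\<eta>, \<Psi>, p)" by (cases lam)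
  show False
   by (rule critical_sequence.legendre_contradiction[OF cs lam(1)[unfolded l] unit lam(2)[unfolded l]])
    (use lam(3)[unfolded l] in blast)
 qed
 moreover have "local_solution P ubar ybar"
 proof -
  obtain \<beta> \<alpha> where b: "\<beta> > 0" "\<alpha> > 0" "gr \<beta> \<alpha>" using ex by blast
  have "cost P ubar ybar <= cost P u y"
   if fe: "feasible P u y" and n: "Linf_norm T (%t. u t - ubar t) + W1inf_norm T (%t. y t - ybar t) <= \<alpha>" for u y
  proof -
   note tr = trf[OF fe]
   have c: "cont T (%t. y t - ybar t)" by (intro continuous_on_diff traj(2)[OF tr] traj(2)[OF trb])
   \<comment> \<open>A neighbourhood in the norm of the function spaces is contained in one of the
     growth condition, because the initial value is controlled by the uniform norm of the continuous
     state.\<close>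
   have "norm (y 0 - ybar 0) <= Linf_norm T (%t. y t - ybar t)"
    by (rule continuous_AE_le_at_0[OF T_pos c Linf_norm(1)[OF T_pos continuous_imp_Linf[OF c]]])
   also have "Linf_norm T (%t. y t - ybar t) <= W1inf_norm T (%t. y t - ybar t)"
    unfolding W1inf_norm_def using Linf_norm_nonneg[OF T_pos] by simp
   finally have "Linf_norm T (%t. u t - ubar t) + norm (y 0 - ybar 0) <= \<alpha>" using n by linarith
   then have "Jcost P u (y 0) >= Jcost P ubar (ybar 0) + 1 / 2 * \<beta> * (L2_norm T (%t. u t - ubar t) + norm (y 0 - ybar 0))\<^sup>2"
    using b(3) fe unfolding gr_def by blast
   moreover have "1 / 2 * \<beta> * (L2_norm T (%t. u t - ubar t) + norm (y 0 - ybar 0))\<^sup>2 >= 0" using b(1) by simp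
   ultimately show ?thesis unfolding Jcost_eq_cost[OF tr] Jcost_eq_cost[OF trb] by linarith
  qed
  then show ?thesis unfolding local_solution_def using assms(4) b(2) by blast
 qed
 ultimately show ?thesis unfolding gr_def by blast
qed

end
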